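(* Let $n\geq 4$, let $F\subseteq E(Q_n)$, and let $M$ be a matching of $Q_n-F$ with $1\leq |M|\leq 2n-2$ and $|F|\leq n-1-\lceil |M|/2\rceil$. Then there exists a Hamiltonian cycle of $Q_n-F$ containing every edge of $M$, except in the following exceptional configuration: $n=4$, $|M|=4$, $|F|=1$, and there is a dimension $i\in[4]$ such that $M\cup F\subseteq E_i$ and the four endpoints of the edges of $M$ whose $i$-th coordinate is $0$ are pairwise at distance $2$.
   Context: $Q_n$ is the graph on binary strings of length $n$, two strings adjacent iff they differ in exactly one position; $[n]=\{1,\dots,n\}$. An edge is $i$-dimensional if its endpoints differ in position $i$, and $E_i$ is the set of $i$-dimensional edges. $Q_n-F$ is the graph with vertex set $V(Q_n)$ and edge set $E(Q_n)\setminus F$. Distance is the shortest-path distance in $Q_n$ (Hamming distance). A matching is a set of pairwise vertex-disjoint edges; a Hamiltonian cycle of $Q_n-F$ is a cycle using only edges not in $F$ and passing through every vertex. *)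

theory Defs
  imports Complex_Main
begin

text \<open>Undirected simple graphs as pairs of a vertex set and a set of two-element edges.\<close>

type_synonym 'a ugraph = "'a set \<times> 'a set set"

abbreviation verts :: "'a ugraph \<Rightarrow> 'a set" where
  "verts G \<equiv> fst G"

abbreviation edges :: "'a ugraph \<Rightarrow> 'a set set" where
  "edges G \<equiv> snd G"

definition delete_edges :: "'a ugraph \<Rightarrow> 'a set set \<Rightarrow> 'a ugraph" where
  "delete_edges G F = (verts G, edges G - F)"

definition matching :: "'a ugraph \<Rightarrow> 'a set set \<Rightarrow> bool" where
  "matching G M \<longleftrightarrow> M \<subseteq> edges G \<and> pairwise disjnt M"

text \<open>A walk is given by its nonempty list of vertices, so its length is one less than
  the length of the list.\<close>

definition walk :: "'a ugraph \<Rightarrow> 'a \<Rightarrow> 'a list \<Rightarrow> 'a \<Rightarrow> bool" where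
  "walk G u p v \<longleftrightarrow> p \<noteq> [] \<and> hd p = u \<and> last p = v \<and> set p \<subseteq> verts G \<and>
     successively (\<lambda>x y. {x, y} \<in> edges G) p"

text \<open>Only meaningful when \<open>u\<close> and \<open>v\<close> lie in the same component.\<close>

definition graph_dist :: "'a ugraph \<Rightarrow> 'a \<Rightarrow> 'a \<Rightarrow> nat" where
  "graph_dist G u v = (LEAST k. \<exists>p. walk G u p v \<and> length p = Suc k)"

text \<open>A cycle is given by the cyclic sequence of its vertices, without repeating the first
  vertex at the end.\<close>

definition cycle_edges :: "'a list \<Rightarrow> 'a set set" where
  "cycle_edges c = {{c ! k, c ! (Suc k mod length c)} | k. k < length c}"

definition cycle :: "'a ugraph \<Rightarrow> 'a list \<Rightarrow> bool" where
  "cycle G c \<longleftrightarrow> 3 \<le> length c \<and> distinct c \<and> set c \<subseteq> verts G \<and> cycle_edges c \<subseteq> edges G"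

definition hamiltonian_cycle :: "'a ugraph \<Rightarrow> 'a list \<Rightarrow> bool" where
  "hamiltonian_cycle G c \<longleftrightarrow> cycle G c \<and> set c = verts G"

text \<open>Binary strings are Boolean lists, with \<open>True\<close> for 1 and \<open>False\<close> for 0. Positions, and hence
  dimensions, are numbered \<open>0, \<dots>, n - 1\<close> instead of \<open>1, \<dots>, n\<close>.\<close>

definition cube :: "nat \<Rightarrow> bool list ugraph" where
  "cube n = ({x. length x = n},
     {{x, y} | x y. length x = n \<and> length y = n \<and> (\<exists>!i. i < n \<and> x ! i \<noteq> y ! i)})"

definition dim_edges :: "nat \<Rightarrow> nat \<Rightarrow> bool list set set" where
  "dim_edges n i = {{x, y} | x y. {x, y} \<in> edges (cube n) \<and> x ! i \<noteq> y ! i}"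

definition exceptional :: "nat \<Rightarrow> bool list set set \<Rightarrow> bool list set set \<Rightarrow> bool" where
  "exceptional n F M \<longleftrightarrow> n = 4 \<and> card M = 4 \<and> card F = 1 \<and>
     (\<exists>i<4. M \<union> F \<subseteq> dim_edges n i \<and>
        pairwise (\<lambda>x y. graph_dist (cube n) x y = 2) {x \<in> \<Union>M. x ! i = False})"

end

theory Submission
  imports Defs
begin

text \<open>The hypotheses on the cardinalities amount to \<open>|M| + 2|F| \<le> 2n - 2\<close>. Induction on \<open>n\<close>: the cube is
  split along a dimension chosen so that few edges of \<open>M\<close> and \<open>F\<close> cross, a Hamiltonian cycle of the
  heavier half is cut open, and the other half is inserted by means of a Hamiltonian path between
  prescribed ends of opposite parity, or of two disjoint spanning paths. The path statement, with the
  bound \<open>|M| + 2|F| \<le> n - 1\<close>, is carried along in the same induction. If one half is too heavy for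
  the induction hypothesis, one or two edges of \<open>M\<close> or \<open>F\<close> are released there and repaired by
  exchanging edges with the other half. For \<open>n = 4\<close>, automorphisms move one edge, or the two ends of
  the path, to a normal position, and the remaining choices of \<open>M\<close> and \<open>F\<close> are covered by explicit
  decision trees of Hamiltonian paths.\<close>

section \<open>Parity and coordinate insertion\<close>

text \<open>Counting a fault twice makes the bound 2n - 2 smaller than twice the number of
  dimensions. So either some dimension carries no edge of \<open>M\<close>, or every dimension
  carries one and some dimension has exactly one edge of \<open>M\<close> and no fault; no other
  split is used for cycles. The path bound n - 1 is below the number of dimensions, so for paths a
  dimension exists in which nothing crosses. Opening the cycle of the heavier half hands the lighter
  half a path problem, and its weight exceeds the path bound only if both halves have weight exactly
  n - 1. Dimension 4 disturbs the passage to dimension 5 twice. A half may be exceptional and have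
  no cycle, and \<open>exc_path_ext\<close> then supplies a path whose ends can be adjusted. And the
  counting that settles the balanced split needs 5m < 2^m, which fails for m = 4, so
  \<open>adjacent_path_ext4\<close> gains one unit over the path bound for adjacent ends.\<close>

definition par :: "bool list \<Rightarrow> bool" where
  "par x \<longleftrightarrow> odd (length (filter id x))"

definition ham_dist :: "bool list \<Rightarrow> bool list \<Rightarrow> nat" where
  "ham_dist x y = length (filter (\<lambda>(a, b). a \<noteq> b) (zip x y))"

definition ins :: "nat \<Rightarrow> bool \<Rightarrow> bool list \<Rightarrow> bool list" where
  "ins i b x = take i x @ b # drop i x"

definition del :: "nat \<Rightarrow> bool list \<Rightarrow> bool list" where
  "del i x = take i x @ drop (Suc i) x"

lemma verts_cube [simp]: "x \<in> verts (cube n) \<longleftrightarrow> length x = n"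
  by (simp add: cube_def)

lemma finite_verts_cube [simp, intro]: "finite (verts (cube n))"
  using finite_lists_length_eq[of "UNIV :: bool set" n] by (simp add: cube_def)

lemma card_verts_cube: "card (verts (cube n)) = 2 ^ n"
  using card_lists_length_eq[of "UNIV :: bool set" n] by (simp add: cube_def)

text \<open>Counting differing positions turns the unique-existence definition of adjacency into an
  equation that list induction and coordinate insertion can compute with.\<close>

lemma edge_iff_ham_dist:
  "{x, y} \<in> edges (cube n) \<longleftrightarrow> length x = n \<and> length y = n \<and> ham_dist x y = 1"
proof -
  have *: "(\<exists>!i. i < n \<and> x ! i \<noteq> y ! i) \<longleftrightarrow> ham_dist x y = 1" if "length x = n" "length y = n" for x y
  proof -
    have "ham_dist x y = card {i. i < n \<and> x ! i \<noteq> y ! i}"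
      unfolding ham_dist_def length_filter_conv_card using that by (intro arg_cong[where f = card]) auto
    then show ?thesis by (simp only: is_singleton_altdef[symmetric] is_singleton_iff_ex1 mem_Collect_eq)
  qed
  have "{x, y} \<in> edges (cube n) \<longleftrightarrow> length x = n \<and> length y = n \<and> (\<exists>!i. i < n \<and> x ! i \<noteq> y ! i)"
    unfolding cube_def by (auto simp: doubleton_eq_iff) (metis (no_types, lifting))+
  with * show ?thesis by blast
qed

lemma ham_dist_0_iff: "length x = length y \<Longrightarrow> ham_dist x y = 0 \<longleftrightarrow> x = y"
  by (induction x y rule: list_induct2) (auto simp: ham_dist_def)

lemma odd_ham_dist: "length x = length y \<Longrightarrow> odd (ham_dist x y) \<longleftrightarrow> par x \<noteq> par y"
  by (induction x y rule: list_induct2) (auto simp: ham_dist_def par_def)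

lemma edge_par: "{x, y} \<in> edges (cube n) \<Longrightarrow> par x \<noteq> par y"
  using odd_ham_dist[of x y] by (simp add: edge_iff_ham_dist)

lemma edge_neq: "{x, y} \<in> edges (cube n) \<Longrightarrow> x \<noteq> y"
  using edge_par by blast

lemma singleton_not_edge [simp]: "{x} \<notin> edges (cube n)"
  using edge_neq[of x x n] by auto

lemma edge_length: "{x, y} \<in> edges (cube n) \<Longrightarrow> length x = n \<and> length y = n"
  by (simp add: edge_iff_ham_dist)

lemma edgeE:
  assumes "e \<in> edges (cube n)"
  obtains x y where "e = {x, y}" "length x = n" "length y = n" "x \<noteq> y" "par x \<noteq> par y"
proof -
  obtain x y where e: "e = {x, y}" using assms unfolding cube_def by auto
  then have "{x, y} \<in> edges (cube n)" using assms by simp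
  from edge_length[OF this] edge_par[OF this] edge_neq[OF this] e show ?thesis by (intro that) auto
qed

lemma finite_edges_cube [simp, intro]: "finite (edges (cube n))"
proof (rule finite_subset)
  show "edges (cube n) \<subseteq> Pow (verts (cube n))" by (auto elim!: edgeE)
qed auto

lemma length_ins [simp]: "length (ins i b x) = Suc (length x)"
  by (simp add: ins_def)

lemma par_ins [simp]: "par (ins i b x) \<longleftrightarrow> b \<noteq> par x"
proof -
  have "length (filter id x) = length (filter id (take i x)) + length (filter id (drop i x))"
    by (metis append_take_drop_id filter_append length_append)
  then show ?thesis by (auto simp: par_def ins_def)
qed

lemma ins_nth [simp]: "i \<le> length x \<Longrightarrow> ins i b x ! i = b"
  by (simp add: ins_def nth_append)

lemma del_ins [simp]: "i \<le> length x \<Longrightarrow> del i (ins i b x) = x"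
  by (simp add: ins_def del_def)

lemma ins_del: "i < length x \<Longrightarrow> ins i (x ! i) (del i x) = x"
  by (simp add: ins_def del_def min_absorb2 Cons_nth_drop_Suc)

lemma length_del [simp]: "i < length x \<Longrightarrow> length (del i x) = length x - 1"
  by (simp add: del_def)

lemma ins_eq_iff [simp]:
  "i \<le> length x \<Longrightarrow> i \<le> length y \<Longrightarrow> ins i b x = ins i c y \<longleftrightarrow> b = c \<and> x = y"
  by (auto dest: arg_cong[where f = "\<lambda>z. z ! i"] arg_cong[where f = "del i"])

lemma insE:
  assumes "length x = Suc m" "i \<le> m"
  obtains b y where "x = ins i b y" "length y = m"
  using assms ins_del[of i x] length_del[of i x] by (metis diff_Suc_1 le_imp_less_Suc)

lemma ham_dist_ins:
  assumes "length x = length y"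
  shows "ham_dist (ins i b x) (ins i c y) = ham_dist x y + (if b = c then 0 else 1)"
proof -
  have "zip x y = zip (take i x @ drop i x) (take i y @ drop i y)" by simp
  also have "\<dots> = zip (take i x) (take i y) @ zip (drop i x) (drop i y)"
    using assms by (intro zip_append) simp
  finally have 1: "zip x y = \<dots>" .
  have "zip (ins i b x) (ins i c y) = zip (take i x) (take i y) @ zip (b # drop i x) (c # drop i y)"
    using assms unfolding ins_def by (intro zip_append) simp
  with 1 show ?thesis by (simp add: ham_dist_def)
qed

lemma edge_ins_same:
  "{ins i b x, ins i b y} \<in> edges (cube (Suc m)) \<longleftrightarrow> {x, y} \<in> edges (cube m)"
  by (auto simp: edge_iff_ham_dist ham_dist_ins)

lemma edge_ins_neq:
  assumes "b \<noteq> c"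
  shows "{ins i b x, ins i c y} \<in> edges (cube (Suc m)) \<longleftrightarrow> length x = m \<and> x = y"
proof (cases "length x = length y")
  case True
  then show ?thesis using assms ham_dist_0_iff[OF True]
    by (simp only: edge_iff_ham_dist ham_dist_ins length_ins if_False) auto
qed (auto simp: edge_iff_ham_dist)

text \<open>Prepending the bit that corrects the parity is a bijection from the cube one dimension
  lower.\<close>

lemma card_par: "card {x \<in> verts (cube (Suc n)). par x = p} = 2 ^ n"
proof -
  have "bij_betw (\<lambda>x. ins 0 (p \<noteq> par x) x) (verts (cube n)) {x \<in> verts (cube (Suc n)). par x = p}"
  proof (rule bij_betwI')
    fix y assume y: "y \<in> {x \<in> verts (cube (Suc n)). par x = p}"
    then obtain b z where "y = ins 0 b z" "length z = n" using insE[of y n 0] by auto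
    with y show "\<exists>x\<in>verts (cube n). y = ins 0 (p \<noteq> par x) x" by (intro bexI[of _ z]) auto
  qed auto
  from bij_betw_same_card[OF this] show ?thesis by (simp add: card_verts_cube)
qed

section \<open>Paths as vertex lists\<close>

fun path_edges :: "'a list \<Rightarrow> 'a set set" where
  "path_edges (x # y # p) = insert {x, y} (path_edges (y # p))"
| "path_edges _ = {}"

lemma path_edges_Cons: "path_edges (x # p) = (if p = [] then {} else insert {x, hd p} (path_edges p))"
  by (cases p) auto

lemma path_edges_append:
  "path_edges (p @ q) = path_edges p \<union> path_edges q \<union>
     (if p = [] \<or> q = [] then {} else {{last p, hd q}})"
  by (induction p rule: path_edges.induct) (auto simp: path_edges_Cons)

lemma path_edges_rev [simp]: "path_edges (rev p) = path_edges p"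
proof (induction p)
  case (Cons a p)
  show ?case
    unfolding rev.simps path_edges_append Cons.IH by (simp add: path_edges_Cons last_rev insert_commute)
qed simp

lemma path_edges_map: "path_edges (map f p) = (`) f ` path_edges p"
  by (induction p rule: path_edges.induct) auto

lemma path_edges_subset: "e \<in> path_edges p \<Longrightarrow> e \<subseteq> set p"
  by (induction p rule: path_edges.induct) auto

lemma finite_path_edges [simp]: "finite (path_edges p)"
  by (induction p rule: path_edges.induct) auto

lemma path_edges_split:
  assumes "e \<in> path_edges p"
  obtains q a b r where "p = q @ a # b # r" "e = {a, b}"
  using assms
proof (induction p arbitrary: thesis rule: path_edges.induct)
  case (1 x y p)
  show ?case
  proof (cases "e = {x, y}")
    case True
    then show ?thesis using "1.prems"(1)[of "[]" x y p] by simp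
  next
    case False
    then have "e \<in> path_edges (y # p)" using "1.prems"(2) by simp
    then obtain q a b r where "y # p = q @ a # b # r" "e = {a, b}" using "1.IH" by blast
    then show ?thesis using "1.prems"(1)[of "x # q" a b r] by simp
  qed
qed auto

lemma card_path_edges: "distinct p \<Longrightarrow> card (path_edges p) = length p - 1"
proof (induction p rule: path_edges.induct)
  case (1 x y p)
  have "{x, y} \<notin> path_edges (y # p)" using path_edges_subset[of "{x, y}" "y # p"] "1.prems" by auto
  with 1 show ?case by simp
qed auto

text \<open>A path plus its closing edge, without modular indices: rotating the list keeps the set,
  and opening the cycle deletes one element. \<open>cycle_edges_eq\<close> translates to the
  official notion at the end.\<close>

definition cyc_edges :: "'a list \<Rightarrow> 'a set set" where
  "cyc_edges p = insert {last p, hd p} (path_edges p)"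

definition ham_path where
  "ham_path n F M u v \<longleftrightarrow> (\<exists>p. p \<noteq> [] \<and> hd p = u \<and> last p = v \<and> distinct p \<and>
     set p = verts (cube n) \<and> path_edges p \<subseteq> edges (cube n) - F \<and> M \<subseteq> path_edges p)"

text \<open>No length is demanded here; from dimension 2 on, spanning the cube already forces the
  three vertices that \<open>cycle\<close> asks for.\<close>

definition ham_cycle where
  "ham_cycle n F M \<longleftrightarrow> (\<exists>p. p \<noteq> [] \<and> distinct p \<and>
     set p = verts (cube n) \<and> cyc_edges p \<subseteq> edges (cube n) - F \<and> M \<subseteq> cyc_edges p)"

text \<open>A paired cover by two disjoint paths, one from \<open>u\<close> to \<open>v\<close>, the
  other from \<open>x\<close> to \<open>y\<close>. Either may be a single vertex;
  \<open>u = v\<close> and \<open>x = y\<close> are excluded separately where the two ends have to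
  be left by different crossing edges.\<close>

definition two_paths where
  "two_paths n F M u v x y \<longleftrightarrow> (\<exists>p q. p \<noteq> [] \<and> q \<noteq> [] \<and> hd p = u \<and> last p = v \<and> hd q = x \<and> last q = y \<and>
     distinct (p @ q) \<and> set (p @ q) = verts (cube n) \<and>
     path_edges p \<union> path_edges q \<subseteq> edges (cube n) - F \<and> M \<subseteq> path_edges p \<union> path_edges q)"

lemma ham_pathI:
  assumes "p \<noteq> []" "hd p = u" "last p = v" "distinct p" "set p = verts (cube n)"
    "path_edges p \<subseteq> edges (cube n) - F" "M \<subseteq> path_edges p"
  shows "ham_path n F M u v"
  using assms unfolding ham_path_def by blast

lemma ham_cycleI:
  assumes "p \<noteq> []" "distinct p" "set p = verts (cube n)"
    "cyc_edges p \<subseteq> edges (cube n) - F" "M \<subseteq> cyc_edges p"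
  shows "ham_cycle n F M"
  using assms unfolding ham_cycle_def by blast

lemma two_pathsI:
  assumes "p \<noteq> []" "q \<noteq> []" "hd p = u" "last p = v" "hd q = x" "last q = y"
    "distinct (p @ q)" "set (p @ q) = verts (cube n)"
    "path_edges p \<union> path_edges q \<subseteq> edges (cube n) - F" "M \<subseteq> path_edges p \<union> path_edges q"
  shows "two_paths n F M u v x y"
  using assms unfolding two_paths_def by blast

lemma ham_path_mono: "ham_path n F M u v \<Longrightarrow> F' \<subseteq> F \<Longrightarrow> M' \<subseteq> M \<Longrightarrow> ham_path n F' M' u v"
  unfolding ham_path_def by blast

lemma ham_cycle_mono: "ham_cycle n F M \<Longrightarrow> F' \<subseteq> F \<Longrightarrow> M' \<subseteq> M \<Longrightarrow> ham_cycle n F' M'"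
  unfolding ham_cycle_def by blast

lemma two_paths_mono:
  "two_paths n F M u v x y \<Longrightarrow> F' \<subseteq> F \<Longrightarrow> M' \<subseteq> M \<Longrightarrow> two_paths n F' M' u v x y"
  unfolding two_paths_def by blast

lemma ham_path_sym: "ham_path n F M u v \<Longrightarrow> ham_path n F M v u"
  unfolding ham_path_def by (elim exE, rule_tac x = "rev p" in exI) (auto simp: hd_rev last_rev)

lemma two_paths_swap: "two_paths n F M u v x y \<Longrightarrow> two_paths n F M x y u v"
  unfolding two_paths_def
  by (elim exE, rule_tac x = q in exI, rule_tac x = p in exI) auto

lemma two_paths_rev1: "two_paths n F M u v x y \<Longrightarrow> two_paths n F M v u x y"
  unfolding two_paths_def
  by (elim exE, rule_tac x = "rev p" in exI, rule_tac x = q in exI) (auto simp: hd_rev last_rev)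

lemma two_paths_rev2: "two_paths n F M u v x y \<Longrightarrow> two_paths n F M u v y x"
  by (metis two_paths_swap two_paths_rev1)

lemma ham_path_verts:
  assumes "ham_path n F M u v" shows "length u = n" "length v = n"
  using assms unfolding ham_path_def by (metis hd_in_set last_in_set verts_cube)+

lemma two_paths_verts:
  assumes "two_paths n F M u v x y"
  shows "length u = n" "length v = n" "length x = n" "length y = n"
  using assms unfolding two_paths_def by (metis UnCI hd_in_set last_in_set set_append verts_cube)+

lemma two_paths_neq:
  assumes "two_paths n F M u v x y"
  shows "u \<noteq> x" "u \<noteq> y" "v \<noteq> x" "v \<noteq> y"
  using assms unfolding two_paths_def distinct_append by (metis disjoint_iff hd_in_set last_in_set)+

lemma cyc_edges_rotate:
  assumes "distinct (q @ a # b # r)"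
  shows "cyc_edges (b # r @ q @ [a]) = cyc_edges (q @ a # b # r)"
  by (cases "q = []"; cases "r = []") (auto simp: cyc_edges_def path_edges_append path_edges_Cons insert_commute)

text \<open>Rotating the list turns the given edge into the closing edge. With at least three
  vertices the first and the last vertex are not consecutive, so the closing edge is not also a path
  edge and deleting it leaves exactly the path.\<close>

lemma cyc_edges_cut:
  assumes "distinct c" "3 \<le> length c" "{u, v} \<in> cyc_edges c"
  obtains p where "p \<noteq> []" "hd p = u" "last p = v" "distinct p" "set p = set c"
    "path_edges p = cyc_edges c - {{u, v}}" "cyc_edges p = cyc_edges c"
proof -
  have main: "\<exists>p. p \<noteq> [] \<and> {hd p, last p} = {u, v} \<and> distinct p \<and> set p = set c \<and> cyc_edges p = cyc_edges c"
  proof (cases "{u, v} = {last c, hd c}")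
    case True
    then show ?thesis using assms by (intro exI[of _ c]) auto
  next
    case False
    then have "{u, v} \<in> path_edges c" using assms(3) by (simp add: cyc_edges_def)
    then obtain q a b r where c: "c = q @ a # b # r" "{u, v} = {a, b}" by (rule path_edges_split)
    show ?thesis using c cyc_edges_rotate[of q a b r] assms(1)
      by (intro exI[of _ "b # r @ q @ [a]"]) auto
  qed
  then obtain p where p: "p \<noteq> []" "{hd p, last p} = {u, v}" "distinct p" "set p = set c"
    "cyc_edges p = cyc_edges c" by blast
  have "length p \<ge> 3" using p(3,4) assms(1,2) by (metis distinct_card)
  have notin: "{u, v} \<notin> path_edges p"
  proof
    assume "{u, v} \<in> path_edges p"
    then have "{hd p, last p} \<in> path_edges p" using p(2) by simp
    then obtain q a b r where "p = q @ a # b # r" "{hd p, last p} = {a, b}" by (rule path_edges_split)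
    then show False using p(3) \<open>length p \<ge> 3\<close>
      by (cases q; cases r rule: rev_cases) (auto simp: doubleton_eq_iff)
  qed
  have "cyc_edges p = insert {u, v} (path_edges p)"
    using p(2) by (simp add: cyc_edges_def insert_commute)
  with notin p(5) have 1: "path_edges p = cyc_edges c - {{u, v}}" by auto
  show thesis
  proof (cases "hd p = u")
    case True
    then have "last p = v" using p(2) by (auto simp: doubleton_eq_iff)
    then show ?thesis using that[of p] p True 1 by blast
  next
    case False
    then have "hd p = v" "last p = u" using p(2) by (auto simp: doubleton_eq_iff)
    moreover have "cyc_edges (rev p) = cyc_edges p"
      using p(1) by (simp add: cyc_edges_def hd_rev last_rev insert_commute)
    ultimately show ?thesis using that[of "rev p"] p 1 by (simp add: hd_rev last_rev)
  qed
qed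

section \<open>Surgery on Hamiltonian cycles and paths\<close>

lemma length_ham: "distinct p \<Longrightarrow> set p = verts (cube n) \<Longrightarrow> length p = 2 ^ n"
  by (metis card_verts_cube distinct_card)

lemma pow2_ge: "k \<le> n \<Longrightarrow> (2::nat) ^ k \<le> 2 ^ n"
  by (rule power_increasing) auto

lemma length_ham_ge3:
  assumes "distinct p" "set p = verts (cube n)" "2 \<le> n"
  shows "3 \<le> length p"
  using length_ham[OF assms(1,2)] pow2_ge[OF assms(3)] by simp

text \<open>Opening the cycle at an edge that enters \<open>x\<close> puts \<open>x\<close> last;
  its neighbours are then the first vertex and the penultimate one.\<close>

lemma cyc_edges_at:
  assumes "distinct c" "3 \<le> length c" "x \<in> set c"
  obtains y z where "y \<noteq> z" "y \<noteq> x" "z \<noteq> x" "{e \<in> cyc_edges c. x \<in> e} = {{x, y}, {x, z}}"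
proof -
  obtain q r where c: "c = q @ x # r" using assms(3) by (meson split_list)
  have "\<exists>y. {y, x} \<in> cyc_edges c"
    by (cases r) (auto simp: c cyc_edges_def path_edges_append path_edges_Cons insert_commute)
  then obtain y where y: "{y, x} \<in> cyc_edges c" ..
  then obtain p where p: "p \<noteq> []" "hd p = y" "last p = x" "distinct p" "set p = set c"
    "path_edges p = cyc_edges c - {{y, x}}" "cyc_edges p = cyc_edges c"
    using cyc_edges_cut[OF assms(1,2)] by metis
  have len: "3 \<le> length p" using p(4,5) assms(1,2) by (metis distinct_card)
  obtain p' where p': "p = p' @ [x]" using p(1,3) by (metis append_butlast_last_id)
  with len obtain p'' z where p'': "p' = p'' @ [z]" by (cases p' rule: rev_cases) auto
  have d: "distinct (p'' @ [z, x])" using p(4) p' p'' by simp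
  have "p'' \<noteq> []" using len p' p'' by auto
  moreover have "hd p'' = y" using p(2) p' p'' \<open>p'' \<noteq> []\<close> by simp
  ultimately have "{e \<in> cyc_edges p. x \<in> e} = {{x, y}, {x, z}}"
    using d path_edges_subset[of _ p'']
    by (auto simp: p' p'' cyc_edges_def path_edges_append insert_commute)
  moreover have "y \<in> set p''" using \<open>hd p'' = y\<close> \<open>p'' \<noteq> []\<close> hd_in_set by blast
  ultimately show ?thesis using that[of y z] d p(7) by auto
qed

lemma finite_cyc_edges [simp]: "finite (cyc_edges c)"
  by (simp add: cyc_edges_def)

lemma card_cyc_edges:
  assumes "distinct c" "3 \<le> length c"
  shows "card (cyc_edges c) = length c"
proof -
  have "{last c, hd c} \<in> cyc_edges c" by (simp add: cyc_edges_def)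
  then obtain p where p: "distinct p" "set p = set c" "path_edges p = cyc_edges c - {{last c, hd c}}"
    using cyc_edges_cut[OF assms] by metis
  have "length p = length c" using p(1,2) assms(1) by (metis distinct_card)
  then have "card (cyc_edges c) - 1 = length c - 1"
    using card_path_edges[OF p(1)] p(3) \<open>{last c, hd c} \<in> cyc_edges c\<close> by simp
  moreover have "card (cyc_edges c) > 0"
    using \<open>{last c, hd c} \<in> cyc_edges c\<close> card_gt_0_iff finite_cyc_edges by blast
  ultimately show ?thesis using assms(2) by linarith
qed

text \<open>Either the cycle avoids the edge, or it is opened there. Since both outcomes avoid it,
  this is how a fault that had been released is declared faulty again.\<close>

lemma ham_cycle_edge:
  assumes "ham_cycle n F M" "2 \<le> n"
  shows "ham_cycle n (insert {u, v} F) M \<or> ham_path n (insert {u, v} F) (M - {{u, v}}) u v"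
proof -
  obtain c where c: "c \<noteq> []" "distinct c" "set c = verts (cube n)"
    "cyc_edges c \<subseteq> edges (cube n) - F" "M \<subseteq> cyc_edges c"
    using assms(1) unfolding ham_cycle_def by blast
  show ?thesis
  proof (cases "{u, v} \<in> cyc_edges c")
    case True
    then obtain p where "p \<noteq> []" "hd p = u" "last p = v" "distinct p" "set p = set c"
      "path_edges p = cyc_edges c - {{u, v}}"
      using cyc_edges_cut[OF c(2) length_ham_ge3[OF c(2,3) assms(2)]] by metis
    then have "ham_path n (insert {u, v} F) (M - {{u, v}}) u v"
      using c by (intro ham_pathI[of p]) auto
    then show ?thesis ..
  next
    case False
    then have "ham_cycle n (insert {u, v} F) M" using c by (intro ham_cycleI[of c]) auto
    then show ?thesis ..
  qed
qed

lemma ham_cycle_cut: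
  assumes "ham_cycle n F M" "2 \<le> n" "{u, v} \<in> M"
  shows "ham_path n (insert {u, v} F) (M - {{u, v}}) u v"
  using ham_cycle_edge[OF assms(1,2), of u v] assms(3) by (auto simp: ham_cycle_def)

text \<open>Both neighbours on the cycle are offered because a matching contains at most one of the
  two edges at \<open>x\<close>; the cycle can then be opened at the other without losing a
  prescribed edge.\<close>

lemma ham_cycle_at:
  assumes "ham_cycle n F M" "2 \<le> n" "length x = n"
  obtains y z where "y \<noteq> z" "{x, y} \<in> edges (cube n)" "{x, z} \<in> edges (cube n)"
    "ham_path n F (M - {{x, y}}) x y" "ham_path n F (M - {{x, z}}) x z"
proof -
  obtain c where c: "c \<noteq> []" "distinct c" "set c = verts (cube n)"
    "cyc_edges c \<subseteq> edges (cube n) - F" "M \<subseteq> cyc_edges c"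
    using assms(1) unfolding ham_cycle_def by blast
  note len = length_ham_ge3[OF c(2,3) assms(2)]
  have "x \<in> set c" using c(3) assms(3) by simp
  then obtain y z where yz: "y \<noteq> z" "y \<noteq> x" "z \<noteq> x" "{e \<in> cyc_edges c. x \<in> e} = {{x, y}, {x, z}}"
    by (rule cyc_edges_at[OF c(2) len])
  have *: "ham_path n F (M - {{x, w}}) x w" if w: "{x, w} \<in> cyc_edges c" for w
  proof -
    obtain p where "p \<noteq> []" "hd p = x" "last p = w" "distinct p" "set p = set c"
      "path_edges p = cyc_edges c - {{x, w}}"
      using cyc_edges_cut[OF c(2) len w] by metis
    then show ?thesis using c by (intro ham_pathI[of p]) auto
  qed
  have xyz: "{x, y} \<in> cyc_edges c" "{x, z} \<in> cyc_edges c" using yz(4) by blast+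
  show ?thesis using that[OF yz(1) _ _ *[OF xyz(1)] *[OF xyz(2)]] xyz c(4) by blast
qed

text \<open>The cycle has \<open>2 ^ n\<close> edges; a vertex of \<open>Y\<close> rules out at most
  the two edges at it, an element of \<open>B\<close> at most one.\<close>

lemma ham_cycle_pick:
  assumes "ham_cycle n F M" "2 \<le> n" "finite B" "finite Y" "card B + 2 * card Y < 2 ^ n"
  obtains u v where "{u, v} \<in> edges (cube n)" "{u, v} \<notin> B" "u \<notin> Y" "v \<notin> Y"
    "ham_path n F (M - {{u, v}}) u v"
proof -
  obtain c where c: "c \<noteq> []" "distinct c" "set c = verts (cube n)"
    "cyc_edges c \<subseteq> edges (cube n) - F" "M \<subseteq> cyc_edges c"
    using assms(1) unfolding ham_cycle_def by blast
  note len = length_ham_ge3[OF c(2,3) assms(2)]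
  have deg: "card {e \<in> cyc_edges c. x \<in> e} \<le> 2" for x
  proof (cases "x \<in> set c")
    case True
    obtain y z where "y \<noteq> z" "y \<noteq> x" "z \<noteq> x" "{e \<in> cyc_edges c. x \<in> e} = {{x, y}, {x, z}}"
      by (rule cyc_edges_at[OF c(2) len True])
    then show ?thesis by (simp add: card_insert_le_m1)
  next
    case False
    then have "{e \<in> cyc_edges c. x \<in> e} = {}"
      using c(1) path_edges_subset[of _ c] by (auto simp: cyc_edges_def)
    then show ?thesis by (simp only: card.empty)
  qed
  let ?D = "B \<union> (\<Union>x\<in>Y. {e \<in> cyc_edges c. x \<in> e})"
  have "card ?D \<le> card B + card (\<Union>x\<in>Y. {e \<in> cyc_edges c. x \<in> e})" by (rule card_Un_le)
  also have "\<dots> \<le> card B + (\<Sum>x\<in>Y. card {e \<in> cyc_edges c. x \<in> e})"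
    using card_UN_le[OF assms(4)] by simp
  also have "\<dots> \<le> card B + (\<Sum>x\<in>Y. 2)" using deg by (intro add_left_mono sum_mono)
  also have "\<dots> < card (cyc_edges c)"
    using assms(5) length_ham[OF c(2,3)] card_cyc_edges[OF c(2) len] by simp
  finally have "\<not> cyc_edges c \<subseteq> ?D"
    using card_mono[of ?D "cyc_edges c"] assms(3,4) by auto
  then obtain e where e: "e \<in> cyc_edges c" "e \<notin> B" "\<forall>x\<in>Y. x \<notin> e" by blast
  then obtain u v where uv: "e = {u, v}" using c(4) by (meson DiffE edgeE subsetD)
  obtain p where "p \<noteq> []" "hd p = u" "last p = v" "distinct p" "set p = set c"
      "path_edges p = cyc_edges c - {{u, v}}"
      using cyc_edges_cut[OF c(2) len] e(1) uv by metis
  then have "ham_path n F (M - {{u, v}}) u v"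
    using c by (intro ham_pathI[of p]) auto
  then show ?thesis using that[of u v] e uv c(4) by blast
qed

lemma path_edges_cut:
  assumes "distinct p" "{a, b} \<in> path_edges p"
  obtains q r where "p = q @ r" "q \<noteq> []" "r \<noteq> []" "last q = a \<and> hd r = b \<or> last q = b \<and> hd r = a"
    "path_edges q \<union> path_edges r = path_edges p - {{a, b}}"
proof -
  obtain q x y r where p: "p = q @ x # y # r" "{a, b} = {x, y}"
    using path_edges_split[OF assms(2)] by metis
  have "{x, y} \<notin> path_edges (q @ [x])" "{x, y} \<notin> path_edges (y # r)"
    using path_edges_subset[of "{x, y}" "q @ [x]"] path_edges_subset[of "{x, y}" "y # r"] assms(1) p(1)
    by auto
  then have "path_edges (q @ [x]) \<union> path_edges (y # r) = path_edges p - {{a, b}}"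
    using p path_edges_append[of "q @ [x]" "y # r"] by auto
  then show ?thesis using that[of "q @ [x]" "y # r"] p by (auto simp: doubleton_eq_iff)
qed

text \<open>If the path uses the edge, deleting it leaves two paths; which end of the edge comes
  first is unknown, hence two alternatives. They serve to restore a released fault or to open a gap
  for a detour.\<close>

lemma ham_path_edge:
  assumes "ham_path n F M u v"
  shows "ham_path n (insert {a, b} F) M u v \<or> two_paths n (insert {a, b} F) (M - {{a, b}}) u a b v \<or>
    two_paths n (insert {a, b} F) (M - {{a, b}}) u b a v"
proof -
  obtain p where p: "p \<noteq> []" "hd p = u" "last p = v" "distinct p" "set p = verts (cube n)"
    "path_edges p \<subseteq> edges (cube n) - F" "M \<subseteq> path_edges p"
    using assms unfolding ham_path_def by blast
  show ?thesis
  proof (cases "{a, b} \<in> path_edges p")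
    case True
    then obtain q r where qr: "p = q @ r" "q \<noteq> []" "r \<noteq> []"
      "last q = a \<and> hd r = b \<or> last q = b \<and> hd r = a"
      "path_edges q \<union> path_edges r = path_edges p - {{a, b}}"
      using path_edges_cut[OF p(4)] by metis
    have "two_paths n (insert {a, b} F) (M - {{a, b}}) u (last q) (hd r) v"
    proof (rule two_pathsI[of q r])
      show "path_edges q \<union> path_edges r \<subseteq> edges (cube n) - insert {a, b} F"
        "M - {{a, b}} \<subseteq> path_edges q \<union> path_edges r"
        unfolding qr(5) using p(6,7) by blast+
    qed (use p qr(1-3) in auto)
    with qr(4) show ?thesis by auto
  next
    case False
    then have "ham_path n (insert {a, b} F) M u v" using p by (intro ham_pathI[of p]) auto
    then show ?thesis ..
  qed
qed

lemma ham_path_through: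
  assumes "ham_path n F M u v" "{a, b} \<in> M"
  shows "two_paths n F (M - {{a, b}}) u a b v \<or> two_paths n F (M - {{a, b}}) u b a v"
proof -
  have "\<not> ham_path n (insert {a, b} F) M u v" using assms(2) by (auto simp: ham_path_def)
  with ham_path_edge[OF assms(1), of a b] show ?thesis by (meson subset_insertI subset_refl two_paths_mono)
qed

lemma ham_path_pick:
  assumes "ham_path n F M u v" "finite B" "card B + 1 < 2 ^ n"
  obtains p q where "{p, q} \<in> edges (cube n)" "{p, q} \<notin> B" "two_paths n F (M - {{p, q}}) u p q v"
proof -
  obtain p where p: "p \<noteq> []" "hd p = u" "last p = v" "distinct p" "set p = verts (cube n)"
    "path_edges p \<subseteq> edges (cube n) - F" "M \<subseteq> path_edges p"
    using assms unfolding ham_path_def by blast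
  have "card (path_edges p) = 2 ^ n - 1" using card_path_edges[OF p(4)] length_ham[OF p(4,5)] by simp
  then have "\<not> path_edges p \<subseteq> B" using card_mono[OF assms(2), of "path_edges p"] assms(3) by linarith
  then obtain e where e: "e \<in> path_edges p" "e \<notin> B" by blast
  then obtain a b where ab: "e = {a, b}" using p(6) by (meson DiffE edgeE subsetD)
  obtain q r where qr: "p = q @ r" "q \<noteq> []" "r \<noteq> []" "last q = a \<and> hd r = b \<or> last q = b \<and> hd r = a"
    "path_edges q \<union> path_edges r = path_edges p - {{a, b}}"
    using path_edges_cut[OF p(4)] e(1) ab by metis
  have eq: "{last q, hd r} = {a, b}" using qr(4) by auto
  have "two_paths n F (M - {{last q, hd r}}) u (last q) (hd r) v"
  proof (rule two_pathsI[of q r])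
    show "path_edges q \<union> path_edges r \<subseteq> edges (cube n) - F"
      "M - {{last q, hd r}} \<subseteq> path_edges q \<union> path_edges r"
      unfolding qr(5) eq using p(6,7) by blast+
  qed (use p qr(1-3) in auto)
  then show ?thesis using that[of "last q" "hd r"] eq e ab p(6) by auto
qed

text \<open>Since \<open>x\<close> is uncovered, either path edge at \<open>x\<close> may be
  deleted. The edge to its successor is taken unless that is \<open>v\<close>; then the edge to its
  predecessor is taken. In this way neither of the two paths shrinks to a single vertex.\<close>

lemma ham_path_split_at:
  assumes "ham_path n F M u v" "2 \<le> n" "length x = n" "x \<noteq> u" "x \<noteq> v" "x \<notin> \<Union>M"
  shows "\<exists>y. {x, y} \<in> edges (cube n) \<and>
    (two_paths n F M u x y v \<and> y \<noteq> v \<or> two_paths n F M u y x v \<and> u \<noteq> y)"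
proof -
  obtain p where p: "p \<noteq> []" "hd p = u" "last p = v" "distinct p" "set p = verts (cube n)"
    "path_edges p \<subseteq> edges (cube n) - F" "M \<subseteq> path_edges p"
    using assms(1) unfolding ham_path_def by blast
  have len: "4 \<le> length p" using length_ham[OF p(4,5)] pow2_ge[OF assms(2)] by simp
  obtain q r where c: "p = q @ x # r" using p(5) assms(3) by (metis split_list verts_cube)
  have "q \<noteq> []" using c p(2) assms(4) by auto
  moreover have "r \<noteq> []" using c p(3) assms(5) by auto
  ultimately obtain q' a b r' where qr: "q = q' @ [a]" "r = b # r'" by (metis list.exhaust rev_exhaust)
  have P: "path_edges p = path_edges q \<union> path_edges r \<union> {{a, x}, {x, b}}"
    unfolding c qr by (auto simp: path_edges_append path_edges_Cons)
  have M: "M \<subseteq> {e \<in> path_edges p. x \<notin> e}" using assms(6) p(7) by auto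
  have E: "{x, a} \<in> edges (cube n)" "{x, b} \<in> edges (cube n)" using p(6) P by (auto simp: insert_commute)
  show ?thesis
  proof (cases "r' = []")
    case False
    have R: "path_edges (q @ [x]) = path_edges q \<union> {{a, x}}"
      unfolding qr by (simp add: path_edges_append)
    have "two_paths n F M u x b v"
    proof (rule two_pathsI[of "q @ [x]" r])
      show "path_edges (q @ [x]) \<union> path_edges r \<subseteq> edges (cube n) - F" using p(6) unfolding R P by blast
      show "M \<subseteq> path_edges (q @ [x]) \<union> path_edges r" using M unfolding R P by blast
    qed (use p c qr in \<open>auto simp: hd_append\<close>)
    moreover have "b \<noteq> v" using p(3,4) c qr False by auto
    ultimately show ?thesis using E by blast
  next
    case True
    then have "q' \<noteq> []" using len c qr by auto
    have R: "path_edges (x # r) = path_edges r \<union> {{x, b}}"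
      unfolding qr by simp
    have "two_paths n F M u a x v"
    proof (rule two_pathsI[of q "x # r"])
      show "path_edges q \<union> path_edges (x # r) \<subseteq> edges (cube n) - F" using p(6) unfolding R P by blast
      show "M \<subseteq> path_edges q \<union> path_edges (x # r)" using M unfolding R P by blast
    qed (use p c qr in \<open>auto simp: hd_append\<close>)
    moreover have "u \<noteq> a" using p(2,4) c qr \<open>q' \<noteq> []\<close> by auto
    ultimately show ?thesis using E by blast
  qed
qed

text \<open>If a chord \<open>ab\<close> avoids \<open>M\<close>, deleting one further edge at each of its ends turns the path
  plus the chord into two paths.\<close>

lemma ham_path_chord:
  assumes "ham_path n F M u v" "{a, b} \<in> edges (cube n) - F" "{a, b} \<noteq> {u, v}" "a \<notin> \<Union>M" "b \<notin> \<Union>M"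
  shows "ham_path n F (insert {a, b} M) u v \<or>
    (\<exists>p q. par p \<noteq> par q \<and> two_paths n F (insert {a, b} M) u p q v)"
proof -
  obtain p where p: "p \<noteq> []" "hd p = u" "last p = v" "distinct p" "set p = verts (cube n)"
    "path_edges p \<subseteq> edges (cube n) - F" "M \<subseteq> path_edges p"
    using assms(1) unfolding ham_path_def by blast
  have main: "ham_path n F (insert {a, b} M) u v \<or>
      (\<exists>p q. par p \<noteq> par q \<and> two_paths n F (insert {a, b} M) u p q v)"
    if ab: "{a, b} \<in> edges (cube n) - F" "{a, b} \<noteq> {u, v}" "a \<notin> \<Union>M" "b \<notin> \<Union>M"
      and p': "p = X @ a # Y @ b # Z" for a b X Y Z
  proof (cases Y)
    case Nil
    then have "ham_path n F (insert {a, b} M) u v"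
      using p p' by (intro ham_pathI[of p]) (auto simp: path_edges_append)
    then show ?thesis ..
  next
    case (Cons y Y')
    then have Y: "Y \<noteq> []" by simp
    have M: "M \<subseteq> {e \<in> path_edges p. a \<notin> e \<and> b \<notin> e}" using ab(3,4) p(7) by auto
    have "par a \<noteq> par b" using edge_par ab(1) by blast
    show ?thesis
    proof (cases "Z = []")
      case True
      \<comment> \<open>Here \<open>b\<close> is the last vertex, so no edge follows it; the deleted
        edges are those preceding \<open>a\<close> and \<open>b\<close>. An empty \<open>X\<close>
        would make the chord join the two ends of the path.\<close>
      then have X: "X \<noteq> []" using ab(2) p(2,3) p' by auto
      have P: "path_edges p = path_edges X \<union> path_edges Y \<union> {{last X, a}, {a, hd Y}, {last Y, b}}"
        unfolding p' using X Y True by (simp add: path_edges_append path_edges_Cons; blast)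
      have R: "path_edges (rev Y @ [a, b]) = path_edges Y \<union> {{a, hd Y}, {a, b}}"
        using Y by (simp add: path_edges_append last_rev; blast)
      have 1: "{last X, a} \<in> edges (cube n)" "{last Y, b} \<in> edges (cube n)"
        using p(6) P by auto
      have "two_paths n F (insert {a, b} M) u (last X) (last Y) v"
      proof (rule two_pathsI[of X "rev Y @ [a, b]"])
        show "path_edges X \<union> path_edges (rev Y @ [a, b]) \<subseteq> edges (cube n) - F"
          using p(6) ab(1) unfolding R P by blast
        show "insert {a, b} M \<subseteq> path_edges X \<union> path_edges (rev Y @ [a, b])"
          using M unfolding R P by blast
      qed (use p p' X Y True in \<open>auto simp: hd_append hd_rev\<close>)
      moreover have "par (last X) \<noteq> par (last Y)"
        using edge_par[OF 1(1)] edge_par[OF 1(2)] \<open>par a \<noteq> par b\<close> by blast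
      ultimately show ?thesis by blast
    next
      case Z: False
      have P: "path_edges p = path_edges (X @ [a]) \<union> path_edges Y \<union> path_edges Z \<union>
          {{a, hd Y}, {last Y, b}, {b, hd Z}}"
        unfolding p' using Z Y by (simp add: path_edges_append path_edges_Cons; blast)
      have R: "path_edges (X @ a # b # rev Y) = path_edges (X @ [a]) \<union> path_edges Y \<union> {{last Y, b}, {a, b}}"
        using Y by (simp add: path_edges_append path_edges_Cons hd_rev insert_commute)
      have 1: "{hd Y, a} \<in> edges (cube n)" "{hd Z, b} \<in> edges (cube n)"
        using p(6) P by (auto simp: insert_commute)
      have "two_paths n F (insert {a, b} M) u (hd Y) (hd Z) v"
      proof (rule two_pathsI[of "X @ a # b # rev Y" Z])
        show "path_edges (X @ a # b # rev Y) \<union> path_edges Z \<subseteq> edges (cube n) - F"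
          using p(6) ab(1) unfolding R P by blast
        show "insert {a, b} M \<subseteq> path_edges (X @ a # b # rev Y) \<union> path_edges Z"
          using M unfolding R P by blast
      qed (use p p' Z Y in \<open>auto simp: hd_append last_rev\<close>)
      moreover have "par (hd Y) \<noteq> par (hd Z)"
        using edge_par[OF 1(1)] edge_par[OF 1(2)] \<open>par a \<noteq> par b\<close> by blast
      ultimately show ?thesis by blast
    qed
  qed
  have ab: "a \<in> set p" "b \<in> set p" "a \<noteq> b" using assms(2) p(5) edge_length[of a b n] by auto
  obtain X W where 1: "p = X @ a # W" using ab(1) by (meson split_list)
  show ?thesis
  proof (cases "b \<in> set W")
    case True
    then obtain Y Z where "W = Y @ b # Z" by (meson split_list)
    with main[of a b X Y Z] assms 1 show ?thesis by simp
  next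
    case False
    then have "b \<in> set X" using ab 1 by auto
    then obtain Y Z where "X = Y @ b # Z" by (meson split_list)
    with main[of b a Y Z W] assms 1 show ?thesis by (simp add: insert_commute)
  qed
qed

section \<open>Inserting chords into a Hamiltonian cycle\<close>

lemma cyc_edges_append_commute: "cyc_edges (p @ q) = cyc_edges (q @ p)"
  by (cases "p = []"; cases "q = []") (auto simp: cyc_edges_def path_edges_append)

lemma cyc_edges_rev: "cyc_edges (rev p) = cyc_edges p"
  by (cases "p = []") (simp_all add: cyc_edges_def hd_rev last_rev insert_commute)

lemma cyc_edges_parts:
  assumes "p \<noteq> []" "q \<noteq> []"
  shows "cyc_edges (p @ q) = path_edges p \<union> path_edges q \<union> {{last p, hd q}, {last q, hd p}}"
  using assms by (simp add: cyc_edges_def path_edges_append; blast)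

text \<open>A chord off the cycle becomes part of a Hamiltonian path when one cycle edge is deleted
  at each of its ends, both following or both preceding them in the cyclic order. The two choices
  end in different pairs of vertices, so one remains if the other pair happens to be a matching edge
  of the opposite half.\<close>

lemma ham_cycle_chord:
  assumes "ham_cycle n F M" "3 \<le> n" "{a, b} \<in> edges (cube n) - F" "a \<notin> \<Union>M" "b \<notin> \<Union>M"
  shows "ham_cycle n F (insert {a, b} M) \<or>
    (\<exists>u v x y. ham_path n F (insert {a, b} M) u v \<and> ham_path n F (insert {a, b} M) x y \<and>
       {u, v} \<noteq> {x, y} \<and> par u \<noteq> par v \<and> par x \<noteq> par y)"
proof -
  obtain c where c: "c \<noteq> []" "distinct c" "set c = verts (cube n)"
    "cyc_edges c \<subseteq> edges (cube n) - F" "M \<subseteq> cyc_edges c"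
    using assms(1) unfolding ham_cycle_def by blast
  have ab: "a \<in> set c" "b \<in> set c" "a \<noteq> b" using assms(3) c(3) edge_length[of a b n]  by auto
  show ?thesis
  proof (cases "{a, b} \<in> cyc_edges c")
    case True
    then have "ham_cycle n F (insert {a, b} M)" using c by (intro ham_cycleI[of c]) auto
    then show ?thesis ..
  next
    case False
    obtain q r where qr: "c = q @ a # r" using ab(1) by (meson split_list)
    define W where "W = r @ q"
    have W: "cyc_edges ([a] @ W) = cyc_edges c" "distinct (a # W)" "set (a # W) = verts (cube n)"
      using cyc_edges_append_commute[of q "a # r"] c(2,3) by (auto simp: W_def qr)
    have "b \<in> set W" using ab by (auto simp: W_def qr)
    then obtain X Y where XY: "W = X @ b # Y" by (meson split_list)
    have "X \<noteq> []" "Y \<noteq> []"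
      using False unfolding W(1)[symmetric] XY by (auto simp: cyc_edges_def path_edges_append insert_commute)
    have C: "cyc_edges c = path_edges X \<union> path_edges Y \<union> {{a, hd X}, {last X, b}, {b, hd Y}, {last Y, a}}"
      unfolding W(1)[symmetric] XY using \<open>X \<noteq> []\<close> \<open>Y \<noteq> []\<close>
      by (simp add: cyc_edges_def path_edges_append path_edges_Cons; blast)
    have R: "path_edges (X @ [b, a] @ rev Y) = path_edges X \<union> path_edges Y \<union> {{last X, b}, {a, b}, {last Y, a}}"
      "path_edges (rev X @ [a, b] @ Y) = path_edges X \<union> path_edges Y \<union> {{a, hd X}, {a, b}, {b, hd Y}}"
      using \<open>X \<noteq> []\<close> \<open>Y \<noteq> []\<close> by (auto simp: path_edges_append path_edges_Cons hd_rev last_rev insert_commute)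
    have M: "M \<subseteq> {e \<in> cyc_edges c. a \<notin> e \<and> b \<notin> e}" using c(5) assms(4,5) by auto
    have len: "length X + length Y + 2 \<ge> 8"
      using length_ham[OF W(2,3)] pow2_ge[OF assms(2)] XY by simp
    have 1: "ham_path n F (insert {a, b} M) (hd X) (hd Y)"
    proof (rule ham_pathI[of "X @ [b, a] @ rev Y"])
      show "path_edges (X @ [b, a] @ rev Y) \<subseteq> edges (cube n) - F"
        using c(4) assms(3) unfolding R C by blast
      show "insert {a, b} M \<subseteq> path_edges (X @ [b, a] @ rev Y)"
        using M unfolding R C by blast
    qed (use W XY \<open>X \<noteq> []\<close> \<open>Y \<noteq> []\<close> in \<open>auto simp: last_rev\<close>)
    have 2: "ham_path n F (insert {a, b} M) (last X) (last Y)"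
    proof (rule ham_pathI[of "rev X @ [a, b] @ Y"])
      show "path_edges (rev X @ [a, b] @ Y) \<subseteq> edges (cube n) - F"
        using c(4) assms(3) unfolding R C by blast
      show "insert {a, b} M \<subseteq> path_edges (rev X @ [a, b] @ Y)"
        using M unfolding R C by blast
    qed (use W XY \<open>X \<noteq> []\<close> \<open>Y \<noteq> []\<close> in \<open>auto simp: hd_rev\<close>)
    have "{a, hd X} \<in> edges (cube n)" "{last X, b} \<in> edges (cube n)" "{b, hd Y} \<in> edges (cube n)"
      "{last Y, a} \<in> edges (cube n)" "{a, b} \<in> edges (cube n)"
      using c(4) assms(3) unfolding C by blast+
    note par = this[THEN edge_par]
    \<comment> \<open>Equal pairs would make both arcs single vertices, but a cube of dimension at
      least 3 has eight vertices.\<close>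
    have "{hd X, hd Y} \<noteq> {last X, last Y}"
    proof
      assume *: "{hd X, hd Y} = {last X, last Y}"
      have "hd X \<noteq> last Y" using W(2) XY hd_in_set[OF \<open>X \<noteq> []\<close>] last_in_set[OF \<open>Y \<noteq> []\<close>] by auto
      with * have "hd X = last X" "hd Y = last Y" by (auto simp: doubleton_eq_iff)
      then have "length X \<le> 1" "length Y \<le> 1" using W(2) XY
        by (cases X; cases Y; auto split: if_splits)+
      with len show False by simp
    qed
    moreover have "par (hd X) \<noteq> par (hd Y)" "par (last X) \<noteq> par (last Y)" using par by blast+
    ultimately show ?thesis using 1 2 by blast
  qed
qed

text \<open>Two pairwise complementary ways in which one half of the cube can be joined to the other half
  into a Hamiltonian cycle.\<close>

definition linkable where
  "linkable n F M \<longleftrightarrow> (\<exists>u v. par u \<noteq> par v \<and> ham_path n F M u v) \<or>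
    (\<exists>u v x y. two_paths n F M u v x y \<and> u \<noteq> v \<and> x \<noteq> y \<and> par u \<noteq> par y \<and> par v \<noteq> par x)"

text \<open>The cyclic order of the ends is \<open>c\<close>, \<open>b\<close>, \<open>d\<close>,
  \<open>a\<close>, so the chords cross. The path follows \<open>A\<close> to \<open>c\<close>,
  jumps to \<open>d\<close>, follows \<open>D\<close> to \<open>a\<close>, jumps to \<open>b\<close>
  and runs back through \<open>B\<close>; the gap \<open>Z\<close> is left over as the second path.
  A gap of one vertex is excluded because its two ends would coincide, while an empty gap leaves a
  single Hamiltonian path.\<close>

lemma two_chords_gap:
  assumes ne: "A \<noteq> []" "B \<noteq> []" "D \<noteq> []"
    and ends: "last A = c" "last B = b" "hd D = d" "last D = a"
    and p: "distinct (A @ B @ Z @ D)" "set (A @ B @ Z @ D) = verts (cube n)"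
      "cyc_edges (A @ B @ Z @ D) \<subseteq> edges (cube n) - F" "M \<subseteq> cyc_edges (A @ B @ Z @ D)"
    and ch: "{a, b} \<in> edges (cube n) - F" "{c, d} \<in> edges (cube n) - F"
      "a \<notin> \<Union>M" "b \<notin> \<Union>M" "c \<notin> \<Union>M" "d \<notin> \<Union>M"
    and Z: "length Z \<noteq> 1"
  shows "linkable n F ({{a, b}, {c, d}} \<union> M)"
proof -
  let ?P = "A @ D @ rev B" and ?C = "cyc_edges (A @ B @ Z @ D)"
  have R: "path_edges ?P = path_edges A \<union> path_edges B \<union> path_edges D \<union> {{a, b}, {c, d}}"
    using ne ends by (simp add: path_edges_append hd_rev; blast)
  have M: "M \<subseteq> {e \<in> ?C. a \<notin> e \<and> b \<notin> e \<and> c \<notin> e \<and> d \<notin> e}" using p(4) ch by auto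
  show ?thesis
  proof (cases "Z = []")
    case True
    have C: "?C = path_edges A \<union> path_edges B \<union> path_edges D \<union> {{c, hd B}, {b, d}, {a, hd A}}"
      using ne ends True by (simp add: cyc_edges_def path_edges_append; blast)
    have "ham_path n F ({{a, b}, {c, d}} \<union> M) (hd A) (hd B)"
    proof (rule ham_pathI[of ?P])
      show "path_edges ?P \<subseteq> edges (cube n) - F" using p(3) ch unfolding R C by blast
      show "{{a, b}, {c, d}} \<union> M \<subseteq> path_edges ?P" using M unfolding R C by blast
    qed (use ne p True in \<open>auto simp: last_rev\<close>)
    moreover have "{c, hd B} \<in> edges (cube n)" "{b, d} \<in> edges (cube n)" "{a, hd A} \<in> edges (cube n)"
      "{a, b} \<in> edges (cube n)" "{c, d} \<in> edges (cube n)"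
      using p(3) ch unfolding C by blast+
    note this[THEN edge_par]
    then have "par (hd A) \<noteq> par (hd B)" by blast
    ultimately show ?thesis unfolding linkable_def by blast
  next
    case False
    have C: "?C = path_edges A \<union> path_edges B \<union> path_edges Z \<union> path_edges D \<union>
        {{c, hd B}, {b, hd Z}, {last Z, d}, {a, hd A}}"
      using ne ends False by (auto simp: cyc_edges_def path_edges_append)
    have "two_paths n F ({{a, b}, {c, d}} \<union> M) (hd A) (hd B) (last Z) (hd Z)"
    proof (rule two_pathsI[of ?P "rev Z"])
      show "path_edges ?P \<union> path_edges (rev Z) \<subseteq> edges (cube n) - F"
        using p(3) ch unfolding R C path_edges_rev by blast
      show "{{a, b}, {c, d}} \<union> M \<subseteq> path_edges ?P \<union> path_edges (rev Z)"
        using M unfolding R C path_edges_rev by blast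
    qed (use ne p False in \<open>auto simp: last_rev hd_rev\<close>)
    moreover have "{c, hd B} \<in> edges (cube n)" "{b, hd Z} \<in> edges (cube n)" "{last Z, d} \<in> edges (cube n)"
      "{a, hd A} \<in> edges (cube n)" "{a, b} \<in> edges (cube n)" "{c, d} \<in> edges (cube n)"
      using p(3) ch unfolding C by blast+
    note par = this[THEN edge_par]
    moreover have "par (hd A) \<noteq> par (hd Z)" "par (hd B) \<noteq> par (last Z)" using par by blast+
    moreover have "hd A \<noteq> hd B"
      using p(1) hd_in_set[OF ne(1)] hd_in_set[OF ne(2)] by auto
    moreover have "last Z \<noteq> hd Z"
      using p(1) False Z by (cases Z) (auto split: if_splits)
    ultimately show ?thesis unfolding linkable_def by (intro disjI2 exI conjI)
  qed
qed

text \<open>Both ends of the chord \<open>cd\<close> lie on the same arc between \<open>a\<close>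
  and \<open>b\<close>, so each chord can have a path of its own: one jumps from \<open>c\<close> to
  \<open>d\<close> and turns back through \<open>Y\<close>, the other jumps from \<open>b\<close> to
  \<open>a\<close> and turns back through \<open>W\<close>.\<close>

lemma two_chords_same_side:
  assumes ne: "A \<noteq> []" "Y \<noteq> []" "B \<noteq> []" "W \<noteq> []"
    and ends: "last A = c" "last B = b"
    and p: "distinct (A @ Y @ d # B @ W @ [a])" "set (A @ Y @ d # B @ W @ [a]) = verts (cube n)"
      "cyc_edges (A @ Y @ d # B @ W @ [a]) \<subseteq> edges (cube n) - F"
      "M \<subseteq> cyc_edges (A @ Y @ d # B @ W @ [a])"
    and ch: "{a, b} \<in> edges (cube n) - F" "{c, d} \<in> edges (cube n) - F"
      "a \<notin> \<Union>M" "b \<notin> \<Union>M" "c \<notin> \<Union>M" "d \<notin> \<Union>M"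
  shows "linkable n F ({{a, b}, {c, d}} \<union> M)"
proof -
  let ?P = "A @ d # rev Y" and ?Q = "B @ a # rev W" and ?C = "cyc_edges (A @ Y @ d # B @ W @ [a])"
  have C: "?C = path_edges A \<union> path_edges Y \<union> path_edges B \<union> path_edges W \<union>
      {{c, hd Y}, {last Y, d}, {d, hd B}, {b, hd W}, {last W, a}, {a, hd A}}"
    using ne ends by (auto simp: cyc_edges_def path_edges_append path_edges_Cons)
  have R: "path_edges ?P = path_edges A \<union> path_edges Y \<union> {{c, d}, {last Y, d}}"
      "path_edges ?Q = path_edges B \<union> path_edges W \<union> {{a, b}, {last W, a}}"
    using ne ends by (simp_all add: path_edges_append path_edges_Cons hd_rev insert_commute) 
  have M: "M \<subseteq> {e \<in> ?C. a \<notin> e \<and> b \<notin> e \<and> c \<notin> e \<and> d \<notin> e}" using p(4) ch by auto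
  have "two_paths n F ({{a, b}, {c, d}} \<union> M) (hd A) (hd Y) (hd B) (hd W)"
  proof (rule two_pathsI[of ?P ?Q])
    show "path_edges ?P \<union> path_edges ?Q \<subseteq> edges (cube n) - F" using p(3) ch unfolding R C by blast
    show "{{a, b}, {c, d}} \<union> M \<subseteq> path_edges ?P \<union> path_edges ?Q" using M unfolding R C by blast
  qed (use ne p in \<open>auto simp: last_rev\<close>)
  moreover have "{c, hd Y} \<in> edges (cube n)" "{d, hd B} \<in> edges (cube n)" "{b, hd W} \<in> edges (cube n)"
    "{a, hd A} \<in> edges (cube n)" "{a, b} \<in> edges (cube n)" "{c, d} \<in> edges (cube n)"
    using p(3) ch unfolding C by blast+
  note par = this[THEN edge_par]
  moreover have "par (hd A) \<noteq> par (hd W)" "par (hd Y) \<noteq> par (hd B)" using par by blast+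
  moreover have "hd A \<noteq> hd Y" "hd B \<noteq> hd W"
    using p(1) ne[THEN hd_in_set] by auto
  ultimately show ?thesis unfolding linkable_def by (intro disjI2 exI conjI)
qed

text \<open>If the cycle already contains one of the chords, only the other has to be inserted.
  Otherwise the surgery depends on whether the two chords cross.\<close>

lemma two_chords:
  assumes hc: "ham_cycle n F M" and n: "4 \<le> n"
    and ch: "{a, b} \<in> edges (cube n) - F" "{c, d} \<in> edges (cube n) - F"
      "a \<notin> \<Union>M" "b \<notin> \<Union>M" "c \<notin> \<Union>M" "d \<notin> \<Union>M"
    and dj: "{a, b} \<inter> {c, d} = {}" and fin: "finite M" "card M + 2 < 2 ^ n"
  shows "linkable n F ({{a, b}, {c, d}} \<union> M)"
proof -
  \<comment> \<open>If the chord can be put on a cycle, that cycle is opened at an edge outside the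
    matching; otherwise \<open>ham_cycle_chord\<close> yields a path directly.\<close>
  have single: "linkable n F (insert {a, b} M')"
    if asm: "ham_cycle n F M'" "{a, b} \<in> edges (cube n) - F" "a \<notin> \<Union>M'" "b \<notin> \<Union>M'"
      "finite M' \<and> card M' + 1 < 2 ^ n" for a b M'
  proof (cases "ham_cycle n F (insert {a, b} M')")
    case True
    have "card (insert {a, b} M') + 2 * card ({} :: bool list set) < 2 ^ n"
      using card_insert_le_m1[of "Suc (card M')" M' "{a, b}"] asm(5) by simp
    then obtain u v where "{u, v} \<in> edges (cube n)" "{u, v} \<notin> insert {a, b} M'"
      "ham_path n F (insert {a, b} M' - {{u, v}}) u v"
      using ham_cycle_pick[OF True, of "insert {a, b} M'" "{}"] asm(5) n by auto
    then show ?thesis unfolding linkable_def using edge_par by (metis Diff_insert_absorb Diff_empty Diff_insert0)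
  next
    case False
    have "3 \<le> n" using n by simp
    with ham_cycle_chord[OF asm(1) _ asm(2-4)] False obtain u v where
      "ham_path n F (insert {a, b} M') u v" "par u \<noteq> par v" by blast
    then show ?thesis unfolding linkable_def by blast
  qed
  obtain p where p: "p \<noteq> []" "distinct p" "set p = verts (cube n)"
    "cyc_edges p \<subseteq> edges (cube n) - F" "M \<subseteq> cyc_edges p"
    using hc unfolding ham_cycle_def by blast
  have mem: "a \<in> set p" "b \<in> set p" "c \<in> set p" "d \<in> set p" "a \<noteq> b" "c \<noteq> d"
    using ch(1,2) p(3) edge_length[of a b n]  edge_length[of c d n]  by auto
  consider "{a, b} \<in> cyc_edges p" | "{c, d} \<in> cyc_edges p" |
    "{a, b} \<notin> cyc_edges p" "{c, d} \<notin> cyc_edges p" by blast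
  then show ?thesis
  proof cases
    case 1
    then have "ham_cycle n F (insert {a, b} M)" using p by (intro ham_cycleI[of p]) auto
    then have "linkable n F (insert {c, d} (insert {a, b} M))"
      using ch dj fin card_insert_le_m1[of "Suc (card M)" M "{a, b}"] by (intro single) auto
    then show ?thesis by (simp add: insert_commute)
  next
    case 2
    then have "ham_cycle n F (insert {c, d} M)" using p by (intro ham_cycleI[of p]) auto
    then have "linkable n F (insert {a, b} (insert {c, d} M))"
      using ch dj fin card_insert_le_m1[of "Suc (card M)" M "{c, d}"] by (intro single) auto
    then show ?thesis by simp
  next
    case 3
    have same: "linkable n F ({{a, b}, {c, d}} \<union> M)"
      if q: "distinct (W1 @ b # W2 @ [a])" "set (W1 @ b # W2 @ [a]) = set p"
        "cyc_edges (W1 @ b # W2 @ [a]) = cyc_edges p" and "W2 \<noteq> []" and cd: "c \<in> set W1" "d \<in> set W1" for W1 W2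
    proof -
      have *: "linkable n F ({{a, b}, {c, d}} \<union> M)"
        if W: "W1 = X @ c # Y @ d # Z" and ch': "{c, d} \<in> edges (cube n) - F" "c \<notin> \<Union>M" "d \<notin> \<Union>M"
          "{c, d} \<notin> cyc_edges p" for X Y Z c d
      proof (rule two_chords_same_side[of "X @ [c]" Y "Z @ [b]" W2])
        show "Y \<noteq> []" using ch'(4) unfolding q(3)[symmetric] W by (auto simp: cyc_edges_def path_edges_append)
      qed (use q W p ch ch' \<open>W2 \<noteq> []\<close> in auto)
      obtain X Y where W: "W1 = X @ c # Y" using cd(1) by (meson split_list)
      show ?thesis
      proof (cases "d \<in> set Y")
        case True
        then obtain Y1 Z where "Y = Y1 @ d # Z" by (meson split_list)
        then show ?thesis using *[of X c Y1 d Z] W ch 3 by simp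
      next
        case False
        then have "d \<in> set X" using cd(2) W mem(6) by auto
        then obtain X1 X2 where "X = X1 @ d # X2" by (meson split_list)
        then show ?thesis using *[of X1 d X2 c Y] W ch 3 by (simp add: insert_commute)
      qed
    qed
    have cross: "linkable n F ({{a, b}, {c, d}} \<union> M)"
      if q: "distinct (X @ c # Y @ b # Z @ d # T @ [a])" "set (X @ c # Y @ b # Z @ d # T @ [a]) = set p"
        "cyc_edges (X @ c # Y @ b # Z @ d # T @ [a]) = cyc_edges p"
        and ch: "{a, b} \<in> edges (cube n) - F" "{c, d} \<in> edges (cube n) - F"
        "a \<notin> \<Union>M" "b \<notin> \<Union>M" "c \<notin> \<Union>M" "d \<notin> \<Union>M"
      for X Y Z T a b c d
    proof -
      let ?p = "X @ c # Y @ b # Z @ d # T @ [a]"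
      \<comment> \<open>Four chord ends and four gaps make up the whole cube. Sixteen vertices are
        too many for all gaps to be single vertices, and rotating or reversing the cycle lets any
        gap play the part of \<open>Z\<close>.\<close>
      have "length ?p \<ge> 16" using length_ham[OF q(1)] q(2) p(3) pow2_ge[OF n] by simp
      then consider "length Z \<noteq> 1" | "length X \<noteq> 1" | "length Y \<noteq> 1" | "length T \<noteq> 1" by fastforce
      then show ?thesis
      proof cases
        case 1
        show ?thesis
          by (rule two_chords_gap[of "X @ [c]" "Y @ [b]" "d # T @ [a]" c b d a Z])
            (use q p ch 1 in auto)
      next
        case 2
        let ?q = "(rev Z @ [b]) @ (rev Y @ [c]) @ rev X @ (a # rev T @ [d])"
        have e: "cyc_edges ?q = cyc_edges p"
          using cyc_edges_append_commute[of "rev Z @ b # rev Y @ c # rev X @ [a]" "rev T @ [d]"]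
            cyc_edges_append_commute[of "a # rev T @ d # rev Z @ b # rev Y @ c # rev X" "[]"]
            cyc_edges_append_commute[of "rev T @ [d]" "rev Z @ b # rev Y @ c # rev X @ [a]"]
            cyc_edges_append_commute[of "[a]" "rev T @ d # rev Z @ b # rev Y @ c # rev X"]
            cyc_edges_rev[of ?p] q(3) by simp
        have "linkable n F ({{d, c}, {b, a}} \<union> M)"
          by (rule two_chords_gap[of "rev Z @ [b]" "rev Y @ [c]" "a # rev T @ [d]" b c a d "rev X"])
            (use q p ch 2 in \<open>auto simp: e[simplified] insert_commute\<close>)
        then show ?thesis by (simp add: insert_commute)
      next
        case 3
        let ?q = "(rev T @ [d]) @ (rev Z @ [b]) @ rev Y @ (c # rev X @ [a])"
        have e: "cyc_edges ?q = cyc_edges p"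
          using cyc_edges_append_commute[of "[a]" "rev T @ d # rev Z @ b # rev Y @ c # rev X"]
            cyc_edges_rev[of ?p] q(3) by simp
        have "linkable n F ({{a, b}, {d, c}} \<union> M)"
          by (rule two_chords_gap[of "rev T @ [d]" "rev Z @ [b]" "c # rev X @ [a]" d b c a "rev Y"])
            (use q p ch 3 in \<open>auto simp: e[simplified] insert_commute\<close>)
        then show ?thesis by (simp add: insert_commute)
      next
        case 4
        let ?q = "(Y @ [b]) @ (Z @ [d]) @ T @ (a # X @ [c])"
        have e: "cyc_edges ?q = cyc_edges p"
          using cyc_edges_append_commute[of "X @ [c]" "Y @ b # Z @ d # T @ [a]"] q(3) by simp
        have "linkable n F ({{c, d}, {b, a}} \<union> M)"
          by (rule two_chords_gap[of "Y @ [b]" "Z @ [d]" "a # X @ [c]" b d a c T])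
            (use q p ch 4 in \<open>auto simp: e[simplified] insert_commute\<close>)
        then show ?thesis by (simp add: insert_commute)
      qed
    qed
    obtain q r where qr: "p = q @ a # r" using mem(1) by (meson split_list)
    define W where "W = r @ q"
    have "b \<in> set W" using mem qr by (auto simp: W_def)
    then obtain W1 W2 where W12: "W = W1 @ b # W2" by (meson split_list)
    have W: "cyc_edges (W1 @ b # W2 @ [a]) = cyc_edges p" "distinct (W1 @ b # W2 @ [a])"
      "set (W1 @ b # W2 @ [a]) = set p"
    proof -
      have *: "W1 @ b # W2 @ [a] = r @ q @ [a]" using W12 by (simp add: W_def)
      show "cyc_edges (W1 @ b # W2 @ [a]) = cyc_edges p"
        unfolding * qr using cyc_edges_append_commute[of r "q @ [a]"] by simp
      show "distinct (W1 @ b # W2 @ [a])" "set (W1 @ b # W2 @ [a]) = set p"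
        unfolding * using p(2) by (auto simp: qr)
    qed
    have W': "cyc_edges (rev W2 @ b # rev W1 @ [a]) = cyc_edges p"
      using cyc_edges_append_commute[of "[a]" "rev W2 @ b # rev W1"] cyc_edges_rev[of "W1 @ b # W2 @ [a]"] W(1)
      by simp
    have ne: "W1 \<noteq> []" "W2 \<noteq> []"
      using 3(1) unfolding W(1)[symmetric] by (auto simp: cyc_edges_def path_edges_append insert_commute)
    have "c \<in> set (W1 @ b # W2 @ [a])" "d \<in> set (W1 @ b # W2 @ [a])" using W(3) mem by simp_all
    then consider "c \<in> set W1" "d \<in> set W1" | "c \<in> set W2" "d \<in> set W2" | "c \<in> set W1" "d \<in> set W2"
      | "d \<in> set W1" "c \<in> set W2" using dj by auto
    then show ?thesis
    proof cases
      case 1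
      then show ?thesis using same W ne by blast
    next
      case 2
      then show ?thesis using same[of "rev W2" "rev W1"] W' W(2,3) ne by auto
    next
      case 3
      then obtain X Y Z T where "W1 = X @ c # Y" "W2 = Z @ d # T" by (meson split_list)
      with cross[of X c Y b Z d T a] W ch show ?thesis by simp
    next
      case 4
      then obtain X Y Z T where "W1 = X @ d # Y" "W2 = Z @ c # T" by (meson split_list)
      with cross[of X d Y b Z c T a] W ch show ?thesis by (simp add: insert_commute)
    qed
  qed
qed

section \<open>Splitting the cube along a dimension\<close>

text \<open>Edges inside a half are stored as edges of the smaller cube, so that the induction
  hypothesis applies to them literally. An edge between the halves is represented by the vertex
  below it, see \<open>cross\<close>.\<close>

definition half :: "nat \<Rightarrow> nat \<Rightarrow> bool \<Rightarrow> bool list set set \<Rightarrow> bool list set set" where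
  "half m i b S = {e \<in> edges (cube m). ins i b ` e \<in> S}"

definition cross_edge :: "nat \<Rightarrow> bool list \<Rightarrow> bool list set" where
  "cross_edge i x = {ins i False x, ins i True x}"

definition cross :: "nat \<Rightarrow> nat \<Rightarrow> bool list set set \<Rightarrow> bool list set" where
  "cross m i S = {x \<in> verts (cube m). cross_edge i x \<in> S}"

lemma cross_edge_eq: "{ins i b x, ins i (\<not> b) x} = cross_edge i x" "{ins i (\<not> b) x, ins i b x} = cross_edge i x"
  by (cases b; auto simp: cross_edge_def)+

lemma cross_edge_in_edges: "length x = m \<Longrightarrow> cross_edge i x \<in> edges (cube (Suc m))"
  using edge_ins_neq[of False True i x x m] by (simp add: cross_edge_def)

lemma inj_on_ins: "i \<le> m \<Longrightarrow> inj_on (ins i b) (verts (cube m))"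
  by (auto intro!: inj_onI)

lemma edge_subset_verts: "e \<in> edges (cube m) \<Longrightarrow> e \<subseteq> verts (cube m)"
  by (auto elim!: edgeE)

lemma inj_on_image_ins: "i \<le> m \<Longrightarrow> inj_on ((`) (ins i b)) (edges (cube m))"
  using inj_on_image_Pow[OF inj_on_ins[of i m b]] by (rule inj_on_subset) (auto dest: edge_subset_verts)

lemma image_ins_edge: "e \<in> edges (cube m) \<Longrightarrow> ins i b ` e \<in> edges (cube (Suc m))"
proof -
  assume e: "e \<in> edges (cube m)"
  then obtain x y where "e = {x, y}" by (rule edgeE)
  with e show ?thesis by (simp add: edge_ins_same)
qed

lemma verts_split:
  "i \<le> m \<Longrightarrow> verts (cube (Suc m)) = ins i b ` verts (cube m) \<union> ins i (\<not> b) ` verts (cube m)"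
proof (intro equalityI subsetI)
  fix x assume "i \<le> m" "x \<in> verts (cube (Suc m))"
  then obtain c y where "x = ins i c y" "length y = m" using insE[of x m i] by auto
  then show "x \<in> ins i b ` verts (cube m) \<union> ins i (\<not> b) ` verts (cube m)"
    by (cases "c = b") auto
qed auto

lemma edge_split:
  assumes "e \<in> edges (cube (Suc m))" "i \<le> m"
  shows "(\<exists>b. \<exists>f\<in>edges (cube m). e = ins i b ` f) \<or> (\<exists>x\<in>verts (cube m). e = cross_edge i x)"
proof -
  obtain x y where e: "e = {x, y}" "length x = Suc m" "length y = Suc m" using assms(1) by (rule edgeE)
  obtain b x' where x: "x = ins i b x'" "length x' = m" using insE[OF e(2) assms(2)] by metis
  obtain c y' where y: "y = ins i c y'" "length y' = m" using insE[OF e(3) assms(2)] by metis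
  show ?thesis
  proof (cases "b = c")
    case True
    then have "{x', y'} \<in> edges (cube m)" using assms(1) e x y by (simp add: edge_ins_same)
    moreover have "e = ins i b ` {x', y'}" using e x y True by simp
    ultimately show ?thesis by blast
  next
    case False
    then have "x' = y'" using assms(1) e x y by (simp add: edge_ins_neq)
    then have "e = cross_edge i x'" using e x y False cross_edge_eq[of i b x'] by (cases b; cases c) auto
    then show ?thesis using x(2) by auto
  qed
qed

lemma half_subset: "half m i b S \<subseteq> edges (cube m)"
  by (auto simp: half_def)

lemma finite_half [simp]: "finite (half m i b S)"
  by (rule finite_subset[OF half_subset finite_edges_cube])

lemma cross_subset: "cross m i S \<subseteq> verts (cube m)"
  by (auto simp: cross_def)

lemma finite_cross [simp]: "finite (cross m i S)"
  by (rule finite_subset[OF cross_subset finite_verts_cube])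

lemma mem_cross_length: "x \<in> cross m i S \<Longrightarrow> length x = m"
  by (simp add: cross_def)

lemma cross_edge_neq_image:
  assumes "i \<le> m" "f \<in> edges (cube m)" "length x = m"
  shows "cross_edge i x \<noteq> ins i b ` f"
proof
  assume *: "cross_edge i x = ins i b ` f"
  have "ins i (\<not> b) x \<in> cross_edge i x" by (auto simp: cross_edge_eq[of i b x, symmetric])
  then obtain y where "y \<in> f" "ins i (\<not> b) x = ins i b y" unfolding * by auto
  moreover have "length y = m" using edge_subset_verts[OF assms(2)] \<open>y \<in> f\<close> by auto
  ultimately show False using assms by simp
qed

lemma inj_on_cross_edge: "i \<le> m \<Longrightarrow> inj_on (cross_edge i) (verts (cube m))"
  by (auto intro!: inj_onI simp: cross_edge_def doubleton_eq_iff)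

lemma split_cover:
  assumes "S \<subseteq> edges (cube (Suc m))" "i \<le> m"
  shows "S = (`) (ins i b) ` half m i b S \<union> (`) (ins i (\<not> b)) ` half m i (\<not> b) S \<union>
    cross_edge i ` cross m i S"
proof (intro equalityI subsetI)
  fix e assume e: "e \<in> S"
  with assms(1) have "e \<in> edges (cube (Suc m))" by blast
  from edge_split[OF this assms(2)]
  show "e \<in> (`) (ins i b) ` half m i b S \<union> (`) (ins i (\<not> b)) ` half m i (\<not> b) S \<union> cross_edge i ` cross m i S"
  proof
    assume "\<exists>c. \<exists>f\<in>edges (cube m). e = ins i c ` f"
    then obtain c f where "f \<in> edges (cube m)" "e = ins i c ` f" by blast
    with e have "e \<in> (`) (ins i c) ` half m i c S" by (auto simp: half_def)
    then show ?thesis by (cases "c = b") auto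
  qed (use e in \<open>auto simp: cross_def\<close>)
qed (auto simp: half_def cross_def)

lemma card_split:
  assumes "S \<subseteq> edges (cube (Suc m))" "i \<le> m"
  shows "card S = card (half m i b S) + card (half m i (\<not> b) S) + card (cross m i S)"
proof -
  let ?A = "\<lambda>b. (`) (ins i b) ` half m i b S" and ?C = "cross_edge i ` cross m i S"
  have fin: "finite (?A b)" for b by simp
  have 1: "?A b \<inter> ?A (\<not> b) = {}"
  proof (intro equals0I)
    fix e assume "e \<in> ?A b \<inter> ?A (\<not> b)"
    then obtain f g where fg: "f \<in> edges (cube m)" "g \<in> edges (cube m)" "ins i b ` f = ins i (\<not> b) ` g"
      unfolding half_def by blast
    obtain x where x: "x \<in> f" using fg(1) by (auto elim: edgeE)
    then have "ins i b x \<in> ins i (\<not> b) ` g" using fg(3) by blast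
    then obtain y where y: "y \<in> g" "ins i b x = ins i (\<not> b) y" by blast
    have "length x = m" "length y = m"
      using edge_subset_verts[OF fg(1)] edge_subset_verts[OF fg(2)] x y(1) by auto
    then show False using y(2) assms(2) by simp
  qed
  have 2: "(?A b \<union> ?A (\<not> b)) \<inter> ?C = {}"
    using cross_edge_neq_image[OF assms(2)] unfolding half_def cross_def by fastforce
  have "card S = card (?A b) + card (?A (\<not> b)) + card ?C"
    using card_Un_disjoint[OF _ _ 2] card_Un_disjoint[OF fin fin 1]
    by (subst split_cover[OF assms, of b]) simp
  moreover have "card (?A b) = card (half m i b S)" for b
    by (rule card_image[OF inj_on_subset[OF inj_on_image_ins[OF assms(2)] half_subset]])
  moreover have "card ?C = card (cross m i S)"
    by (rule card_image[OF inj_on_subset[OF inj_on_cross_edge[OF assms(2)] cross_subset]])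
  ultimately show ?thesis by simp
qed

lemma edge_unique_dim:
  assumes "e \<in> edges (cube (Suc m))"
  shows "\<exists>i\<le>m. \<exists>x\<in>verts (cube m). e = cross_edge i x"
proof -
  obtain x y i where e: "e = {x, y}" "length x = Suc m" "length y = Suc m"
    "i < Suc m" "x ! i \<noteq> y ! i" using assms unfolding cube_def by auto
  obtain b x' where x: "x = ins i b x'" "length x' = m" using insE[OF e(2), of i] e(4) by (metis less_Suc_eq_le)
  obtain c y' where y: "y = ins i c y'" "length y' = m" using insE[OF e(3), of i] e(4) by (metis less_Suc_eq_le)
  have "b \<noteq> c" using e x y by simp
  then have "x' = y'" using assms e x y by (simp add: edge_ins_neq)
  then have "e = cross_edge i x'" using e x y \<open>b \<noteq> c\<close> cross_edge_eq[of i b x'] by (cases b; cases c) auto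
  then show ?thesis using x(2) e(4) by (metis less_Suc_eq_le verts_cube)
qed

lemma cross_edge_dim_inj:
  assumes "cross_edge i x = cross_edge j y" "length x = m" "length y = m" "i \<le> m" "j \<le> m"
  shows "i = j"
proof (rule ccontr)
  assume ij: "i \<noteq> j"
  have "(ins i False x) ! j = (ins i True x) ! j"
    using ij assms by (simp add: ins_def nth_append nth_Cons')
  moreover have "{ins i False x, ins i True x} = {ins j False y, ins j True y}"
    using assms(1) by (simp add: cross_edge_def)
  ultimately show False using assms
    by (metis (full_types) doubleton_eq_iff ins_nth)
qed

text \<open>Every edge has exactly one dimension, so the crossing sets of the different dimensions
  partition the edges. The averaging over dimensions rests on this.\<close>

lemma card_eq_sum_cross:
  assumes "S \<subseteq> edges (cube (Suc m))"
  shows "card S = (\<Sum>i\<le>m. card (cross m i S))"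
proof -
  have "S = (\<Union>i\<le>m. cross_edge i ` cross m i S)"
  proof (intro equalityI subsetI)
    fix e assume "e \<in> S"
    with edge_unique_dim[of e m] assms show "e \<in> (\<Union>i\<le>m. cross_edge i ` cross m i S)"
      unfolding cross_def by blast
  qed (auto simp: cross_def)
  then have "card S = card (\<Union>i\<in>{..m}. cross_edge i ` cross m i S)" by simp
  also have "\<dots> = (\<Sum>i\<le>m. card (cross_edge i ` cross m i S))"
  proof (rule card_UN_disjoint)
    show "\<forall>i\<in>{..m}. \<forall>j\<in>{..m}. i \<noteq> j \<longrightarrow> cross_edge i ` cross m i S \<inter> cross_edge j ` cross m j S = {}"
      unfolding cross_def by (auto dest!: cross_edge_dim_inj)
  qed simp_all
  also have "\<dots> = (\<Sum>i\<le>m. card (cross m i S))"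
    by (intro sum.cong refl card_image inj_on_subset[OF inj_on_cross_edge cross_subset]) auto
  finally show ?thesis .
qed

lemma lift_edges:
  assumes "S \<subseteq> edges (cube m) - half m i b F"
  shows "(`) (ins i b) ` S \<subseteq> edges (cube (Suc m)) - F"
  using assms image_ins_edge unfolding half_def by blast

lemma lift_cross: "length x = m \<Longrightarrow> x \<notin> cross m i F \<Longrightarrow> cross_edge i x \<in> edges (cube (Suc m)) - F"
  by (simp add: cross_edge_in_edges) (simp add: cross_def)

lemma covered_by_halves:
  assumes "M \<subseteq> edges (cube (Suc m))" "i \<le> m" "half m i b M \<subseteq> S" "half m i (\<not> b) M \<subseteq> T" "cross m i M \<subseteq> X"
  shows "M \<subseteq> (`) (ins i b) ` S \<union> (`) (ins i (\<not> b)) ` T \<union> cross_edge i ` X"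
proof -
  have "(`) (ins i b) ` half m i b M \<union> (`) (ins i (\<not> b)) ` half m i (\<not> b) M \<union> cross_edge i ` cross m i M
      \<subseteq> (`) (ins i b) ` S \<union> (`) (ins i (\<not> b)) ` T \<union> cross_edge i ` X"
    by (intro Un_mono image_mono assms(3-5))
  then show ?thesis by (rule ord_eq_le_trans[OF split_cover[OF assms(1,2), of b]])
qed

lemma distinct_map_ins: "i \<le> m \<Longrightarrow> distinct p \<Longrightarrow> set p \<subseteq> verts (cube m) \<Longrightarrow> distinct (map (ins i b) p)"
  using inj_on_subset[OF inj_on_ins] by (auto simp: distinct_map)

lemma disjoint_image_ins:
  "i \<le> m \<Longrightarrow> A \<subseteq> verts (cube m) \<Longrightarrow> B \<subseteq> verts (cube m) \<Longrightarrow> b \<noteq> c \<Longrightarrow> ins i b ` A \<inter> ins i c ` B = {}"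
proof (intro equals0I)
  fix z assume *: "i \<le> m" "A \<subseteq> verts (cube m)" "B \<subseteq> verts (cube m)" "b \<noteq> c" "z \<in> ins i b ` A \<inter> ins i c ` B"
  then obtain x y where xy: "x \<in> A" "y \<in> B" "ins i b x = ins i c y" by auto
  then have "length x = m" "length y = m" using *(2,3) by auto
  with xy(3) *(1,4) show False by simp
qed

section \<open>Joining paths of the two halves through crossing edges\<close>

context
  fixes m i :: nat and b :: bool
  assumes i: "i \<le> m"
begin

lemma join_cycle:
  assumes "ham_path m (half m i b F) (half m i b M) u v"
    "ham_path m (half m i (\<not> b) F) (half m i (\<not> b) M) u v"
    and ends: "u \<noteq> v" "u \<notin> cross m i F" "v \<notin> cross m i F" "cross m i M \<subseteq> {u, v}"
    and M: "M \<subseteq> edges (cube (Suc m))"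
  shows "ham_cycle (Suc m) F M"
proof -
  obtain p where p: "p \<noteq> []" "hd p = u" "last p = v" "distinct p" "set p = verts (cube m)"
    "path_edges p \<subseteq> edges (cube m) - half m i b F" "half m i b M \<subseteq> path_edges p"
    using assms(1) unfolding ham_path_def by blast
  obtain q where q: "q \<noteq> []" "hd q = u" "last q = v" "distinct q" "set q = verts (cube m)"
    "path_edges q \<subseteq> edges (cube m) - half m i (\<not> b) F" "half m i (\<not> b) M \<subseteq> path_edges q"
    using assms(2) unfolding ham_path_def by blast
  have uv: "length u = m" "length v = m" using ham_path_verts[OF assms(1)] by auto
  let ?c = "map (ins i b) p @ rev (map (ins i (\<not> b)) q)"
  have C: "cyc_edges ?c = (`) (ins i b) ` path_edges p \<union> (`) (ins i (\<not> b)) ` path_edges q \<union> cross_edge i ` {u, v}"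
    using p(1-3) q(1-3) by (simp add: cyc_edges_parts path_edges_map hd_rev last_rev hd_map last_map cross_edge_eq) blast
  show ?thesis
  proof (rule ham_cycleI[of ?c])
    show "set ?c = verts (cube (Suc m))" using p(5) q(5) verts_split[OF i, of b] by simp
    show "distinct ?c"
      using p(4,5) q(4,5) distinct_map_ins[OF i] disjoint_image_ins[OF i, of _ _ b "\<not> b"] by simp
    show "cyc_edges ?c \<subseteq> edges (cube (Suc m)) - F"
      unfolding C using lift_edges[OF p(6)] lift_edges[OF q(6)] lift_cross[OF uv(1) ends(2)] lift_cross[OF uv(2) ends(3)]
      by blast
    show "M \<subseteq> cyc_edges ?c" unfolding C by (rule covered_by_halves[OF M i p(7) q(7) ends(4)])
  qed (use p in simp)
qed

text \<open>The closed tour passes over \<open>u\<close>, \<open>v\<close>, \<open>x\<close>,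
  \<open>y\<close> in this order and changes half at each of them. Hence the pairing in the opposite
  half is shifted by one: \<open>v\<close> with \<open>x\<close>, and \<open>y\<close> with
  \<open>u\<close>.\<close>

lemma join_cycle4:
  assumes "two_paths m (half m i b F) (half m i b M) u v x y"
    "two_paths m (half m i (\<not> b) F) (half m i (\<not> b) M) v x u y"
    and ends: "{u, v, x, y} \<inter> cross m i F = {}" "cross m i M \<subseteq> {u, v, x, y}"
    and M: "M \<subseteq> edges (cube (Suc m))"
  shows "ham_cycle (Suc m) F M"
proof -
  obtain p p' where p: "p \<noteq> []" "p' \<noteq> []" "hd p = u" "last p = v" "hd p' = x" "last p' = y"
    "distinct (p @ p')" "set (p @ p') = verts (cube m)"
    "path_edges p \<union> path_edges p' \<subseteq> edges (cube m) - half m i b F" "half m i b M \<subseteq> path_edges p \<union> path_edges p'"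
    using assms(1) unfolding two_paths_def by blast
  obtain q q' where q: "q \<noteq> []" "q' \<noteq> []" "hd q = v" "last q = x" "hd q' = u" "last q' = y"
    "distinct (q @ q')" "set (q @ q') = verts (cube m)"
    "path_edges q \<union> path_edges q' \<subseteq> edges (cube m) - half m i (\<not> b) F" "half m i (\<not> b) M \<subseteq> path_edges q \<union> path_edges q'"
    using assms(2) unfolding two_paths_def by blast
  have uv: "length u = m" "length v = m" "length x = m" "length y = m" using two_paths_verts[OF assms(1)] by auto
  let ?c = "(map (ins i b) p @ map (ins i (\<not> b)) q) @ (map (ins i b) p' @ rev (map (ins i (\<not> b)) q'))"
  have C: "cyc_edges ?c = (`) (ins i b) ` (path_edges p \<union> path_edges p') \<union>
      (`) (ins i (\<not> b)) ` (path_edges q \<union> path_edges q') \<union> cross_edge i ` {u, v, x, y}"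
    using p(1-6) q(1-6)
    by (auto simp: cyc_edges_parts path_edges_append path_edges_map hd_rev last_rev hd_map last_map cross_edge_eq)
  have sub: "set p \<subseteq> verts (cube m)" "set p' \<subseteq> verts (cube m)" "set q \<subseteq> verts (cube m)" "set q' \<subseteq> verts (cube m)"
    using p(8) q(8) by auto
  have dj: "ins i b ` set p \<inter> ins i b ` set p' = {}" "ins i (\<not> b) ` set q \<inter> ins i (\<not> b) ` set q' = {}"
    using inj_on_image_Int[OF inj_on_ins[OF i] sub(1,2)] inj_on_image_Int[OF inj_on_ins[OF i] sub(3,4)] p(7) q(7)
    by (metis distinct_append image_empty)+
  show ?thesis
  proof (rule ham_cycleI[of ?c])
    show "set ?c = verts (cube (Suc m))"
      using p(8) q(8) verts_split[OF i, of b] by (auto simp: image_Un[symmetric])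
    show "distinct ?c"
      using p(7) q(7) distinct_map_ins[OF i _ sub(1)] distinct_map_ins[OF i _ sub(2)] distinct_map_ins[OF i _ sub(3)]
        distinct_map_ins[OF i _ sub(4)] disjoint_image_ins[OF i sub(1) sub(3), of b "\<not> b"]
        disjoint_image_ins[OF i sub(1) sub(4), of b "\<not> b"] disjoint_image_ins[OF i sub(2) sub(3), of b "\<not> b"]
        disjoint_image_ins[OF i sub(2) sub(4), of b "\<not> b"] dj
      by (simp add: Int_Un_distrib Int_Un_distrib2 Int_commute)
    have "cross_edge i ` {u, v, x, y} \<subseteq> edges (cube (Suc m)) - F"
      using lift_cross[of _ m i F] uv ends(1) by simp
    then show "cyc_edges ?c \<subseteq> edges (cube (Suc m)) - F"
      unfolding C using lift_edges[OF p(9)] lift_edges[OF q(9)] by blast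
    show "M \<subseteq> cyc_edges ?c" unfolding C by (rule covered_by_halves[OF M i p(10) q(10) ends(2)])
  qed (use p in simp)
qed

lemma join_path:
  assumes "ham_path m (half m i b F) (half m i b M) u z"
    "ham_path m (half m i (\<not> b) F) (half m i (\<not> b) M) z v"
    and ends: "z \<notin> cross m i F" "cross m i M \<subseteq> {z}"
    and M: "M \<subseteq> edges (cube (Suc m))"
  shows "ham_path (Suc m) F M (ins i b u) (ins i (\<not> b) v)"
proof -
  obtain p where p: "p \<noteq> []" "hd p = u" "last p = z" "distinct p" "set p = verts (cube m)"
    "path_edges p \<subseteq> edges (cube m) - half m i b F" "half m i b M \<subseteq> path_edges p"
    using assms(1) unfolding ham_path_def by blast
  obtain q where q: "q \<noteq> []" "hd q = z" "last q = v" "distinct q" "set q = verts (cube m)"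
    "path_edges q \<subseteq> edges (cube m) - half m i (\<not> b) F" "half m i (\<not> b) M \<subseteq> path_edges q"
    using assms(2) unfolding ham_path_def by blast
  have z: "length z = m" using ham_path_verts[OF assms(1)] by auto
  let ?c = "map (ins i b) p @ map (ins i (\<not> b)) q"
  have C: "path_edges ?c = (`) (ins i b) ` path_edges p \<union> (`) (ins i (\<not> b)) ` path_edges q \<union> cross_edge i ` {z}"
    using p(1-3) q(1-3) by (simp add: path_edges_append path_edges_map hd_map last_map cross_edge_eq)
  show ?thesis
  proof (rule ham_pathI[of ?c])
    show "set ?c = verts (cube (Suc m))" using p(5) q(5) verts_split[OF i, of b] by simp
    show "distinct ?c"
      using p(4,5) q(4,5) distinct_map_ins[OF i] disjoint_image_ins[OF i, of _ _ b "\<not> b"] by simp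
    show "path_edges ?c \<subseteq> edges (cube (Suc m)) - F"
      unfolding C using lift_edges[OF p(6)] lift_edges[OF q(6)] lift_cross[OF z ends(1)] by blast
    show "M \<subseteq> path_edges ?c" unfolding C by (rule covered_by_halves[OF M i p(7) q(7) ends(2)])
  qed (use p q in \<open>auto simp: hd_map last_map\<close>)
qed

text \<open>The gap from \<open>x\<close> to \<open>y\<close> in one half is bridged by a spanning
  path of the other half over the same two vertices.\<close>

lemma join_detour:
  assumes "two_paths m (half m i b F) (half m i b M) u x y v"
    "ham_path m (half m i (\<not> b) F) (half m i (\<not> b) M) x y"
    and ends: "x \<notin> cross m i F" "y \<notin> cross m i F" "cross m i M \<subseteq> {x, y}"
    and M: "M \<subseteq> edges (cube (Suc m))"
  shows "ham_path (Suc m) F M (ins i b u) (ins i b v)"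
proof -
  obtain p p' where p: "p \<noteq> []" "p' \<noteq> []" "hd p = u" "last p = x" "hd p' = y" "last p' = v"
    "distinct (p @ p')" "set (p @ p') = verts (cube m)"
    "path_edges p \<union> path_edges p' \<subseteq> edges (cube m) - half m i b F" "half m i b M \<subseteq> path_edges p \<union> path_edges p'"
    using assms(1) unfolding two_paths_def by blast
  obtain q where q: "q \<noteq> []" "hd q = x" "last q = y" "distinct q" "set q = verts (cube m)"
    "path_edges q \<subseteq> edges (cube m) - half m i (\<not> b) F" "half m i (\<not> b) M \<subseteq> path_edges q"
    using assms(2) unfolding ham_path_def by blast
  have xy: "length x = m" "length y = m" using ham_path_verts[OF assms(2)] by auto
  let ?c = "map (ins i b) p @ map (ins i (\<not> b)) q @ map (ins i b) p'"
  have C: "path_edges ?c = (`) (ins i b) ` (path_edges p \<union> path_edges p') \<union> (`) (ins i (\<not> b)) ` path_edges q \<union> cross_edge i ` {x, y}"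
    using p(1-6) q(1-3) by (auto simp: path_edges_append path_edges_map hd_map last_map cross_edge_eq)
  have sub: "set p \<subseteq> verts (cube m)" "set p' \<subseteq> verts (cube m)" using p(8) by auto
  have dj: "ins i b ` set p \<inter> ins i b ` set p' = {}"
    using inj_on_image_Int[OF inj_on_ins[OF i] sub(1,2)] p(7) by (metis distinct_append image_empty)
  show ?thesis
  proof (rule ham_pathI[of ?c])
    show "set ?c = verts (cube (Suc m))"
      using p(8) q(5) verts_split[OF i, of b] by (auto simp: image_Un[symmetric])
    show "distinct ?c"
      using p(7) q(4,5) distinct_map_ins[OF i _ sub(1)] distinct_map_ins[OF i _ sub(2)] distinct_map_ins[OF i, of q "\<not> b"]
        disjoint_image_ins[OF i sub(1), of "set q" b "\<not> b"] disjoint_image_ins[OF i sub(2), of "set q" b "\<not> b"] dj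
      by (simp add: Int_Un_distrib Int_Un_distrib2 Int_commute)
    show "path_edges ?c \<subseteq> edges (cube (Suc m)) - F"
      unfolding C using lift_edges[OF p(9)] lift_edges[OF q(6)] lift_cross[OF xy(1) ends(1)] lift_cross[OF xy(2) ends(2)]
      by blast
    show "M \<subseteq> path_edges ?c" unfolding C by (rule covered_by_halves[OF M i p(10) q(7) ends(3)])
  qed (use p q in \<open>auto simp: hd_map last_map\<close>)
qed

lemma join_two_paths_one_crossing:
  assumes "two_paths m {} {} u z x y" "ham_path m {} {} z v"
  shows "two_paths (Suc m) {} {} (ins i b u) (ins i (\<not> b) v) (ins i b x) (ins i b y)"
proof -
  obtain p p' where p: "p \<noteq> []" "p' \<noteq> []" "hd p = u" "last p = z" "hd p' = x" "last p' = y"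
    "distinct (p @ p')" "set (p @ p') = verts (cube m)" "path_edges p \<union> path_edges p' \<subseteq> edges (cube m)"
    using assms(1) unfolding two_paths_def by auto
  obtain q where q: "q \<noteq> []" "hd q = z" "last q = v" "distinct q" "set q = verts (cube m)"
    "path_edges q \<subseteq> edges (cube m)"
    using assms(2) unfolding ham_path_def by auto
  have z: "length z = m" using ham_path_verts[OF assms(2)] by auto
  have sub: "set p \<subseteq> verts (cube m)" "set p' \<subseteq> verts (cube m)" using p(8) by auto
  have dj: "ins i b ` set p \<inter> ins i b ` set p' = {}"
    using inj_on_image_Int[OF inj_on_ins[OF i] sub(1,2)] p(7) by (metis distinct_append image_empty)
  show ?thesis
  proof (rule two_pathsI[of "map (ins i b) p @ map (ins i (\<not> b)) q" "map (ins i b) p'"])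
    show "set ((map (ins i b) p @ map (ins i (\<not> b)) q) @ map (ins i b) p') = verts (cube (Suc m))"
      using p(8) q(5) verts_split[OF i, of b] by (auto simp: image_Un[symmetric])
    show "distinct ((map (ins i b) p @ map (ins i (\<not> b)) q) @ map (ins i b) p')"
      using p(7) q(4,5) distinct_map_ins[OF i _ sub(1)] distinct_map_ins[OF i _ sub(2)] distinct_map_ins[OF i, of q "\<not> b"]
        disjoint_image_ins[OF i sub(1), of "set q" b "\<not> b"] disjoint_image_ins[OF i sub(2), of "set q" b "\<not> b"] dj
      by (simp add: Int_Un_distrib Int_Un_distrib2 Int_commute)
    show "path_edges (map (ins i b) p @ map (ins i (\<not> b)) q) \<union> path_edges (map (ins i b) p') \<subseteq> edges (cube (Suc m)) - {}"
      using p(1-6,9) q(1-3,6) cross_edge_in_edges[OF z, of i] image_ins_edge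
      by (auto simp: path_edges_append path_edges_map hd_map last_map cross_edge_eq)
  qed (use p q in \<open>auto simp: hd_map last_map\<close>)
qed

lemma join_two_paths_two_crossings:
  assumes "two_paths m {} {} u z x w" "two_paths m {} {} z v w y"
  shows "two_paths (Suc m) {} {} (ins i b u) (ins i (\<not> b) v) (ins i b x) (ins i (\<not> b) y)"
proof -
  obtain p p' where p: "p \<noteq> []" "p' \<noteq> []" "hd p = u" "last p = z" "hd p' = x" "last p' = w"
    "distinct (p @ p')" "set (p @ p') = verts (cube m)" "path_edges p \<union> path_edges p' \<subseteq> edges (cube m)"
    using assms(1) unfolding two_paths_def by auto
  obtain q q' where q: "q \<noteq> []" "q' \<noteq> []" "hd q = z" "last q = v" "hd q' = w" "last q' = y"
    "distinct (q @ q')" "set (q @ q') = verts (cube m)" "path_edges q \<union> path_edges q' \<subseteq> edges (cube m)"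
    using assms(2) unfolding two_paths_def by auto
  have zw: "length z = m" "length w = m" using two_paths_verts[OF assms(1)] by auto
  have sub: "set p \<subseteq> verts (cube m)" "set p' \<subseteq> verts (cube m)" "set q \<subseteq> verts (cube m)" "set q' \<subseteq> verts (cube m)"
    using p(8) q(8) by auto
  have dj: "ins i b ` set p \<inter> ins i b ` set p' = {}" "ins i (\<not> b) ` set q \<inter> ins i (\<not> b) ` set q' = {}"
    using inj_on_image_Int[OF inj_on_ins[OF i] sub(1,2)] inj_on_image_Int[OF inj_on_ins[OF i] sub(3,4)] p(7) q(7)
    by (metis distinct_append image_empty)+
  let ?c = "(map (ins i b) p @ map (ins i (\<not> b)) q) @ (map (ins i b) p' @ map (ins i (\<not> b)) q')"
  show ?thesis
  proof (rule two_pathsI[of "map (ins i b) p @ map (ins i (\<not> b)) q" "map (ins i b) p' @ map (ins i (\<not> b)) q'"])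
    show "set ?c = verts (cube (Suc m))"
      using p(8) q(8) verts_split[OF i, of b] by (auto simp: image_Un[symmetric])
    show "distinct ?c"
      using p(7) q(7) distinct_map_ins[OF i _ sub(1)] distinct_map_ins[OF i _ sub(2)] distinct_map_ins[OF i _ sub(3)]
        distinct_map_ins[OF i _ sub(4)] disjoint_image_ins[OF i sub(1) sub(3), of b "\<not> b"]
        disjoint_image_ins[OF i sub(1) sub(4), of b "\<not> b"] disjoint_image_ins[OF i sub(2) sub(3), of b "\<not> b"]
        disjoint_image_ins[OF i sub(2) sub(4), of b "\<not> b"] dj
      by (simp add: Int_Un_distrib Int_Un_distrib2 Int_commute)
    show "path_edges (map (ins i b) p @ map (ins i (\<not> b)) q) \<union> path_edges (map (ins i b) p' @ map (ins i (\<not> b)) q')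
        \<subseteq> edges (cube (Suc m)) - {}"
      using p(1-6,9) q(1-6,9) cross_edge_in_edges[OF zw(1), of i] cross_edge_in_edges[OF zw(2), of i] image_ins_edge
      by (auto simp: path_edges_append path_edges_map hd_map last_map cross_edge_eq)
  qed (use p q in \<open>auto simp: hd_map last_map\<close>)
qed

end

section \<open>The statements carried through the induction\<close>

definition good :: "nat \<Rightarrow> bool list set set \<Rightarrow> bool list set set \<Rightarrow> bool" where
  "good n M F \<longleftrightarrow> M \<subseteq> edges (cube n) \<and> F \<subseteq> edges (cube n) \<and> M \<inter> F = {} \<and> pairwise disjnt M"

text \<open>The edges of one dimension over a colour class of the three-dimensional cube. Such a
  class consists of four vertices pairwise at distance two, and there are no other quadruples of
  this kind, which is why it describes the matching of the exception.\<close>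

definition parity_class :: "nat \<Rightarrow> bool \<Rightarrow> bool list set set" where
  "parity_class i p = cross_edge i ` {x \<in> verts (cube 3). par x = p}"

text \<open>Working form of \<open>exceptional\<close>. In a \<open>good\<close> pair the fault then
  lies over the colour class opposite to that of the matching.\<close>

definition exc :: "nat \<Rightarrow> bool list set set \<Rightarrow> bool list set set \<Rightarrow> bool" where
  "exc n M F \<longleftrightarrow> n = 4 \<and> card F = 1 \<and>
     (\<exists>i\<le>3. \<exists>p. M = parity_class i p \<and> F \<subseteq> cross_edge i ` verts (cube 3))"

text \<open>An empty \<open>M\<close> cannot be allowed: \<open>n - 1\<close> faults at one vertex
  leave it with a single edge. \<open>cycle_extD\<close> treats an empty \<open>M\<close> with fewer
  faults.\<close>

definition cycle_ext :: "nat \<Rightarrow> bool" where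
  "cycle_ext n \<longleftrightarrow> (\<forall>M F. good n M F \<longrightarrow> M \<noteq> {} \<longrightarrow> card M + 2 * card F \<le> 2 * n - 2 \<longrightarrow>
     \<not> exc n M F \<longrightarrow> ham_cycle n F M)"

text \<open>A prescribed edge joining the two ends could not lie on a spanning path of more than two
  vertices, hence the condition on \<open>{u, v}\<close>.\<close>

definition path_ext :: "nat \<Rightarrow> bool" where
  "path_ext n \<longleftrightarrow> (\<forall>M F u v. good n M F \<longrightarrow> card M + 2 * card F \<le> n - 1 \<longrightarrow>
     length u = n \<longrightarrow> length v = n \<longrightarrow> par u \<noteq> par v \<longrightarrow> {u, v} \<notin> M \<longrightarrow> ham_path n F M u v)"

text \<open>One unit of weight more than in \<open>path_ext 4\<close>. Two halves of weight 4 occur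
  in the five-dimensional cube, and opening the cycle of one half at an edge requires such a path
  between adjacent ends in the other.\<close>

definition adjacent_path_ext4 :: bool where
  "adjacent_path_ext4 \<longleftrightarrow> (\<forall>M F u v. good 4 M F \<longrightarrow> card M + 2 * card F \<le> 4 \<longrightarrow>
     {u, v} \<in> edges (cube 4) - M \<longrightarrow> ham_path 4 F M u v)"

text \<open>Replaces the missing cycle when a half is exceptional. The end \<open>y\<close> is not
  adjacent to \<open>x\<close>, so \<open>{x, y}\<close> cannot be a matching edge of the other
  half, and a vertex \<open>z\<close> over which the crossing edge is faulty can be avoided.\<close>

definition exc_path_ext :: bool where
  "exc_path_ext \<longleftrightarrow> (\<forall>M F x z. good 4 M F \<longrightarrow> exc 4 M F \<longrightarrow> length x = 4 \<longrightarrow> x \<notin> \<Union>M \<longrightarrow> z \<noteq> x \<longrightarrow>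
     (\<exists>y. y \<noteq> z \<and> {x, y} \<notin> edges (cube 4) \<and> par x \<noteq> par y \<and> ham_path 4 F M x y))"

definition laceable :: "nat \<Rightarrow> bool" where
  "laceable n \<longleftrightarrow> (\<forall>u v. length u = n \<longrightarrow> length v = n \<longrightarrow> par u \<noteq> par v \<longrightarrow> ham_path n {} {} u v)"

text \<open>Known as a paired two-disjoint path cover: the counterpart of Hamiltonian laceability
  for two pairs of ends.\<close>

definition paired_laceable :: "nat \<Rightarrow> bool" where
  "paired_laceable n \<longleftrightarrow> (\<forall>u v x y. length u = n \<longrightarrow> length v = n \<longrightarrow> length x = n \<longrightarrow> length y = n \<longrightarrow>
     par u \<noteq> par v \<longrightarrow> par x \<noteq> par y \<longrightarrow> u \<noteq> x \<longrightarrow> u \<noteq> y \<longrightarrow> v \<noteq> x \<longrightarrow> v \<noteq> y \<longrightarrow> two_paths n {} {} u v x y)"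

lemma goodD:
  assumes "good n M F"
  shows "M \<subseteq> edges (cube n)" "F \<subseteq> edges (cube n)" "finite M" "finite F"
  using assms finite_subset[OF _ finite_edges_cube] unfolding good_def by auto

lemma good_subset: "good n M F \<Longrightarrow> M' \<subseteq> M \<Longrightarrow> F' \<subseteq> F \<Longrightarrow> good n M' F'"
  unfolding good_def using pairwise_subset by blast

lemma good_unique:
  assumes "good n M F" "e \<in> M" "f \<in> M" "x \<in> e" "x \<in> f"
  shows "e = f"
  using assms unfolding good_def pairwise_def disjnt_def by blast

lemma good_half:
  assumes "good (Suc m) M F" "i \<le> m"
  shows "good m (half m i b M) (half m i b F)"
proof -
  have "disjnt e f" if "e \<in> half m i b M" "f \<in> half m i b M" "e \<noteq> f" for e f
  proof -
    have "ins i b ` e \<noteq> ins i b ` f"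
      using inj_onD[OF inj_on_image_ins[OF assms(2)], of b e f] that unfolding half_def by blast
    moreover have "ins i b ` e \<in> M" "ins i b ` f \<in> M" using that by (auto simp: half_def)
    moreover have "pairwise disjnt M" using assms(1) by (simp add: good_def)
    ultimately have "disjnt (ins i b ` e) (ins i b ` f)" by (meson pairwiseD)
    then show ?thesis unfolding disjnt_def by blast
  qed
  moreover have "half m i b M \<inter> half m i b F = {}"
    using assms(1) unfolding good_def half_def by blast
  ultimately show ?thesis unfolding good_def by (simp add: half_subset pairwiseI)
qed

text \<open>The crossing edge of \<open>M\<close> already covers both copies of \<open>x\<close>, so
  inside either half \<open>x\<close> is free and every edge at it is unprescribed.\<close>

lemma cross_not_covered:
  assumes "good (Suc m) M F" "i \<le> m" "x \<in> cross m i M"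
  shows "x \<notin> \<Union>(half m i b M)"
proof
  assume "x \<in> \<Union>(half m i b M)"
  then obtain e where e: "e \<in> edges (cube m)" "ins i b ` e \<in> M" "x \<in> e" unfolding half_def by blast
  have "cross_edge i x \<in> M" "length x = m" using assms(3) by (auto simp: cross_def)
  moreover have "ins i b x \<in> cross_edge i x" by (cases b) (auto simp: cross_edge_def)
  ultimately have "cross_edge i x = ins i b ` e" using good_unique[OF assms(1)] e by blast
  then show False using cross_edge_neq_image[OF assms(2) e(1)] \<open>length x = m\<close> by blast
qed

lemma weight_split:
  assumes "good (Suc m) M F" "i \<le> m"
  shows "card M = card (half m i b M) + card (half m i (\<not> b) M) + card (cross m i M)"
    "card F = card (half m i b F) + card (half m i (\<not> b) F) + card (cross m i F)"
  using card_split[OF _ assms(2)] goodD[OF assms(1)] by blast+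

lemma weight_dims:
  assumes "good (Suc m) M F"
  shows "card M + 2 * card F = (\<Sum>i\<le>m. card (cross m i M) + 2 * card (cross m i F))"
  using card_eq_sum_cross goodD[OF assms] by (simp add: sum.distrib sum_distrib_left)

text \<open>Pigeonhole on \<open>weight_dims\<close>: weights of at least \<open>k\<close> in all
  \<open>Suc m\<close> dimensions would add up to \<open>k * Suc m\<close>. It is applied with
  \<open>k = 1\<close> for paths and with \<open>k = 2\<close> for cycles.\<close>

lemma exists_light_dim:
  assumes "good (Suc m) M F" "card M + 2 * card F < k * Suc m"
  obtains i where "i \<le> m" "card (cross m i M) + 2 * card (cross m i F) < k"
proof (rule ccontr)
  assume "\<not> thesis"
  then have "k \<le> card (cross m i M) + 2 * card (cross m i F)" if "i \<le> m" for i
    using that \<open>\<And>i. i \<le> m \<Longrightarrow> card (cross m i M) + 2 * card (cross m i F) < k \<Longrightarrow> thesis\<close> by (meson not_le)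
  then have "(\<Sum>i\<le>m. k) \<le> card M + 2 * card F"
    unfolding weight_dims[OF assms(1)] by (intro sum_mono) auto
  then show False using assms(2) by (simp add: mult.commute)
qed

lemma card_Union_matching:
  assumes "M \<subseteq> edges (cube n)"
  shows "card (\<Union>M) \<le> 2 * card M"
proof -
  have fin: "finite M" using assms finite_subset by blast
  have "card (\<Union>M) \<le> (\<Sum>e\<in>M. card e)" using card_Union_le_sum_card by blast
  also have "\<dots> \<le> (\<Sum>e\<in>M. 2)"
  proof (rule sum_mono)
    fix e assume "e \<in> M"
    then obtain x y where "e = {x, y}" using assms edgeE by blast
    then show "card e \<le> 2" by (simp add: card_insert_le_m1)
  qed
  finally show ?thesis using fin by simp
qed

text \<open>An edge determines its dimension and the vertex below it, so a single common edge
  identifies two classes.\<close>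

lemma parity_class_eq:
  assumes "e \<in> parity_class i p" "e \<in> parity_class j q" "i \<le> 3" "j \<le> 3"
  shows "i = j \<and> p = q"
proof -
  obtain x y where x: "e = cross_edge i x" "length x = 3" "par x = p" and y: "e = cross_edge j y" "length y = 3" "par y = q"
    using assms(1,2) unfolding parity_class_def by auto
  have "i = j" using cross_edge_dim_inj[of i x j y 3] x y assms(3,4) by simp
  moreover from this have "x = y"
    using inj_onD[OF inj_on_cross_edge[OF assms(3)], of x y] x y by simp
  ultimately show ?thesis using x y by simp
qed

lemma card_parity_class: "i \<le> 3 \<Longrightarrow> card (parity_class i p) = 4"
  unfolding parity_class_def using card_par[of 2 p]
  by (subst card_image[OF inj_on_subset[OF inj_on_cross_edge[of i 3]]]) auto

lemma parity_class_edges: "parity_class i p \<subseteq> edges (cube 4)"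
  using cross_edge_in_edges[of _ 3 i] unfolding parity_class_def by auto

lemma excD:
  assumes "exc n M F"
  shows "n = 4" "card M = 4" "card F = 1"
  using assms card_parity_class unfolding exc_def by auto

text \<open>The four edges cover at most eight of the sixteen vertices, which leaves room to avoid
  one more vertex.\<close>

lemma exc_uncovered:
  assumes "exc n M F"
  obtains x where "length x = 4" "x \<notin> \<Union>M" "x \<noteq> z"
proof -
  have "M \<subseteq> edges (cube 4)" using assms parity_class_edges unfolding exc_def by blast
  then have "card (\<Union>M) \<le> 8" using card_Union_matching[of M 4] excD(2)[OF assms] by simp
  then have "card (insert z (\<Union>M)) < card (verts (cube 4))"
    using card_insert_le_m1[of 9 "\<Union>M" z] by (simp add: card_verts_cube)
  moreover have "finite (insert z (\<Union>M))"
    using \<open>M \<subseteq> edges (cube 4)\<close> edge_subset_verts finite_subset[OF _ finite_verts_cube[of 4], of "\<Union>M"] by blast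
  ultimately have "\<not> verts (cube 4) \<subseteq> insert z (\<Union>M)" using card_mono leD by metis
  then obtain x where "x \<in> verts (cube 4)" "x \<notin> insert z (\<Union>M)" by blast
  then show ?thesis using that[of x] by auto
qed

text \<open>If removing \<open>e\<close> and removing \<open>f\<close> both left parity classes, a
  third edge would lie in both. The classes would then coincide, although only one of them contains
  \<open>f\<close>.\<close>

lemma not_exc_remove:
  assumes "3 \<le> card M"
  obtains e where "e \<in> M" "\<not> exc n (M - {e}) F"
proof (rule ccontr)
  assume "\<not> thesis"
  then have all: "exc n (M - {e}) F" if "e \<in> M" for e using that \<open>\<And>e. e \<in> M \<Longrightarrow> \<not> exc n (M - {e}) F \<Longrightarrow> thesis\<close> by blast
  obtain A where "A \<subseteq> M" "card A = 3" using assms by (meson obtain_subset_with_card_n)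
  then obtain e f g where e: "e \<in> M" "f \<in> M" "g \<in> M" "e \<noteq> f" "e \<noteq> g" "f \<noteq> g"
    by (auto simp: card_3_iff)
  obtain i p where ip: "i \<le> 3" "M - {e} = parity_class i p" using all[OF e(1)] unfolding exc_def by blast
  obtain j q where jq: "j \<le> 3" "M - {f} = parity_class j q" using all[OF e(2)] unfolding exc_def by blast
  have "g \<in> parity_class i p" "g \<in> parity_class j q" using e ip(2) jq(2) by blast+
  from parity_class_eq[OF this ip(1) jq(1)] have "M - {e} = M - {f}" using ip(2) jq(2) by simp
  then show False using e by blast
qed

text \<open>An empty matching with at most \<open>n - 2\<close> faults is enlarged by one fault-free
  edge of dimension 0. There are \<open>2 ^ (n - 1)\<close> edges of that dimension, more than there
  are faults, and the weight stays within the bound.\<close>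

lemma cycle_extD:
  assumes "cycle_ext n" "good n M F" "card M + 2 * card F \<le> 2 * n - 2" "\<not> exc n M F"
    "\<not> (M = {} \<and> card F = n - 1)" "2 \<le> n"
  shows "ham_cycle n F M"
proof (cases "M = {}")
  case True
  then have card: "card F + 2 \<le> n" using assms(3,5,6) by auto
  obtain m where n: "n = Suc m" using assms(6) by (cases n) auto
  have "card (cross_edge 0 ` verts (cube m)) = 2 ^ m"
    by (simp add: card_image inj_on_cross_edge card_verts_cube)
  moreover have "m < 2 ^ m" by simp
  ultimately have "card F < card (cross_edge 0 ` verts (cube m))" using card n by linarith
  then have "\<not> cross_edge 0 ` verts (cube m) \<subseteq> F" using card_mono[OF goodD(4)[OF assms(2)]] leD by blast
  then obtain x where "x \<in> verts (cube m)" and x: "cross_edge 0 x \<notin> F" by blast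
  then have x: "length x = m" "cross_edge 0 x \<notin> F" by simp_all
  let ?e = "cross_edge 0 x"
  have "good n {?e} F" using assms(2) cross_edge_in_edges[OF x(1)] x(2) unfolding good_def n by auto
  moreover have "\<not> exc n {?e} F" using excD(2)[of n "{?e}" F] by auto
  ultimately have "ham_cycle n F {?e}" using assms(1) card assms(6) unfolding cycle_ext_def by simp
  then show ?thesis using True ham_cycle_mono by blast
qed (use assms in \<open>auto simp: cycle_ext_def\<close>)

lemma path_extD:
  "path_ext n \<Longrightarrow> good n M F \<Longrightarrow> card M + 2 * card F \<le> n - 1 \<Longrightarrow> length u = n \<Longrightarrow> length v = n \<Longrightarrow>
   par u \<noteq> par v \<Longrightarrow> {u, v} \<notin> M \<Longrightarrow> ham_path n F M u v"
  unfolding path_ext_def by blast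

lemma path_ext_laceable: "path_ext n \<Longrightarrow> laceable n"
  unfolding path_ext_def laceable_def good_def by simp

section \<open>Hamiltonian paths through few edges\<close>

lemma exists_opposite_avoiding:
  assumes "finite B" "card B < 2 ^ (n - 1)" "1 \<le> n"
  obtains z where "length z = n" "par z = p" "z \<notin> B"
proof -
  have "card {x \<in> verts (cube n). par x = p} = 2 ^ (n - 1)" using card_par[of "n - 1" p] assms(3) by simp
  then have "\<not> {x \<in> verts (cube n). par x = p} \<subseteq> B" using card_mono[OF assms(1)] assms(2) by (metis leD)
  then obtain x where "x \<in> verts (cube n)" "par x = p" "x \<notin> B" by blast
  then show ?thesis using that[of x] by simp
qed

lemma card_partners_le:
  assumes "finite M"
  shows "finite {z. {u, z} \<in> M}" "card {z. {u, z} \<in> M} \<le> card M"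
proof -
  have inj: "inj_on (\<lambda>z. {u, z}) {z. {u, z} \<in> M}" by (auto intro!: inj_onI simp: doubleton_eq_iff)
  show "finite {z. {u, z} \<in> M}" by (rule inj_on_finite[OF inj _ assms]) auto
  show "card {z. {u, z} \<in> M} \<le> card M" by (rule card_inj_on_le[OF inj _ assms]) auto
qed

lemma double_lt_pow2: "4 \<le> m \<Longrightarrow> 2 * m + 2 \<le> (2::nat) ^ m"
proof (induction m rule: dec_induct)
  case (step m)
  have "(2::nat) \<le> 2 ^ m" using step.hyps pow2_ge[of 1 m] by simp
  with step show ?case by simp
qed simp

text \<open>The weight is below the number of dimensions, so the cube can be split where nothing
  crosses. A half that exceeds the path bound \<open>m - 1\<close> has weight exactly
  \<open>m\<close>, and then the other half is empty and its paths are unrestricted.\<close>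

lemma path_ext_step:
  assumes m: "4 \<le> m" and A: "cycle_ext m" and H: "path_ext m"
  shows "path_ext (Suc m)"
  unfolding path_ext_def
proof (intro allI impI)
  fix M F u v
  assume g: "good (Suc m) M F" and w: "card M + 2 * card F \<le> Suc m - 1"
    and len: "length u = Suc m" "length v = Suc m" and puv: "par u \<noteq> par v" and uv: "{u, v} \<notin> M"
  obtain i where i: "i \<le> m" "card (cross m i M) + 2 * card (cross m i F) < 1"
    using exists_light_dim[OF g, of 1] w by auto
  then have cr: "cross m i M = {}" "cross m i F = {}" by simp_all
  let ?M = "\<lambda>b. half m i b M" and ?F = "\<lambda>b. half m i b F"
  let ?w = "\<lambda>b. card (?M b) + 2 * card (?F b)"
  have ws: "?w b + ?w (\<not> b) \<le> m" for b using weight_split[OF g i(1), of b] w by simp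
  have gh: "good m (?M b) (?F b)" for b using good_half[OF g i(1)] .
  have ME: "M \<subseteq> edges (cube (Suc m))" using goodD[OF g] by blast
  have zero: "?M b = {} \<and> ?F b = {}" if "?w b = 0" for b using that by simp
  note pow = double_lt_pow2[OF m]
  \<comment> \<open>Weight \<open>m\<close> rules out the exceptional configuration, which has
    weight 6 in dimension 4, and also an empty matching with \<open>m - 1\<close> faults.\<close>
  have cyc: "ham_cycle m (?F b) (?M b)" if "?w b = m" for b
    using that m excD[of m "?M b" "?F b"] by (intro cycle_extD[OF A gh]) auto
  have across: "ham_path (Suc m) F M (ins i b x) (ins i (\<not> b) y)"
    if a: "length x = m" "length y = m" "par x = par y" "?w (\<not> b) \<le> ?w b" for b x y
  proof -
    have "\<exists>z. ham_path m (?F b) (?M b) x z \<and> ham_path m (?F (\<not> b)) (?M (\<not> b)) z y"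
    proof (cases "?w b \<le> m - 1")
      case True
      \<comment> \<open>The path changes half at a vertex \<open>z\<close>. As
        \<open>path_ext\<close> does not admit a prescribed edge between the two ends,
        \<open>z\<close> must not be the partner of \<open>x\<close> in one half or of
        \<open>y\<close> in the other.\<close>
      let ?B = "{z. {x, z} \<in> ?M b} \<union> {z. {y, z} \<in> ?M (\<not> b)}"
      have "card ?B \<le> card (?M b) + card (?M (\<not> b))"
        using card_Un_le[of "{z. {x, z} \<in> ?M b}" "{z. {y, z} \<in> ?M (\<not> b)}"] card_partners_le(2)[of "?M b" x]
          card_partners_le(2)[of "?M (\<not> b)" y] by simp
      moreover have "m < 2 ^ (m - 1)" using pow m by (cases m) auto
      ultimately have card: "card ?B < 2 ^ (m - 1)" using ws[of b] by linarith
      have fin: "finite ?B" using card_partners_le(1)[OF finite_half] by simp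
      have "1 \<le> m" using m by simp
      from exists_opposite_avoiding[OF fin card this, of "\<not> par x"]
      obtain z where z: "length z = m" "par z = (\<not> par x)" "z \<notin> ?B" by metis
      have "ham_path m (?F b) (?M b) x z"
        using z a True by (intro path_extD[OF H gh]) auto
      moreover have "ham_path m (?F (\<not> b)) (?M (\<not> b)) z y"
        using z a True by (intro path_extD[OF H gh]) (auto simp: insert_commute)
      ultimately show ?thesis by blast
    next
      case False
      then have wb: "?w b = m" "?w (\<not> b) = 0" using ws[of b] by linarith+
      have "2 \<le> m" using m by simp
      then obtain z z' where z: "z \<noteq> z'" "{x, z} \<in> edges (cube m)" "{x, z'} \<in> edges (cube m)"
        "ham_path m (?F b) (?M b - {{x, z}}) x z" "ham_path m (?F b) (?M b - {{x, z'}}) x z'"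
        using ham_cycle_at[OF cyc[OF wb(1)] _ a(1)] by metis
      have "{x, z} \<notin> ?M b \<or> {x, z'} \<notin> ?M b"
        using good_unique[OF gh, of "{x, z}" b "{x, z'}" x] z(1) by (auto simp: doubleton_eq_iff)
      then obtain t where t: "{x, t} \<in> edges (cube m)" "ham_path m (?F b) (?M b) x t"
        using z by (metis Diff_empty Diff_insert0)
      have "ham_path m (?F (\<not> b)) (?M (\<not> b)) t y"
        using t(1) wb(2) a edge_par[OF t(1)] edge_length[OF t(1)] m zero[OF wb(2)]
        by (intro path_extD[OF H gh]) auto
      with t show ?thesis by blast
    qed
    then show ?thesis using join_path[OF i(1)] cr ME by (metis empty_iff empty_subsetI)
  qed
  have same: "ham_path (Suc m) F M (ins i b x) (ins i b y)"
    if xy: "length x = m" "length y = m" "par x \<noteq> par y" "{x, y} \<notin> ?M b" for b x y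
  proof -
    have detour: "ham_path (Suc m) F M (ins i b x) (ins i b y)"
      if "two_paths m (?F b) (?M b) x p q y" "par p \<noteq> par q" "{p, q} \<notin> ?M (\<not> b)" "?w (\<not> b) \<le> m - 1" for p q
    proof -
      have "ham_path m (?F (\<not> b)) (?M (\<not> b)) p q"
        using that two_paths_verts[OF that(1)] by (intro path_extD[OF H gh]) auto
      then show ?thesis using join_detour[OF i(1) that(1)] cr ME by auto
    qed
    \<comment> \<open>A path edge outside both matchings is replaced by a detour through the other
      half. The matchings have at most \<open>m\<close> edges together, far fewer than the
      path.\<close>
    have splice: "ham_path (Suc m) F M (ins i b x) (ins i b y)"
      if a: "ham_path m (?F b) (?M b) x y" "?w (\<not> b) \<le> m - 1"
    proof -
      have "card (?M b \<union> ?M (\<not> b)) + 1 < 2 ^ m"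
        using card_Un_le[of "?M b" "?M (\<not> b)"] ws[of b] pow by linarith
      then obtain p q where pq: "{p, q} \<in> edges (cube m)" "{p, q} \<notin> ?M b \<union> ?M (\<not> b)"
        "two_paths m (?F b) (?M b - {{p, q}}) x p q y"
        using ham_path_pick[OF a(1), of "?M b \<union> ?M (\<not> b)"] by auto
      then show ?thesis using a(2) edge_par[OF pq(1)] by (intro detour[of p q]) auto
    qed
    show ?thesis
    proof (cases "?w b \<le> m - 1")
      case wb: True
      show ?thesis
      proof (cases "?w (\<not> b) \<le> m - 1")
        case True
        then show ?thesis using wb xy by (intro splice path_extD[OF H gh]) auto
      next
        case False
        then have w: "?w (\<not> b) = m" "?w b = 0" using ws[of b] by linarith+
        \<comment> \<open>The path in the empty half has to pass through the edge at which the cycle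
          of the other half is opened. So that edge is prescribed there as a matching of size one,
          which is possible only if it differs from \<open>{x, y}\<close>.\<close>
        have "card (insert {x, y} (?M (\<not> b))) + 2 * card ({} :: bool list set) < 2 ^ m"
          using card_insert_le_m1[of "Suc m" "?M (\<not> b)" "{x, y}"] w pow by simp
        then obtain p q where pq: "{p, q} \<in> edges (cube m)" "{p, q} \<notin> insert {x, y} (?M (\<not> b))"
          "ham_path m (?F (\<not> b)) (?M (\<not> b) - {{p, q}}) p q"
          using ham_cycle_pick[OF cyc[OF w(1)], of "insert {x, y} (?M (\<not> b))" "{}"] m by auto
        have "good m {{p, q}} {}" using pq(1) by (simp add: good_def)
        then have "ham_path m {} {{p, q}} x y"
          using xy pq(2) m by (intro path_extD[OF H]) auto
        from ham_path_through[OF this, of p q]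
        have "two_paths m {} {} x p q y \<or> two_paths m {} {} x q p y" by simp
        then show ?thesis
        proof
          assume "two_paths m {} {} x p q y"
          then show ?thesis using join_detour[OF i(1), of b F M x p q y] zero[OF w(2)] pq(2,3) cr ME by simp
        next
          assume "two_paths m {} {} x q p y"
          then show ?thesis using join_detour[OF i(1), of b F M x q p y] zero[OF w(2)] pq(2)
              ham_path_sym[OF pq(3)] cr ME by simp
        qed
      qed
    next
      case False
      then have wb: "?w b = m" "?w (\<not> b) = 0" using ws[of b] by linarith+
      show ?thesis
      proof (cases "?F b = {}")
        case False
        \<comment> \<open>Releasing one fault brings the half within the path bound. If the
          resulting path uses the fault, a detour through the empty half replaces it.\<close>
        then obtain f where f: "f \<in> ?F b" by blast
        then obtain p q where pq: "f = {p, q}" "par p \<noteq> par q" using half_subset edgeE by blast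
        have "ham_path m (?F b - {f}) (?M b) x y"
          using xy wb f card_Suc_Diff1[OF finite_half f] by (intro path_extD[OF H good_subset[OF gh]]) auto
        from ham_path_edge[OF this, of p q] f pq(1)
        have "ham_path m (?F b) (?M b) x y \<or> two_paths m (?F b) (?M b - {f}) x p q y \<or>
            two_paths m (?F b) (?M b - {f}) x q p y" by (simp add: insert_absorb)
        moreover have "?M b - {f} = ?M b" using gh[of b] f unfolding good_def by blast
        ultimately show ?thesis
          using splice detour[of p q] detour[of q p] wb(2) zero[OF wb(2)] pq(2) by auto
      next
        case True
        \<comment> \<open>Without faults a matching edge is released instead and put back as a
          chord; if this splits the path, the detour bridges the gap.\<close>
        then have "?M b \<noteq> {}" using wb(1) m by auto
        then obtain e where e: "e \<in> ?M b" by blast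
        then obtain p q where pq: "e = {p, q}" using half_subset edgeE by blast
        have gd: "good m (?M b - {e}) (?F b)" by (rule good_subset[OF gh]) auto
        have "ham_path m (?F b) (?M b - {e}) x y"
          using xy wb e card_Suc_Diff1[OF finite_half e] by (intro path_extD[OF H gd]) auto
        moreover have "e \<in> edges (cube m) - ?F b" using e gh[of b] unfolding good_def by blast
        moreover have "p \<notin> \<Union>(?M b - {e})" "q \<notin> \<Union>(?M b - {e})"
          using good_unique[OF gh[of b] e] pq by auto
        moreover have "e \<noteq> {x, y}" using e xy(4) by blast
        ultimately have "ham_path m (?F b) (insert e (?M b - {e})) x y \<or>
            (\<exists>s t. par s \<noteq> par t \<and> two_paths m (?F b) (insert e (?M b - {e})) x s t y)"
          using ham_path_chord[of m "?F b" "?M b - {e}" x y p q] pq by simp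
        then show ?thesis using splice detour zero[OF wb(2)] wb(2) e by (auto simp: insert_absorb)
      qed
    qed
  qed
  obtain b x where x: "u = ins i b x" "length x = m" using insE[OF len(1) i(1)] by metis
  obtain c y where y: "v = ins i c y" "length y = m" using insE[OF len(2) i(1)] by metis
  show "ham_path (Suc m) F M u v"
  proof (cases "b = c")
    case True
    then have "{x, y} \<notin> ?M b" using uv x y by (auto simp: half_def)
    then show ?thesis using same[of x y b] x y True puv by auto
  next
    case False
    then have c: "c = (\<not> b)" "par x = par y" using puv x y by auto
    show ?thesis
    proof (cases "?w (\<not> b) \<le> ?w b")
      case True
      then show ?thesis using across[of x y b] x y c by simp
    next
      case False
      then have "ham_path (Suc m) F M v u" using across[of y x "\<not> b"] x y c by simp
      then show ?thesis by (rule ham_path_sym)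
    qed
  qed
qed

text \<open>Splitting along a dimension that separates \<open>u\<close> from \<open>v\<close> leaves
  two cases up to symmetry: \<open>x\<close> and \<open>y\<close> in the same half, where only the
  first path crosses, or in different halves, where each path crosses once.\<close>

lemma paired_laceable_step:
  assumes m: "3 \<le> m" and L: "laceable m" and S: "paired_laceable m"
  shows "paired_laceable (Suc m)"
  unfolding paired_laceable_def
proof (intro allI impI)
  fix u v x y :: "bool list"
  assume len: "length u = Suc m" "length v = Suc m" "length x = Suc m" "length y = Suc m"
    and par: "par u \<noteq> par v" "par x \<noteq> par y" and ne: "u \<noteq> x" "u \<noteq> y" "v \<noteq> x" "v \<noteq> y"
  have "u \<noteq> v" using par by blast
  then obtain i where i: "i \<le> m" "u ! i \<noteq> v ! i" using len list_eq_iff_nth_eq[of u v] by (auto simp: less_Suc_eq_le)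
  \<comment> \<open>A crossing vertex of given parity must avoid at most three others, and each
    parity offers \<open>2 ^ (m - 1)\<close> vertices, at least four.\<close>
  have opp: "\<exists>z. length z = m \<and> par z = p \<and> z \<notin> B" if "finite B" "card B \<le> 3" for B p
  proof -
    have "(2::nat) ^ 2 \<le> 2 ^ (m - 1)" using m by (intro pow2_ge) simp
    then have card: "card B < 2 ^ (m - 1)" using that(2) by simp
    have "1 \<le> m" using m by simp
    from exists_opposite_avoiding[OF that(1) card this, of p]
    obtain z where "length z = m" "par z = p" "z \<notin> B" by metis
    then show ?thesis by blast
  qed
  have one: "two_paths (Suc m) {} {} (ins i b u') (ins i (\<not> b) v') (ins i b x') (ins i b y')"
    if *: "length u' = m" "length v' = m" "length x' = m" "length y' = m" "par u' = par v'" "par x' \<noteq> par y'"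
      "u' \<noteq> x'" "u' \<noteq> y'" for b u' v' x' y'
  proof -
    obtain z where z: "length z = m" "par z = (\<not> par u')" "z \<notin> {x', y'}"
      using opp[of "{x', y'}" "\<not> par u'"] by (auto simp: card_insert_le_m1)
    have "two_paths m {} {} u' z x' y'" using S z * unfolding paired_laceable_def by auto
    moreover have "ham_path m {} {} z v'" using L z * unfolding laceable_def by auto
    ultimately show ?thesis using join_two_paths_one_crossing[OF i(1)] by blast
  qed
  have two: "two_paths (Suc m) {} {} (ins i b u') (ins i (\<not> b) v') (ins i b x') (ins i (\<not> b) y')"
    if *: "length u' = m" "length v' = m" "length x' = m" "length y' = m" "par u' = par v'" "par x' = par y'"
      "u' \<noteq> x'" "v' \<noteq> y'" for b u' v' x' y'
  proof -
    obtain z where z: "length z = m" "par z = (\<not> par u')" "z \<notin> {x', y'}"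
      using opp[of "{x', y'}" "\<not> par u'"] by (auto simp: card_insert_le_m1)
    obtain w where w: "length w = m" "par w = (\<not> par x')" "w \<notin> {u', v', z}"
      using opp[of "{u', v', z}" "\<not> par x'"] by (auto simp: card_insert_le_m1)
    have "two_paths m {} {} u' z x' w" using S z w * unfolding paired_laceable_def by auto
    moreover have "two_paths m {} {} z v' w y'" using S z w * unfolding paired_laceable_def by auto
    ultimately show ?thesis using join_two_paths_two_crossings[OF i(1)] by blast
  qed
  obtain b u' where u: "u = ins i b u'" "length u' = m" using insE[OF len(1) i(1)] by metis
  obtain b2 v' where v: "v = ins i b2 v'" "length v' = m" using insE[OF len(2) i(1)] by metis
  obtain c x' where x: "x = ins i c x'" "length x' = m" using insE[OF len(3) i(1)] by metis
  obtain d y' where y: "y = ins i d y'" "length y' = m" using insE[OF len(4) i(1)] by metis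
  have b2: "b2 = (\<not> b)" using i u v by auto
  consider "c = b" "d = b" | "c = (\<not> b)" "d = (\<not> b)" | "c = b" "d = (\<not> b)" | "c = (\<not> b)" "d = b" by auto
  then show "two_paths (Suc m) {} {} u v x y"
  proof cases
    case 1
    then show ?thesis using one[of u' v' x' y' b] u v x y b2 par ne i(1) by auto
  next
    case 2
    then have "two_paths (Suc m) {} {} v u x y" using one[of v' u' x' y' "\<not> b"] u v x y b2 par ne i(1) by auto
    then show ?thesis by (rule two_paths_rev1)
  next
    case 3
    then show ?thesis using two[of u' v' x' y' b] u v x y b2 par ne i(1) by auto
  next
    case 4
    then have "two_paths (Suc m) {} {} u v y x" using two[of u' v' y' x' b] u v x y b2 par ne i(1) by auto
    then show ?thesis by (rule two_paths_rev2)
  qed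
qed

section \<open>Hamiltonian cycles: the induction step\<close>

text \<open>In the balanced split a cycle is opened away from the at most \<open>m\<close> matching
  edges of its own half and from the at most \<open>2 * m\<close> vertices covered in the other
  half. A vertex spoils two cycle edges, which makes \<open>m + 2 * (2 * m)\<close> in all. The
  inequality fails for \<open>m = 4\<close>.\<close>

lemma five_lt_pow2: "5 \<le> m \<Longrightarrow> 5 * m < (2::nat) ^ m"
proof (induction m rule: dec_induct)
  case (step m)
  have "(2::nat) ^ 5 \<le> 2 ^ m" using step.hyps by (intro pow2_ge)
  with step show ?case by simp
qed simp

lemma good_insert:
  assumes "good n M F" "{u, v} \<in> edges (cube n)" "u \<notin> \<Union>M" "v \<notin> \<Union>M"
  shows "good n (insert {u, v} M) (F - {{u, v}})"
  using assms unfolding good_def pairwise_insert by (auto simp: disjnt_def)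

text \<open>One splitting dimension with \<open>b\<close> the heavier half. Below, the suffix 0
  marks the heavier half, 1 the lighter one and x the crossing edges.\<close>

locale cycle_step =
  fixes m :: nat and M F :: "bool list set set" and i :: nat and b :: bool
  assumes m: "4 \<le> m" and A: "cycle_ext m" and H: "path_ext m" and S: "paired_laceable m"
    and X: exc_path_ext and J: adjacent_path_ext4
    and g: "good (Suc m) M F" and ne: "M \<noteq> {}" and w: "card M + 2 * card F \<le> 2 * m" and i: "i \<le> m"
    and b: "card (half m i (\<not> b) M) + 2 * card (half m i (\<not> b) F) \<le> card (half m i b M) + 2 * card (half m i b F)"
begin

abbreviation "M0 \<equiv> half m i b M"
abbreviation "F0 \<equiv> half m i b F"
abbreviation "M1 \<equiv> half m i (\<not> b) M"
abbreviation "F1 \<equiv> half m i (\<not> b) F"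
abbreviation "Mx \<equiv> cross m i M"
abbreviation "Fx \<equiv> cross m i F"

lemma g0: "good m M0 F0" and g1: "good m M1 F1"
  using good_half[OF g i] by blast+

lemma ME: "M \<subseteq> edges (cube (Suc m))"
  using goodD[OF g] by blast

lemma weights: "card M = card M0 + card M1 + card Mx" "card F = card F0 + card F1 + card Fx"
  using weight_split[OF g i] by blast+

lemma total: "card M0 + 2 * card F0 + (card M1 + 2 * card F1) + (card Mx + 2 * card Fx) \<le> 2 * m"
  using weights w by linarith

lemma pow: "2 * m + 2 \<le> 2 ^ m"
  by (rule double_lt_pow2[OF m])

section \<open>Closing a cycle through the lighter half\<close>

lemma close_path:
  assumes "ham_path m F0 M0 u v" "par u \<noteq> par v" "{u, v} \<notin> M1" "u \<notin> Fx" "v \<notin> Fx" "Mx \<subseteq> {u, v}"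
    "card M1 + 2 * card F1 \<le> m - 1"
  shows "ham_cycle (Suc m) F M"
proof -
  have "ham_path m F1 M1 u v"
    using assms ham_path_verts[OF assms(1)] by (intro path_extD[OF H g1]) auto
  then show ?thesis using join_cycle[OF i assms(1)] assms ME by blast
qed

text \<open>A faulty crossing edge spoils the two cycle edges at its end, which is just its weight.
  So the edges at which the cycle cannot be opened are bounded by the total weight
  \<open>2 * m\<close>, below the length \<open>2 ^ m\<close> of the cycle.\<close>

lemma close_cycle:
  assumes "ham_cycle m F0 M0" "Mx = {}" "card M1 + 2 * card F1 \<le> m - 1"
  shows "ham_cycle (Suc m) F M"
proof -
  have "card (M0 \<union> M1) + 2 * card Fx < 2 ^ m"
    using card_Un_le[of M0 M1] total pow by linarith
  then obtain u v where uv: "{u, v} \<in> edges (cube m)" "{u, v} \<notin> M0 \<union> M1" "u \<notin> Fx" "v \<notin> Fx"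
    "ham_path m F0 (M0 - {{u, v}}) u v"
    using ham_cycle_pick[OF assms(1), of "M0 \<union> M1" Fx] m by auto
  then show ?thesis using close_path[of u v] edge_par[OF uv(1)] assms by auto
qed

text \<open>The lighter half is empty and joins \<open>v\<close> to \<open>x\<close> and
  \<open>u\<close> to \<open>y\<close>; pairing \<open>u\<close> with \<open>v\<close> again would
  close the two pieces separately. This explains which ends must have opposite parity.\<close>

lemma close_two_paths:
  assumes "two_paths m F0 M0 u v x y" "u \<noteq> v" "x \<noteq> y" "par u \<noteq> par y" "par v \<noteq> par x"
    "M1 = {}" "F1 = {}" "Fx = {}" "Mx \<subseteq> {u, v, x, y}"
  shows "ham_cycle (Suc m) F M"
proof -
  have "two_paths m {} {} v x u y"
    using S two_paths_verts[OF assms(1)] two_paths_neq[OF assms(1)] assms(2-5)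
    unfolding paired_laceable_def by metis
  then show ?thesis using join_cycle4[OF i assms(1)] assms ME by auto
qed

lemma close_linkable:
  assumes "linkable m F0 M0" "Mx = {}" "Fx = {}" "M1 = {}" "F1 = {}"
  shows "ham_cycle (Suc m) F M"
  using assms(1) unfolding linkable_def
proof
  assume "\<exists>u v. par u \<noteq> par v \<and> ham_path m F0 M0 u v"
  then show ?thesis using close_path assms by auto
next
  assume "\<exists>u v x y. two_paths m F0 M0 u v x y \<and> u \<noteq> v \<and> x \<noteq> y \<and> par u \<noteq> par y \<and> par v \<noteq> par x"
  then show ?thesis using close_two_paths assms by blast
qed

text \<open>Either the cycle avoids the released fault, or it is opened there and the two ends of
  the fault are joined through the lighter half. The latter requires that the corresponding edge of
  that half is not prescribed.\<close>

lemma close_after_unfaulting: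
  assumes "ham_cycle m (F0 - {f}) M0" "f \<in> F0" "f \<notin> M1" "Mx = {}" "Fx = {}" "card M1 + 2 * card F1 \<le> m - 1"
  shows "ham_cycle (Suc m) F M"
proof -
  obtain p q where pq: "f = {p, q}" "par p \<noteq> par q" using assms(2) half_subset edgeE by blast
  have "M0 - {f} = M0" using g0 assms(2) unfolding good_def by blast
  then have "ham_cycle m F0 M0 \<or> ham_path m F0 M0 p q"
    using ham_cycle_edge[OF assms(1), of p q] m assms(2) pq by (simp add: insert_absorb)
  then show ?thesis using close_cycle close_path[of p q] assms pq by auto
qed

text \<open>The vertex \<open>x\<close> is the place of the prescribed crossing edge, if there is
  one, and \<open>z\<close> the place of a faulty one; the two never occur together in the
  applications.\<close>

lemma close_exc:
  assumes "exc m M0 F0" "x \<notin> \<Union>M0" "length x = m" "z \<noteq> x" "x \<notin> Fx" "Fx \<subseteq> {z}" "Mx \<subseteq> {x}"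
    "card M1 + 2 * card F1 \<le> m - 1"
  shows "ham_cycle (Suc m) F M"
proof -
  have m4: "m = 4" using excD[OF assms(1)] by blast
  then obtain y where y: "y \<noteq> z" "{x, y} \<notin> edges (cube m)" "par x \<noteq> par y" "ham_path m F0 M0 x y"
    using X g0 assms unfolding exc_path_ext_def by metis
  then have "{x, y} \<notin> M1" using half_subset by blast
  then show ?thesis using close_path[OF y(4,3)] y(1) assms by auto
qed

text \<open>A faulty crossing edge uses two units of the total \<open>2 * m\<close>. This is just
  what brings the heavier half within the cycle bound and the lighter one within the path
  bound.\<close>

lemma step_faulty_dim:
  assumes "Mx = {}" "Fx \<noteq> {}"
  shows "ham_cycle (Suc m) F M"
proof -
  have fx: "1 \<le> card Fx" using assms(2) card_gt_0_iff[of Fx] by (simp add: Suc_le_eq)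
  have w1: "card M1 + 2 * card F1 \<le> m - 1" using total b fx m by linarith
  have w0: "card M0 + 2 * card F0 \<le> 2 * m - 2" using total fx by linarith
  show ?thesis
  proof (cases "exc m M0 F0")
    case True
    then have "card Fx = 1" using total fx excD[OF True] by simp
    then obtain z where z: "Fx = {z}" using card_1_singletonE by blast
    obtain x where "length x = 4" "x \<notin> \<Union>M0" "x \<noteq> z" using exc_uncovered[OF True] by metis
    then show ?thesis using close_exc[OF True, of x z] z assms(1) w1 excD[OF True] by auto
  next
    case False
    \<comment> \<open>Together with a crossing fault this would exhaust the weight and leave
      \<open>M\<close> empty.\<close>
    have "\<not> (M0 = {} \<and> card F0 = m - 1)"
    proof
      assume *: "M0 = {} \<and> card F0 = m - 1"
      then have "card M0 = 0" "card F0 = m - 1" by simp_all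
      then have "card M1 = 0" using total fx m by linarith
      then show False using * ne weights(1) assms(1) goodD(3)[OF g] by simp
    qed
    then have "ham_cycle m F0 M0" using cycle_extD[OF A g0 w0 False] m by simp
    then show ?thesis using close_cycle assms(1) w1 by blast
  qed
qed

text \<open>Both halves have weight exactly \<open>m\<close>, one more than the path bound. For
  \<open>m = 4\<close> adjacent ends still admit a path. For larger \<open>m\<close> the path in the
  lighter half comes from a cycle: the edge at which the first cycle is opened is added to the
  matching, giving weight at most \<open>m + 1\<close>, and cut out afterwards.\<close>

lemma step_balanced:
  assumes "Mx = {}" "Fx = {}" "m \<le> card M1 + 2 * card F1"
  shows "ham_cycle (Suc m) F M"
proof -
  have w: "card M0 + 2 * card F0 = m" "card M1 + 2 * card F1 = m" using total b assms by simp_all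
  have "\<not> exc m M0 F0" using excD[of m M0 F0] w(1) by auto
  then have hc: "ham_cycle m F0 M0" using w m by (intro cycle_extD[OF A g0]) auto
  show ?thesis
  proof (cases "m = 4")
    case True
    have "card (M0 \<union> M1) + 2 * card ({} :: bool list set) < 2 ^ m"
      using card_Un_le[of M0 M1] w pow by simp
    then obtain u v where uv: "{u, v} \<in> edges (cube m)" "{u, v} \<notin> M0 \<union> M1"
      "ham_path m F0 (M0 - {{u, v}}) u v"
      using ham_cycle_pick[OF hc, of "M0 \<union> M1" "{}"] m by auto
    have "ham_path m F1 M1 u v"
      using J g1 w(2) uv(1,2) True unfolding adjacent_path_ext4_def by simp
    then show ?thesis using join_cycle[OF i, of b F M u v] uv edge_neq[OF uv(1)] assms ME by simp
  next
    case False
    then have m5: "5 \<le> m" using m by simp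
    have "card (\<Union>M1) \<le> 2 * card M1" by (rule card_Union_matching[OF half_subset])
    then have "card M0 + 2 * card (\<Union>M1) < 2 ^ m" using five_lt_pow2[OF m5] w by linarith
    moreover have "finite (\<Union>M1)"
      using half_subset[of m i "\<not> b" M] edge_subset_verts finite_subset[OF _ finite_verts_cube[of m], of "\<Union>M1"] by blast
    ultimately obtain u v where uv: "{u, v} \<in> edges (cube m)" "{u, v} \<notin> M0" "u \<notin> \<Union>M1" "v \<notin> \<Union>M1"
      "ham_path m F0 (M0 - {{u, v}}) u v"
      using ham_cycle_pick[OF hc, of M0 "\<Union>M1"] m by auto
    \<comment> \<open>The added edge may be faulty in this half. It is taken out of the faults
      because only the auxiliary cycle uses it, and that cycle is opened there.\<close>
    let ?M = "insert {u, v} M1" and ?F = "F1 - {{u, v}}"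
    have "card ?M + 2 * card ?F \<le> 2 * m - 2"
      using card_insert_le_m1[of "Suc (card M1)" M1 "{u, v}"] card_Diff1_le[of F1 "{u, v}"] w m5 by simp
    then have "ham_cycle m ?F ?M"
      using excD(1)[of m ?M ?F] m5 by (intro cycle_extD[OF A good_insert[OF g1 uv(1,3,4)]]) auto
    then have "ham_path m (insert {u, v} ?F) (?M - {{u, v}}) u v" using m by (intro ham_cycle_cut) auto
    moreover have "{u, v} \<notin> M1" using uv(3) by blast
    ultimately have "ham_path m F1 M1 u v" by (elim ham_path_mono) auto
    then show ?thesis using join_cycle[OF i, of b F M u v] uv edge_neq[OF uv(1)] assms ME by simp
  qed
qed

text \<open>The heavier half is one or two units above the cycle bound, so the lighter half has
  weight at most 1. The excess is removed by releasing one fault, one matching edge, or, when there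
  are \<open>2 * m\<close> matching edges and no fault, two matching edges, which
  \<open>two_chords\<close> puts back.\<close>

lemma step_unbalanced:
  assumes "Mx = {}" "Fx = {}" "2 * m - 1 \<le> card M0 + 2 * card F0"
  shows "ham_cycle (Suc m) F M"
proof -
  have w1: "card M1 + 2 * card F1 \<le> 1" using total assms m by simp
  then have w1': "card M1 + 2 * card F1 \<le> m - 1" using m by simp
  have full: "M1 = {} \<and> F1 = {}" if "card M0 + 2 * card F0 = 2 * m" using total that by simp
  have Mne: "M0 \<noteq> {}" if "card M0 + 2 * card F0 = 2 * m"
    using full[OF that] weights(1) assms(1) ne goodD(3)[OF g] by auto
  consider (fault) "2 \<le> card F0 \<or> F0 \<noteq> {} \<and> card M0 + 2 * card F0 = 2 * m"
    | (odd) "card F0 \<le> 1" "card M0 + 2 * card F0 = 2 * m - 1"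
    | (plain) "F0 = {}" "card M0 = 2 * m"
  proof -
    have "card M0 + 2 * card F0 = 2 * m - 1 \<or> card M0 + 2 * card F0 = 2 * m" using total assms(3) by linarith
    then show ?thesis using fault odd plain by (cases "F0 = {}"; cases "2 \<le> card F0") auto
  qed
  then show ?thesis
  proof cases
    case fault
    \<comment> \<open>The fault to be released must not correspond to a prescribed edge of the
      lighter half, where its ends are to be joined. That half has at most one prescribed edge;
      there are two faults to choose from, or else the weight is full and the lighter half is
      empty.\<close>
    have cand: "\<exists>f\<in>F0. f \<notin> M1"
    proof (rule ccontr)
      assume "\<not> ?thesis"
      then have "F0 \<subseteq> M1" by blast
      then have "card F0 \<le> card M1" by (rule card_mono[OF finite_half])
      then have "card F0 \<le> 1" using w1 by linarith
      then have "F0 \<noteq> {} \<and> M1 = {}" using fault full by auto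
      then show False using \<open>F0 \<subseteq> M1\<close> by blast
    qed
    show ?thesis
    proof (cases "\<exists>f\<in>F0. f \<notin> M1 \<and> \<not> exc m M0 (F0 - {f})")
      case True
      then obtain f where f: "f \<in> F0" "f \<notin> M1" "\<not> exc m M0 (F0 - {f})" by blast
      have c: "card (F0 - {f}) = card F0 - 1" "1 \<le> card F0"
        using f(1) card_gt_0_iff[of F0] by (auto simp: Suc_le_eq)
      have "ham_cycle m (F0 - {f}) M0"
      proof (rule cycle_extD[OF A good_subset[OF g0] _ f(3)])
        show "card M0 + 2 * card (F0 - {f}) \<le> 2 * m - 2" using c total by linarith
        show "\<not> (M0 = {} \<and> card (F0 - {f}) = m - 1)"
        proof
          assume *: "M0 = {} \<and> card (F0 - {f}) = m - 1"
          then have "card F0 = m" "card M0 = 0" using c m by (linarith, simp)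
          then have "card M0 + 2 * card F0 = 2 * m" by simp
          then show False using Mne * by blast
        qed
      qed (use m in auto)
      then show ?thesis using close_after_unfaulting f assms w1' by blast
    next
      case False
      \<comment> \<open>This leaves only two faults over an exceptional matching in dimension 4.
        Both are released and restored one at a time; the first restoration leaves a cycle or opens
        it, the second leaves the path or splits it.\<close>
      then have all: "\<And>f. f \<in> F0 \<Longrightarrow> f \<notin> M1 \<Longrightarrow> exc m M0 (F0 - {f})" by blast
      obtain f where f: "f \<in> F0" "f \<notin> M1" using cand by blast
      note ex = excD[OF all[OF f]]
      have c: "card F0 = 2" using ex(3) f(1) card_Suc_Diff1[OF finite_half f(1)] by simp
      have M1: "M1 = {}" "F1 = {}" using full ex c by simp_all
      obtain h where h: "F0 = {f, h}" "f \<noteq> h"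
        using c f(1) by (metis card_2_iff doubleton_eq_iff insertE singletonD)
      have exc2: "exc m M0 {h}" "exc m M0 {f}" using all[of f] all[of h] h M1 by (auto simp: insert_Diff_if)
      obtain j p where j: "j \<le> 3" "M0 = parity_class j p" "h \<in> cross_edge j ` verts (cube 3)"
        using exc2(1) unfolding exc_def by auto
      obtain j' p' where j': "j' \<le> 3" "M0 = parity_class j' p'" "f \<in> cross_edge j' ` verts (cube 3)"
        using exc2(2) unfolding exc_def by auto
      \<comment> \<open>Both faults have the dimension of the matching and are therefore disjoint,
        so the two paths obtained by deleting them have distinct ends.\<close>
      have "parity_class j p \<noteq> {}" using card_parity_class[OF j(1), of p] by auto
      then have "j = j'" using parity_class_eq[OF _ _ j(1) j'(1)] j(2) j'(2) by blast
      then obtain x y where xy: "f = cross_edge j x" "h = cross_edge j y" "length x = 3" "length y = 3"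
        using j(3) j'(3) by auto
      have "x \<noteq> y" using xy h(2) by blast
      let ?a = "ins j False x" and ?a' = "ins j True x" and ?c = "ins j False y" and ?c' = "ins j True y"
      have dj: "?a \<noteq> ?c" "?a \<noteq> ?c'" "?a' \<noteq> ?c" "?a' \<noteq> ?c'" using \<open>x \<noteq> y\<close> xy(3,4) j(1) by auto
      have fh: "f = {?a, ?a'}" "h = {?c, ?c'}" using xy by (simp_all add: cross_edge_def)
      have notin: "f \<notin> M0" "h \<notin> M0" using g0 h unfolding good_def by blast+
      have "ham_cycle m {} M0"
        using ex m Mne excD(3)[of m M0 "{}"] by (intro cycle_extD[OF A good_subset[OF g0]]) auto
      from ham_cycle_edge[OF this, of ?c ?c']
      have "ham_cycle m {h} M0 \<or> ham_path m {h} M0 ?c ?c'" using m notin by (simp add: fh)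
      then show ?thesis
      proof
        assume "ham_cycle m {h} M0"
        moreover have "F0 - {f} = {h}" using h by auto
        ultimately have "ham_cycle m (F0 - {f}) M0" by (simp only:)
        then show ?thesis using close_after_unfaulting f assms w1' by blast
      next
        assume "ham_path m {h} M0 ?c ?c'"
        from ham_path_edge[OF this, of ?a ?a']
        have "ham_path m F0 M0 ?c ?c' \<or> two_paths m F0 M0 ?c ?a ?a' ?c' \<or> two_paths m F0 M0 ?c ?a' ?a ?c'"
          using notin h by (simp add: fh)
        then show ?thesis
        proof (elim disjE)
          assume "ham_path m F0 M0 ?c ?c'"
          then show ?thesis using close_path[of ?c ?c'] M1 assms w1' by simp
        next
          assume "two_paths m F0 M0 ?c ?a ?a' ?c'"
          then show ?thesis using close_two_paths[of ?c ?a ?a' ?c'] M1 assms dj by simp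
        next
          assume "two_paths m F0 M0 ?c ?a' ?a ?c'"
          then show ?thesis using close_two_paths[of ?c ?a' ?a ?c'] M1 assms dj by simp
        qed
      qed
    qed
  next
    case odd
    then have c3: "3 \<le> card M0" using m by linarith
    then obtain e where e: "e \<in> M0" "\<not> exc m (M0 - {e}) F0" using not_exc_remove by blast
    obtain p q where pq: "e = {p, q}" using e(1) half_subset edgeE by blast
    have c: "card (M0 - {e}) = card M0 - 1" using e(1) by simp
    have "M0 - {e} \<noteq> {}"
    proof
      assume "M0 - {e} = {}"
      then have "card (M0 - {e}) = 0" by (simp only: card.empty)
      then show False using c c3 by simp
    qed
    then have hc: "ham_cycle m F0 (M0 - {e})"
      using c odd m e(2) by (intro cycle_extD[OF A good_subset[OF g0]]) auto
    have "e \<in> edges (cube m) - F0" using e(1) g0 unfolding good_def by blast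
    moreover have "p \<notin> \<Union>(M0 - {e})" "q \<notin> \<Union>(M0 - {e})" using good_unique[OF g0 e(1)] pq by auto
    ultimately have "ham_cycle m F0 M0 \<or> (\<exists>u v x y. ham_path m F0 M0 u v \<and> ham_path m F0 M0 x y \<and>
       {u, v} \<noteq> {x, y} \<and> par u \<noteq> par v \<and> par x \<noteq> par y)"
      using ham_cycle_chord[OF hc, of p q] m pq e(1) by (simp add: insert_absorb)
    then show ?thesis
    proof
      assume "ham_cycle m F0 M0"
      then show ?thesis using close_cycle assms(1) w1' by blast
    next
      assume "\<exists>u v x y. ham_path m F0 M0 u v \<and> ham_path m F0 M0 x y \<and>
        {u, v} \<noteq> {x, y} \<and> par u \<noteq> par v \<and> par x \<noteq> par y"
      then obtain u v x y where uv: "ham_path m F0 M0 u v" "ham_path m F0 M0 x y" "{u, v} \<noteq> {x, y}"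
        "par u \<noteq> par v" "par x \<noteq> par y" by blast
      \<comment> \<open>The lighter half has at most one prescribed edge, which can spoil only one
        of the two pairs of ends.\<close>
      have "card M1 \<le> Suc 0" using w1 by simp
      then have "e = f" if "e \<in> M1" "f \<in> M1" for e f
        using that by (simp only: card_le_Suc0_iff_eq[OF finite_half])
      from this[of "{u, v}" "{x, y}"] have "{u, v} \<notin> M1 \<or> {x, y} \<notin> M1" using uv(3) by argo
      then show ?thesis
        using close_path[OF uv(1,4)] close_path[OF uv(2,5)] assms w1' by (elim disjE) simp_all
    qed
  next
    case plain
    have M1: "M1 = {}" "F1 = {}" using full plain by simp_all
    have "2 \<le> card M0" using plain m by simp
    then obtain B where "B \<subseteq> M0" "card B = 2" by (meson obtain_subset_with_card_n)
    then obtain e f where e: "e \<in> M0" "f \<in> M0" "e \<noteq> f" by (auto simp: card_2_iff)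
    obtain p q where pq: "e = {p, q}" using e(1) half_subset edgeE by blast
    obtain s t where st: "f = {s, t}" using e(2) half_subset edgeE by blast
    let ?N = "M0 - {e, f}"
    have c: "card ?N = 2 * m - 2" using e plain by (simp add: card_Diff_subset)
    have "?N \<noteq> {}"
    proof
      assume "?N = {}"
      then have "card ?N = 0" by (simp only: card.empty)
      then show False using c m by simp
    qed
    then have hc: "ham_cycle m {} ?N"
      using c m excD(3)[of m ?N "{}"] by (intro cycle_extD[OF A good_subset[OF g0]]) auto
    have "linkable m {} ({{p, q}, {s, t}} \<union> ?N)"
    proof (rule two_chords[OF hc m])
      show "{p, q} \<in> edges (cube m) - {}" "{s, t} \<in> edges (cube m) - {}"
        using e pq st half_subset by blast+
      show "p \<notin> \<Union>?N" "q \<notin> \<Union>?N" "s \<notin> \<Union>?N" "t \<notin> \<Union>?N"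
        using good_unique[OF g0 e(1)] good_unique[OF g0 e(2)] pq st by auto
      show "{p, q} \<inter> {s, t} = {}"
        using good_unique[OF g0 e(1,2)] e(3) pq st by blast
      show "card ?N + 2 < 2 ^ m" using c pow m by linarith
    qed simp
    moreover have "{{p, q}, {s, t}} \<union> ?N = M0" using e pq st by blast
    ultimately show ?thesis using close_linkable plain(1) M1 assms by simp
  qed
qed

text \<open>Between the two extremes, the cycle hypothesis fails for the heavier half only if that
  half is exceptional or consists of \<open>m - 1\<close> faults without a matching edge.\<close>

lemma step_empty_dim:
  assumes "Mx = {}" "Fx = {}"
  shows "ham_cycle (Suc m) F M"
proof -
  consider "m \<le> card M1 + 2 * card F1" | "2 * m - 1 \<le> card M0 + 2 * card F0"
    | "card M1 + 2 * card F1 \<le> m - 1" "card M0 + 2 * card F0 \<le> 2 * m - 2" by linarith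
  then show ?thesis
  proof cases
    case 1
    then show ?thesis using step_balanced assms by blast
  next
    case 2
    then show ?thesis using step_unbalanced assms by blast
  next
    case 3
    show ?thesis
    proof (cases "exc m M0 F0")
      case True
      obtain x where x: "length x = 4" "x \<notin> \<Union>M0" "x \<noteq> []" using exc_uncovered[OF True] by metis
      then show ?thesis using close_exc[OF True, of x "[]"] assms 3 excD[OF True] by auto
    next
      case not_exc: False
      show ?thesis
      proof (cases "M0 = {} \<and> card F0 = m - 1")
        case True
        \<comment> \<open>The faults of the heavier half weigh \<open>2 * m - 2\<close>, so
          \<open>M1\<close> has at most two edges, fewer than there are faults; some fault can be
          released.\<close>
        have "card M1 < card F0" using total True m by simp
        then have "\<not> F0 \<subseteq> M1" using card_mono[OF finite_half, of F0 m i "\<not> b" M] by linarith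
        then obtain f where f: "f \<in> F0" "f \<notin> M1" by blast
        have c: "card (F0 - {f}) = m - 2" using f(1) True by simp
        then have "ham_cycle m (F0 - {f}) M0"
          using True m excD(2)[of m M0 "F0 - {f}"] by (intro cycle_extD[OF A good_subset[OF g0]]) auto
        then show ?thesis using close_after_unfaulting f assms 3 by blast
      next
        case False
        then have "ham_cycle m F0 M0" using cycle_extD[OF A g0 _ not_exc] 3 m by simp
        then show ?thesis using close_cycle assms 3 by blast
      qed
    qed
  qed
qed

text \<open>The cycle of the heavier half must be opened at the vertex \<open>x\<close> under the
  crossing edge; \<open>x\<close> is free in both halves, so either cycle edge at it will do. The
  lower bound on \<open>card M\<close> makes \<open>M0\<close> nonempty and, when the heavier half
  has weight \<open>2 * m - 1\<close>, large enough for one of its edges to be released.\<close>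

lemma step_single_edge_dim:
  assumes "card Mx = 1" "Fx = {}" "m + 1 \<le> card M"
  shows "ham_cycle (Suc m) F M"
proof -
  obtain x where x: "Mx = {x}" using assms(1) card_1_singletonE by blast
  then have len: "length x = m" using mem_cross_length[of x m i M] by simp
  have un: "x \<notin> \<Union>M0" "x \<notin> \<Union>M1" using cross_not_covered[OF g i, of x] x by simp_all
  then have notin: "{x, y} \<notin> M0" "{x, y} \<notin> M1" for y by auto
  have tot: "card M0 + 2 * card F0 + (card M1 + 2 * card F1) \<le> 2 * m - 1" using total assms by linarith
  then have w1: "card M1 + 2 * card F1 \<le> m - 1" using b m by linarith
  have M0: "M0 \<noteq> {}"
  proof
    assume "M0 = {}"
    then show False using weights(1) assms w1 m by simp
  qed
  have finish: "ham_cycle (Suc m) F M" if hc: "ham_cycle m F0 M0"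
  proof -
    have two: "2 \<le> m" using m by simp
    obtain y where y: "{x, y} \<in> edges (cube m)" "ham_path m F0 (M0 - {{x, y}}) x y"
      using ham_cycle_at[OF hc two len] by metis
    then show ?thesis
      using close_path[of x y] notin edge_par[OF y(1)] x assms(2) w1 by simp
  qed
  show ?thesis
  proof (cases "card M0 + 2 * card F0 \<le> 2 * m - 2")
    case True
    show ?thesis
    proof (cases "exc m M0 F0")
      case True
      have "[] \<noteq> x" using len m by auto
      then show ?thesis using close_exc[OF True un(1) len, of "[]"] x assms(2) w1 by simp
    next
      case False
      then have "ham_cycle m F0 M0" using cycle_extD[OF A g0 True False] M0 m by simp
      then show ?thesis by (rule finish)
    qed
  next
    case False
    then have w0: "card M0 + 2 * card F0 = 2 * m - 1" "card M1 + 2 * card F1 = 0" using tot by linarith+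
    then have M1: "M1 = {}" "F1 = {}" by simp_all
    have c4: "4 \<le> card M0" using weights(1) assms(1,3) M1 m by simp
    then obtain e where e: "e \<in> M0" "\<not> exc m (M0 - {e}) F0" using not_exc_remove[of M0] by auto
    obtain p q where pq: "e = {p, q}" using e(1) half_subset edgeE by blast
    have c: "card (M0 - {e}) = card M0 - 1" using e(1) by simp
    have "M0 - {e} \<noteq> {}"
    proof
      assume "M0 - {e} = {}"
      then have "card (M0 - {e}) = 0" by (simp only: card.empty)
      then show False using c c4 by simp
    qed
    then have hc: "ham_cycle m F0 (M0 - {e})"
      using c w0 m e(2) by (intro cycle_extD[OF A good_subset[OF g0]]) auto
    have "e \<in> edges (cube m) - F0" using e(1) g0 unfolding good_def by blast
    moreover have "p \<notin> \<Union>(M0 - {e})" "q \<notin> \<Union>(M0 - {e})" using good_unique[OF g0 e(1)] pq by auto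
    ultimately have "ham_cycle m F0 M0 \<or> (\<exists>u v x y. ham_path m F0 M0 u v \<and> ham_path m F0 M0 x y \<and>
       {u, v} \<noteq> {x, y} \<and> par u \<noteq> par v \<and> par x \<noteq> par y)"
      using ham_cycle_chord[OF hc, of p q] m pq e(1) by (simp add: insert_absorb)
    then show ?thesis
    proof
      assume "ham_cycle m F0 M0"
      then show ?thesis by (rule finish)
    next
      assume "\<exists>u v x y. ham_path m F0 M0 u v \<and> ham_path m F0 M0 x y \<and>
        {u, v} \<noteq> {x, y} \<and> par u \<noteq> par v \<and> par x \<noteq> par y"
      then obtain u v where uv: "ham_path m F0 M0 u v" "par u \<noteq> par v" by blast
      show ?thesis
      proof (cases "x = u \<or> x = v")
        case True
        then show ?thesis using close_path[OF uv] M1 assms(2) x w1 by auto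
      next
        case False
        \<comment> \<open>The path misses \<open>x\<close> as an end, but the crossing edge over
          \<open>x\<close> has to be used. So the path is split at \<open>x\<close> and the pieces
          are linked through the empty lighter half.\<close>
        then obtain y where y: "{x, y} \<in> edges (cube m)"
          "two_paths m F0 M0 u x y v \<and> y \<noteq> v \<or> two_paths m F0 M0 u y x v \<and> u \<noteq> y"
          using ham_path_split_at[OF uv(1) _ len _ _ un(1)] m by auto
        from y(2) show ?thesis
        proof
          assume "two_paths m F0 M0 u x y v \<and> y \<noteq> v"
          then show ?thesis using close_two_paths[of u x y v] False M1 assms(2) x uv(2) edge_par[OF y(1)] by auto
        next
          assume "two_paths m F0 M0 u y x v \<and> u \<noteq> y"
          then show ?thesis using close_two_paths[of u y x v] False M1 assms(2) x uv(2) edge_par[OF y(1)] by auto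
        qed
      qed
    qed
  qed
qed

end

text \<open>If no dimension is free of \<open>M\<close>, summing over the dimensions gives
  \<open>m + 1 \<le> card M\<close>, and a dimension of crossing weight below 2 carries exactly one
  edge of \<open>M\<close> and no fault.\<close>

lemma cycle_ext_step:
  assumes m: "4 \<le> m" and A: "cycle_ext m" and H: "path_ext m" and S: "paired_laceable m"
    and X: exc_path_ext and J: adjacent_path_ext4
  shows "cycle_ext (Suc m)"
  unfolding cycle_ext_def
proof (intro allI impI)
  fix M F
  assume g: "good (Suc m) M F" and ne: "M \<noteq> {}" and w: "card M + 2 * card F \<le> 2 * Suc m - 2"
  have loc: "\<exists>b. cycle_step m M F i b" if "i \<le> m" for i
  proof -
    have "cycle_step m M F i b"
      if "card (half m i (\<not> b) M) + 2 * card (half m i (\<not> b) F) \<le> card (half m i b M) + 2 * card (half m i b F)" for b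
      using assms g ne w that \<open>i \<le> m\<close> by unfold_locales auto
    from this[of True] this[of False] show ?thesis by (auto intro: le_cases)
  qed
  show "ham_cycle (Suc m) F M"
  proof (cases "\<exists>i\<le>m. cross m i M = {}")
    case True
    then obtain i where i: "i \<le> m" "cross m i M = {}" by blast
    obtain b where "cycle_step m M F i b" using loc[OF i(1)] by blast
    then show ?thesis using cycle_step.step_faulty_dim cycle_step.step_empty_dim i(2) by blast
  next
    case False
    have pos: "1 \<le> card (cross m i M)" if "i \<le> m" for i
      using False that card_gt_0_iff[of "cross m i M"] by (simp add: Suc_le_eq)
    obtain i where i: "i \<le> m" "card (cross m i M) + 2 * card (cross m i F) < 2"
      using exists_light_dim[OF g, of 2] w by auto
    then have "card (cross m i M) = 1" "card (cross m i F) = 0" using pos[OF i(1)] by linarith+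
    then have "card (cross m i M) = 1" "cross m i F = {}" by simp_all
    moreover have "m + 1 \<le> card M"
    proof -
      have "(\<Sum>i\<le>m. 1) \<le> (\<Sum>i\<le>m. card (cross m i M))" using pos by (intro sum_mono) auto
      then show ?thesis using card_eq_sum_cross[OF goodD(1)[OF g]] by simp
    qed
    ultimately show ?thesis using loc[OF i(1)] cycle_step.step_single_edge_dim by blast
  qed
qed

section \<open>A certificate checker for the four-dimensional cube\<close>

text \<open>Edges are represented by their indices below 32. A search state assigns to every edge its
  status: forced into \<open>M\<close> or \<open>F\<close>, still possible in both, only in \<open>M\<close>, only in \<open>F\<close>, or in
  neither. A node of a certificate names a path; if \<open>M\<close> and \<open>F\<close> are not served by this path, some
  edge off the path lies in \<open>M\<close> or some edge on it lies in \<open>F\<close>, and there is one subtree for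
  the first such edge in a fixed order. Leaves marked \<open>X\<close> are the states that have no path.\<close>

datatype cert = X | N nat "cert list"

datatype status = Mf | Ff | MF | Mo | Fo | No

text \<open>How an edge relates to the one being decided: equal, sharing an end, or
  disjoint.\<close>

datatype rel = Same | Touch | Apart

text \<open>Written, like the functions that follow, as a recursion on explicit lists so that the
  simplifier evaluates certificates by rewriting alone. \<open>okc_iff\<close> and the equations in
  terms of \<open>map2\<close> and \<open>filter\<close> give the forms used in proofs.\<close>

fun okc :: "bool list \<Rightarrow> status list \<Rightarrow> bool" where
  "okc (True # C) (Mf # ss) = okc C ss"
| "okc (False # C) (Mf # ss) = False"
| "okc (True # C) (Ff # ss) = False"
| "okc (False # C) (Ff # ss) = okc C ss"
| "okc (c # C) (MF # ss) = okc C ss"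
| "okc (c # C) (Mo # ss) = okc C ss"
| "okc (c # C) (Fo # ss) = okc C ss"
| "okc (c # C) (No # ss) = okc C ss"
| "okc [] ss = True"
| "okc (c # C) [] = True"

fun noM :: "status \<Rightarrow> status" where
  "noM MF = Fo" | "noM Mo = No" | "noM Mf = Mf" | "noM Ff = Ff" | "noM Fo = Fo" | "noM No = No"

fun noF :: "status \<Rightarrow> status" where
  "noF MF = Mo" | "noF Fo = No" | "noF Mf = Mf" | "noF Ff = Ff" | "noF Mo = Mo" | "noF No = No"

fun setM :: "rel list \<Rightarrow> status list \<Rightarrow> status list" where
  "setM (Same # r) (s # ss) = Mf # setM r ss"
| "setM (Touch # r) (s # ss) = noM s # setM r ss"
| "setM (Apart # r) (s # ss) = s # setM r ss"
| "setM [] ss = []"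
| "setM (x # r) [] = []"

fun setF :: "rel list \<Rightarrow> status list \<Rightarrow> status list" where
  "setF (Same # r) (s # ss) = Ff # setF r ss"
| "setF (Touch # r) (s # ss) = s # setF r ss"
| "setF (Apart # r) (s # ss) = s # setF r ss"
| "setF [] ss = []"
| "setF (x # r) [] = []"

fun dropM :: "rel list \<Rightarrow> status list \<Rightarrow> status list" where
  "dropM (Same # r) (s # ss) = noM s # dropM r ss"
| "dropM (Touch # r) (s # ss) = s # dropM r ss"
| "dropM (Apart # r) (s # ss) = s # dropM r ss"
| "dropM [] ss = []"
| "dropM (x # r) [] = []"

fun dropF :: "rel list \<Rightarrow> status list \<Rightarrow> status list" where
  "dropF (Same # r) (s # ss) = noF s # dropF r ss"
| "dropF (Touch # r) (s # ss) = s # dropF r ss"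
| "dropF (Apart # r) (s # ss) = s # dropF r ss"
| "dropF [] ss = []"
| "dropF (x # r) [] = []"

fun badM :: "nat list \<Rightarrow> bool list \<Rightarrow> status list \<Rightarrow> nat list" where
  "badM (i # is) (True # C) (MF # ss) = badM is C ss"
| "badM (i # is) (False # C) (MF # ss) = i # badM is C ss"
| "badM (i # is) (True # C) (Mo # ss) = badM is C ss"
| "badM (i # is) (False # C) (Mo # ss) = i # badM is C ss"
| "badM (i # is) (c # C) (Fo # ss) = badM is C ss"
| "badM (i # is) (c # C) (No # ss) = badM is C ss"
| "badM (i # is) (c # C) (Mf # ss) = badM is C ss"
| "badM (i # is) (c # C) (Ff # ss) = badM is C ss"
| "badM [] C ss = []"
| "badM (i # is) [] ss = []"
| "badM (i # is) (c # C) [] = []"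

fun badF :: "nat list \<Rightarrow> bool list \<Rightarrow> status list \<Rightarrow> nat list" where
  "badF (i # is) (True # C) (MF # ss) = i # badF is C ss"
| "badF (i # is) (False # C) (MF # ss) = badF is C ss"
| "badF (i # is) (True # C) (Fo # ss) = i # badF is C ss"
| "badF (i # is) (False # C) (Fo # ss) = badF is C ss"
| "badF (i # is) (c # C) (Mo # ss) = badF is C ss"
| "badF (i # is) (c # C) (No # ss) = badF is C ss"
| "badF (i # is) (c # C) (Mf # ss) = badF is C ss"
| "badF (i # is) (c # C) (Ff # ss) = badF is C ss"
| "badF [] C ss = []"
| "badF (i # is) [] ss = []"
| "badF (i # is) (c # C) [] = []"

context
  fixes row :: "nat \<Rightarrow> rel list" and bM bF :: "bool list \<Rightarrow> status list \<Rightarrow> nat list"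
    and ex :: "status list \<Rightarrow> bool" and cy :: "nat \<Rightarrow> bool list"
begin

text \<open>The number \<open>b\<close> bounds the weight \<open>|M| + 2|F|\<close> of the edges that are not forced yet;
  in \<open>check_M\<close> and \<open>check_F\<close> the weight of the edge under consideration is already deducted.\<close>

fun check :: "nat \<Rightarrow> status list \<Rightarrow> cert \<Rightarrow> bool"
and check_N :: "nat \<Rightarrow> bool list \<Rightarrow> status list \<Rightarrow> cert list \<Rightarrow> bool"
and check_M :: "nat \<Rightarrow> bool list \<Rightarrow> nat list \<Rightarrow> status list \<Rightarrow> cert list \<Rightarrow> bool"
and check_F :: "nat \<Rightarrow> nat list \<Rightarrow> status list \<Rightarrow> cert list \<Rightarrow> bool"
where
  "check b ss X = (case b of 0 \<Rightarrow> ex ss | Suc b' \<Rightarrow> False)"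
| "check b ss (N k ts) = check_N b (cy k) ss ts"
| "check_N b C ss ts = (okc C ss \<and> (case b of 0 \<Rightarrow> True | Suc b' \<Rightarrow> check_M b' C (bM C ss) ss ts))"
| "check_M b C (i # is) ss (t # ts) =
     (check b (setM (row i) ss) t \<and> check_M b C is (dropM (row i) ss) ts)"
| "check_M b C (i # is) ss [] = False"
| "check_M b C [] ss ts = (case b of 0 \<Rightarrow> True | Suc b' \<Rightarrow> check_F b' (bF C ss) ss ts)"
| "check_F b (i # is) ss (t # ts) =
     (check b (setF (row i) ss) t \<and> check_F b is (dropF (row i) ss) ts)"
| "check_F b (i # is) ss [] = False"
| "check_F b [] ss ts = True"

end

lemma okc_iff:
  "length C = length ss \<Longrightarrow> okc C ss \<longleftrightarrow>
    (\<forall>j<length ss. (ss ! j = Mf \<longrightarrow> C ! j) \<and> (ss ! j = Ff \<longrightarrow> \<not> C ! j))"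
proof (induction C ss rule: list_induct2)
  case (Cons c C s ss)
  then show ?case by (cases s; cases c) (auto simp: All_less_Suc2)
qed simp

lemma setM_eq: "setM r ss = map2 (\<lambda>r s. case r of Same \<Rightarrow> Mf | Touch \<Rightarrow> noM s | Apart \<Rightarrow> s) r ss"
  by (induction r ss rule: setM.induct) auto

lemma setF_eq: "setF r ss = map2 (\<lambda>r s. case r of Same \<Rightarrow> Ff | Touch \<Rightarrow> s | Apart \<Rightarrow> s) r ss"
  by (induction r ss rule: setF.induct) auto

lemma dropM_eq: "dropM r ss = map2 (\<lambda>r s. case r of Same \<Rightarrow> noM s | Touch \<Rightarrow> s | Apart \<Rightarrow> s) r ss"
  by (induction r ss rule: dropM.induct) auto

lemma dropF_eq: "dropF r ss = map2 (\<lambda>r s. case r of Same \<Rightarrow> noF s | Touch \<Rightarrow> s | Apart \<Rightarrow> s) r ss"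
  by (induction r ss rule: dropF.induct) auto

lemma badM_eq: "badM is C ss = map fst (filter (\<lambda>(i, c, s). \<not> c \<and> (s = MF \<or> s = Mo)) (zip is (zip C ss)))"
  by (induction "is" C ss rule: badM.induct) auto

lemma badF_eq: "badF is C ss = map fst (filter (\<lambda>(i, c, s). c \<and> (s = MF \<or> s = Fo)) (zip is (zip C ss)))"
  by (induction "is" C ss rule: badF.induct) auto

text \<open>The searches differ in the ends of the path and in what a leaf without path may
  conclude: \<open>R\<close> is the conclusion, and \<open>ex\<close> the test that justifies such a
  leaf.\<close>

locale checker =
  fixes row :: "nat \<Rightarrow> rel list" and bM bF :: "bool list \<Rightarrow> status list \<Rightarrow> nat list"
    and ex :: "status list \<Rightarrow> bool" and cy :: "nat \<Rightarrow> bool list" and n :: nat and R :: "nat set \<Rightarrow> nat set \<Rightarrow> bool"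
  assumes bM: "\<And>C ss. bM C ss = badM [0..<n] C ss" and bF: "\<And>C ss. bF C ss = badF [0..<n] C ss"
    and row: "\<And>i. i < n \<Longrightarrow> length (row i) = n" "\<And>i j. i < n \<Longrightarrow> j < n \<Longrightarrow> row i ! j = Same \<longleftrightarrow> i = j"
    and cy_length: "\<And>k. length (cy k) = n"
    and cy_R: "\<And>k M F. M \<subseteq> {..<n} \<Longrightarrow> F \<subseteq> {..<n} \<Longrightarrow> (\<And>j. j \<in> M \<Longrightarrow> cy k ! j) \<Longrightarrow>
      (\<And>j. j \<in> F \<Longrightarrow> \<not> cy k ! j) \<Longrightarrow> R M F"
    and ex_R: "\<And>ss. length ss = n \<Longrightarrow> ex ss \<Longrightarrow> R {j. j < n \<and> ss ! j = Mf} {j. j < n \<and> ss ! j = Ff}"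
begin

text \<open>Invariant of the search: the forced part of the unknown pair agrees with the state, and
  the part still open has weight at most \<open>b\<close>.\<close>

definition fits :: "nat \<Rightarrow> status list \<Rightarrow> nat set \<Rightarrow> nat set \<Rightarrow> bool" where
  "fits b ss M F \<longleftrightarrow> length ss = n \<and> M \<subseteq> {..<n} \<and> F \<subseteq> {..<n} \<and>
     (\<forall>j<n. (j \<in> M \<longrightarrow> ss ! j \<in> {Mf, MF, Mo}) \<and> (j \<in> F \<longrightarrow> ss ! j \<in> {Ff, MF, Fo}) \<and>
        (ss ! j = Mf \<longrightarrow> j \<in> M) \<and> (ss ! j = Ff \<longrightarrow> j \<in> F)) \<and>
     (\<forall>i\<in>M. \<forall>j\<in>M. row i ! j \<noteq> Touch) \<and> M \<inter> F = {} \<and>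
     card {j \<in> M. ss ! j \<noteq> Mf} + 2 * card {j \<in> F. ss ! j \<noteq> Ff} \<le> b"

lemma set_filter_zip:
  assumes "length L = n"
  shows "set (map fst (filter P (zip [0..<n] L))) = {j. j < n \<and> P (j, L ! j)}"
proof -
  have "zip [0..<n] L = map (\<lambda>j. (j, L ! j)) [0..<n]" using assms by (intro nth_equalityI) auto
  then show ?thesis by (auto simp: image_iff)
qed

lemma set_badM: "length C = n \<Longrightarrow> length ss = n \<Longrightarrow>
    set (badM [0..<n] C ss) = {j. j < n \<and> \<not> C ! j \<and> ss ! j \<in> {MF, Mo}}"
  unfolding badM_eq by (subst set_filter_zip) auto

lemma set_badF: "length C = n \<Longrightarrow> length ss = n \<Longrightarrow>
    set (badF [0..<n] C ss) = {j. j < n \<and> C ! j \<and> ss ! j \<in> {MF, Fo}}"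
  unfolding badF_eq by (subst set_filter_zip) auto

lemma distinct_bad: "distinct (badM [0..<n] C ss)" "distinct (badF [0..<n] C ss)"
proof -
  have *: "distinct (map fst (filter P (zip xs ys)))" if "distinct xs" for P and xs :: "nat list" and ys :: "'b list"
    using that by (induction xs ys rule: list_induct2') (auto dest: set_zip_leftD)
  show "distinct (badM [0..<n] C ss)" "distinct (badF [0..<n] C ss)"
    unfolding badM_eq badF_eq by (rule *, simp)+
qed

lemma nth_ops:
  assumes "length ss = n" "i < n" "j < n"
  shows "setM (row i) ss ! j = (if j = i then Mf else if row i ! j = Touch then noM (ss ! j) else ss ! j)"
    "setF (row i) ss ! j = (if j = i then Ff else ss ! j)"
    "dropM (row i) ss ! j = (if j = i then noM (ss ! j) else ss ! j)"
    "dropF (row i) ss ! j = (if j = i then noF (ss ! j) else ss ! j)"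
  using assms row(1)[OF assms(2)] row(2)[OF assms(2,3)]
  by (auto simp: setM_eq setF_eq dropM_eq dropF_eq split: rel.splits)

lemma length_ops:
  assumes "length ss = n" "i < n"
  shows "length (setM (row i) ss) = n" "length (setF (row i) ss) = n"
    "length (dropM (row i) ss) = n" "length (dropF (row i) ss) = n"
  using assms row(1)[OF assms(2)] by (simp_all add: setM_eq setF_eq dropM_eq dropF_eq)

lemma noM_mem [simp]: "noM s \<in> {Ff, MF, Fo} \<longleftrightarrow> s \<in> {Ff, MF, Fo}" "noM s = Mf \<longleftrightarrow> s = Mf" "noM s = Ff \<longleftrightarrow> s = Ff"
  by (cases s; simp)+

lemma noF_mem [simp]: "noF s \<in> {Mf, MF, Mo} \<longleftrightarrow> s \<in> {Mf, MF, Mo}" "noF s = Mf \<longleftrightarrow> s = Mf" "noF s = Ff \<longleftrightarrow> s = Ff"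
  by (cases s; simp)+

lemma fits_mem:
  assumes "fits b ss M F"
  shows "j \<in> M \<Longrightarrow> j < n \<and> ss ! j \<in> {Mf, MF, Mo}" "j \<in> F \<Longrightarrow> j < n \<and> ss ! j \<in> {Ff, MF, Fo}"
  using assms unfolding fits_def by blast+

lemma okcD:
  assumes "okc C ss" "length C = n" "length ss = n" "j < n"
  shows "ss ! j = Mf \<Longrightarrow> C ! j" "ss ! j = Ff \<Longrightarrow> \<not> C ! j"
  using assms by (simp_all add: okc_iff)

lemma fits_finite: "fits b ss M F \<Longrightarrow> finite M \<and> finite F"
  unfolding fits_def using finite_subset by blast

lemma card_filter_0: "finite A \<Longrightarrow> card {j \<in> A. P j} = 0 \<Longrightarrow> \<forall>j\<in>A. \<not> P j"
  by auto

text \<open>Edges touching the newly forced one cannot lie in \<open>M\<close>, since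
  \<open>M\<close> is a matching; lowering their status by \<open>noM\<close> loses nothing, and one
  unit of the budget is spent.\<close>

lemma fits_setM:
  assumes f: "fits (Suc b) ss M F" and i: "i \<in> M" "ss ! i \<noteq> Mf"
  shows "fits b (setM (row i) ss) M F"
proof -
  have len: "length ss = n" and iN: "i < n" using f i(1) unfolding fits_def by auto
  have *: "\<not> (j \<in> M \<and> row i ! j = Touch)" for j using f i(1) unfolding fits_def by blast
  have lt: "\<And>j. j \<in> M \<Longrightarrow> j < n" "\<And>j. j \<in> F \<Longrightarrow> j < n" using f unfolding fits_def by auto
  have "i \<notin> F" using f i(1) unfolding fits_def by blast
  note f' = f[unfolded fits_def]
  have fw: "card {j \<in> M. ss ! j \<noteq> Mf} + 2 * card {j \<in> F. ss ! j \<noteq> Ff} \<le> Suc b" using f' by blast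
  have e1: "{j \<in> M. setM (row i) ss ! j \<noteq> Mf} = {j \<in> M. ss ! j \<noteq> Mf} - {i}"
    using * by (auto simp: nth_ops(1)[OF len iN] lt split: if_splits)
  have e2: "{j \<in> F. setM (row i) ss ! j \<noteq> Ff} = {j \<in> F. ss ! j \<noteq> Ff}"
    using \<open>i \<notin> F\<close> by (auto simp: nth_ops(1)[OF len iN] lt split: if_splits)
  have e3: "card ({j \<in> M. ss ! j \<noteq> Mf} - {i}) = card {j \<in> M. ss ! j \<noteq> Mf} - 1"
    "1 \<le> card {j \<in> M. ss ! j \<noteq> Mf}"
    using i fits_finite[OF f] card_gt_0_iff[of "{j \<in> M. ss ! j \<noteq> Mf}"] by (auto simp: Suc_le_eq)
  have eqs: "card {j \<in> M. setM (row i) ss ! j \<noteq> Mf} + 2 * card {j \<in> F. setM (row i) ss ! j \<noteq> Ff} \<le> b"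
    unfolding e1 e2 using e3 fw by linarith
  have st: "(j \<in> M \<longrightarrow> setM (row i) ss ! j \<in> {Mf, MF, Mo}) \<and> (j \<in> F \<longrightarrow> setM (row i) ss ! j \<in> {Ff, MF, Fo}) \<and>
        (setM (row i) ss ! j = Mf \<longrightarrow> j \<in> M) \<and> (setM (row i) ss ! j = Ff \<longrightarrow> j \<in> F)" if "j < n" for j
  proof -
    have fj: "(j \<in> M \<longrightarrow> ss ! j \<in> {Mf, MF, Mo}) \<and> (j \<in> F \<longrightarrow> ss ! j \<in> {Ff, MF, Fo}) \<and>
        (ss ! j = Mf \<longrightarrow> j \<in> M) \<and> (ss ! j = Ff \<longrightarrow> j \<in> F)" using f that unfolding fits_def by blast
    show ?thesis using \<open>i \<notin> F\<close> fj *[of j] i(1) unfolding nth_ops(1)[OF len iN that] by (cases "j = i") auto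
  qed
  show ?thesis unfolding fits_def
  proof (intro conjI)
    show "length (setM (row i) ss) = n" by (rule length_ops(1)[OF len iN])
    show "card {j \<in> M. setM (row i) ss ! j \<noteq> Mf} + 2 * card {j \<in> F. setM (row i) ss ! j \<noteq> Ff} \<le> b" by (rule eqs)
  qed (use f' st in blast)+
qed

lemma fits_setF:
  assumes f: "fits (Suc (Suc b)) ss M F" and i: "i \<in> F" "ss ! i \<noteq> Ff"
  shows "fits b (setF (row i) ss) M F"
proof -
  have len: "length ss = n" and iN: "i < n" using f i(1) unfolding fits_def by auto
  have "i \<notin> M" using f i(1) unfolding fits_def by blast
  have lt: "\<And>j. j \<in> M \<Longrightarrow> j < n" "\<And>j. j \<in> F \<Longrightarrow> j < n" using f unfolding fits_def by auto
  note f' = f[unfolded fits_def]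
  have fw: "card {j \<in> M. ss ! j \<noteq> Mf} + 2 * card {j \<in> F. ss ! j \<noteq> Ff} \<le> Suc (Suc b)" using f' by blast
  have e1: "{j \<in> M. setF (row i) ss ! j \<noteq> Mf} = {j \<in> M. ss ! j \<noteq> Mf}"
    using \<open>i \<notin> M\<close> by (auto simp: nth_ops(2)[OF len iN] lt split: if_splits)
  have e2: "{j \<in> F. setF (row i) ss ! j \<noteq> Ff} = {j \<in> F. ss ! j \<noteq> Ff} - {i}"
    by (auto simp: nth_ops(2)[OF len iN] lt split: if_splits)
  have e3: "card ({j \<in> F. ss ! j \<noteq> Ff} - {i}) = card {j \<in> F. ss ! j \<noteq> Ff} - 1"
    "1 \<le> card {j \<in> F. ss ! j \<noteq> Ff}"
    using i fits_finite[OF f] card_gt_0_iff[of "{j \<in> F. ss ! j \<noteq> Ff}"] by (auto simp: Suc_le_eq)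
  have eqs: "card {j \<in> M. setF (row i) ss ! j \<noteq> Mf} + 2 * card {j \<in> F. setF (row i) ss ! j \<noteq> Ff} \<le> b"
    unfolding e1 e2 using e3 fw by linarith
  have st: "(j \<in> M \<longrightarrow> setF (row i) ss ! j \<in> {Mf, MF, Mo}) \<and> (j \<in> F \<longrightarrow> setF (row i) ss ! j \<in> {Ff, MF, Fo}) \<and>
        (setF (row i) ss ! j = Mf \<longrightarrow> j \<in> M) \<and> (setF (row i) ss ! j = Ff \<longrightarrow> j \<in> F)" if "j < n" for j
  proof -
    have fj: "(j \<in> M \<longrightarrow> ss ! j \<in> {Mf, MF, Mo}) \<and> (j \<in> F \<longrightarrow> ss ! j \<in> {Ff, MF, Fo}) \<and>
        (ss ! j = Mf \<longrightarrow> j \<in> M) \<and> (ss ! j = Ff \<longrightarrow> j \<in> F)" using f that unfolding fits_def by blast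
    then show ?thesis using i(1) \<open>i \<notin> M\<close> unfolding nth_ops(2)[OF len iN that] by (cases "j = i") auto
  qed
  show ?thesis unfolding fits_def
  proof (intro conjI)
    show "length (setF (row i) ss) = n" by (rule length_ops(2)[OF len iN])
    show "card {j \<in> M. setF (row i) ss ! j \<noteq> Mf} + 2 * card {j \<in> F. setF (row i) ss ! j \<noteq> Ff} \<le> b" by (rule eqs)
  qed (use f' st in blast)+
qed

lemma fits_dropM:
  assumes f: "fits b ss M F" and i: "i < n" "i \<notin> M"
  shows "fits b (dropM (row i) ss) M F"
proof -
  have len: "length ss = n" using f unfolding fits_def by auto
  have lt: "\<And>j. j \<in> M \<Longrightarrow> j < n" "\<And>j. j \<in> F \<Longrightarrow> j < n" using f unfolding fits_def by auto
  note f' = f[unfolded fits_def]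
  have fw: "card {j \<in> M. ss ! j \<noteq> Mf} + 2 * card {j \<in> F. ss ! j \<noteq> Ff} \<le> b" using f' by blast
  have e1: "{j \<in> M. dropM (row i) ss ! j \<noteq> Mf} = {j \<in> M. ss ! j \<noteq> Mf}"
    "{j \<in> F. dropM (row i) ss ! j \<noteq> Ff} = {j \<in> F. ss ! j \<noteq> Ff}"
    by (auto simp: nth_ops(3)[OF len i(1)] lt split: if_splits)
  have eqs: "card {j \<in> M. dropM (row i) ss ! j \<noteq> Mf} + 2 * card {j \<in> F. dropM (row i) ss ! j \<noteq> Ff} \<le> b"
    unfolding e1 using fw .
  have st: "(j \<in> M \<longrightarrow> dropM (row i) ss ! j \<in> {Mf, MF, Mo}) \<and> (j \<in> F \<longrightarrow> dropM (row i) ss ! j \<in> {Ff, MF, Fo}) \<and>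
        (dropM (row i) ss ! j = Mf \<longrightarrow> j \<in> M) \<and> (dropM (row i) ss ! j = Ff \<longrightarrow> j \<in> F)" if "j < n" for j
  proof -
    have fj: "(j \<in> M \<longrightarrow> ss ! j \<in> {Mf, MF, Mo}) \<and> (j \<in> F \<longrightarrow> ss ! j \<in> {Ff, MF, Fo}) \<and>
        (ss ! j = Mf \<longrightarrow> j \<in> M) \<and> (ss ! j = Ff \<longrightarrow> j \<in> F)" using f that unfolding fits_def by blast
    then show ?thesis using i(2) noM_mem(1)[of "ss ! j"] unfolding nth_ops(3)[OF len i(1) that]
      by (cases "j = i"; simp only: if_True if_False noM_mem simp_thms; argo)
  qed
  show ?thesis unfolding fits_def
  proof (intro conjI)
    show "length (dropM (row i) ss) = n" by (rule length_ops(3)[OF len i(1)])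
    show "card {j \<in> M. dropM (row i) ss ! j \<noteq> Mf} + 2 * card {j \<in> F. dropM (row i) ss ! j \<noteq> Ff} \<le> b" by (rule eqs)
  qed (use f' st in blast)+
qed

lemma fits_dropF:
  assumes f: "fits b ss M F" and i: "i < n" "i \<notin> F"
  shows "fits b (dropF (row i) ss) M F"
proof -
  have len: "length ss = n" using f unfolding fits_def by auto
  have lt: "\<And>j. j \<in> M \<Longrightarrow> j < n" "\<And>j. j \<in> F \<Longrightarrow> j < n" using f unfolding fits_def by auto
  note f' = f[unfolded fits_def]
  have fw: "card {j \<in> M. ss ! j \<noteq> Mf} + 2 * card {j \<in> F. ss ! j \<noteq> Ff} \<le> b" using f' by blast
  have e1: "{j \<in> M. dropF (row i) ss ! j \<noteq> Mf} = {j \<in> M. ss ! j \<noteq> Mf}"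
    "{j \<in> F. dropF (row i) ss ! j \<noteq> Ff} = {j \<in> F. ss ! j \<noteq> Ff}"
    by (auto simp: nth_ops(4)[OF len i(1)] lt split: if_splits)
  have eqs: "card {j \<in> M. dropF (row i) ss ! j \<noteq> Mf} + 2 * card {j \<in> F. dropF (row i) ss ! j \<noteq> Ff} \<le> b"
    unfolding e1 using fw .
  have st: "(j \<in> M \<longrightarrow> dropF (row i) ss ! j \<in> {Mf, MF, Mo}) \<and> (j \<in> F \<longrightarrow> dropF (row i) ss ! j \<in> {Ff, MF, Fo}) \<and>
        (dropF (row i) ss ! j = Mf \<longrightarrow> j \<in> M) \<and> (dropF (row i) ss ! j = Ff \<longrightarrow> j \<in> F)" if "j < n" for j
  proof -
    have fj: "(j \<in> M \<longrightarrow> ss ! j \<in> {Mf, MF, Mo}) \<and> (j \<in> F \<longrightarrow> ss ! j \<in> {Ff, MF, Fo}) \<and>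
        (ss ! j = Mf \<longrightarrow> j \<in> M) \<and> (ss ! j = Ff \<longrightarrow> j \<in> F)" using f that unfolding fits_def by blast
    then show ?thesis using i(2) noF_mem(1)[of "ss ! j"] unfolding nth_ops(4)[OF len i(1) that]
      by (cases "j = i"; simp only: if_True if_False noF_mem simp_thms; argo)
  qed
  show ?thesis unfolding fits_def
  proof (intro conjI)
    show "length (dropF (row i) ss) = n" by (rule length_ops(4)[OF len i(1)])
    show "card {j \<in> M. dropF (row i) ss ! j \<noteq> Mf} + 2 * card {j \<in> F. dropF (row i) ss ! j \<noteq> Ff} \<le> b" by (rule eqs)
  qed (use f' st in blast)+
qed

lemma serves:
  assumes f: "fits b ss M F" and C: "C = cy k" and "\<forall>j\<in>M. C ! j" "\<forall>j\<in>F. \<not> C ! j"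
  shows "R M F"
  using assms unfolding fits_def by (intro cy_R[of M F k]) auto

text \<open>An edge leaves the list once it is known not to lie in the set concerned. So the
  invariant for the lists is that every edge at which the named path fails is still listed; when
  both lists are exhausted, the path serves.\<close>

lemma check_sound:
  "check row bM bF ex cy b ss t \<Longrightarrow> fits b ss M F \<Longrightarrow> R M F"
  "check_N row bM bF ex cy b C ss ts \<Longrightarrow> fits b ss M F \<Longrightarrow> C = cy k \<Longrightarrow> R M F"
  "check_M row bM bF ex cy b C js ss ts \<Longrightarrow> fits (Suc b) ss M F \<Longrightarrow> C = cy k \<Longrightarrow> okc C ss \<Longrightarrow> distinct js \<Longrightarrow>
     (\<forall>i\<in>set js. i < n \<and> ss ! i \<noteq> Mf) \<Longrightarrow> (\<forall>j\<in>M. \<not> C ! j \<longrightarrow> j \<in> set js) \<Longrightarrow> R M F"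
  "check_F row bM bF ex cy b js ss ts \<Longrightarrow> fits (Suc (Suc b)) ss M F \<Longrightarrow> C = cy k \<Longrightarrow> okc C ss \<Longrightarrow> distinct js \<Longrightarrow>
     (\<forall>i\<in>set js. i < n \<and> ss ! i \<noteq> Ff) \<Longrightarrow> (\<forall>j\<in>M. C ! j) \<Longrightarrow> (\<forall>j\<in>F. C ! j \<longrightarrow> j \<in> set js) \<Longrightarrow> R M F"
proof (induction b ss t and b C ss ts and b C js ss ts and b js ss ts arbitrary: and k and k and C k
    rule: check_check_N_check_M_check_F.induct[where row = row and bM = bM and bF = bF and cy = cy])
  case (1 b ss)
  then have b: "b = 0" "ex ss" by (auto split: nat.splits)
  have fin: "finite M" "finite F" using fits_finite[OF "1.prems"(2)] by auto
  have "card {j \<in> M. ss ! j \<noteq> Mf} = 0" "card {j \<in> F. ss ! j \<noteq> Ff} = 0"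
    using "1.prems"(2) b(1) unfolding fits_def by auto
  from card_filter_0[OF fin(1) this(1)] card_filter_0[OF fin(2) this(2)]
  have "\<forall>j\<in>M. ss ! j = Mf" "\<forall>j\<in>F. ss ! j = Ff" by simp_all
  moreover have "\<And>j. j < n \<Longrightarrow> ss ! j = Mf \<Longrightarrow> j \<in> M" "\<And>j. j < n \<Longrightarrow> ss ! j = Ff \<Longrightarrow> j \<in> F"
    "\<And>j. j \<in> M \<Longrightarrow> j < n" "\<And>j. j \<in> F \<Longrightarrow> j < n"
    using "1.prems"(2) unfolding fits_def by blast+
  ultimately have eq: "{j. j < n \<and> ss ! j = Mf} = M" "{j. j < n \<and> ss ! j = Ff} = F" by blast+
  have "length ss = n" using "1.prems"(2) unfolding fits_def by blast
  from ex_R[OF this b(2)] show ?case unfolding eq .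
next
  case (2 b ss k' ts)
  then show ?case by simp
next
  case (3 b C ss ts)
  note f = "3.prems"(2)
  have len: "length ss = n" "length C = n" using f cy_length "3.prems"(3) unfolding fits_def by auto
  have ok: "okc C ss" using "3.prems"(1) by simp
  show ?case
  proof (cases b)
    case 0
    have "card {j \<in> M. ss ! j \<noteq> Mf} = 0" "card {j \<in> F. ss ! j \<noteq> Ff} = 0"
      using f 0 unfolding fits_def by auto
    with card_filter_0[of M "\<lambda>j. ss ! j \<noteq> Mf"] card_filter_0[of F "\<lambda>j. ss ! j \<noteq> Ff"] fits_finite[OF f]
    have "\<forall>j\<in>M. ss ! j = Mf" "\<forall>j\<in>F. ss ! j = Ff" by simp_all
    then have "\<forall>j\<in>M. C ! j" "\<forall>j\<in>F. \<not> C ! j"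
      using okcD[OF ok len(2,1)] fits_mem[OF f] by blast+
    then show ?thesis using serves[OF f "3.prems"(3)] by blast
  next
    case (Suc b')
    have "check_M row bM bF ex cy b' C (badM [0..<n] C ss) ss ts" using "3.prems"(1) Suc by (simp add: bM[of C ss])
    then show ?thesis
    proof (rule "3.IH"[unfolded bM[of C ss], OF Suc _ _ "3.prems"(3) ok distinct_bad(1)])
      show "fits (Suc b') ss M F" using f Suc by simp
      show "\<forall>i\<in>set (badM [0..<n] C ss). i < n \<and> ss ! i \<noteq> Mf" by (auto simp: set_badM len)
      show "\<forall>j\<in>M. \<not> C ! j \<longrightarrow> j \<in> set (badM [0..<n] C ss)"
      proof (intro ballI impI)
        fix j assume j: "j \<in> M" "\<not> C ! j"
        then have "j < n" "ss ! j \<in> {Mf, MF, Mo}" using fits_mem(1)[OF f] by blast+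
        moreover from this(1) have "ss ! j \<noteq> Mf" using j(2) okcD[OF ok len(2,1)] by blast
        ultimately show "j \<in> set (badM [0..<n] C ss)" using j(2) len by (simp add: set_badM)
      qed
    qed
  qed
next
  case (4 b C i js ss t ts)
  note f = "4.prems"(2)
  have i: "i < n" "ss ! i \<noteq> Mf" using "4.prems"(6) by auto
  have len: "length ss = n" "length C = n" using f cy_length "4.prems"(3) unfolding fits_def by auto
  show ?case
  proof (cases "i \<in> M")
    case True
    then show ?thesis using "4.IH"(1) "4.prems"(1) fits_setM[OF f _ i(2)] by simp
  next
    case False
    have c: "check_M row bM bF ex cy b C js (dropM (row i) ss) ts" using "4.prems"(1) by simp
    show ?thesis
    proof (rule "4.IH"(2)[OF c fits_dropM[OF f i(1) False] "4.prems"(3)])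
      show "okc C (dropM (row i) ss)"
        using "4.prems"(4) len length_ops(3)[OF len(1) i(1)] nth_ops(3)[OF len(1) i(1)]
        by (simp add: okc_iff)
      show "\<forall>k\<in>set js. k < n \<and> dropM (row i) ss ! k \<noteq> Mf"
        using "4.prems"(6) nth_ops(3)[OF len(1) i(1)] by simp
    qed (use "4.prems"(5,7) False in auto)
  qed
next
  case (5 b C i js ss)
  then show ?case by simp
next
  case (6 b C ss ts)
  note f = "6.prems"(2)
  have len: "length ss = n" "length C = n" using f cy_length "6.prems"(3) unfolding fits_def by auto
  note ok = "6.prems"(4)
  have M: "\<forall>j\<in>M. C ! j" using "6.prems"(7) by auto
  show ?case
  proof (cases b)
    case 0
    have "card {j \<in> F. ss ! j \<noteq> Ff} = 0" using f 0 unfolding fits_def by auto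
    with card_filter_0[of F "\<lambda>j. ss ! j \<noteq> Ff"] fits_finite[OF f]
    have "\<forall>j\<in>F. ss ! j = Ff" by simp
    then have "\<forall>j\<in>F. \<not> C ! j"
      using okcD[OF ok len(2,1)] fits_mem[OF f] by blast
    then show ?thesis using serves[OF f "6.prems"(3)] M by blast
  next
    case (Suc b')
    have "check_F row bM bF ex cy b' (badF [0..<n] C ss) ss ts" using "6.prems"(1) Suc by (simp add: bF[of C ss])
    then show ?thesis
    proof (rule "6.IH"[unfolded bF[of C ss], OF Suc _ _ "6.prems"(3) ok distinct_bad(2)])
      show "fits (Suc (Suc b')) ss M F" using f Suc by simp
      show "\<forall>i\<in>set (badF [0..<n] C ss). i < n \<and> ss ! i \<noteq> Ff" by (auto simp: set_badF len)
      show "\<forall>j\<in>F. C ! j \<longrightarrow> j \<in> set (badF [0..<n] C ss)"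
      proof (intro ballI impI)
        fix j assume j: "j \<in> F" "C ! j"
        then have "j < n" "ss ! j \<in> {Ff, MF, Fo}" using fits_mem(2)[OF f] by blast+
        moreover from this(1) have "ss ! j \<noteq> Ff" using j(2) okcD[OF ok len(2,1)] by blast
        ultimately show "j \<in> set (badF [0..<n] C ss)" using j(2) len by (simp add: set_badF)
      qed
    qed (rule M)
  qed
next
  case (7 b i js ss t ts)
  note f = "7.prems"(2)
  have i: "i < n" "ss ! i \<noteq> Ff" using "7.prems"(6) by auto
  have len: "length ss = n" "length C = n" using f cy_length "7.prems"(3) unfolding fits_def by auto
  show ?case
  proof (cases "i \<in> F")
    case True
    then show ?thesis using "7.IH"(1) "7.prems"(1) fits_setF[OF f _ i(2)] by simp
  next
    case False
    have c: "check_F row bM bF ex cy b js (dropF (row i) ss) ts" using "7.prems"(1) by simp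
    show ?thesis
    proof (rule "7.IH"(2)[OF c fits_dropF[OF f i(1) False] "7.prems"(3)])
      show "okc C (dropF (row i) ss)"
        using "7.prems"(4) len length_ops(4)[OF len(1) i(1)] nth_ops(4)[OF len(1) i(1)]
        by (simp add: okc_iff)
      show "\<forall>k\<in>set js. k < n \<and> dropF (row i) ss ! k \<noteq> Ff"
        using "7.prems"(6) nth_ops(4)[OF len(1) i(1)] by simp
    qed (use "7.prems"(5,7,8) False in auto)
  qed
next
  case (8 b i js ss)
  then show ?case by simp
next
  case (9 b ss ts)
  then show ?case using serves[OF "9.prems"(2,3)] by auto
qed

end

section \<open>Certificates for the four-dimensional cube\<close>

definition vtx :: "nat \<Rightarrow> bool list" where
  "vtx v = [odd (v div 8), odd (v div 4), odd (v div 2), odd v]"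

text \<open>Indices 24 to 31 are the edges of dimension 0, in the order of their lower ends 0 to 7.
  Edge 24 joins 0 and 8 and is the normal position of a distinguished edge.\<close>

definition es :: "(nat \<times> nat) list" where
  "es = [(0,1),(2,3),(0,2),(1,3),(4,5),(6,7),(4,6),(5,7),(0,4),(1,5),(2,6),(3,7),(8,9),(10,11),(8,10),(9,11),
(12,13),(14,15),(12,14),(13,15),(8,12),(9,13),(10,14),(11,15),(0,8),(1,9),(2,10),(3,11),(4,12),(5,
13),(6,14),(7,15)]"

definition ixs :: "nat list" where
  "ixs = [0,1,2,3,4,5,6,7,8,9,10,11,12,13,14,15,16,17,18,19,20,21,22,23,24,25,26,27,28,29,30,31]"

definition ed :: "nat \<Rightarrow> bool list set" where
  "ed j = {vtx (fst (es ! j)), vtx (snd (es ! j))}"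

definition row :: "nat \<Rightarrow> rel list" where
  "row i = map (\<lambda>e. if e = es ! i then Same
     else if fst e = fst (es ! i) \<or> fst e = snd (es ! i) \<or> snd e = fst (es ! i) \<or> snd e = snd (es ! i) then Touch
     else Apart) es"

text \<open>Evaluated once, so that checking a certificate never compares end points of
  edges.\<close>

lemma row_simps:
    "row 0 = [Same,Apart,Touch,Touch,Apart,Apart,Apart,Apart,Touch,Touch,Apart,Apart,Apart,Apart,Apart,Apart,Apart,Apart,Apart,Apart,Apart,Apart,Apart,Apart,Touch,Touch,Apart,Apart,Apart,Apart,Apart,Apart]"
    "row 1 = [Apart,Same,Touch,Touch,Apart,Apart,Apart,Apart,Apart,Apart,Touch,Touch,Apart,Apart,Apart,Apart,Apart,Apart,Apart,Apart,Apart,Apart,Apart,Apart,Apart,Apart,Touch,Touch,Apart,Apart,Apart,Apart]"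
    "row 2 = [Touch,Touch,Same,Apart,Apart,Apart,Apart,Apart,Touch,Apart,Touch,Apart,Apart,Apart,Apart,Apart,Apart,Apart,Apart,Apart,Apart,Apart,Apart,Apart,Touch,Apart,Touch,Apart,Apart,Apart,Apart,Apart]"
    "row 3 = [Touch,Touch,Apart,Same,Apart,Apart,Apart,Apart,Apart,Touch,Apart,Touch,Apart,Apart,Apart,Apart,Apart,Apart,Apart,Apart,Apart,Apart,Apart,Apart,Apart,Touch,Apart,Touch,Apart,Apart,Apart,Apart]"
    "row 4 = [Apart,Apart,Apart,Apart,Same,Apart,Touch,Touch,Touch,Touch,Apart,Apart,Apart,Apart,Apart,Apart,Apart,Apart,Apart,Apart,Apart,Apart,Apart,Apart,Apart,Apart,Apart,Apart,Touch,Touch,Apart,Apart]"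
    "row 5 = [Apart,Apart,Apart,Apart,Apart,Same,Touch,Touch,Apart,Apart,Touch,Touch,Apart,Apart,Apart,Apart,Apart,Apart,Apart,Apart,Apart,Apart,Apart,Apart,Apart,Apart,Apart,Apart,Apart,Apart,Touch,Touch]"
    "row 6 = [Apart,Apart,Apart,Apart,Touch,Touch,Same,Apart,Touch,Apart,Touch,Apart,Apart,Apart,Apart,Apart,Apart,Apart,Apart,Apart,Apart,Apart,Apart,Apart,Apart,Apart,Apart,Apart,Touch,Apart,Touch,Apart]"
    "row 7 = [Apart,Apart,Apart,Apart,Touch,Touch,Apart,Same,Apart,Touch,Apart,Touch,Apart,Apart,Apart,Apart,Apart,Apart,Apart,Apart,Apart,Apart,Apart,Apart,Apart,Apart,Apart,Apart,Apart,Touch,Apart,Touch]"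
    "row 8 = [Touch,Apart,Touch,Apart,Touch,Apart,Touch,Apart,Same,Apart,Apart,Apart,Apart,Apart,Apart,Apart,Apart,Apart,Apart,Apart,Apart,Apart,Apart,Apart,Touch,Apart,Apart,Apart,Touch,Apart,Apart,Apart]"
    "row 9 = [Touch,Apart,Apart,Touch,Touch,Apart,Apart,Touch,Apart,Same,Apart,Apart,Apart,Apart,Apart,Apart,Apart,Apart,Apart,Apart,Apart,Apart,Apart,Apart,Apart,Touch,Apart,Apart,Apart,Touch,Apart,Apart]"
    "row 10 = [Apart,Touch,Touch,Apart,Apart,Touch,Touch,Apart,Apart,Apart,Same,Apart,Apart,Apart,Apart,Apart,Apart,Apart,Apart,Apart,Apart,Apart,Apart,Apart,Apart,Apart,Touch,Apart,Apart,Apart,Touch,Apart]"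
    "row 11 = [Apart,Touch,Apart,Touch,Apart,Touch,Apart,Touch,Apart,Apart,Apart,Same,Apart,Apart,Apart,Apart,Apart,Apart,Apart,Apart,Apart,Apart,Apart,Apart,Apart,Apart,Apart,Touch,Apart,Apart,Apart,Touch]"
    "row 12 = [Apart,Apart,Apart,Apart,Apart,Apart,Apart,Apart,Apart,Apart,Apart,Apart,Same,Apart,Touch,Touch,Apart,Apart,Apart,Apart,Touch,Touch,Apart,Apart,Touch,Touch,Apart,Apart,Apart,Apart,Apart,Apart]"
    "row 13 = [Apart,Apart,Apart,Apart,Apart,Apart,Apart,Apart,Apart,Apart,Apart,Apart,Apart,Same,Touch,Touch,Apart,Apart,Apart,Apart,Apart,Apart,Touch,Touch,Apart,Apart,Touch,Touch,Apart,Apart,Apart,Apart]"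
    "row 14 = [Apart,Apart,Apart,Apart,Apart,Apart,Apart,Apart,Apart,Apart,Apart,Apart,Touch,Touch,Same,Apart,Apart,Apart,Apart,Apart,Touch,Apart,Touch,Apart,Touch,Apart,Touch,Apart,Apart,Apart,Apart,Apart]"
    "row 15 = [Apart,Apart,Apart,Apart,Apart,Apart,Apart,Apart,Apart,Apart,Apart,Apart,Touch,Touch,Apart,Same,Apart,Apart,Apart,Apart,Apart,Touch,Apart,Touch,Apart,Touch,Apart,Touch,Apart,Apart,Apart,Apart]"
    "row 16 = [Apart,Apart,Apart,Apart,Apart,Apart,Apart,Apart,Apart,Apart,Apart,Apart,Apart,Apart,Apart,Apart,Same,Apart,Touch,Touch,Touch,Touch,Apart,Apart,Apart,Apart,Apart,Apart,Touch,Touch,Apart,Apart]"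
    "row 17 = [Apart,Apart,Apart,Apart,Apart,Apart,Apart,Apart,Apart,Apart,Apart,Apart,Apart,Apart,Apart,Apart,Apart,Same,Touch,Touch,Apart,Apart,Touch,Touch,Apart,Apart,Apart,Apart,Apart,Apart,Touch,Touch]"
    "row 18 = [Apart,Apart,Apart,Apart,Apart,Apart,Apart,Apart,Apart,Apart,Apart,Apart,Apart,Apart,Apart,Apart,Touch,Touch,Same,Apart,Touch,Apart,Touch,Apart,Apart,Apart,Apart,Apart,Touch,Apart,Touch,Apart]"
    "row 19 = [Apart,Apart,Apart,Apart,Apart,Apart,Apart,Apart,Apart,Apart,Apart,Apart,Apart,Apart,Apart,Apart,Touch,Touch,Apart,Same,Apart,Touch,Apart,Touch,Apart,Apart,Apart,Apart,Apart,Touch,Apart,Touch]"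
    "row 20 = [Apart,Apart,Apart,Apart,Apart,Apart,Apart,Apart,Apart,Apart,Apart,Apart,Touch,Apart,Touch,Apart,Touch,Apart,Touch,Apart,Same,Apart,Apart,Apart,Touch,Apart,Apart,Apart,Touch,Apart,Apart,Apart]"
    "row 21 = [Apart,Apart,Apart,Apart,Apart,Apart,Apart,Apart,Apart,Apart,Apart,Apart,Touch,Apart,Apart,Touch,Touch,Apart,Apart,Touch,Apart,Same,Apart,Apart,Apart,Touch,Apart,Apart,Apart,Touch,Apart,Apart]"
    "row 22 = [Apart,Apart,Apart,Apart,Apart,Apart,Apart,Apart,Apart,Apart,Apart,Apart,Apart,Touch,Touch,Apart,Apart,Touch,Touch,Apart,Apart,Apart,Same,Apart,Apart,Apart,Touch,Apart,Apart,Apart,Touch,Apart]"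
    "row 23 = [Apart,Apart,Apart,Apart,Apart,Apart,Apart,Apart,Apart,Apart,Apart,Apart,Apart,Touch,Apart,Touch,Apart,Touch,Apart,Touch,Apart,Apart,Apart,Same,Apart,Apart,Apart,Touch,Apart,Apart,Apart,Touch]"
    "row 24 = [Touch,Apart,Touch,Apart,Apart,Apart,Apart,Apart,Touch,Apart,Apart,Apart,Touch,Apart,Touch,Apart,Apart,Apart,Apart,Apart,Touch,Apart,Apart,Apart,Same,Apart,Apart,Apart,Apart,Apart,Apart,Apart]"
    "row 25 = [Touch,Apart,Apart,Touch,Apart,Apart,Apart,Apart,Apart,Touch,Apart,Apart,Touch,Apart,Apart,Touch,Apart,Apart,Apart,Apart,Apart,Touch,Apart,Apart,Apart,Same,Apart,Apart,Apart,Apart,Apart,Apart]"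
    "row 26 = [Apart,Touch,Touch,Apart,Apart,Apart,Apart,Apart,Apart,Apart,Touch,Apart,Apart,Touch,Touch,Apart,Apart,Apart,Apart,Apart,Apart,Apart,Touch,Apart,Apart,Apart,Same,Apart,Apart,Apart,Apart,Apart]"
    "row 27 = [Apart,Touch,Apart,Touch,Apart,Apart,Apart,Apart,Apart,Apart,Apart,Touch,Apart,Touch,Apart,Touch,Apart,Apart,Apart,Apart,Apart,Apart,Apart,Touch,Apart,Apart,Apart,Same,Apart,Apart,Apart,Apart]"
    "row 28 = [Apart,Apart,Apart,Apart,Touch,Apart,Touch,Apart,Touch,Apart,Apart,Apart,Apart,Apart,Apart,Apart,Touch,Apart,Touch,Apart,Touch,Apart,Apart,Apart,Apart,Apart,Apart,Apart,Same,Apart,Apart,Apart]"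
    "row 29 = [Apart,Apart,Apart,Apart,Touch,Apart,Apart,Touch,Apart,Touch,Apart,Apart,Apart,Apart,Apart,Apart,Touch,Apart,Apart,Touch,Apart,Touch,Apart,Apart,Apart,Apart,Apart,Apart,Apart,Same,Apart,Apart]"
    "row 30 = [Apart,Apart,Apart,Apart,Apart,Touch,Touch,Apart,Apart,Apart,Touch,Apart,Apart,Apart,Apart,Apart,Apart,Touch,Touch,Apart,Apart,Apart,Touch,Apart,Apart,Apart,Apart,Apart,Apart,Apart,Same,Apart]"
    "row 31 = [Apart,Apart,Apart,Apart,Apart,Touch,Apart,Touch,Apart,Apart,Apart,Touch,Apart,Apart,Apart,Apart,Apart,Touch,Apart,Touch,Apart,Apart,Apart,Touch,Apart,Apart,Apart,Apart,Apart,Apart,Apart,Same]"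
  by (simp_all add: row_def es_def)

text \<open>Paths are encoded by the sequence of the flipped positions, two binary digits per step and
  the least significant first; edge sets by binary numbers. In both cases the leading digit only
  marks the end.\<close>

fun nbits :: "num \<Rightarrow> bool list" where
  "nbits num.One = []"
| "nbits (num.Bit0 k) = False # nbits k"
| "nbits (num.Bit1 k) = True # nbits k"

definition nb :: "nat \<Rightarrow> bool list" where
  "nb k = nbits (num_of_nat k)"

lemma nb_numeral: "nb (numeral k) = nbits k"
  by (simp add: nb_def)

text \<open>Entry \<open>4 * v + d\<close> gives the index of the edge and the vertex reached from
  \<open>v\<close> by flipping binary digit \<open>d\<close>, digit 0 being the least
  significant.\<close>

definition stt :: "(nat \<times> nat) list" where
  "stt = [(0,1),(2,2),(8,4),(24,8),(0,0),(3,3),(9,5),(25,9),(1,3),(2,0),(10,6),(26,10),(1,2),(3,1),(11,7),(27,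
11),(4,5),(6,6),(8,0),(28,12),(4,4),(7,7),(9,1),(29,13),(5,7),(6,4),(10,2),(30,14),(5,6),(7,5),(11,
3),(31,15),(12,9),(14,10),(20,12),(24,0),(12,8),(15,11),(21,13),(25,1),(13,11),(14,8),(22,14),(26,
2),(13,10),(15,9),(23,15),(27,3),(16,13),(18,14),(20,8),(28,4),(16,12),(19,15),(21,9),(29,5),(17,
15),(18,12),(22,10),(30,6),(17,14),(19,13),(23,11),(31,7)]"

definition st :: "nat \<Rightarrow> bool \<Rightarrow> bool \<Rightarrow> nat \<times> nat" where
  "st v a b = stt ! (4 * v + (if a then 1 else 0) + (if b then 2 else 0))"

lemma st_simps:
    "st 0 False False = (0,1)"
    "st 0 True False = (2,2)"
    "st 0 False True = (8,4)"
    "st 0 True True = (24,8)"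
    "st 1 False False = (0,0)"
    "st 1 True False = (3,3)"
    "st 1 False True = (9,5)"
    "st 1 True True = (25,9)"
    "st 2 False False = (1,3)"
    "st 2 True False = (2,0)"
    "st 2 False True = (10,6)"
    "st 2 True True = (26,10)"
    "st 3 False False = (1,2)"
    "st 3 True False = (3,1)"
    "st 3 False True = (11,7)"
    "st 3 True True = (27,11)"
    "st 4 False False = (4,5)"
    "st 4 True False = (6,6)"
    "st 4 False True = (8,0)"
    "st 4 True True = (28,12)"
    "st 5 False False = (4,4)"
    "st 5 True False = (7,7)"
    "st 5 False True = (9,1)"
    "st 5 True True = (29,13)"
    "st 6 False False = (5,7)"
    "st 6 True False = (6,4)"
    "st 6 False True = (10,2)"
    "st 6 True True = (30,14)"
    "st 7 False False = (5,6)"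
    "st 7 True False = (7,5)"
    "st 7 False True = (11,3)"
    "st 7 True True = (31,15)"
    "st 8 False False = (12,9)"
    "st 8 True False = (14,10)"
    "st 8 False True = (20,12)"
    "st 8 True True = (24,0)"
    "st 9 False False = (12,8)"
    "st 9 True False = (15,11)"
    "st 9 False True = (21,13)"
    "st 9 True True = (25,1)"
    "st 10 False False = (13,11)"
    "st 10 True False = (14,8)"
    "st 10 False True = (22,14)"
    "st 10 True True = (26,2)"
    "st 11 False False = (13,10)"
    "st 11 True False = (15,9)"
    "st 11 False True = (23,15)"
    "st 11 True True = (27,3)"
    "st 12 False False = (16,13)"
    "st 12 True False = (18,14)"
    "st 12 False True = (20,8)"
    "st 12 True True = (28,4)"
    "st 13 False False = (16,12)"
    "st 13 True False = (19,15)"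
    "st 13 False True = (21,9)"
    "st 13 True True = (29,5)"
    "st 14 False False = (17,15)"
    "st 14 True False = (18,12)"
    "st 14 False True = (22,10)"
    "st 14 True True = (30,6)"
    "st 15 False False = (17,14)"
    "st 15 True False = (19,13)"
    "st 15 False True = (23,11)"
    "st 15 True True = (31,7)"
  by (simp_all add: st_def stt_def)

fun trail :: "nat \<Rightarrow> bool list \<Rightarrow> (nat \<times> nat) list" where
  "trail v (a # b # ds) = st v a b # trail (snd (st v a b)) ds"
| "trail v [] = []"
| "trail v [a] = []"

fun setbit :: "rel list \<Rightarrow> bool list \<Rightarrow> bool list" where
  "setbit (Same # r) (c # C) = True # setbit r C"
| "setbit (Touch # r) (c # C) = c # setbit r C"
| "setbit (Apart # r) (c # C) = c # setbit r C"
| "setbit [] C = []"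
| "setbit (x # r) [] = []"

fun mask :: "(nat \<times> nat) list \<Rightarrow> bool list" where
  "mask [] = [False, False, False, False, False, False, False, False, False, False, False, False, False, False, False, False,
     False, False, False, False, False, False, False, False, False, False, False, False, False, False, False, False]"
| "mask (x # L) = setbit (row (fst x)) (mask L)"

definition ok_trail :: "nat \<Rightarrow> nat \<Rightarrow> (nat \<times> nat) list \<Rightarrow> bool" where
  "ok_trail s t L \<longleftrightarrow> length L = 15 \<and> last (map snd L) = t \<and> distinct (s # map snd L)"

text \<open>Falling back to \<open>p\<^sub>0\<close> makes the value the mask of a Hamiltonian path
  for every \<open>p\<close>, so that soundness only depends on one valid encoding.\<close>

definition path_mask :: "nat \<Rightarrow> nat \<Rightarrow> nat \<Rightarrow> nat \<Rightarrow> bool list" where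
  "path_mask s t p\<^sub>0 p = mask (trail s (nb (if ok_trail s t (trail s (nb p)) then p else p\<^sub>0)))"

text \<open>Encodings of Hamiltonian paths from vertex 8 to vertex 0; edge 24 closes each of them to
  a Hamiltonian cycle. Rows of twenty keep the indexing short.\<close>

definition cyc_row0 :: "nat list" where "cyc_row0 =
  [1629610273,1684325958,1376965138,1376968993,1629606418,1684326472,1630330438,1368510865,1629608217,
1376970278,1367655569,1376966937,1558261318,1295127366,1684333154,1179051108,1684935373,1713824033,
1486408073,1658004242]"

definition cyc_row1 :: "nat list" where "cyc_row1 =
  [1212728902,1685136156,1233768849,1368507524,1306816018,1557732632,1650648164,1726246508,1212729416,
1179043398,1179043912,1830625745,1713820178,1730356962,1367658884,1301401997,1685137229,1650640454,
1394685036,1650640968]"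

definition cyc_row2 :: "nat list" where "cyc_row2 =
  [1658727954,1552751074,1648936081,1315734745,1713821977,1713825318,1816945860,1724344134,1233766793,
1579639090,1194872088,1149551748,1150403729,1817061073,1402704345,1687037874,1494866201,1309860973,
1295140626,1262962884]"

definition cyc_row3 :: "nat list" where "cyc_row3 =
  [1306838253,1486410129,1494868257,1553060252,1659253302,1631264146,1372724510,1630416354,1215097928,
1830410541,1506916785,1724804678,1179050594,1373836065,1712964753,1377667564,1713185650,1378955985,
1321503878,1551242054]"

definition cyc_row4 :: "nat list" where "cyc_row4 =
  [1662138524,1377627529,1830628572,1494869542,1535717788,1726117490,1226643917,1684958438,1551289650,
1322818849,1214432401,1222413464,1641144785,1367663176,1212736098,1558303212,1215186868,1239009753,
1551267038,1486692814]"

definition cyc_row5 :: "nat list" where "cyc_row5 =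
  [1367656546,1486724313,1830739501,1194903352,1550109070,1496816934,1179406020,1294063774,1825776412,
1237895624,1372729650,1840801688,1637716461,1495119654,1309886001,1637694226,1527978449,1150407044,
1295174962,1367664153]"

definition cyc_row6 :: "nat list" where "cyc_row6 =
  [1367660838,1394897196,1222347672,1551249870,1197552749,1553687670,1591533276,1590795666,1506053740,
1481448305,1651739720,1374039118,1295135182,1690625220,1315849958,1496419228,1724403100,1534172769,
1826216173,1233765508]"

definition cyc_row7 :: "nat list" where "cyc_row7 =
  [1481394396,1732653676,1373311769,1659298534,1495026545,1826417884,1495043554,1837748764,1374440998,
1294174514,1825759964,1830707908,1651905325,1658769901,1496398289,1507368348,1486802209,1590816226,
1154008264,1179425005]"

definition cyc_row8 :: "nat list" where "cyc_row8 =
  [1558072398,1552797084,1150404706,1214435716,1226591028,1580077794,1578752286,1831265837,1637770166,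
1200325832,1506647433,1506515849,1182037700,1495716228,1372769742,1590399788,1649174326,1724311238,
1236683678,1506400713]"

definition cyc_row9 :: "nat list" where "cyc_row9 =
  [1268696941,1724826860,1495079132,1662962588,1497067046,1551255314,1551293558,1305071049,1534294481,
1535539598,1372770770,1630679522,1369234577,1305358642,1657987794,1488566489,1672983270,1552204956,
1221697069,1495712913]"

definition cyc_row10 :: "nat list" where "cyc_row10 =
  [1714179793,1726199730,1236507928,1197950694,1557777864,1530186609,1301138829,1558109406,1648939396,
1495713890,1821951565,1382954785,1233948104,1395448718,1368169273,1827507341,1368159108,1390334686,
1261910212,1370705028]"

definition cyc_row11 :: "nat list" where "cyc_row11 =
  [1389482705,1650647650,1831726381,1552719566,1584690908,1222561496,1226683288,1495195161,1640943074,
1559026924,1305353502,1506925009,1535876814,1486406788,1300546701,1302087910,1382965982,1261735460,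
1294872014,1580279650]"

definition cyc_row12 :: "nat list" where "cyc_row12 =
  [1177323320,1530498193,1726179170,1824110829,1496218406,1507375544,1552370104,1313787470,1844223388,
1662838605,1536026446,1826415057,1496191921,1404494713,1322830046,1305398734,1394810092,1590401934,
1672883334,1558387598]"

definition cyc_row13 :: "nat list" where "cyc_row13 =
  [1842209988,1236682605,1506729673,1268698014,1827532013,1558103238,1315851757,1316250406,1322070577,
1322069549,1203007048,1194972024,1152601233,1302170073,1591504492,1825777485,1506658524,1395509100,
1150143876,1506700420]"

definition cyc_row14 :: "nat list" where "cyc_row14 =
  [1668928438,1150412313,1153877190,1712965730,1668422950,1313392718,1659351990,1830523441,1496182041,
1507031921,1379441550,1390599404,1693246700,1658645714,1395446572,1672792886,1557716184,1214440008,
1214433378,1215183714]"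

definition cyc_row15 :: "nat list" where "cyc_row15 =
  [1261888436,1840814948,1843555937,1822268653,1238223309,1641771958,1713223449,1195062472,1150411336,
1558635742,1726275292,1295152350,1550740702,1536086828,1305399762,1827522761,1535602126,1215592644,
1215601549,1826942180]"

definition cyc_row16 :: "nat list" where "cyc_row16 =
  [1714566882,1534257073,1555662664,1373753825,1494864402,1651391304,1267936478,1558082678,1714300140,
1555688566,1713298982,1831045560,1179511960,1311894713,1189328696,1197677805,1195078104,1311881453,
1591535332,1733158733]"

definition cyc_row17 :: "nat list" where "cyc_row17 =
  [1156390498,1323076766,1819691908,1590286798,1826518201,1187301060,1714194354,1535751758,1321651910,
1841784653,1662201052,1652239944,1649193800,1552718024,1731774386,1726146274,1507388908,1590849122,
1559024354,1495721497]"

definition cyc_row18 :: "nat list" where "cyc_row18 =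
  [1559043372,1534310113,1315103310,1844230584,1221192941,1642979821,1181969956,1400492921,1238596404,
1323223513,1307003806,1662562844,1152851345,1198314285,1302125709,1322110669,1303941913,1268485854,
1177429710,1315761230]"

definition cyc_row19 :: "nat list" where "cyc_row19 =
  [1156376270,1215532130,1214437670,1837834680,1826500124,1832046008,1648943688,1824116273,1672930230,
1844243948,1507383768,1507040145,1534188401,1495718182]"

text \<open>Hamiltonian paths from 0 to 7, the normal position of two ends at distance
  three.\<close>

definition hp_row0 :: "nat list" where "hp_row0 =
  [1152981297,1150490907,1150492963,1220841928,1264871266,1221085410,1898000968,1222927586,1368163468,
1367840923,1154585041,1151148333,1657049570,1713080715,1367827559,1838259784,1220953826,1713051931,
1506054617,1820626457]"

definition hp_row1 :: "nat list" where "hp_row1 =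
  [1818521113,1371836881,1215587442,1221690568,1154581700,1368270380,1199867793,1372685521,1830891080,
1652050040,1662128968,1910031544,1984328849,1536267046,1266976610,1279806562,1725007078,1846681160,
1952739912,1373228652]"

definition hp_row2 :: "nat list" where "hp_row2 =
  [1151210013,1898001945,1905375526,1724158438,1371060107,1368155244,1222789320,1649219868,1153729745,
1507400166,1726356919,1400404359,2071665563,1649166412,1847995929,1852710301,1819064633,1528898342,
1913796902,1534288182]"

definition hp_row3 :: "nat list" where "hp_row3 =
  [1535740710,1536898678,1284272690,1850139827,1372112779,1570585467,2043917515,1562497659,1914512587,
1402703468,1402154092,1905468652,1987274568,1536391473,1508002009,1844258521,1952740889,1917283545,
1267426083,1153731699]"

definition hp_row4 :: "nat list" where "hp_row4 =
  [1154584013,1724408550,1984329826,1507401143,1898846407,1838397128,1739698715,1734810523,1733216059,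
1371085683,1557891955,1572282078,1372698397,1570582126,2043825255,1374034385,1941142331,1374451275,
2067483531,2000127815]"

definition hp_row5 :: "nat list" where "hp_row5 =
  [1393788743,1649100875,1367820363,1221092040,1562826972,1562227828,1899082868,1663257740,1506903257,
1852717497,1905490713,1730354317,1994512689,1152928567,1153020827,1156395547,1221086387,1195951843,
1263029090,1726105830]"

definition hp_row6 :: "nat list" where "hp_row6 =
  [1844255206,1536896622,1899614694,1899696934,1536396398,1938580194,1852709787,1662917707,1733184795,
1734422967,1734534347,1562227571,2070816486,1954854033,1953384915,1557689895,2000129100,1998091419,
2022905971,1508042531]"

definition hp_row7 :: "nat list" where "hp_row7 =
  [2008497019,1915898763,1934397905,1495732755]"

definition cyc :: "nat \<Rightarrow> bool list" where
  "cyc k = path_mask 8 0 1629610273 ([cyc_row0,cyc_row1,cyc_row2,cyc_row3,cyc_row4,cyc_row5,cyc_row6,cyc_row7,cyc_row8,cyc_row9,cyc_row10,cyc_row11,cyc_row12,cyc_row13,cyc_row14,cyc_row15,cyc_row16,cyc_row17,cyc_row18,cyc_row19] ! (k div 20) ! (k mod 20))"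

definition hp :: "nat \<Rightarrow> bool list" where
  "hp k = path_mask 0 7 1152981297 ([hp_row0,hp_row1,hp_row2,hp_row3,hp_row4,hp_row5,hp_row6,hp_row7] ! (k div 20) ! (k mod 20))"

lemmas trail_simps = nb_numeral nbits.simps st_simps trail.simps mask.simps row_simps setbit.simps
  path_mask_def ok_trail_def

text \<open>Each path is decoded and tested once here; the searches then read only its mask over the
  32 edges.\<close>

lemma cyc_simps:
    "cyc 0 = nb 4339492282"
    "cyc 1 = nb 4366181354"
    "cyc 2 = nb 4334529142"
    "cyc 3 = nb 4339493494"
    "cyc 4 = nb 4334527930"
    "cyc 5 = nb 4373033962"
    "cyc 6 = nb 4533921208"
    "cyc 7 = nb 4566475502"
    "cyc 8 = nb 4342007226"
    "cyc 9 = nb 4345047670"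
    "cyc 10 = nb 6445064830"
    "cyc 11 = nb 4342008438"
    "cyc 12 = nb 4533922420"
    "cyc 13 = nb 4934510707"
    "cyc 14 = nb 4378035178"
    "cyc 15 = nb 4375551193"
    "cyc 16 = nb 4540810210"
    "cyc 17 = nb 4339494850"
    "cyc 18 = nb 4578332220"
    "cyc 19 = nb 5471185714"
    "cyc 20 = nb 4366183027"
    "cyc 21 = nb 4941361642"
    "cyc 22 = nb 4566478531"
    "cyc 23 = nb 4568363758"
    "cyc 24 = nb 4535848145"
    "cyc 25 = nb 4767757036"
    "cyc 26 = nb 4375551800"
    "cyc 27 = nb 4543291328"
    "cyc 28 = nb 4373035635"
    "cyc 29 = nb 4366183641"
    "cyc 30 = nb 4373036249"
    "cyc 31 = nb 5134804394"
    "cyc 32 = nb 4334530498"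
    "cyc 33 = nb 5481114562"
    "cyc 34 = nb 6447542910"
    "cyc 35 = nb 5478664403"
    "cyc 36 = nb 4941398506"
    "cyc 37 = nb 4366184248"
    "cyc 38 = nb 4736103142"
    "cyc 39 = nb 4373036856"
    "cyc 40 = nb 4535848752"
    "cyc 41 = nb 5481113820"
    "cyc 42 = nb 6445066042"
    "cyc 43 = nb 4746658995"
    "cyc 44 = nb 4342009794"
    "cyc 45 = nb 4345049026"
    "cyc 46 = nb 5705020330"
    "cyc 47 = nb 4934512072"
    "cyc 48 = nb 4578332355"
    "cyc 49 = nb 4946364540"
    "cyc 50 = nb 4767757497"
    "cyc 51 = nb 4568364219"
    "cyc 52 = nb 6445065435"
    "cyc 53 = nb 5671481218"
    "cyc 54 = nb 4746658534"
    "cyc 55 = nb 4946365282"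
    "cyc 56 = nb 4342009052"
    "cyc 57 = nb 4540812497"
    "cyc 58 = nb 5471185107"
    "cyc 59 = nb 5168347747"
    "cyc 60 = nb 5872798865"
    "cyc 61 = nb 4566478396"
    "cyc 62 = nb 4339494108"
    "cyc 63 = nb 5478627548"
    "cyc 64 = nb 5481704242"
    "cyc 65 = nb 5483626938"
    "cyc 66 = nb 5139767534"
    "cyc 67 = nb 4545775032"
    "cyc 68 = nb 6646349393"
    "cyc 69 = nb 4767795112"
    "cyc 70 = nb 4734217924"
    "cyc 71 = nb 4533923776"
    "cyc 72 = nb 4378037465"
    "cyc 73 = nb 5681406142"
    "cyc 74 = nb 6445066186"
    "cyc 75 = nb 5147212390"
    "cyc 76 = nb 7018358218"
    "cyc 77 = nb 5671479862"
    "cyc 78 = nb 4944439411"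
    "cyc 79 = nb 4934510716"
    "cyc 80 = nb 4941364536"
    "cyc 81 = nb 5146659430"
    "cyc 82 = nb 5336085928"
    "cyc 83 = nb 4345048284"
    "cyc 84 = nb 5683887260"
    "cyc 85 = nb 4946365896"
    "cyc 86 = nb 4767793891"
    "cyc 87 = nb 4546364386"
    "cyc 88 = nb 8155015260"
    "cyc 89 = nb 5144734915"
    "cyc 90 = nb 6445067859"
    "cyc 91 = nb 5715540531"
    "cyc 92 = nb 7550657946"
    "cyc 93 = nb 6457471614"
    "cyc 94 = nb 4378036851"
    "cyc 95 = nb 5336087140"
    "cyc 96 = nb 6648864337"
    "cyc 97 = nb 6852232899"
    "cyc 98 = nb 6276425932"
    "cyc 99 = nb 5139770428"
    "cyc 100 = nb 6450029182"
    "cyc 101 = nb 5147249724"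
    "cyc 102 = nb 5336125216"
    "cyc 103 = nb 7451587641"
    "cyc 104 = nb 5708098108"
    "cyc 105 = nb 7018949724"
    "cyc 106 = nb 5705022617"
    "cyc 107 = nb 5139770563"
    "cyc 108 = nb 6283276714"
    "cyc 109 = nb 6851606211"
    "cyc 110 = nb 7018356862"
    "cyc 111 = nb 4780201896"
    "cyc 112 = nb 5478665624"
    "cyc 113 = nb 6618359004"
    "cyc 114 = nb 6612804819"
    "cyc 115 = nb 5471186328"
    "cyc 116 = nb 5671480476"
    "cyc 117 = nb 6447543515"
    "cyc 118 = nb 8155015251"
    "cyc 119 = nb 6457508478"
    "cyc 120 = nb 6450619006"
    "cyc 121 = nb 6615282294"
    "cyc 122 = nb 4780203569"
    "cyc 123 = nb 6276425788"
    "cyc 124 = nb 6646383833"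
    "cyc 125 = nb 5481703644"
    "cyc 126 = nb 8569032908"
    "cyc 127 = nb 5483628764"
    "cyc 128 = nb 4736106180"
    "cyc 129 = nb 4734215356"
    "cyc 130 = nb 6646347576"
    "cyc 131 = nb 5686960318"
    "cyc 132 = nb 6276425779"
    "cyc 133 = nb 7046935402"
    "cyc 134 = nb 4546366673"
    "cyc 135 = nb 7025802332"
    "cyc 136 = nb 4941364680"
    "cyc 137 = nb 5681999004"
    "cyc 138 = nb 6283316616"
    "cyc 139 = nb 4568366787"
    "cyc 140 = nb 4736103612"
    "cyc 141 = nb 5478628290"
    "cyc 142 = nb 7025836158"
    "cyc 143 = nb 4546367280"
    "cyc 144 = nb 6612804828"
    "cyc 145 = nb 8556590472"
    "cyc 146 = nb 6617769180"
    "cyc 147 = nb 5147211178"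
    "cyc 148 = nb 7028875390"
    "cyc 149 = nb 7018359891"
    "cyc 150 = nb 5347939752"
    "cyc 151 = nb 5168348968"
    "cyc 152 = nb 6646384440"
    "cyc 153 = nb 7751978768"
    "cyc 154 = nb 7013395548"
    "cyc 155 = nb 5147213004"
    "cyc 156 = nb 5144734780"
    "cyc 157 = nb 7766868188"
    "cyc 158 = nb 5714948283"
    "cyc 159 = nb 5714988185"
    "cyc 160 = nb 5875835068"
    "cyc 161 = nb 6283278540"
    "cyc 162 = nb 6450029787"
    "cyc 163 = nb 6447545939"
    "cyc 164 = nb 4769682147"
    "cyc 165 = nb 4545776244"
    "cyc 166 = nb 4772758252"
    "cyc 167 = nb 5178314536"
    "cyc 168 = nb 5481704856"
    "cyc 169 = nb 4779611321"
    "cyc 170 = nb 5146660044"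
    "cyc 171 = nb 4746071748"
    "cyc 172 = nb 5168348361"
    "cyc 173 = nb 6447545948"
    "cyc 174 = nb 8360861758"
    "cyc 175 = nb 5885205044"
    "cyc 176 = nb 7587275578"
    "cyc 177 = nb 7050014536"
    "cyc 178 = nb 4772761281"
    "cyc 179 = nb 6851643084"
    "cyc 180 = nb 7451627073"
    "cyc 181 = nb 7214677824"
    "cyc 182 = nb 6615282908"
    "cyc 183 = nb 8162458904"
    "cyc 184 = nb 7028878428"
    "cyc 185 = nb 5471185116"
    "cyc 186 = nb 8155605084"
    "cyc 187 = nb 7419970755"
    "cyc 188 = nb 8355900444"
    "cyc 189 = nb 7792537116"
    "cyc 190 = nb 7555621086"
    "cyc 191 = nb 5481111994"
    "cyc 192 = nb 7786980046"
    "cyc 193 = nb 7219675251"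
    "cyc 194 = nb 7555624722"
    "cyc 195 = nb 4746661428"
    "cyc 196 = nb 7230195000"
    "cyc 197 = nb 4941363324"
    "cyc 198 = nb 4767796785"
    "cyc 199 = nb 6445067868"
    "cyc 200 = nb 7013396290"
    "cyc 201 = nb 7219679040"
    "cyc 202 = nb 4767760065"
    "cyc 203 = nb 6651938009"
    "cyc 204 = nb 7988261580"
    "cyc 205 = nb 7954719900"
    "cyc 206 = nb 6283315395"
    "cyc 207 = nb 8559665356"
    "cyc 208 = nb 6447544122"
    "cyc 209 = nb 6450032220"
    "cyc 210 = nb 5714985898"
    "cyc 211 = nb 5681408710"
    "cyc 212 = nb 5714950851"
    "cyc 213 = nb 7960273462"
    "cyc 214 = nb 7799423550"
    "cyc 215 = nb 6283316002"
    "cyc 216 = nb 7789457982"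
    "cyc 217 = nb 8360864326"
    "cyc 218 = nb 8388852291"
    "cyc 219 = nb 7252193902"
    "cyc 220 = nb 7550659158"
    "cyc 221 = nb 4378038072"
    "cyc 222 = nb 5346051496"
    "cyc 223 = nb 6286354492"
    "cyc 224 = nb 5348528364"
    "cyc 225 = nb 7988854289"
    "cyc 226 = nb 4780200675"
    "cyc 227 = nb 6625248476"
    "cyc 228 = nb 7754425752"
    "cyc 229 = nb 8556591684"
    "cyc 230 = nb 5341085923"
    "cyc 231 = nb 5134806220"
    "cyc 232 = nb 8370793500"
    "cyc 233 = nb 4568366652"
    "cyc 234 = nb 4941400179"
    "cyc 235 = nb 4946954355"
    "cyc 236 = nb 5686962886"
    "cyc 237 = nb 5180201571"
    "cyc 238 = nb 8360864787"
    "cyc 239 = nb 6651347580"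
    "cyc 240 = nb 5178276921"
    "cyc 241 = nb 7786982940"
    "cyc 242 = nb 6651348936"
    "cyc 243 = nb 5882728320"
    "cyc 244 = nb 6618361428"
    "cyc 245 = nb 7262715468"
    "cyc 246 = nb 5178276460"
    "cyc 247 = nb 5875838097"
    "cyc 248 = nb 6283869576"
    "cyc 249 = nb 8162492730"
    "cyc 250 = nb 7960274076"
    "cyc 251 = nb 8355308938"
    "cyc 252 = nb 6612807252"
    "cyc 253 = nb 7967163078"
    "cyc 254 = nb 6286354627"
    "cyc 255 = nb 8562180147"
    "cyc 256 = nb 7419933286"
    "cyc 257 = nb 5888281140"
    "cyc 258 = nb 4944440632"
    "cyc 259 = nb 5875837492"
    "cyc 260 = nb 8389440298"
    "cyc 261 = nb 4767796929"
    "cyc 262 = nb 7419973188"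
    "cyc 263 = nb 7456591425"
    "cyc 264 = nb 8556629760"
    "cyc 265 = nb 7217750140"
    "cyc 266 = nb 5883317393"
    "cyc 267 = nb 6618358995"
    "cyc 268 = nb 7418045491"
    "cyc 269 = nb 5346053169"
    "cyc 270 = nb 6658790617"
    "cyc 271 = nb 7451587785"
    "cyc 272 = nb 7786980507"
    "cyc 273 = nb 5147249859"
    "cyc 274 = nb 5885205188"
    "cyc 275 = nb 6283313578"
    "cyc 276 = nb 7419933900"
    "cyc 277 = nb 7957197510"
    "cyc 278 = nb 7252784187"
    "cyc 279 = nb 7252196940"
    "cyc 280 = nb 8155606296"
    "cyc 281 = nb 6457509083"
    "cyc 282 = nb 7050010747"
    "cyc 283 = nb 6450030538"
    "cyc 284 = nb 7018947898"
    "cyc 285 = nb 4739179699"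
    "cyc 286 = nb 7755018000"
    "cyc 287 = nb 4734216098"
    "cyc 288 = nb 6615322196"
    "cyc 289 = nb 7418045644"
    "cyc 290 = nb 5686962742"
    "cyc 291 = nb 8367716934"
    "cyc 292 = nb 7227118434"
    "cyc 293 = nb 7756940082"
    "cyc 294 = nb 7957197366"
    "cyc 295 = nb 8165531962"
    "cyc 296 = nb 7988851260"
    "cyc 297 = nb 6457474643"
    "cyc 298 = nb 6450032211"
    "cyc 299 = nb 6651350609"
    "cyc 300 = nb 7453515329"
    "cyc 301 = nb 5180792616"
    "cyc 302 = nb 5681999746"
    "cyc 303 = nb 7988299656"
    "cyc 304 = nb 7988298435"
    "cyc 305 = nb 7755015576"
    "cyc 306 = nb 7025837514"
    "cyc 307 = nb 7988262041"
    "cyc 308 = nb 6457472219"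
    "cyc 309 = nb 5875837636"
    "cyc 310 = nb 7227119048"
    "cyc 311 = nb 6276425923"
    "cyc 312 = nb 8391928396"
    "cyc 313 = nb 7957200404"
    "cyc 314 = nb 7756939475"
    "cyc 315 = nb 7419971362"
    "cyc 316 = nb 8360864796"
    "cyc 317 = nb 7584201299"
    "cyc 318 = nb 7594166867"
    "cyc 319 = nb 8401294122"
    "cyc 320 = nb 6617769922"
    "cyc 321 = nb 7955312148"
    "cyc 322 = nb 7594130012"
    "cyc 323 = nb 7560585438"
    "cyc 324 = nb 4334529756"
    "cyc 325 = nb 7594131224"
    "cyc 326 = nb 8391928387"
    "cyc 327 = nb 7755014364"
    "cyc 328 = nb 7025803074"
    "cyc 329 = nb 8165533788"
    "cyc 330 = nb 7028876746"
    "cyc 331 = nb 5178277672"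
    "cyc 332 = nb 5715541145"
    "cyc 333 = nb 7967163539"
    "cyc 334 = nb 8399371289"
    "cyc 335 = nb 7988298905"
    "cyc 336 = nb 7988851865"
    "cyc 337 = nb 5882727569"
    "cyc 338 = nb 8401295948"
    "cyc 339 = nb 8162492874"
    "cyc 340 = nb 7599128795"
    "cyc 341 = nb 7423009987"
    "cyc 342 = nb 7789459338"
    "cyc 343 = nb 6288869436"
    "cyc 344 = nb 8367752586"
    "cyc 345 = nb 7046937689"
    "cyc 346 = nb 7018360642"
    "cyc 347 = nb 5686963356"
    "cyc 348 = nb 7217753169"
    "cyc 349 = nb 6283903402"
    "cyc 350 = nb 7214675256"
    "cyc 351 = nb 6658791224"
    "cyc 352 = nb 7594128186"
    "cyc 353 = nb 5714950716"
    "cyc 354 = nb 8155016002"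
    "cyc 355 = nb 4545777600"
    "cyc 356 = nb 7420526148"
    "cyc 357 = nb 7599131228"
    "cyc 358 = nb 7754426964"
    "cyc 359 = nb 6457511516"
    "cyc 360 = nb 7751940692"
    "cyc 361 = nb 8365829148"
    "cyc 362 = nb 5686963347"
    "cyc 363 = nb 8399372040"
    "cyc 364 = nb 7988301329"
    "cyc 365 = nb 7761905048"
    "cyc 366 = nb 5180202185"
    "cyc 367 = nb 7957234374"
    "cyc 368 = nb 7990776515"
    "cyc 369 = nb 7430489283"
    "cyc 370 = nb 5341088961"
    "cyc 371 = nb 7025800506"
    "cyc 372 = nb 7787570331"
    "cyc 373 = nb 7451624505"
    "cyc 374 = nb 6283905075"
    "cyc 375 = nb 8567144499"
    "cyc 376 = nb 7025839187"
    "cyc 377 = nb 8404372035"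
    "cyc 378 = nb 5183278137"
    "cyc 379 = nb 5888278707"
    "cyc 380 = nb 8404369467"
    "cyc 381 = nb 7586687571"
    "cyc 382 = nb 6450622035"
    "cyc 383 = nb 7262713642"
    "cyc 384 = nb 8367715722"
    "cyc 385 = nb 7451588392"
    "cyc 386 = nb 6457472826"
    "cyc 387 = nb 7954720642"
    "cyc 388 = nb 8165535000"
    "cyc 389 = nb 8557182720"
    "cyc 390 = nb 6852196044"
    "cyc 391 = nb 7250308684"
    "cyc 392 = nb 7955309724"
    "cyc 393 = nb 6450622044"
  by (simp_all add: cyc_def cyc_row0_def cyc_row1_def cyc_row2_def cyc_row3_def cyc_row4_def cyc_row5_def cyc_row6_def cyc_row7_def cyc_row8_def cyc_row9_def cyc_row10_def cyc_row11_def cyc_row12_def cyc_row13_def cyc_row14_def cyc_row15_def cyc_row16_def cyc_row17_def cyc_row18_def cyc_row19_def) (simp_all add: trail_simps del: One_nat_def)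

lemma hp_simps:
    "hp 0 = nb 4466827894"
    "hp 1 = nb 4382958202"
    "hp 2 = nb 4389810810"
    "hp 3 = nb 4700665395"
    "hp 4 = nb 4500408120"
    "hp 5 = nb 4468717362"
    "hp 6 = nb 6579254867"
    "hp 7 = nb 4476196658"
    "hp 8 = nb 4468716755"
    "hp 9 = nb 4361823450"
    "hp 10 = nb 4867416190"
    "hp 11 = nb 4502295164"
    "hp 12 = nb 5404094226"
    "hp 13 = nb 4394815064"
    "hp 14 = nb 4358784218"
    "hp 15 = nb 4500409937"
    "hp 16 = nb 4466829106"
    "hp 17 = nb 4382961240"
    "hp 18 = nb 4700665548"
    "hp 19 = nb 4468719188"
    "hp 20 = nb 4466830932"
    "hp 21 = nb 5404090590"
    "hp 22 = nb 4867417402"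
    "hp 23 = nb 4702590515"
    "hp 24 = nb 4900958331"
    "hp 25 = nb 4478682323"
    "hp 26 = nb 5106217582"
    "hp 27 = nb 5411533022"
    "hp 28 = nb 4502298193"
    "hp 29 = nb 5106220611"
    "hp 30 = nb 5437635155"
    "hp 31 = nb 7384495683"
    "hp 32 = nb 7520182878"
    "hp 33 = nb 4466829250"
    "hp 34 = nb 4502296376"
    "hp 35 = nb 5437633338"
    "hp 36 = nb 4900962120"
    "hp 37 = nb 4507262545"
    "hp 38 = nb 6581769811"
    "hp 39 = nb 5615927507"
    "hp 40 = nb 4507259516"
    "hp 41 = nb 6579254876"
    "hp 42 = nb 6982920010"
    "hp 43 = nb 4907851592"
    "hp 44 = nb 4562552024"
    "hp 45 = nb 4466828499"
    "hp 46 = nb 4712519219"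
    "hp 47 = nb 4867419219"
    "hp 48 = nb 4874268798"
    "hp 49 = nb 4500408264"
    "hp 50 = nb 5195091528"
    "hp 51 = nb 5698774170"
    "hp 52 = nb 7246971992"
    "hp 53 = nb 4874271827"
    "hp 54 = nb 4478684756"
    "hp 55 = nb 5615929940"
    "hp 56 = nb 5808746004"
    "hp 57 = nb 4468717506"
    "hp 58 = nb 6984808266"
    "hp 59 = nb 5605409730"
    "hp 60 = nb 4478683074"
    "hp 61 = nb 5615928258"
    "hp 62 = nb 6015889722"
    "hp 63 = nb 4560068176"
    "hp 64 = nb 5497888986"
    "hp 65 = nb 6305644746"
    "hp 66 = nb 8184234074"
    "hp 67 = nb 5156545738"
    "hp 68 = nb 7035135066"
    "hp 69 = nb 5821187219"
    "hp 70 = nb 5808743571"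
    "hp 71 = nb 7150658643"
    "hp 72 = nb 7721501267"
    "hp 73 = nb 5808743110"
    "hp 74 = nb 4712519372"
    "hp 75 = nb 5273996868"
    "hp 76 = nb 6581769820"
    "hp 77 = nb 7386420812"
    "hp 78 = nb 4796388920"
    "hp 79 = nb 4958138490"
    "hp 80 = nb 5068697724"
    "hp 81 = nb 4912815944"
    "hp 82 = nb 7520184090"
    "hp 83 = nb 4784572104"
    "hp 84 = nb 6629582418"
    "hp 85 = nb 5842325009"
    "hp 86 = nb 4961217624"
    "hp 87 = nb 4963732568"
    "hp 88 = nb 6293203992"
    "hp 89 = nb 4560065752"
    "hp 90 = nb 5364716744"
    "hp 91 = nb 6418093448"
    "hp 92 = nb 5612851420"
    "hp 93 = nb 6221776266"
    "hp 94 = nb 7042614362"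
    "hp 95 = nb 5416534238"
    "hp 96 = nb 8576443416"
    "hp 97 = nb 5500403930"
    "hp 98 = nb 7783645778"
    "hp 99 = nb 8372675610"
    "hp 100 = nb 5688255642"
    "hp 101 = nb 4351307346"
    "hp 102 = nb 4351304922"
    "hp 103 = nb 4705629747"
    "hp 104 = nb 5273994435"
    "hp 105 = nb 5302572233"
    "hp 106 = nb 7181161561"
    "hp 107 = nb 6015891539"
    "hp 108 = nb 4702590668"
    "hp 109 = nb 5821189652"
    "hp 110 = nb 7150658652"
    "hp 111 = nb 6015891548"
    "hp 112 = nb 7687922262"
    "hp 113 = nb 4557587058"
    "hp 114 = nb 4563141234"
    "hp 115 = nb 4961214586"
    "hp 116 = nb 4752881202"
    "hp 117 = nb 5195051626"
    "hp 118 = nb 4507260728"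
    "hp 119 = nb 4910890824"
    "hp 120 = nb 5068738368"
    "hp 121 = nb 5821187970"
    "hp 122 = nb 7181162312"
    "hp 123 = nb 7147583298"
    "hp 124 = nb 5808744322"
    "hp 125 = nb 7687333650"
    "hp 126 = nb 4563144272"
    "hp 127 = nb 5487962706"
    "hp 128 = nb 4951288920"
    "hp 129 = nb 4958178392"
    "hp 130 = nb 4963142744"
    "hp 131 = nb 5352862920"
    "hp 132 = nb 7196645192"
    "hp 133 = nb 7522071134"
    "hp 134 = nb 6665639512"
    "hp 135 = nb 5163435210"
    "hp 136 = nb 8490087443"
    "hp 137 = nb 7035724890"
    "hp 138 = nb 7042577498"
    "hp 139 = nb 4796389064"
    "hp 140 = nb 8578957890"
    "hp 141 = nb 6634546770"
    "hp 142 = nb 8087920734"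
    "hp 143 = nb 4585141962"
  by (simp_all add: hp_def hp_row0_def hp_row1_def hp_row2_def hp_row3_def hp_row4_def hp_row5_def hp_row6_def hp_row7_def) (simp_all add: trail_simps del: One_nat_def)

fun forced_M :: "nat list \<Rightarrow> status list \<Rightarrow> nat list" where
  "forced_M (i # is) (Mf # ss) = i # forced_M is ss"
| "forced_M (i # is) (Ff # ss) = forced_M is ss"
| "forced_M (i # is) (MF # ss) = forced_M is ss"
| "forced_M (i # is) (Mo # ss) = forced_M is ss"
| "forced_M (i # is) (Fo # ss) = forced_M is ss"
| "forced_M (i # is) (No # ss) = forced_M is ss"
| "forced_M [] ss = []"
| "forced_M (i # is) [] = []"

fun forced_F :: "nat list \<Rightarrow> status list \<Rightarrow> nat list" where
  "forced_F (i # is) (Mf # ss) = forced_F is ss"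
| "forced_F (i # is) (Ff # ss) = i # forced_F is ss"
| "forced_F (i # is) (MF # ss) = forced_F is ss"
| "forced_F (i # is) (Mo # ss) = forced_F is ss"
| "forced_F (i # is) (Fo # ss) = forced_F is ss"
| "forced_F (i # is) (No # ss) = forced_F is ss"
| "forced_F [] ss = []"
| "forced_F (i # is) [] = []"

text \<open>With the prescribed edge 24, the edges 27, 29 and 30 form the even parity class of
  dimension 0, while 25, 26, 28 and 31 form the odd one.\<close>

definition exc_state :: "status list \<Rightarrow> bool" where
  "exc_state ss \<longleftrightarrow> forced_M ixs ss = [27,29,30] \<and> (forced_F ixs ss = [25] \<or> forced_F ixs ss = [26] \<or> forced_F ixs ss = [28] \<or> forced_F ixs ss = [31])"

definition no_state :: "status list \<Rightarrow> bool" where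
  "no_state ss \<longleftrightarrow> False"

definition badM4 :: "bool list \<Rightarrow> status list \<Rightarrow> nat list" where
  "badM4 C ss = badM ixs C ss"

definition badF4 :: "bool list \<Rightarrow> status list \<Rightarrow> nat list" where
  "badF4 C ss = badF ixs C ss"

lemmas check_simps = badM4_def badF4_def nb_numeral nbits.simps okc.simps noM.simps noF.simps setM.simps setF.simps
  dropM.simps dropF.simps badM.simps badF.simps row_simps ixs_def
  check.simps check_N.simps check_M.simps check_F.simps nat.case simp_thms if_True if_False
  list.map rel.case

text \<open>The budget 3 is the path bound in dimension 4. Like the other budgets it is a successor
  term, so that the case distinctions of \<open>check\<close> reduce by rewriting.\<close>

lemma check_far:
  "check row badM4 badF4 no_state hp (Suc (Suc (Suc 0))) (map (\<lambda>r. MF) (row 0))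
    (N 102[N 45[N 3[N 23[],N 23[],N 103[],N 23[],N 46[],N 24[],N 24[]],N 15[N 28[],N 47[],N 28[],N 28[],
N 37[],N 29[],N 47[],N 30[]],N 8[N 37[],N 37[],N 28[],N 3[],N 24[],N 30[],N 6[]],N 104[N 15[],
N 28[],N 15[],N 15[],N 30[],N 38[]],N 25[N 8[],N 28[],N 30[],N 6[]],N 69[N 8[],N 29[],N 38[]],
N 39[N 25[],N 46[],N 53[]],N 39[N 15[],N 105[],N 24[],N 106[]],N 70[N 29[],N 31[]],N 71[N 107[]],
N 70[N 72[]],N 71[],N 15[],N 29[],N 3[],N 15[],N 24[],N 25[],N 8[],N 39[],N 8[],N 25[],N 37[],N 8[],
N 15[],N 47[]],N 20[N 10[N 18[],N 18[],N 11[],N 18[],N 11[],N 40[],N 18[],N 21[],N 41[]],N 0[N 11[],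
N 11[],N 11[],N 11[],N 40[],N 26[],N 10[]],N 73[N 18[],N 21[],N 21[],N 18[],N 108[],N 74[]],
N 19[N 40[],N 40[],N 18[],N 26[],N 27[],N 41[]],N 75[N 11[],N 11[],N 10[],N 21[],N 76[]],
N 54[N 19[],N 21[],N 41[]],N 109[N 19[],N 26[],N 76[]],N 55[N 74[],N 48[]],N 56[N 26[],N 77[]],
N 110[N 75[],N 111[]],N 56[N 32[]],N 112[],N 18[],N 56[],N 10[],N 0[],N 0[],N 54[],N 19[],N 27[],
N 19[],N 54[],N 40[],N 19[],N 11[],N 10[]],N 2[N 16[N 4[],N 5[],N 4[],N 5[],N 5[],N 7[],N 4[],
N 22[]],N 113[N 4[],N 4[],N 0[],N 3[],N 10[]],N 1[N 11[],N 11[],N 23[],N 10[]],N 114[N 1[],N 5[],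
N 1[],N 3[]],N 115[N 1[],N 5[],N 0[]],N 78[N 5[],N 5[],N 26[]],N 79[N 0[],N 116[]],N 78[N 0[],
N 80[]],N 117[],N 79[],N 4[],N 0[],N 26[],N 16[],N 10[],N 1[],N 7[],N 1[],N 7[],N 5[],N 5[],N 1[],
N 0[],N 0[]],N 33[N 49[N 34[],N 22[],N 34[],N 34[],N 118[],N 22[],N 35[],N 42[]],N 36[N 43[],N 43[],
N 119[],N 81[],N 43[],N 120[],N 12[]],N 57[N 7[],N 7[],N 34[],N 36[],N 35[],N 58[]],N 59[N 4[],
N 4[],N 34[],N 22[],N 42[]],N 60[N 5[],N 34[],N 12[],N 58[]],N 121[N 81[],N 58[]],N 61[N 7[],
N 43[]],N 61[N 4[],N 36[],N 122[]],N 123[N 22[],N 62[]],N 124[N 82[]],N 125[N 42[]],N 4[],N 16[],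
N 16[],N 22[],N 35[],N 7[],N 5[],N 7[],N 5[],N 60[],N 7[],N 5[],N 4[],N 22[]],N 15[N 32[N 2[],N 2[],
N 1[],N 5[],N 2[],N 1[],N 3[]],N 63[N 2[],N 2[],N 3[],N 35[],N 6[]],N 17[N 2[],N 3[],N 12[],N 6[]],
N 13[N 7[],N 5[],N 12[],N 6[]],N 126[N 13[],N 23[],N 38[]],N 50[N 13[],N 61[]],N 83[N 17[],N 127[],
N 84[]],N 85[N 31[]],N 85[N 32[]],N 72[N 6[]],N 1[],N 33[],N 16[],N 1[],N 1[],N 1[],N 2[],N 7[],
N 13[],N 2[],N 2[],N 5[],N 0[],N 1[]],N 128[N 63[N 19[],N 19[],N 29[],N 53[],N 30[]],N 129[N 20[],
N 20[],N 50[],N 12[]],N 130[N 19[],N 12[]],N 86[N 13[],N 50[],N 55[]],N 87[N 29[]],N 86[N 50[],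
N 55[]],N 88[],N 88[],N 20[],N 36[],N 12[],N 30[],N 13[],N 20[],N 63[],N 13[],N 13[],N 37[],N 20[],
N 17[],N 20[],N 17[]],N 89[N 27[N 2[],N 8[],N 3[],N 48[],N 6[]],N 131[N 2[],N 2[],N 27[],N 6[]],
N 90[N 2[]],N 91[N 23[],N 31[]],N 132[N 62[]],N 92[N 133[]],N 134[],N 8[],N 57[],N 5[],N 2[],N 2[],
N 3[],N 8[],N 2[],N 2[],N 8[],N 8[],N 2[],N 8[],N 2[]],N 14[N 135[N 0[],N 0[],N 0[]],N 51[N 0[],
N 0[],N 6[]],N 136[N 0[],N 45[],N 7[]],N 93[N 31[]],N 94[N 93[]],N 95[N 32[]],N 94[],N 20[],N 0[],
N 33[],N 16[],N 0[],N 0[],N 0[],N 0[],N 25[],N 25[],N 0[],N 0[],N 0[],N 4[]],N 9[N 137[N 14[],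
N 1[]],N 52[N 49[],N 1[]],N 52[N 45[],N 0[]],N 138[],N 84[N 41[]],N 17[],N 0[],N 33[],N 16[],N 1[],
N 1[],N 14[],N 2[],N 14[],N 14[],N 1[],N 1[],N 0[],N 1[]],N 44[N 64[N 9[],N 3[],N 6[]],N 96[N 9[],
N 9[]],N 139[N 51[],N 31[]],N 64[N 39[],N 32[]],N 52[],N 0[],N 33[],N 16[],N 1[],N 1[],N 9[],N 9[],
N 2[],N 1[],N 1[],N 0[],N 1[],N 9[],N 9[]],N 97[N 44[N 46[],N 53[]],N 65[],N 65[],N 13[],N 7[],
N 60[],N 7[],N 2[],N 9[],N 9[],N 2[],N 14[],N 2[],N 7[],N 2[],N 14[],N 14[]],N 97[N 44[N 1[],N 83[],
N 24[]],N 140[N 4[],N 49[],N 11[]],N 65[N 96[]],N 66[],N 66[],N 17[],N 15[],N 49[],N 4[],N 1[],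
N 2[],N 1[],N 2[],N 2[],N 1[],N 1[],N 4[],N 1[],N 1[]],N 44[N 69[N 0[],N 89[]],N 90[N 73[],N 31[]],
N 52[N 80[],N 91[]],N 98[N 59[]],N 141[],N 0[],N 33[],N 16[],N 0[],N 0[],N 0[],N 7[],N 7[],N 8[],
N 0[],N 0[],N 0[],N 4[],N 0[]],N 67[N 99[N 51[]],N 99[N 77[]],N 18[],N 3[],N 3[],N 3[],N 26[],
N 23[],N 3[],N 51[],N 46[],N 3[],N 3[],N 3[],N 3[],N 3[]],N 68[N 66[N 62[]],N 36[],N 47[],N 36[],
N 22[],N 10[],N 43[],N 48[],N 10[],N 87[],N 48[],N 10[],N 10[],N 24[],N 10[]],N 21[N 100[N 98[]],
N 142[],N 92[],N 12[],N 12[],N 59[],N 12[],N 12[],N 95[],N 35[],N 27[],N 39[],N 27[],N 64[],N 27[],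
N 35[]],N 68[N 41[],N 6[],N 42[],N 82[],N 32[],N 38[],N 6[],N 42[],N 38[],N 6[],N 6[],N 6[],N 6[],
N 6[]],N 44[N 17[],N 17[],N 17[]],N 101[N 45[]],N 67[N 57[]],N 100[N 16[],N 5[]],N 101[N 1[]],
N 21[N 11[],N 1[]],N 14[N 13[],N 13[]],N 9[N 2[],N 2[]],N 67[N 9[]],N 14[N 9[],N 9[]],N 68[N 25[]],
N 14[N 2[],N 2[]],N 21[N 17[],N 1[]],N 8[N 4[],N 4[]],N 143[N 1[],N 1[]]])"
  by (simp only: check_simps hp_simps)

text \<open>Edge 24 joins the two ends and may be faulty but not prescribed, hence its initial
  status \<open>Fo\<close>.\<close>

lemma check_adjacent:
  "check row badM4 badF4 no_state cyc (Suc (Suc (Suc (Suc 0))))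
    (map (\<lambda>r. case r of Same \<Rightarrow> Fo | Touch \<Rightarrow> MF | Apart \<Rightarrow> MF) (row 24))
    (N 324[N 20[N 22[N 139[N 30[],N 30[],N 30[],N 50[],N 106[]],N 48[N 30[],N 30[],N 24[],N 58[]],
N 178[N 107[],N 29[],N 72[],N 58[]],N 97[N 15[]],N 89[N 30[],N 35[]],N 86[N 58[]],N 261[N 60[]],
N 372[],N 29[],N 51[],N 29[],N 86[],N 51[],N 15[],N 29[],N 30[],N 15[],N 72[],N 30[],N 15[],N 29[]],
N 198[N 122[N 30[],N 30[],N 30[],N 172[],N 117[]],N 348[N 30[],N 29[],N 22[]],N 299[N 57[],N 30[]],
N 299[N 29[],N 72[],N 107[]],N 122[N 15[],N 107[],N 117[]],N 269[],N 180[],N 373[],N 22[],N 29[],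
N 29[],N 51[],N 29[],N 30[],N 15[],N 72[],N 30[],N 15[],N 22[],N 29[],N 29[]],N 28[N 91[N 15[],
N 15[],N 50[]],N 237[N 15[],N 164[],N 117[]],N 103[N 202[],N 164[],N 307[]],N 218[N 51[],N 169[]],
N 59[N 240[],N 218[],N 345[]],N 317[N 158[]],N 317[],N 30[],N 139[],N 30[],N 51[],N 30[],N 51[],
N 15[],N 50[],N 15[],N 51[],N 15[],N 51[],N 51[]],N 234[N 374[N 22[],N 43[]],N 375[N 57[],N 57[],
N 57[]],N 268[N 57[],N 57[],N 60[]],N 206[N 43[],N 97[]],N 318[N 206[]],N 376[],N 57[],N 22[],
N 57[],N 43[],N 43[],N 57[],N 22[],N 43[],N 48[],N 22[],N 22[],N 22[],N 57[]],N 94[N 118[N 28[]],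
N 193[N 60[]],N 318[],N 193[],N 30[],N 139[],N 30[],N 51[],N 30[],N 51[],N 28[],N 15[],N 28[],
N 15[],N 28[],N 24[],N 51[]],N 255[N 377[N 15[],N 24[]],N 378[N 15[]],N 379[N 162[]],N 380[],N 15[],
N 139[],N 15[],N 134[],N 94[],N 15[],N 15[],N 51[],N 15[],N 15[],N 15[],N 15[],N 15[]],
N 78[N 91[N 89[]],N 254[N 35[]],N 30[],N 48[],N 30[],N 43[],N 43[],N 15[],N 15[],N 94[],N 28[],
N 15[],N 28[],N 48[],N 28[]],N 348[N 50[N 230[],N 230[]],N 134[N 43[],N 60[]],N 103[N 60[]],
N 255[N 247[]],N 202[],N 43[],N 86[],N 43[],N 24[],N 134[],N 24[],N 57[],N 24[],N 50[],N 43[],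
N 24[],N 24[]],N 132[N 326[N 43[]],N 218[],N 50[],N 22[],N 22[],N 51[],N 48[],N 43[],N 43[],N 48[],
N 22[],N 22[],N 22[],N 22[],N 22[]],N 13[N 118[],N 282[],N 172[],N 107[],N 107[],N 240[],N 230[],
N 234[],N 78[],N 273[],N 107[],N 234[],N 234[],N 59[],N 107[]],N 381[N 58[],N 106[],N 212[],N 106[],
N 58[],N 158[],N 35[],N 158[],N 91[],N 35[],N 35[],N 58[],N 272[],N 58[]],N 282[N 68[],N 90[],
N 109[],N 52[],N 278[],N 281[],N 308[],N 117[],N 162[],N 52[],N 117[],N 52[],N 52[]],N 29[N 50[]],
N 59[N 178[],N 22[]],N 29[N 22[]],N 132[N 43[],N 43[]],N 13[N 29[]],N 282[N 51[]],N 94[N 15[],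
N 15[]],N 78[N 134[]],N 235[N 91[],N 134[]],N 94[N 51[],N 24[]],N 78[N 94[]],N 28[N 15[],N 15[]],
N 13[],N 382[N 51[],N 22[]]],N 4[N 32[N 328[N 5[],N 5[],N 23[]],N 17[N 11[],N 11[],N 36[],N 10[]],
N 45[N 11[],N 13[],N 10[]],N 283[N 3[]],N 55[N 17[]],N 110[],N 346[],N 2[],N 2[],N 13[],N 2[],N 1[],
N 11[],N 3[],N 9[],N 11[],N 3[],N 3[],N 3[],N 1[]],N 46[N 210[N 3[],N 11[],N 10[]],N 208[N 3[],
N 3[]],N 176[N 2[],N 2[],N 9[]],N 383[N 3[],N 33[]],N 319[N 2[]],N 319[],N 342[],N 2[],N 32[],N 2[],
N 2[],N 2[],N 11[],N 3[],N 9[],N 11[],N 3[],N 2[],N 2[],N 2[]],N 108[N 34[N 28[],N 28[],N 158[]],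
N 147[N 34[]],N 147[N 46[]],N 319[N 23[]],N 384[],N 28[],N 139[],N 28[],N 28[],N 164[],N 226[],
N 226[],N 23[],N 5[],N 23[],N 5[],N 5[],N 5[]],N 275[N 249[N 0[],N 8[],N 0[]],N 349[N 0[],N 10[]],
N 349[],N 210[N 10[]],N 251[],N 3[],N 17[],N 3[],N 3[],N 0[],N 7[],N 8[],N 7[],N 7[],N 0[],N 0[],
N 0[],N 0[]],N 295[N 45[N 8[]],N 284[],N 64[],N 3[],N 17[],N 17[],N 3[],N 8[],N 0[],N 8[],N 1[],
N 1[],N 0[],N 0[],N 0[],N 0[]],N 131[N 191[N 45[],N 42[]],N 285[],N 213[],N 0[],N 3[],N 17[],N 17[],
N 3[],N 14[],N 0[],N 0[],N 0[],N 1[],N 1[],N 0[],N 0[]],N 65[N 147[N 73[]],N 55[N 108[]],N 3[],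
N 17[],N 17[],N 3[],N 3[],N 0[],N 9[],N 0[],N 0[],N 0[],N 5[],N 0[],N 0[]],N 66[N 311[N 192[]],
N 174[],N 22[],N 22[],N 22[],N 51[],N 81[],N 48[],N 38[],N 54[],N 48[],N 7[],N 7[],N 7[],N 7[]],
N 110[N 76[N 21[],N 108[]],N 118[],N 13[],N 13[],N 21[],N 107[],N 31[],N 36[],N 21[],N 13[],N 235[],
N 21[],N 13[],N 59[],N 13[]],N 92[N 190[N 19[]],N 58[],N 33[],N 19[],N 58[],N 58[],N 35[],N 58[],
N 191[],N 64[],N 58[],N 191[],N 46[],N 58[]],N 194[N 74[],N 10[],N 52[],N 10[],N 10[],N 119[],
N 93[],N 120[],N 10[],N 10[],N 10[],N 10[],N 10[]],N 2[N 32[],N 32[]],N 32[N 1[]],N 32[N 58[]],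
N 2[N 55[]],N 2[N 7[]],N 2[N 1[],N 1[]],N 65[N 14[]],N 285[N 0[],N 0[]],N 285[N 45[],N 1[]],
N 65[N 9[]],N 191[N 14[],N 14[]],N 8[N 0[],N 0[]],N 19[N 0[]],N 51[N 1[],N 1[]]],
N 39[N 61[N 233[N 25[],N 197[],N 38[],N 197[]],N 18[N 2[],N 2[],N 165[]],N 99[N 2[],N 9[],N 9[],
N 12[]],N 195[N 23[],N 2[],N 49[]],N 156[N 3[]],N 129[N 79[]],N 129[N 12[],N 95[]],N 156[N 79[]],
N 2[],N 7[],N 129[],N 2[],N 7[],N 11[],N 2[],N 3[],N 11[],N 2[],N 3[],N 2[],N 2[]],N 69[N 0[N 8[],
N 8[],N 129[]],N 16[N 0[],N 8[]],N 167[N 0[]],N 102[],N 31[N 102[]],N 3[],N 3[],N 3[],N 0[],N 3[],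
N 0[],N 8[],N 18[],N 0[],N 8[],N 0[],N 0[],N 0[]],N 37[N 221[],N 99[N 4[],N 2[]],N 151[],
N 79[N 36[]],N 2[],N 1[],N 2[],N 4[],N 2[],N 4[],N 8[],N 8[],N 4[],N 14[],N 8[],N 4[],N 4[]],
N 6[N 111[N 2[],N 2[]],N 50[N 26[],N 26[]],N 4[N 40[],N 23[]],N 82[],N 2[],N 1[],N 2[],N 2[],N 2[],
N 8[],N 8[],N 4[],N 8[],N 4[],N 1[],N 4[],N 4[]],N 67[N 14[N 2[],N 12[]],N 258[],N 196[N 13[]],
N 2[],N 1[],N 2[],N 2[],N 2[],N 9[],N 9[],N 4[],N 1[],N 4[],N 1[],N 4[],N 4[]],N 150[N 67[N 26[]],
N 111[N 2[]],N 111[],N 2[],N 2[],N 2[],N 2[],N 4[],N 9[],N 8[],N 4[],N 26[],N 4[],N 4[],N 4[],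
N 4[]],N 80[N 350[N 129[]],N 108[],N 2[],N 16[],N 2[],N 2[],N 4[],N 4[],N 8[],N 9[],N 8[],N 4[],
N 4[],N 4[],N 4[]],N 130[N 385[],N 82[],N 12[],N 16[],N 12[],N 6[],N 12[],N 6[],N 40[],N 6[],N 87[],
N 40[],N 40[],N 129[],N 6[]],N 246[N 51[],N 38[],N 61[],N 51[],N 7[],N 7[],N 18[],N 54[],N 23[],
N 23[],N 7[],N 7[],N 7[]],N 21[N 79[],N 13[],N 80[],N 13[],N 13[],N 13[],N 36[],N 13[],N 235[],
N 49[],N 13[],N 59[],N 31[]],N 28[N 40[]],N 5[],N 28[N 7[]],N 80[N 0[]],N 5[N 2[]],N 5[N 4[]],
N 0[N 2[],N 1[]],N 351[N 14[]],N 331[N 9[]],N 352[],N 353[N 4[]],N 80[N 2[]],N 130[],N 386[N 4[]]],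
N 71[N 47[N 136[N 26[],N 26[],N 46[],N 208[]],N 112[N 0[],N 0[],N 36[],N 42[]],N 85[N 4[],N 115[],
N 42[]],N 168[N 0[],N 14[],N 42[]],N 85[N 4[],N 208[]],N 168[N 21[]],N 280[N 115[]],N 177[],N 4[],
N 37[],N 1[],N 4[],N 8[],N 0[],N 8[],N 4[],N 0[],N 0[],N 1[],N 4[],N 4[]],N 27[N 181[N 5[],N 147[],
N 46[]],N 181[N 5[]],N 310[N 80[],N 108[]],N 141[N 145[],N 352[]],N 351[],N 39[],N 39[],N 21[],
N 5[],N 5[],N 111[],N 150[],N 5[],N 5[],N 151[],N 5[],N 147[],N 5[]],N 243[N 53[N 8[],N 36[],
N 42[]],N 302[N 16[],N 36[],N 42[]],N 53[N 69[]],N 264[N 36[]],N 387[],N 167[],N 0[],N 16[],N 0[],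
N 69[],N 8[],N 8[],N 69[],N 69[],N 0[],N 0[],N 0[],N 0[]],N 201[N 115[N 8[],N 4[]],N 151[N 42[]],
N 40[N 19[]],N 354[],N 4[],N 4[],N 1[],N 4[],N 1[],N 8[],N 8[],N 1[],N 1[],N 4[],N 4[],N 4[],N 4[]],
N 243[N 53[N 42[]],N 27[N 208[]],N 153[],N 39[],N 4[],N 5[],N 4[],N 4[],N 8[],N 4[],N 4[],N 5[],
N 4[],N 4[],N 4[],N 4[]],N 45[N 320[N 40[],N 150[]],N 85[N 76[]],N 320[],N 26[],N 4[],N 26[],N 4[],
N 14[],N 4[],N 8[],N 4[],N 14[],N 8[],N 4[],N 4[],N 26[]],N 168[N 143[N 141[]],N 388[],N 17[],
N 17[],N 39[],N 5[],N 0[],N 8[],N 14[],N 0[],N 0[],N 8[],N 5[],N 0[],N 0[]],N 181[N 201[N 47[],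
N 354[]],N 389[],N 80[],N 47[],N 21[],N 21[],N 47[],N 36[],N 47[],N 147[],N 55[],N 151[],N 31[],
N 47[],N 47[]],N 286[N 305[],N 141[],N 115[],N 19[],N 191[],N 112[],N 19[],N 191[],N 141[],N 19[],
N 46[],N 53[],N 19[],N 19[]],N 286[N 74[],N 76[],N 133[],N 42[],N 152[],N 283[],N 42[],N 42[],
N 208[],N 42[],N 42[],N 42[],N 42[]],N 6[N 37[],N 37[]],N 286[N 37[]],N 6[N 47[]],N 1[N 55[],N 16[],
N 16[]],N 6[N 1[]],N 143[N 8[],N 14[]],N 286[N 8[]],N 355[N 4[],N 4[]],N 355[N 0[],N 0[]],
N 287[N 17[],N 5[]],N 47[N 32[],N 40[]],N 37[N 1[],N 69[]],N 45[N 4[],N 287[]],N 45[N 4[],N 1[]]],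
N 70[N 128[N 356[N 5[],N 5[]],N 274[N 39[]],N 229[N 26[]],N 313[],N 109[N 34[]],N 5[],N 39[],N 28[],
N 5[],N 5[],N 26[],N 25[],N 26[],N 5[],N 5[],N 5[],N 5[],N 5[]],N 262[N 288[N 1[]],N 178[N 2[],
N 11[],N 19[]],N 209[N 1[],N 19[]],N 218[],N 241[],N 32[],N 37[],N 2[],N 1[],N 2[],N 1[],N 11[],
N 1[],N 1[],N 2[],N 2[],N 2[],N 2[]],N 171[N 199[N 19[]],N 229[N 5[]],N 253[N 19[]],N 288[],N 32[],
N 39[],N 2[],N 2[],N 5[],N 2[],N 11[],N 2[],N 3[],N 2[],N 5[],N 2[],N 2[]],N 309[N 244[N 32[],
N 45[]],N 244[N 9[]],N 357[],N 358[],N 32[],N 37[],N 2[],N 1[],N 14[],N 9[],N 14[],N 2[],N 1[],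
N 2[],N 2[],N 2[],N 2[]],N 171[N 128[],N 179[],N 32[],N 26[],N 2[],N 2[],N 14[],N 2[],N 9[],N 11[],
N 2[],N 2[],N 26[],N 2[],N 2[]],N 171[N 359[N 5[]],N 212[],N 211[],N 17[],N 39[],N 3[],N 3[],N 5[],
N 9[],N 9[],N 11[],N 11[],N 3[],N 5[],N 3[],N 3[]],N 202[N 225[],N 180[],N 1[],N 37[],N 20[],N 1[],
N 1[],N 1[],N 26[],N 26[],N 14[],N 5[],N 26[],N 1[],N 1[]],N 321[N 19[],N 141[],N 19[],N 46[],
N 210[],N 19[],N 19[],N 33[],N 19[],N 46[],N 19[],N 19[],N 19[]],N 321[N 252[],N 42[],N 74[],N 10[],
N 10[],N 119[],N 34[],N 100[],N 10[],N 34[],N 10[],N 10[],N 10[],N 10[]],N 22[N 71[]],N 61[N 40[]],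
N 61[N 2[],N 12[]],N 12[N 3[],N 7[]],N 7[N 287[],N 16[]],N 261[N 11[]],N 202[N 2[]],N 321[N 11[]],
N 128[N 18[],N 14[]],N 252[N 18[]],N 128[N 11[],N 11[]],N 61[N 1[],N 25[]],N 61[N 2[]],
N 252[N 2[]]],N 155[N 63[N 173[N 30[],N 30[],N 140[]],N 197[N 140[]],N 84[N 140[],N 34[]],N 360[],
N 322[],N 28[],N 28[],N 39[],N 28[],N 51[],N 15[],N 50[],N 51[],N 28[],N 51[],N 28[],N 51[],N 28[]],
N 161[N 276[N 30[],N 30[]],N 126[N 15[]],N 204[],N 322[],N 5[],N 28[],N 39[],N 28[],N 5[],N 15[],
N 15[],N 23[],N 5[],N 23[],N 5[],N 5[],N 5[]],N 172[N 161[N 38[]],N 271[],N 5[],N 28[],N 39[],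
N 28[],N 5[],N 5[],N 164[],N 5[],N 23[],N 5[],N 23[],N 5[],N 5[]],N 224[N 248[N 28[]],N 126[N 63[]],
N 271[],N 5[],N 28[],N 30[],N 39[],N 28[],N 164[],N 5[],N 5[],N 25[],N 5[],N 5[],N 5[],N 5[]],
N 356[N 390[N 274[]],N 294[N 145[]],N 27[],N 140[],N 140[],N 38[],N 38[],N 27[],N 38[],N 169[],
N 25[],N 25[],N 27[],N 27[],N 27[]],N 84[N 161[N 183[]],N 216[],N 141[],N 141[],N 141[],N 353[],
N 63[],N 46[],N 175[],N 91[],N 158[],N 63[],N 46[],N 46[],N 63[]],N 245[N 117[],N 163[],N 208[],
N 117[],N 34[],N 34[],N 96[],N 109[],N 34[],N 130[],N 34[],N 34[],N 34[]],N 147[N 5[],N 28[]],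
N 75[N 27[],N 27[]],N 147[N 233[],N 39[]],N 245[N 26[]],N 75[N 5[],N 5[]],N 147[N 23[],N 5[]],
N 224[N 15[],N 15[]],N 84[N 23[],N 237[]],N 245[N 5[]],N 172[N 25[],N 5[]],N 172[N 23[],N 23[]],
N 245[N 5[],N 15[]],N 135[N 5[],N 15[]],N 84[N 5[],N 5[]]],N 62[N 231[N 116[N 8[],N 10[]],
N 170[N 35[],N 10[]],N 188[N 35[]],N 391[],N 8[],N 11[],N 8[],N 11[],N 11[],N 8[],N 8[],N 8[],
N 18[],N 18[],N 7[],N 8[],N 8[]],N 137[N 56[N 70[]],N 392[],N 8[],N 11[],N 44[],N 11[],N 11[],N 8[],
N 8[],N 77[],N 8[],N 7[],N 7[],N 8[],N 8[]],N 144[N 205[N 102[]],N 289[N 264[]],N 205[],N 16[],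
N 16[],N 16[],N 129[],N 195[],N 16[],N 16[],N 129[],N 54[],N 171[],N 102[],N 86[],N 16[]],
N 361[N 73[N 22[]],N 156[],N 22[],N 22[],N 7[],N 7[],N 7[],N 18[],N 18[],N 31[],N 7[],N 7[],N 7[],
N 7[],N 7[]],N 154[N 361[N 36[]],N 188[],N 36[],N 234[],N 36[],N 31[],N 36[],N 36[],N 36[],N 156[],
N 31[],N 101[],N 81[],N 167[],N 36[]],N 323[N 211[N 35[]],N 112[],N 35[],N 35[],N 53[],N 112[],
N 77[],N 35[],N 137[],N 77[],N 35[],N 77[],N 210[],N 35[]],N 144[N 52[],N 90[],N 74[],N 42[],N 10[],
N 10[],N 119[],N 97[],N 119[],N 179[],N 288[],N 10[],N 10[]],N 57[N 0[]],N 57[N 3[]],N 17[N 7[],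
N 7[]],N 0[N 61[],N 61[]],N 3[N 61[],N 61[]],N 3[N 7[],N 16[]],N 144[N 0[]],N 56[N 16[],N 16[]],
N 156[N 7[],N 7[]],N 56[N 54[]],N 171[N 18[],N 18[]],N 56[N 36[]],N 144[N 61[]],N 199[N 7[],
N 18[]]],N 83[N 105[N 56[N 1[]],N 186[],N 8[],N 11[],N 44[],N 8[],N 11[],N 8[],N 8[],N 36[],N 8[],
N 1[],N 1[],N 8[],N 8[]],N 134[N 125[N 79[],N 130[]],N 181[N 21[]],N 265[],N 1[],N 1[],N 37[],
N 20[],N 1[],N 1[],N 5[],N 5[],N 15[],N 1[],N 1[],N 1[],N 1[]],N 113[N 289[],N 6[],N 12[],N 71[],
N 6[],N 12[],N 12[],N 16[],N 16[],N 16[],N 27[],N 6[],N 25[],N 6[]],N 135[N 13[],N 13[],N 47[],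
N 80[],N 13[],N 21[],N 13[],N 36[],N 13[],N 13[],N 13[],N 59[],N 13[]],N 144[N 52[],N 90[],N 74[],
N 42[],N 10[],N 10[],N 119[],N 34[],N 120[],N 34[],N 34[],N 10[],N 10[]],N 168[N 17[]],N 9[N 17[],
N 17[]],N 155[N 17[]],N 137[],N 184[N 11[]],N 125[],N 113[N 0[]],N 56[N 16[]],N 62[],N 62[N 8[]],
N 56[N 13[]],N 62[N 1[]],N 113[N 20[]],N 29[N 7[],N 5[]]],N 347[N 41[N 157[N 9[]],N 207[],N 265[],
N 17[],N 3[],N 17[],N 3[],N 1[],N 14[],N 9[],N 9[],N 3[],N 1[],N 1[],N 3[],N 3[]],
N 160[N 247[N 0[]],N 104[],N 0[],N 3[],N 17[],N 62[],N 3[],N 14[],N 0[],N 0[],N 1[],N 0[],N 0[],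
N 0[],N 0[]],N 157[N 257[],N 204[N 169[]],N 1[],N 20[],N 1[],N 37[],N 20[],N 1[],N 5[],N 1[],N 1[],
N 1[],N 1[],N 1[],N 1[]],N 250[N 6[],N 12[],N 71[],N 12[],N 12[],N 16[],N 16[],N 16[],N 6[],N 25[],
N 6[],N 6[],N 6[]],N 189[N 52[],N 90[],N 74[],N 52[],N 10[],N 10[],N 119[],N 93[],N 10[],N 10[],
N 10[],N 10[],N 10[]],N 362[N 0[]],N 362[N 3[]],N 236[N 1[],N 17[]],N 232[],N 131[N 3[]],
N 131[N 0[]],N 72[N 165[],N 18[],N 210[]],N 232[N 0[]],N 137[N 18[]],N 137[N 1[]],N 189[N 1[]],
N 189[N 1[],N 5[]],N 83[N 191[]],N 83[N 7[]]],N 127[N 85[N 56[N 83[]],N 170[],N 17[],N 0[],N 39[],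
N 62[],N 0[],N 0[],N 83[],N 8[],N 0[],N 0[],N 30[],N 0[],N 0[]],N 161[N 170[],N 48[],N 48[],N 18[],
N 18[],N 54[],N 18[],N 18[],N 54[],N 54[],N 18[],N 18[],N 18[],N 18[]],N 49[N 223[],N 21[],N 234[],
N 21[],N 136[],N 80[],N 21[],N 21[],N 78[],N 235[],N 21[],N 21[],N 246[],N 156[]],N 72[N 0[],
N 141[]],N 165[N 17[],N 141[]],N 85[N 171[],N 141[]],N 65[N 18[],N 39[]],N 49[N 64[]],N 157[],
N 41[N 9[]],N 125[N 9[]],N 41[N 14[]],N 63[N 8[]],N 41[],N 357[N 5[]],N 56[N 9[],N 73[]],
N 49[N 0[]]],N 185[N 314[N 24[N 25[],N 82[]],N 145[N 25[]],N 207[],N 6[],N 6[],N 71[],N 6[],N 12[],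
N 6[],N 6[],N 16[],N 16[],N 6[],N 25[],N 6[],N 6[]],N 98[N 260[N 145[]],N 50[],N 202[],N 50[],
N 198[],N 25[],N 86[],N 25[],N 226[],N 169[],N 25[],N 25[],N 25[],N 25[]],N 88[N 13[],N 13[],N 47[],
N 80[],N 21[],N 36[],N 21[],N 13[],N 235[],N 21[],N 59[],N 13[],N 13[]],N 88[N 130[],N 68[],N 242[],
N 130[],N 130[],N 124[],N 130[],N 203[],N 96[],N 130[],N 130[],N 130[],N 130[]],N 58[N 1[]],N 58[],
N 98[N 5[]],N 115[],N 88[N 20[]],N 65[N 1[],N 1[]],N 127[N 14[]],N 41[N 6[]],N 98[N 20[]],N 127[],
N 41[N 14[]],N 63[N 15[],N 5[]],N 29[N 5[],N 46[]],N 24[N 1[]]],N 276[N 146[N 250[],N 358[],N 6[],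
N 12[],N 6[],N 12[],N 12[],N 24[],N 6[],N 134[],N 57[],N 24[],N 6[],N 50[],N 6[]],N 250[N 113[],
N 6[],N 12[],N 71[],N 12[],N 12[],N 24[],N 27[],N 24[],N 6[],N 25[],N 6[],N 6[],N 6[]],
N 146[N 201[N 265[],N 207[]],N 327[],N 6[],N 12[],N 71[],N 6[],N 12[],N 12[],N 24[],N 6[],N 87[],
N 24[],N 6[],N 166[],N 6[]],N 126[N 60[],N 60[],N 60[],N 259[],N 60[],N 160[],N 60[],N 60[],N 204[],
N 205[],N 360[],N 60[],N 60[]],N 187[],N 187[N 12[]],N 140[N 82[],N 130[]],N 262[],N 256[N 16[]],
N 187[N 12[]],N 187[N 165[]],N 289[N 87[]],N 126[N 27[]],N 289[N 16[]],N 179[N 103[]],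
N 146[N 350[]],N 128[N 114[]],N 128[N 82[]]],N 316[N 116[N 140[N 23[]],N 22[],N 22[],N 7[],N 7[],
N 7[],N 48[],N 23[],N 129[],N 7[],N 54[],N 48[],N 7[],N 7[]],N 231[N 22[],N 22[],N 61[],N 61[],
N 7[],N 7[],N 18[],N 23[],N 129[],N 23[],N 18[],N 7[],N 7[]],N 238[N 51[]],N 217[N 22[]],
N 217[N 7[],N 22[]],N 174[N 81[]],N 174[N 51[]],N 101[N 210[],N 179[]],N 232[N 129[]],N 232[N 18[]],
N 188[N 23[]],N 188[],N 189[N 59[]],N 189[N 129[]],N 99[N 109[]],N 99[N 77[]]],N 88[N 99[N 76[],
N 47[],N 107[],N 47[],N 47[],N 31[],N 85[],N 80[],N 147[],N 80[],N 80[],N 47[],N 172[],N 47[]],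
N 105[N 55[],N 55[],N 55[],N 99[],N 49[],N 66[],N 49[],N 147[],N 49[],N 49[],N 81[],N 237[],N 49[]],
N 118[N 47[]],N 118[N 81[]],N 98[N 200[]],N 123[N 284[]],N 110[N 108[]],N 49[N 275[],N 142[]],
N 329[N 21[]],N 98[N 284[]],N 186[],N 154[N 108[]],N 312[],N 154[N 66[],N 251[]],N 79[N 154[]],
N 98[]],N 185[N 190[N 322[],N 92[],N 220[],N 192[],N 92[],N 220[],N 318[],N 323[],N 176[],N 323[],
N 92[],N 92[],N 317[]],N 115[],N 58[N 77[]],N 98[N 141[]],N 115[N 77[]],N 123[N 19[]],N 190[],
N 127[],N 63[N 191[]],N 125[N 104[]],N 127[N 63[]],N 41[N 210[]],N 116[],N 106[N 104[],N 104[]],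
N 116[N 131[]]],N 209[N 146[N 114[],N 114[],N 320[],N 284[],N 252[],N 121[],N 288[],N 267[],N 121[],
N 114[],N 121[],N 114[],N 154[]],N 162[],N 298[N 252[]],N 283[N 179[]],N 189[N 42[]],N 162[N 144[]],
N 100[],N 100[N 52[]],N 359[N 239[]],N 146[],N 105[],N 173[N 120[]],N 173[],N 173[N 110[]],
N 199[N 282[]]],N 4[N 32[N 1[]],N 32[N 20[]],N 29[],N 32[],N 32[],N 32[],N 20[],N 20[],N 1[],N 8[],
N 0[],N 45[],N 8[],N 0[],N 0[],N 0[],N 1[]],N 2[N 32[N 70[]],N 32[N 24[]],N 12[],N 32[],N 32[],
N 40[],N 24[],N 16[],N 11[],N 3[],N 9[],N 11[],N 3[],N 3[],N 3[],N 20[]],N 32[N 66[N 70[],N 23[]],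
N 283[N 1[]],N 71[],N 287[],N 55[],N 7[],N 47[],N 1[],N 1[],N 44[],N 17[],N 45[],N 44[],N 17[],
N 17[],N 17[],N 1[]],N 99[N 4[N 129[]],N 233[N 4[]],N 115[],N 19[],N 4[],N 8[],N 0[],N 8[],N 0[],
N 0[],N 0[],N 37[],N 4[],N 4[]],N 209[N 105[],N 2[N 40[]],N 13[],N 2[],N 10[],N 11[],N 3[],N 9[],
N 11[],N 3[],N 2[],N 3[],N 2[]],N 185[N 127[],N 1[],N 11[],N 3[],N 9[],N 11[],N 3[],N 3[],N 1[],
N 2[],N 2[]],N 146[N 4[N 7[],N 1[]],N 113[],N 8[],N 1[],N 8[],N 0[],N 4[],N 0[],N 1[],N 4[],N 4[]],
N 56[N 72[N 165[],N 24[]],N 127[N 72[]],N 15[],N 16[],N 87[],N 14[],N 14[],N 16[],N 24[],N 15[]],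
N 83[N 62[N 27[]],N 62[N 6[]],N 67[],N 0[],N 0[],N 27[],N 0[],N 6[],N 5[]],N 105[N 66[N 83[]],
N 79[N 29[]],N 285[],N 78[],N 7[],N 1[],N 1[],N 9[],N 9[]],N 56[N 83[N 63[]],N 83[N 235[]],N 9[],
N 65[],N 93[],N 63[],N 34[],N 15[]],N 209[N 146[N 14[]],N 146[N 3[]],N 0[],N 0[],N 21[],N 0[],
N 0[]],N 116[N 56[N 3[],N 3[]],N 56[],N 5[],N 5[],N 0[],N 0[]],N 185[N 115[],N 1[],N 0[],N 0[]],
N 209[N 23[N 29[],N 1[]],N 393[],N 29[],N 15[],N 1[]]])"
  by (simp only: check_simps cyc_simps)

text \<open>Edge 24 is a prescribed edge put in normal position and already accounted for, hence its
  status \<open>No\<close> and a budget of 5 instead of 6. Edges touching it can only be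
  faulty.\<close>

lemma check_matching:
  "check row badM4 badF4 exc_state cyc (Suc (Suc (Suc (Suc (Suc 0)))))
    (map (\<lambda>r. case r of Same \<Rightarrow> No | Touch \<Rightarrow> Fo | Apart \<Rightarrow> MF) (row 24))
    (N 324[N 2[N 211[N 23[N 44[],N 53[],N 44[],N 44[],N 44[],N 53[],N 4[],N 4[],N 44[],N 1[],N 44[],
N 14[],N 1[],N 4[]],N 45[N 0[],N 7[],N 0[],N 1[],N 0[],N 44[],N 0[],N 0[],N 44[],N 0[],N 1[],N 1[]],
N 236[N 4[],N 4[],N 4[],N 4[],N 44[],N 44[],N 4[],N 1[],N 4[],N 1[],N 4[],N 4[]],N 253[N 4[],N 4[],
N 4[],N 4[],N 45[],N 4[],N 4[],N 14[],N 4[],N 4[],N 4[],N 4[]],N 33[N 53[]],N 73[],N 73[N 21[]],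
N 73[N 1[]],N 253[N 14[]],N 33[N 23[]],N 254[],N 236[N 44[]],N 108[N 44[]],N 192[N 4[]],N 212[],
N 33[],N 17[N 7[]]],N 9[N 34[N 142[],N 44[],N 44[],N 44[],N 44[],N 8[],N 8[],N 8[],N 8[],N 1[],
N 142[],N 1[],N 8[]],N 148[N 21[],N 13[],N 21[],N 89[],N 31[],N 142[],N 21[],N 13[],N 13[],N 13[],
N 59[],N 13[]],N 148[N 10[],N 52[],N 90[],N 74[],N 52[],N 42[],N 142[],N 10[],N 34[],N 10[],N 10[],
N 10[],N 10[]],N 64[N 17[]],N 45[N 1[]],N 45[N 52[]],N 64[],N 148[N 8[]],N 148[N 1[],N 8[]],
N 11[N 16[]],N 3[],N 3[N 8[]],N 11[N 13[]],N 3[N 1[]],N 20[N 13[]],N 20[N 5[]]],N 290[N 100[N 9[],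
N 17[],N 3[],N 17[],N 17[],N 89[],N 14[],N 3[],N 9[],N 9[],N 3[],N 3[],N 3[]],N 3[N 7[],N 0[],
N 17[],N 17[],N 0[],N 0[],N 0[],N 14[],N 1[],N 1[],N 14[],N 1[],N 1[]],N 213[N 52[],N 74[],N 52[],
N 52[],N 253[],N 10[],N 10[],N 10[],N 10[],N 10[],N 10[],N 10[]],N 91[N 45[]],N 236[N 1[]],
N 236[N 52[]],N 131[],N 131[N 1[]],N 214[],N 214[N 0[]],N 91[N 214[]],N 91[],N 213[],N 91[N 14[]],
N 9[N 33[]],N 9[N 7[]]],N 81[N 65[N 3[],N 35[],N 3[],N 3[],N 0[],N 9[],N 0[],N 0[],N 0[],N 91[],
N 0[],N 0[]],N 215[N 35[],N 35[],N 35[],N 65[],N 33[],N 33[],N 64[],N 35[],N 212[],N 73[],N 35[],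
N 35[]],N 55[N 89[]],N 291[],N 215[N 8[]],N 142[N 89[]],N 292[N 73[]],N 55[N 131[]],N 292[N 89[]],
N 75[],N 75[N 8[]],N 215[N 3[]],N 237[],N 55[],N 11[N 73[]]],N 174[N 216[N 7[],N 59[],N 81[],N 7[],
N 53[],N 7[],N 81[],N 75[],N 7[],N 81[],N 7[],N 7[],N 7[]],N 31[N 89[],N 89[],N 81[],N 7[],N 7[],
N 81[],N 23[],N 89[],N 23[],N 89[],N 7[],N 7[]],N 238[N 31[]],N 238[N 81[]],N 217[N 7[]],N 217[],
N 255[],N 213[N 89[]],N 291[N 81[],N 81[]],N 216[N 31[],N 31[]],N 132[N 192[]],N 216[N 59[]],
N 216[N 53[]],N 66[N 109[]],N 66[N 53[]]],N 110[N 174[N 132[],N 132[],N 108[],N 254[],N 215[],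
N 108[],N 108[],N 108[],N 132[],N 218[],N 118[],N 132[]],N 76[N 13[]],N 149[N 13[]],N 66[N 76[]],
N 76[],N 174[N 31[]],N 193[],N 256[],N 66[N 148[]],N 142[N 75[]],N 256[N 31[]],N 13[N 118[]],
N 219[],N 66[]],N 220[N 194[],N 53[N 192[]],N 194[],N 92[],N 92[N 192[]],N 293[],N 194[],N 294[],
N 213[N 132[]],N 194[],N 118[N 33[]],N 216[],N 19[]],N 34[N 110[N 76[],N 149[],N 76[],N 76[],N 92[],
N 142[],N 148[],N 148[],N 142[],N 142[],N 92[],N 92[]],N 163[],N 163[],N 219[],N 163[],N 194[],
N 110[],N 100[],N 119[],N 93[],N 120[],N 100[],N 100[],N 10[]],N 4[N 32[],N 32[N 1[]],N 32[],N 32[],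
N 32[],N 20[],N 20[],N 1[],N 8[],N 0[],N 45[],N 8[],N 0[],N 0[],N 0[],N 1[]],N 23[N 38[],N 32[],
N 32[],N 31[],N 55[],N 21[],N 32[],N 44[],N 17[],N 45[],N 44[],N 17[],N 17[],N 32[]],
N 32[N 149[N 35[]],N 53[],N 90[],N 89[],N 89[],N 35[],N 52[],N 44[],N 17[],N 45[],N 44[],N 17[],
N 17[],N 17[],N 212[]],N 77[N 293[],N 4[],N 4[],N 8[],N 4[],N 0[],N 31[],N 8[],N 0[],N 91[],N 4[],
N 4[]],N 110[N 4[N 13[]],N 13[],N 8[],N 0[],N 13[],N 8[],N 0[],N 0[],N 52[],N 4[],N 4[]],
N 34[N 10[N 4[]],N 121[],N 16[],N 4[],N 8[],N 0[],N 1[],N 4[],N 0[],N 0[],N 4[]],N 11[N 55[N 193[]],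
N 14[],N 16[],N 255[],N 14[],N 14[],N 16[],N 193[],N 14[]],N 121[N 3[],N 0[],N 9[],N 38[],N 0[],
N 0[],N 5[],N 0[],N 0[]],N 9[N 20[N 66[]],N 20[N 13[]],N 66[],N 89[],N 7[],N 13[],N 1[],N 1[],
N 1[]],N 11[N 121[],N 9[],N 65[],N 93[],N 35[],N 34[],N 91[]],N 100[N 110[],N 3[],N 0[],N 21[],
N 0[],N 0[]],N 77[N 23[N 3[]],N 11[],N 5[],N 5[],N 0[],N 0[]],N 19[N 220[N 3[]],N 3[],N 1[],N 0[],
N 0[]],N 100[N 34[],N 20[],N 23[],N 1[]]],N 37[N 221[N 4[N 2[],N 39[],N 2[],N 5[],N 2[],N 2[],N 2[],
N 0[],N 34[],N 0[],N 0[],N 0[],N 5[]],N 67[N 2[],N 16[],N 2[],N 2[],N 2[],N 8[],N 0[],N 4[],N 0[],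
N 4[],N 4[],N 4[]],N 40[N 16[],N 38[],N 67[],N 16[],N 16[],N 16[],N 121[],N 16[],N 16[],N 16[],
N 164[],N 38[]],N 94[],N 14[],N 94[N 23[]],N 49[],N 14[N 2[]],N 14[N 4[]],N 39[N 67[]],N 26[],
N 26[N 0[]],N 26[N 4[]],N 39[N 19[]],N 239[],N 18[]],N 195[N 101[N 18[],N 4[],N 14[],N 14[],N 4[],
N 4[],N 67[],N 4[],N 14[],N 4[],N 26[],N 4[],N 4[]],N 101[N 23[],N 4[],N 2[],N 14[],N 2[],N 4[],
N 4[],N 4[],N 14[],N 4[],N 26[],N 4[],N 4[]],N 150[N 55[],N 49[],N 49[],N 49[],N 49[],N 66[],N 75[],
N 66[],N 237[],N 66[],N 49[],N 49[]],N 143[N 164[]],N 54[],N 43[],N 257[],N 54[N 4[]],N 257[],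
N 257[],N 165[N 18[]],N 175[],N 213[],N 122[],N 290[],N 143[]],N 258[N 122[N 3[],N 5[],N 3[],N 5[],
N 3[],N 14[],N 3[],N 11[],N 3[],N 3[],N 3[],N 3[]],N 222[N 54[],N 18[],N 18[],N 54[],N 122[],N 54[],
N 18[],N 81[],N 18[],N 18[],N 18[],N 18[]],N 78[],N 222[],N 78[N 18[]],N 295[],N 295[],N 196[],
N 196[],N 223[],N 222[N 0[]],N 197[],N 240[],N 148[],N 0[N 5[]]],N 82[N 6[N 2[],N 2[],N 2[],N 2[],
N 8[],N 8[],N 4[],N 0[],N 0[],N 4[],N 4[],N 4[]],N 95[],N 95[],N 95[],N 95[],N 102[N 4[]],N 102[],
N 224[N 9[]],N 132[N 40[]],N 222[N 0[]],N 31[N 38[]],N 13[N 31[]],N 6[N 13[]],N 6[N 38[]]],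
N 198[N 82[N 95[],N 95[],N 95[],N 95[],N 102[],N 102[],N 224[],N 150[],N 222[],N 103[],N 256[],
N 193[]],N 12[N 38[]],N 25[],N 50[],N 12[N 38[]],N 25[N 6[]],N 12[N 38[]],N 12[N 38[]],N 122[],
N 259[],N 103[N 16[]],N 95[N 40[]],N 195[N 38[]],N 12[]],N 151[N 25[N 43[],N 54[],N 18[],N 18[],
N 43[],N 7[],N 18[],N 54[],N 18[],N 18[],N 7[],N 7[]],N 59[],N 59[N 7[]],N 123[],N 59[N 7[]],
N 46[N 31[]],N 123[N 7[]],N 102[N 18[]],N 25[N 75[]],N 260[],N 46[N 66[]],N 219[N 240[]],
N 7[N 31[]],N 46[]],N 151[N 13[],N 79[],N 79[],N 79[],N 133[],N 79[],N 36[],N 21[],N 260[],N 123[],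
N 133[],N 31[],N 79[]],N 20[N 2[],N 12[],N 16[],N 40[],N 43[],N 16[],N 11[],N 3[],N 11[],N 2[],
N 3[],N 3[],N 2[],N 2[]],N 1[N 25[],N 31[],N 55[],N 7[],N 21[],N 14[],N 5[],N 54[],N 14[],N 5[],
N 5[],N 23[],N 7[]],N 61[N 20[N 25[]],N 20[],N 43[],N 2[],N 7[],N 11[],N 2[],N 3[],N 11[],N 2[],
N 3[],N 2[],N 2[]],N 6[N 79[],N 13[],N 13[],N 8[],N 8[],N 4[],N 0[],N 0[],N 4[],N 50[],N 4[],N 4[]],
N 176[N 104[],N 12[],N 11[],N 3[],N 2[],N 3[],N 3[],N 2[],N 2[],N 2[],N 2[]],N 176[N 1[N 4[]],N 6[],
N 8[],N 0[],N 4[],N 0[],N 0[],N 4[],N 4[],N 4[],N 4[]],N 152[N 26[],N 26[],N 16[],N 143[],N 8[],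
N 14[],N 8[],N 8[],N 8[],N 8[]],N 39[N 296[],N 0[],N 9[],N 9[],N 67[],N 38[],N 6[],N 0[]],
N 176[N 26[],N 65[],N 93[],N 8[],N 8[],N 8[],N 8[],N 8[]],N 104[N 4[],N 14[],N 23[],N 4[],N 4[],
N 4[],N 4[]],N 39[N 152[],N 0[],N 78[],N 21[],N 10[],N 0[]],N 61[N 198[N 5[]],N 0[],N 5[],N 8[],
N 0[]],N 151[N 79[],N 4[],N 4[],N 4[],N 4[]],N 61[N 4[],N 4[],N 4[]]],N 261[N 90[N 22[N 77[],N 2[],
N 37[],N 37[],N 2[],N 2[],N 1[],N 2[],N 9[],N 9[],N 2[],N 2[],N 2[]],N 241[N 22[],N 22[],N 7[],
N 7[],N 7[],N 23[],N 38[],N 7[],N 75[],N 23[],N 7[],N 7[]],N 241[N 19[],N 19[],N 33[],N 19[],N 46[],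
N 19[],N 33[],N 64[],N 64[],N 19[],N 19[],N 19[]],N 199[],N 199[],N 17[N 74[]],N 39[N 42[]],
N 3[N 10[]],N 74[],N 68[],N 68[],N 177[],N 297[],N 298[],N 200[],N 17[]],N 299[N 27[N 33[],N 39[],
N 3[],N 3[],N 3[],N 5[],N 3[],N 14[],N 3[],N 3[],N 5[],N 3[],N 3[]],N 153[N 33[],N 77[],N 19[],
N 46[],N 19[],N 33[],N 19[],N 33[],N 46[],N 77[],N 19[],N 19[]],N 201[],N 201[],N 40[N 42[]],
N 239[N 2[]],N 242[],N 68[N 27[]],N 96[],N 300[],N 201[],N 68[N 19[]],N 262[],N 298[N 5[]],
N 40[N 2[]]],N 178[N 48[N 11[],N 26[],N 26[],N 11[],N 11[],N 14[],N 9[],N 9[],N 9[],N 11[],N 11[],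
N 11[]],N 179[N 163[],N 163[],N 194[],N 34[],N 34[],N 34[],N 93[],N 120[],N 34[],N 34[],N 34[],
N 34[]],N 195[N 2[],N 2[]],N 195[N 26[]],N 263[N 2[]],N 166[N 2[]],N 97[],N 195[N 9[]],N 97[N 11[]],
N 263[],N 97[N 11[]],N 96[N 23[]],N 97[N 2[]],N 48[N 2[]],N 96[N 9[]]],N 363[N 28[N 3[],N 27[],
N 17[],N 17[],N 5[],N 3[],N 11[],N 9[],N 11[],N 14[],N 11[],N 3[]],N 122[N 33[]],N 122[N 211[]],
N 91[],N 111[N 214[]],N 167[N 33[]],N 122[N 175[]],N 243[],N 301[N 175[]],N 302[],N 325[],
N 122[N 33[]],N 122[],N 122[N 33[]]],N 364[N 104[N 259[],N 19[],N 19[],N 53[],N 53[],N 46[],N 175[],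
N 64[],N 64[],N 77[],N 19[],N 77[],N 19[]],N 303[N 19[]],N 303[N 33[]],N 304[N 19[]],N 304[],
N 225[N 19[]],N 225[],N 225[N 104[]],N 225[N 220[]],N 264[],N 241[N 294[]],N 326[],N 153[N 33[]],
N 104[N 259[]]],N 180[N 152[N 10[],N 179[]],N 152[N 241[]],N 304[N 10[]],N 97[N 152[]],
N 263[N 34[]],N 68[N 109[]],N 97[N 96[]],N 263[],N 96[N 219[]],N 97[],N 177[N 219[]],N 68[N 10[]],
N 97[N 68[]]],N 102[N 12[N 2[]],N 167[N 12[]],N 32[],N 2[],N 2[],N 1[],N 2[],N 3[],N 11[],N 2[],
N 3[],N 1[],N 2[],N 2[],N 2[],N 2[]],N 198[N 111[],N 53[],N 19[],N 111[],N 37[],N 39[],N 26[],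
N 221[],N 39[],N 26[],N 61[],N 37[],N 37[]],N 180[N 198[N 2[]],N 2[],N 10[],N 2[],N 3[],N 11[],
N 2[],N 2[],N 2[],N 2[],N 2[],N 2[],N 2[]],N 86[N 20[N 81[]],N 12[],N 33[],N 2[],N 3[],N 11[],N 2[],
N 3[],N 2[],N 2[],N 2[],N 2[]],N 86[N 69[],N 25[],N 74[],N 1[],N 5[],N 54[],N 14[],N 5[],N 23[],
N 7[],N 1[],N 1[]],N 178[N 96[N 9[]],N 9[],N 9[],N 5[],N 5[],N 2[],N 1[],N 2[],N 2[],N 2[]],
N 202[N 3[],N 16[],N 9[],N 165[],N 3[],N 27[],N 3[],N 3[],N 3[]],N 97[N 122[N 11[],N 11[]],
N 226[N 26[]],N 26[],N 290[],N 93[],N 11[],N 64[],N 11[],N 11[],N 11[]],N 178[N 14[],N 23[],N 2[],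
N 19[],N 2[],N 2[],N 2[]],N 180[N 55[],N 3[],N 3[],N 3[],N 3[],N 3[]],N 102[N 59[N 27[]],N 32[],
N 2[],N 26[],N 2[],N 2[],N 2[],N 2[]],N 22[N 70[],N 61[],N 11[],N 2[]],N 22[N 20[N 59[]],N 37[],
N 11[],N 2[]],N 71[N 20[N 32[]],N 2[],N 11[],N 3[],N 1[]]],N 83[N 29[N 177[N 13[],N 31[],N 13[],
N 13[],N 13[],N 36[],N 36[],N 101[],N 36[],N 13[],N 31[],N 13[]],N 124[N 10[],N 90[],N 74[],N 42[],
N 10[],N 10[],N 34[],N 120[],N 34[],N 34[],N 10[],N 10[]],N 56[N 1[]],N 261[N 11[]],N 47[],N 112[],
N 37[N 11[]],N 79[N 1[]],N 203[],N 15[],N 15[],N 124[N 167[]],N 15[],N 15[],N 56[]],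
N 134[N 203[N 30[N 21[]],N 133[],N 1[],N 1[],N 37[],N 37[],N 1[],N 5[],N 5[],N 5[],N 15[],N 1[],
N 1[],N 1[]],N 292[N 197[],N 79[],N 47[],N 258[],N 13[],N 13[],N 13[],N 13[],N 13[],N 13[],N 59[],
N 13[],N 13[]],N 265[N 68[],N 68[],N 133[],N 68[],N 152[],N 124[],N 96[],N 68[],N 96[],N 68[],
N 133[],N 68[]],N 125[N 6[]],N 71[N 5[]],N 266[],N 12[N 28[]],N 125[N 12[]],N 87[N 6[]],N 57[],
N 57[N 15[]],N 27[N 15[]],N 57[N 1[]],N 12[N 1[]],N 29[N 5[],N 25[]],N 125[]],N 267[N 181[N 82[],
N 95[],N 82[],N 95[],N 82[],N 102[],N 102[],N 82[],N 224[],N 103[],N 268[],N 82[]],N 113[],N 113[],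
N 71[N 97[]],N 305[],N 244[],N 327[],N 134[N 124[]],N 114[],N 114[N 27[]],N 182[],N 114[N 6[]],
N 203[],N 134[]],N 135[N 136[N 200[]],N 328[],N 136[N 200[]],N 183[],N 329[],N 330[],N 184[],
N 306[N 101[]],N 184[],N 136[N 200[]],N 154[],N 245[],N 136[]],N 113[N 52[N 114[]],N 114[],N 330[],
N 305[],N 184[],N 148[],N 227[],N 184[],N 144[],N 182[],N 144[],N 52[],N 184[]],N 168[N 45[N 1[]],
N 17[],N 17[],N 20[],N 20[],N 1[],N 0[],N 8[],N 0[],N 0[],N 8[],N 1[],N 1[],N 0[],N 0[]],
N 45[N 9[N 57[]],N 12[],N 143[],N 3[],N 3[],N 57[],N 3[],N 16[],N 11[],N 3[],N 3[],N 11[],N 3[],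
N 20[],N 20[]],N 155[N 17[N 1[]],N 69[],N 75[],N 1[],N 1[],N 17[],N 44[],N 17[],N 17[],N 1[],N 1[],
N 17[],N 17[]],N 137[N 37[],N 64[],N 0[],N 8[],N 37[],N 0[],N 8[],N 37[],N 37[],N 0[],N 0[]],
N 184[N 105[],N 3[],N 10[],N 11[],N 3[],N 11[],N 3[],N 20[],N 20[],N 3[],N 3[]],N 125[N 1[],N 11[],
N 3[],N 3[],N 11[],N 1[],N 1[],N 3[],N 3[]],N 113[N 227[],N 8[],N 0[],N 0[],N 8[],N 0[],N 1[],N 0[],
N 0[]],N 56[N 57[N 69[]],N 15[],N 16[],N 87[],N 16[],N 16[],N 86[],N 15[]],N 62[N 5[],N 78[],N 93[],
N 21[],N 10[],N 5[]],N 62[N 56[N 7[]],N 5[],N 7[],N 8[],N 8[],N 7[],N 5[]],N 56[N 47[N 13[]],N 15[],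
N 27[],N 13[],N 13[],N 13[],N 15[]],N 125[N 168[],N 1[],N 1[],N 0[],N 0[]],N 113[N 244[],N 1[],
N 1[],N 1[]],N 29[N 30[],N 1[],N 5[],N 15[],N 7[]]],N 307[N 30[N 227[N 9[],N 45[],N 9[],N 45[],
N 9[],N 9[],N 9[],N 9[],N 14[],N 166[],N 14[],N 9[],N 9[]],N 124[N 12[],N 12[],N 71[],N 12[],N 12[],
N 12[],N 12[],N 12[],N 87[],N 165[],N 70[],N 12[]],N 177[N 90[],N 10[],N 52[],N 10[],N 10[],N 119[],
N 93[],N 120[],N 100[],N 10[],N 10[],N 10[]],N 41[],N 33[],N 5[N 17[]],N 246[],N 41[],N 5[],N 41[],
N 72[],N 29[N 9[]],N 125[],N 41[],N 29[],N 62[]],N 240[N 18[N 45[],N 9[],N 45[],N 83[],N 83[],N 9[],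
N 9[],N 9[],N 9[],N 9[],N 178[],N 9[]],N 91[N 41[],N 41[],N 33[],N 41[],N 41[],N 41[],N 243[],
N 41[],N 41[],N 104[],N 211[],N 41[]],N 39[N 61[]],N 269[N 3[]],N 331[],N 30[N 22[]],N 223[],
N 258[N 61[]],N 269[],N 332[],N 223[N 72[]],N 247[],N 156[],N 30[],N 30[N 61[]]],
N 227[N 111[N 179[],N 48[],N 48[],N 18[],N 18[],N 43[],N 54[],N 18[],N 18[],N 18[],N 166[],N 18[],
N 18[]],N 270[],N 333[],N 111[N 242[]],N 67[N 196[]],N 196[],N 157[],N 270[],N 113[N 9[]],
N 67[N 100[]],N 113[],N 270[],N 308[],N 67[]],N 332[N 168[N 18[]],N 266[],N 111[N 33[]],N 334[],
N 158[],N 158[N 0[]],N 159[],N 159[],N 159[],N 159[],N 137[],N 168[],N 169[]],N 228[N 303[N 7[]],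
N 3[],N 17[],N 3[],N 3[],N 3[],N 14[],N 9[],N 9[],N 0[],N 1[],N 0[],N 0[],N 0[],N 0[]],
N 247[N 225[],N 17[],N 3[],N 3[],N 16[],N 94[],N 9[],N 3[],N 3[],N 20[],N 3[],N 3[],N 3[],N 3[]],
N 271[N 204[],N 69[],N 246[],N 1[],N 17[],N 14[],N 45[],N 14[],N 17[],N 17[],N 17[],N 17[],N 17[]],
N 103[N 296[],N 90[],N 3[],N 3[],N 94[],N 9[],N 94[],N 3[],N 3[],N 3[],N 3[],N 3[]],N 160[N 296[],
N 1[],N 41[],N 14[],N 9[],N 3[],N 3[],N 1[],N 3[],N 3[],N 3[],N 3[]],N 335[N 272[],N 9[],N 0[],
N 9[],N 9[],N 0[],N 0[],N 0[],N 0[],N 0[]],N 335[N 14[],N 16[],N 87[],N 87[],N 18[],N 14[],N 14[],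
N 14[],N 14[]],N 336[N 50[],N 166[],N 78[],N 9[],N 9[],N 9[],N 9[],N 9[]],N 336[N 131[],N 93[],
N 9[],N 9[],N 9[],N 9[],N 9[]],N 205[N 0[],N 9[],N 7[],N 0[],N 0[],N 0[],N 0[]],
N 272[N 158[N 177[]],N 62[],N 9[],N 0[],N 0[],N 0[],N 0[]],N 228[N 3[],N 0[],N 1[],N 0[],N 0[]],
N 50[N 103[],N 62[],N 14[],N 0[]],N 50[N 160[],N 62[],N 14[],N 0[]]],N 170[N 112[N 56[N 8[],N 11[],
N 8[],N 11[],N 11[],N 8[],N 9[],N 9[],N 9[],N 94[],N 94[],N 15[]],N 337[],N 183[],N 41[N 62[]],
N 41[],N 365[],N 183[],N 183[],N 168[],N 41[N 72[]],N 183[],N 159[],N 84[],N 80[]],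
N 161[N 206[N 5[]],N 206[],N 138[],N 338[N 165[]],N 126[],N 206[N 14[]],N 206[N 15[]],
N 254[N 111[]],N 126[N 15[]],N 338[N 5[]],N 136[N 35[]],N 41[N 169[]],N 136[N 169[]]],N 161[N 138[],
N 206[],N 138[],N 215[N 223[]],N 108[],N 138[],N 138[],N 248[],N 84[N 248[]],N 159[N 334[]],
N 84[N 291[]],N 112[N 183[]],N 84[]],N 85[N 150[N 48[]],N 17[],N 0[],N 28[],N 28[],N 5[],N 0[],
N 0[],N 45[],N 8[],N 0[],N 0[],N 5[],N 0[],N 0[]],N 171[N 273[],N 143[],N 3[],N 57[],N 3[],N 16[],
N 9[],N 9[],N 11[],N 11[],N 3[],N 28[],N 3[],N 3[]],N 84[N 101[],N 111[],N 39[],N 64[],N 0[],N 0[],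
N 8[],N 143[],N 0[],N 0[],N 39[],N 0[],N 0[]],N 135[N 101[],N 55[],N 3[],N 93[],N 3[],N 11[],N 9[],
N 94[],N 3[],N 28[],N 3[],N 3[]],N 161[N 126[N 11[]],N 5[],N 3[],N 11[],N 9[],N 11[],N 5[],N 3[],
N 3[],N 3[],N 3[]],N 306[N 150[],N 67[],N 54[],N 5[],N 0[],N 87[],N 14[],N 0[],N 5[],N 0[],N 0[]],
N 155[N 85[],N 9[],N 15[],N 14[],N 5[],N 5[],N 5[],N 9[],N 9[]],N 155[N 62[N 27[]],N 0[],N 16[],
N 67[],N 0[],N 0[],N 5[],N 0[],N 0[]],N 155[N 9[],N 87[],N 131[],N 78[],N 78[],N 226[],N 9[],N 9[]],
N 56[N 155[],N 155[],N 44[],N 65[],N 93[],N 35[],N 15[]],N 138[N 136[],N 3[],N 5[],N 0[],N 0[],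
N 0[],N 0[]],N 366[N 5[],N 14[],N 18[],N 5[],N 5[]],N 85[N 3[],N 0[],N 0[],N 0[]],N 56[N 84[],
N 17[],N 14[],N 0[]]],N 185[N 126[N 153[N 40[],N 12[],N 6[],N 12[],N 6[],N 6[],N 6[],N 6[],N 40[],
N 57[],N 50[],N 6[],N 6[]],N 150[N 16[N 95[]],N 12[],N 71[],N 12[],N 12[],N 12[],N 6[],N 6[],N 6[],
N 6[],N 25[],N 6[],N 6[]],N 309[N 6[],N 6[],N 12[],N 6[],N 6[],N 40[],N 27[],N 27[],N 40[],N 25[],
N 6[],N 6[]],N 145[N 71[]],N 229[N 71[]],N 145[],N 229[],N 207[N 40[]],N 207[],N 145[N 12[]],
N 145[N 12[]],N 204[N 103[]],N 157[N 181[]],N 157[N 25[]],N 310[N 25[]],N 274[N 82[]]],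
N 98[N 260[N 145[],N 103[],N 180[],N 271[],N 103[],N 103[],N 180[],N 180[],N 103[],N 300[],N 103[],
N 204[],N 103[]],N 138[N 50[]],N 311[],N 123[N 50[]],N 123[],N 275[N 25[]],N 138[N 86[]],
N 161[N 25[]],N 248[N 301[]],N 138[],N 138[N 25[]],N 172[N 46[]],N 106[N 160[]],N 172[N 82[]]],
N 88[N 118[N 47[]],N 118[],N 98[N 133[]],N 123[N 196[]],N 207[N 36[]],N 49[N 275[],N 193[]],
N 161[N 181[]],N 98[N 177[]],N 186[],N 161[N 36[],N 133[]],N 312[],N 79[N 133[]],N 98[]],
N 88[N 118[N 124[]],N 118[],N 339[],N 249[],N 157[N 124[]],N 157[N 124[]],N 157[],N 186[],
N 157[N 96[]],N 249[N 68[]],N 340[],N 340[N 153[]],N 124[N 181[]]],N 58[N 106[N 1[]],N 1[],N 29[],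
N 1[],N 37[],N 20[],N 1[],N 15[],N 5[],N 1[],N 15[],N 5[],N 5[],N 1[],N 1[]],N 58[N 12[],N 12[],
N 71[],N 40[],N 20[],N 16[],N 94[],N 28[],N 20[],N 27[],N 28[],N 28[],N 20[],N 20[]],
N 98[N 85[N 33[]],N 69[],N 55[],N 1[],N 14[],N 5[],N 27[],N 5[],N 5[],N 1[],N 1[],N 1[],N 1[]],
N 115[N 37[],N 50[],N 19[],N 6[],N 26[],N 39[],N 37[],N 26[],N 39[],N 39[],N 37[],N 37[]],
N 88[N 186[],N 152[],N 26[],N 28[],N 20[],N 26[],N 28[],N 20[],N 20[],N 20[],N 20[]],
N 65[N 36[N 1[]],N 67[N 1[]],N 6[],N 124[],N 25[],N 5[],N 1[],N 5[],N 5[],N 1[],N 1[],N 1[],N 1[]],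
N 127[N 72[N 40[]],N 16[],N 87[],N 14[],N 15[],N 16[],N 40[],N 15[],N 15[]],N 41[N 125[],N 6[],
N 27[],N 5[],N 27[],N 6[],N 5[],N 5[]],N 98[N 123[],N 87[],N 78[],N 25[],N 1[],N 1[],N 1[],N 1[]],
N 127[N 270[],N 15[],N 35[],N 96[],N 15[],N 15[]],N 41[N 72[N 159[]],N 5[],N 21[],N 68[],N 5[],
N 5[]],N 106[N 15[N 5[],N 16[]],N 60[],N 5[],N 5[],N 16[],N 5[],N 5[]],N 106[N 29[N 5[]],N 1[],
N 1[],N 1[],N 1[],N 1[]],N 24[N 29[N 5[]],N 1[],N 1[],N 1[],N 1[]]],N 276[N 313[N 24[N 6[],N 6[],
N 12[],N 12[],N 6[],N 6[],N 6[],N 57[],N 57[],N 6[],N 50[],N 114[]],N 153[N 24[]],N 182[N 60[]],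
N 293[],N 182[N 160[]],N 153[N 24[]],N 153[N 24[]],N 250[],N 333[],N 153[],N 96[N 307[]],
N 182[N 153[]],N 182[],N 24[N 60[]]],N 274[N 43[N 6[],N 6[],N 71[],N 71[],N 40[],N 6[],N 24[],
N 24[],N 6[],N 6[],N 50[],N 6[]],N 230[N 60[]],N 250[],N 175[N 12[]],N 230[N 60[]],N 277[],N 367[],
N 54[N 160[]],N 309[],N 277[],N 368[],N 277[],N 314[],N 38[]],N 145[N 277[N 229[]],N 229[],N 126[],
N 126[],N 205[N 264[]],N 126[],N 207[],N 126[],N 204[X],N 205[X],N 228[X],N 205[],N 60[X]],
N 187[N 6[],N 6[],N 6[],N 40[],N 16[],N 6[],N 6[],N 6[],N 27[],N 6[],N 50[],N 6[],N 6[],N 6[]],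
N 187[N 12[],N 12[],N 40[],N 12[],N 12[],N 12[],N 12[],N 12[],N 27[],N 12[],N 202[],N 12[],N 12[],
N 12[]],N 150[N 315[],N 60[],N 40[],N 43[],N 160[],N 6[],N 6[],N 143[],N 6[],N 6[],N 50[],N 43[],
N 6[],N 6[]],N 262[N 269[],N 12[],N 121[],N 12[],N 12[],N 12[],N 143[],N 12[],N 198[],N 12[],N 12[],
N 12[]],N 126[N 38[N 95[]],N 12[],N 12[],N 12[],N 12[],N 25[],N 38[],N 12[],N 12[],N 12[],N 12[]],
N 187[N 6[],N 6[],N 6[],N 6[],N 6[],N 87[],N 6[],N 86[],N 6[],N 6[],N 6[]],N 187[N 40[],N 24[],
N 24[],N 16[],N 87[],N 27[],N 16[],N 86[],N 24[],N 24[],N 24[]],N 341[N 6[],N 6[],N 87[],N 70[],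
N 82[],N 6[],N 25[],N 6[],N 6[],N 6[]],N 310[N 369[],N 134[],N 175[],N 266[],N 121[],N 226[],N 54[],
N 27[],N 27[]],N 145[N 114[N 95[]],N 12[],N 25[],N 70[],N 6[],N 6[],N 6[],N 6[]],N 109[N 300[],
N 25[],N 25[],N 50[],N 164[],N 68[],N 25[]],N 146[N 201[],N 71[],N 16[],N 24[],N 6[]],
N 128[N 182[N 109[]],N 6[],N 6[],N 16[]],N 128[N 370[],N 6[],N 6[],N 16[]]],
N 316[N 116[N 66[N 170[N 128[]],N 128[],N 48[],N 48[],N 48[],N 43[],N 48[],N 38[],N 54[],N 48[],
N 23[],N 23[],N 23[]],N 31[N 53[]],N 53[],N 31[N 53[]],N 98[],N 31[N 73[]],N 60[N 69[]],
N 106[N 38[]],N 82[N 73[]],N 31[N 137[]],N 137[N 273[]],N 251[],N 106[],N 31[]],N 231[N 31[N 22[]],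
N 107[],N 99[],N 99[],N 123[],N 31[],N 170[],N 99[],N 156[],N 99[],N 156[N 18[]],N 172[],N 116[]],
N 238[N 278[N 46[]],N 69[],N 50[],N 22[],N 86[],N 43[],N 48[],N 43[],N 48[],N 22[],N 22[],N 22[],
N 22[],N 22[],N 22[]],N 238[N 70[],N 70[],N 22[],N 38[],N 38[],N 48[],N 70[],N 48[],N 22[],N 22[],
N 22[],N 22[],N 22[],N 22[]],N 217[N 342[N 31[]],N 107[N 109[]],N 70[],N 69[],N 31[],N 7[],N 48[],
N 70[],N 48[],N 7[],N 7[],N 7[],N 7[],N 7[],N 7[]],N 174[N 217[],N 25[],N 211[],N 54[],N 38[],
N 81[],N 7[],N 7[],N 7[],N 7[],N 7[],N 7[]],N 174[N 278[N 43[]],N 25[],N 109[],N 54[],N 38[],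
N 169[],N 7[],N 7[],N 7[],N 7[],N 7[],N 7[]],N 101[N 343[N 214[]],N 344[],N 48[],N 164[],N 171[],
N 18[],N 18[],N 86[],N 86[],N 18[],N 18[]],N 232[N 84[],N 70[],N 38[],N 70[],N 70[],N 25[],N 70[],
N 70[],N 70[]],N 232[N 344[N 18[]],N 18[],N 81[],N 156[],N 109[],N 18[],N 18[],N 18[],N 18[]],
N 188[N 101[N 109[]],N 23[],N 23[],N 7[],N 7[],N 7[],N 7[]],N 188[N 25[],N 77[],N 7[],N 7[],N 7[],
N 7[]],N 189[N 279[N 218[]],N 50[],N 23[],N 7[],N 7[]],N 189[N 313[],N 43[],N 23[],N 7[],N 7[]],
N 99[N 279[N 268[]],N 22[],N 54[]],N 99[N 123[],N 22[],N 54[]]],N 154[N 105[N 85[N 76[]],N 149[],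
N 85[N 76[]],N 316[],N 49[N 110[]],N 76[],N 85[N 142[]],N 135[],N 85[N 110[]],N 85[N 110[]],
N 170[N 135[]],N 279[],N 85[]],N 88[N 280[],N 118[],N 98[N 339[]],N 280[],N 251[],N 138[N 249[]],
N 183[],N 186[],N 186[],N 188[],N 312[],N 188[],N 123[]],N 47[N 76[],N 13[],N 80[],N 13[],N 13[],
N 13[],N 21[],N 36[],N 21[],N 273[],N 55[],N 21[],N 21[],N 59[],N 31[]],N 200[N 95[],N 102[],N 13[],
N 13[],N 13[],N 230[],N 55[],N 13[],N 78[],N 13[],N 75[],N 55[],N 59[],N 13[]],N 231[N 76[],N 31[],
N 55[],N 21[],N 21[],N 36[],N 47[],N 21[],N 75[],N 55[],N 21[],N 59[],N 47[]],N 99[N 280[],N 138[],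
N 132[],N 31[],N 101[],N 80[],N 101[],N 80[],N 80[],N 80[],N 151[],N 80[]],N 88[N 21[],N 36[],
N 21[],N 13[],N 75[],N 21[],N 59[],N 66[],N 13[],N 13[]],N 76[N 82[],N 110[],N 66[],N 36[],N 21[],
N 31[],N 224[],N 21[],N 21[],N 133[],N 21[]],N 170[N 306[],N 49[],N 49[],N 222[],N 101[],N 101[],
N 36[],N 102[],N 167[],N 36[]],N 105[N 47[],N 21[],N 49[],N 21[],N 21[],N 13[],N 59[],N 13[]],
N 135[N 136[],N 78[],N 78[],N 150[],N 21[],N 82[],N 246[],N 21[]],N 231[N 105[],N 13[],N 75[],
N 66[],N 78[],N 59[],N 13[]],N 105[N 343[],N 135[],N 75[],N 248[],N 301[],N 75[]],N 279[N 149[],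
N 49[],N 49[],N 132[],N 49[],N 49[]],N 345[N 151[],N 167[],N 219[],N 59[]],N 231[N 13[],N 21[],
N 13[]]],N 185[N 92[N 88[],N 220[],N 251[],N 88[],N 88[],N 88[],N 249[],N 88[],N 228[],N 186[],
N 88[],N 88[],N 272[]],N 115[N 58[],N 33[],N 19[],N 58[],N 58[],N 65[],N 35[],N 33[],N 64[],N 35[],
N 33[],N 35[],N 46[],N 53[]],N 58[N 19[],N 60[],N 33[],N 19[],N 19[],N 314[],N 35[],N 33[],N 64[],
N 35[],N 33[],N 35[],N 212[],N 77[]],N 98[N 53[N 46[]],N 53[],N 215[],N 46[],N 243[],N 33[],N 302[],
N 33[],N 53[],N 46[],N 53[],N 33[],N 33[]],N 116[N 19[],N 19[],N 65[],N 112[],N 19[],N 64[],N 64[],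
N 112[],N 73[],N 46[],N 19[]],N 88[N 123[],N 176[],N 175[],N 64[],N 64[],N 64[],N 77[],N 104[],
N 77[],N 19[],N 19[]],N 190[N 160[],N 65[],N 73[],N 131[],N 73[],N 73[],N 73[],N 46[],N 65[]],
N 127[N 337[],N 266[],N 159[],N 35[],N 35[],N 60[],N 159[],N 214[]],N 63[N 41[],N 125[],N 41[],
N 41[],N 160[],N 158[],N 73[]],N 125[N 104[N 311[]],N 131[],N 223[],N 137[],N 132[],N 104[],N 104[],
N 137[]],N 63[N 112[],N 35[],N 65[],N 325[],N 92[],N 91[],N 137[]],N 41[N 159[],N 73[],N 108[],
N 228[],N 158[],N 73[]],N 116[N 63[],N 63[],N 46[],N 63[]],N 106[N 46[],N 46[],N 104[],N 192[],
N 176[]],N 116[N 77[],N 84[],N 92[]]],N 182[N 117[N 173[],N 173[],N 163[],N 242[],N 208[],N 173[],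
N 34[],N 162[],N 281[],N 203[],N 162[],N 162[],N 52[]],N 117[N 149[],N 42[],N 68[],N 90[],N 74[],
N 42[],N 42[],N 133[],N 52[],N 281[],N 308[],N 267[],N 162[],N 52[],N 52[]],N 149[N 121[],N 244[],
N 109[],N 268[],N 121[],N 114[],N 96[],N 297[],N 267[],N 163[],N 90[],N 90[],N 90[],N 90[]],
N 276[N 315[],N 200[],N 133[],N 74[],N 242[],N 97[],N 97[],N 74[],N 74[],N 74[],N 74[],N 74[]],
N 371[N 152[],N 92[],N 278[],N 176[],N 42[],N 152[],N 196[],N 315[],N 42[],N 42[],N 42[],N 42[]],
N 135[N 10[],N 10[],N 10[],N 119[],N 120[],N 100[],N 10[],N 10[],N 10[],N 10[]],N 190[N 239[],
N 119[],N 93[],N 120[],N 10[],N 10[],N 10[],N 10[],N 10[]],N 146[N 119[],N 120[],N 120[],N 10[],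
N 154[],N 10[],N 10[],N 10[]],N 227[N 96[],N 203[],N 239[],N 96[],N 124[],N 124[],N 119[],N 119[]],
N 113[N 341[],N 148[],N 97[],N 105[],N 177[],N 120[],N 120[]],N 146[N 190[],N 109[],N 110[],N 228[],
N 100[],N 100[]],N 135[N 10[],N 10[],N 10[],N 10[],N 10[]],N 144[N 68[],N 92[],N 154[],N 10[],
N 10[]],N 117[N 10[],N 199[],N 93[]],N 135[N 10[],N 10[],N 10[]]],N 32[N 4[N 117[N 1[]],N 29[],
N 1[],N 29[],N 37[],N 29[],N 1[],N 8[],N 0[],N 1[],N 8[],N 0[],N 0[],N 0[],N 1[]],N 4[N 24[N 20[]],
N 29[],N 20[],N 29[],N 20[],N 20[],N 20[],N 8[],N 0[],N 20[],N 8[],N 0[],N 0[],N 0[],N 20[]],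
N 24[N 29[]],N 4[N 37[]],N 149[N 20[]],N 24[N 20[]],N 24[N 4[]],N 58[N 14[]],N 4[N 1[]],N 24[],
N 17[N 45[],N 45[]],N 107[],N 44[N 45[]],N 85[N 0[]],N 139[N 0[]],N 47[N 0[]],N 139[]],
N 32[N 2[N 24[N 247[]],N 12[],N 24[],N 40[],N 24[],N 43[],N 11[],N 3[],N 9[],N 11[],N 3[],N 3[],
N 3[],N 20[]],N 24[N 12[]],N 53[N 40[]],N 2[N 40[]],N 24[N 2[]],N 24[N 13[]],N 2[N 16[]],
N 38[N 43[],N 86[]],N 24[],N 128[],N 107[],N 44[N 9[]],N 149[N 17[]],N 139[N 3[]],N 58[N 17[]],
N 139[]],N 32[N 23[N 76[N 69[]],N 25[],N 47[],N 69[],N 151[],N 47[],N 1[],N 14[],N 5[],N 1[],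
N 111[],N 5[],N 1[],N 1[]],N 128[N 69[]],N 53[N 111[]],N 346[N 75[]],N 139[N 70[]],N 107[N 21[]],
N 23[N 55[],N 16[]],N 76[N 1[]],N 44[N 14[]],N 128[],N 107[],N 44[N 45[]],N 85[N 17[]],
N 139[N 17[]],N 47[N 17[]],N 139[]],N 116[N 84[N 4[N 26[]],N 26[],N 65[],N 4[],N 4[],N 8[],N 143[],
N 221[],N 4[],N 26[],N 4[],N 4[]],N 99[N 39[]],N 19[N 65[],N 65[]],N 4[],N 112[N 221[]],N 115[],
N 84[N 0[]],N 99[N 6[]],N 112[N 64[]],N 0[N 39[],N 221[]],N 106[],N 115[],N 4[N 37[]]],
N 173[N 154[N 2[],N 10[],N 94[],N 2[],N 3[],N 20[],N 2[],N 20[],N 2[],N 2[]],N 105[N 149[],N 2[],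
N 121[],N 11[],N 3[],N 2[],N 3[],N 3[],N 3[],N 2[],N 2[]],N 105[N 197[]],N 2[N 79[]],N 34[N 42[]],
N 105[N 2[]],N 26[N 11[]],N 135[N 9[]],N 105[],N 233[N 2[]],N 209[],N 199[N 20[]],N 233[N 2[]]],
N 185[N 127[N 14[],N 9[],N 9[],N 14[],N 11[],N 2[],N 14[],N 2[],N 2[]],N 190[N 1[]],N 127[N 14[]],
N 63[N 3[]],N 79[N 1[]],N 63[N 11[]],N 41[N 14[]],N 63[N 11[],N 3[]],N 23[N 20[],N 20[]],N 2[N 7[],
N 7[]],N 2[N 1[],N 1[]]],N 4[N 190[N 76[],N 25[],N 14[],N 5[],N 1[],N 5[],N 5[],N 1[],N 1[],N 1[],
N 1[]],N 140[N 69[]],N 117[N 52[],N 114[]],N 140[N 7[]],N 8[N 14[]],N 140[],N 6[N 1[],N 87[]],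
N 8[N 131[]],N 162[N 0[]],N 140[N 8[]],N 92[N 0[]],N 51[]],N 56[N 72[N 24[],N 14[],N 16[],N 86[],
N 16[],N 24[],N 16[],N 24[],N 18[]],N 15[N 24[]],N 27[N 67[],N 57[]],N 134[N 69[],N 86[]],
N 24[N 14[]],N 72[N 16[]],N 112[N 16[]],N 24[N 69[]],N 15[]],N 62[N 83[N 38[],N 27[],N 27[],N 6[],
N 6[],N 25[]],N 83[N 84[N 27[]],N 67[],N 67[],N 27[],N 27[],N 38[],N 169[]],N 30[N 9[]],N 83[N 6[]],
N 83[N 27[]],N 41[N 67[]],N 136[N 140[]],N 144[N 12[]],N 30[]],N 83[N 29[N 203[N 178[]],N 1[],
N 101[],N 166[],N 167[],N 7[],N 13[],N 7[]],N 29[N 71[N 6[]],N 1[],N 166[],N 78[],N 7[],N 13[],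
N 7[]],N 347[N 166[]],N 184[N 89[]],N 155[N 61[]],N 155[N 13[]],N 29[N 6[]],N 113[N 20[]],
N 29[N 166[]]],N 56[N 83[N 63[N 84[]],N 84[],N 93[],N 75[],N 75[],N 63[],N 34[],N 91[]],N 15[N 9[]],
N 127[N 84[]],N 281[N 297[],N 227[]],N 112[N 63[]],N 117[N 163[],N 121[]],N 15[]],N 62[N 72[N 14[],
N 18[],N 36[],N 36[],N 10[],N 18[]],N 72[N 171[N 67[]],N 14[],N 18[],N 49[],N 100[],N 18[]],
N 30[N 67[]],N 41[N 72[]],N 136[N 197[]],N 144[N 90[]],N 30[]],N 116[N 56[N 62[N 7[]],N 170[],N 5[],
N 23[],N 3[],N 7[],N 5[]],N 56[N 15[],N 23[],N 23[],N 15[]],N 106[N 27[]],N 106[],N 62[N 8[],N 8[]],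
N 62[N 8[],N 8[]]],N 115[N 185[N 1[],N 3[],N 3[]],N 116[],N 106[],N 116[],N 62[N 1[],N 1[]]],
N 209[N 162[N 117[],N 1[],N 29[],N 15[],N 1[]],N 173[N 29[],N 1[],N 23[],N 1[]],N 72[N 29[]],
N 233[N 15[]],N 72[N 1[]]]])"
  by (simp only: check_simps cyc_simps exc_state_def forced_M.simps forced_F.simps
    list.inject numeral_eq_iff num.inject num.distinct)

text \<open>Entries \<open>(x, y, p, q)\<close>: the walk \<open>p\<close> between the two ends given in the check and the walk
  \<open>q\<close> from \<open>x\<close> to \<open>y\<close> partition the vertices.\<close>

definition ok_two :: "nat \<Rightarrow> nat \<Rightarrow> nat \<times> nat \<times> nat \<times> nat \<Rightarrow> bool" where
  "ok_two s t e \<longleftrightarrow> (case e of (x, y, p, q) \<Rightarrow>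
     length (trail s (nb p)) + length (trail x (nb q)) = 14 \<and>
     last (s # map snd (trail s (nb p))) = t \<and> last (x # map snd (trail x (nb q))) = y \<and>
     distinct (s # map snd (trail s (nb p)) @ x # map snd (trail x (nb q))))"

text \<open>Only even \<open>x\<close> and odd \<open>y\<close> are listed; reversing the second
  path gives the other order.\<close>

definition two_table_adjacent :: "(nat \<times> nat \<times> nat \<times> nat) list" where
  "two_table_adjacent = [(3,1,7,122178632),(3,2,7,119032905),(3,4,7,118627912),(3,7,7,122035736),(3,11,7,77380040),(3,13,7,
80431304),(3,14,7,102642120),(5,1,7,126127236),(5,2,7,126983556),(5,4,7,118627617),(5,7,7,
122035492),(5,11,7,80184516),(5,13,7,74217156),(5,14,7,86848196),(6,1,7,125011140),(6,2,7,74745028),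
(6,4,7,122047588),(6,7,7,118639713),(6,11,7,97748164),(6,13,7,114500036),(6,14,7,113730756),(9,1,7,
86061345),(9,2,7,103166241),(9,4,7,121185057),(9,7,7,75903265),(9,11,7,80089874),(9,13,7,80290593),
(9,14,7,85739825),(10,1,7,86274340),(10,2,7,73478436),(10,4,7,76689700),(10,7,7,121135908),(10,11,7,
97653522),(10,13,7,85739636),(10,14,7,80241444),(12,1,7,125377412),(12,2,7,105280644),(12,4,7,
71857284),(12,7,7,85488772),(12,11,7,98640772),(12,13,7,115417889),(12,14,7,115631972),(15,1,7,
101855620),(15,2,7,121129860),(15,4,7,85537156),(15,7,7,71905668),(15,11,7,82077572),(15,13,7,
115138868),(15,14,7,102572337)]"

definition two_table_far :: "(nat \<times> nat \<times> nat \<times> nat) list" where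
  "two_table_far = [(3,1,73,6506003),(3,2,88,6768147),(3,4,88,7936312),(3,8,88,4490456),(3,11,88,5342424),(3,13,88,
6365656),(3,14,88,6579416),(5,1,97,7627060),(5,2,100,7414068),(5,4,100,5981715),(5,8,100,6579428),
(5,11,100,6365668),(5,13,100,5342436),(5,14,100,4490468),(6,1,97,7414065),(6,2,100,7627057),(6,4,
100,5052494),(6,8,100,4928654),(6,11,100,6409758),(6,13,100,7555358),(6,14,100,4667470),(9,1,97,
7134340),(9,2,100,6603908),(9,4,100,5082840),(9,8,100,6582705),(9,11,100,6369716),(9,13,100,
7451160),(9,14,100,4777160),(10,1,97,6407300),(10,2,100,6607236),(10,4,100,5015099),(10,8,100,
4592411),(10,11,100,5392155),(10,13,100,7571003),(10,14,100,4793115),(12,1,97,6415460),(12,2,100,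
7627596),(12,4,100,5083629),(12,8,100,4599372),(12,11,100,5366993),(12,13,100,7451745),(12,14,100,
4791884),(15,1,97,7627548),(15,2,100,6612068),(15,4,100,5014764),(15,8,100,4515012),(15,11,100,
5366980),(15,13,100,7450916),(15,14,100,5787213)]"

lemma two_table_adjacent_ok: "list_all (ok_two 8 0) two_table_adjacent"
  by (simp add: two_table_adjacent_def ok_two_def trail_simps del: One_nat_def)

lemma two_table_far_ok: "list_all (ok_two 0 7) two_table_far"
  by (simp add: two_table_far_def ok_two_def trail_simps del: One_nat_def)

lemma two_table_adjacent_complete:
  "map (\<lambda>(x, y, p, q). (x, y)) two_table_adjacent = List.product [3,5,6,9,10,12,15] [1,2,4,7,11,13,14]"
  by (simp add: two_table_adjacent_def del: One_nat_def)

lemma two_table_far_complete: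
  "map (\<lambda>(x, y, p, q). (x, y)) two_table_far = List.product [3,5,6,9,10,12,15] [1,2,4,8,11,13,14]"
  by (simp add: two_table_far_def del: One_nat_def)

text \<open>Entries \<open>(x, y, p, y', p')\<close> for the exceptional configuration in normal form.\<close>

definition exc_state0 :: "status list" where
  "exc_state0 = [No,No,No,No,No,No,No,No,No,No,No,No,No,No,No,No,No,No,No,No,No,No,No,No,Mf,No,No,Mf,No,Mf,Mf,Ff]"

text \<open>The first components are the eight vertices not covered by the edges 24, 27, 29 and 30.
  Two possible ends for each of them allow any one vertex to be avoided.\<close>

definition exc_table :: "(nat \<times> nat \<times> nat \<times> nat \<times> nat) list" where
  "exc_table = [(1,10,1938584499,12,1934406515),(2,9,1941130419,12,2067483827),(4,9,1936952435,10,2000129139),(7,9,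
2000139084,10,1936962380),(9,2,1938584499,4,1934406515),(10,1,1941130419,4,2067483827),(12,1,
1936952435,2,2000129139),(15,1,2000139084,2,1936962380)]"

definition ok_exc :: "nat \<times> nat \<times> nat \<times> nat \<times> nat \<Rightarrow> bool" where
  "ok_exc e \<longleftrightarrow> (case e of (x, y, p, y', p') \<Rightarrow> y \<noteq> y' \<and>
     ham_dist (vtx x) (vtx y) = 3 \<and> ham_dist (vtx x) (vtx y') = 3 \<and>
     ok_trail x y (trail x (nb p)) \<and> okc (mask (trail x (nb p))) exc_state0 \<and>
     ok_trail x y' (trail x (nb p')) \<and> okc (mask (trail x (nb p'))) exc_state0)"

lemma exc_table_ok: "list_all ok_exc exc_table"
  by (simp add: exc_table_def ok_exc_def ok_trail_def exc_state0_def trail_simps ham_dist_def vtx_def del: One_nat_def)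

section \<open>From certificates to paths\<close>

lemma ixs_eq: "ixs = [0..<32]"
  by (simp add: ixs_def upt_rec)

lemma lt_list_all: "list_all P [0..<n] \<Longrightarrow> j < n \<Longrightarrow> P j"
  by (simp add: list_all_iff)

lemma length_es: "length es = 32"
  by (simp add: es_def)

lemma vtx_inj: "inj_on vtx {..<16}"
proof (rule inj_on_inverseI)
  define val where "val xs = foldl (\<lambda>n b. 2 * n + (if b then 1 else 0)) (0::nat) xs" for xs
  have "list_all (\<lambda>v. val (vtx v) = v) [0..<16]" by (simp add: val_def vtx_def upt_rec)
  then show "val (vtx v) = v" if "v \<in> {..<16}" for v using that lt_list_all by fastforce
qed

lemma length_vtx [simp]: "length (vtx v) = 4"
  by (simp add: vtx_def)

lemma verts4: "verts (cube 4) = vtx ` {..<16}"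
proof (rule card_subset_eq[symmetric])
  show "card (vtx ` {..<16}) = card (verts (cube 4))" by (simp add: card_image vtx_inj card_verts_cube)
qed auto

lemma vtxE:
  assumes "length x = 4"
  obtains v where "v < 16" "x = vtx v"
  using assms verts4 by (metis imageE lessThan_iff verts_cube)

lemma es_props: "list_all (\<lambda>e. fst e < snd e \<and> snd e < 16 \<and> ham_dist (vtx (fst e)) (vtx (snd e)) = 1) es"
  by (simp add: es_def ham_dist_def vtx_def)

lemma es_nth:
  assumes "j < 32"
  shows "fst (es ! j) < snd (es ! j)" "snd (es ! j) < 16" "ed j \<in> edges (cube 4)"
proof -
  have "es ! j \<in> set es" using assms length_es by simp
  then have "fst (es ! j) < snd (es ! j) \<and> snd (es ! j) < 16 \<and> ham_dist (vtx (fst (es ! j))) (vtx (snd (es ! j))) = 1"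
    using es_props unfolding list_all_iff by blast
  then show "fst (es ! j) < snd (es ! j)" "snd (es ! j) < 16" "ed j \<in> edges (cube 4)"
    by (simp_all add: ed_def edge_iff_ham_dist)
qed

lemma distinct_es: "distinct es"
  by (simp add: es_def)

lemma ed_inj: "inj_on ed {..<32}"
proof (rule inj_onI)
  fix j k assume jk: "j \<in> {..<32}" "k \<in> {..<32}" "ed j = ed k"
  note p = es_nth(1,2)[of j] es_nth(1,2)[of k]
  have v: "vtx a = vtx b \<longleftrightarrow> a = b" if "a < 16" "b < 16" for a b
    using inj_on_eq_iff[OF vtx_inj] that by simp
  have "fst (es ! j) = fst (es ! k) \<and> snd (es ! j) = snd (es ! k)"
    using jk p unfolding ed_def doubleton_eq_iff by (auto simp: v)
  then have "es ! j = es ! k" by (simp add: prod_eq_iff)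
  then show "j = k" using jk distinct_es length_es by (simp add: nth_eq_iff_index_eq)
qed

text \<open>\<open>ed\<close> is injective on 32 indices, and the cube has eight edges in each of
  its four dimensions.\<close>

lemma edges4: "edges (cube 4) = ed ` {..<32}"
proof (rule card_subset_eq[symmetric])
  have "cross 3 i (edges (cube (Suc 3))) = verts (cube 3)" for i
    using cross_edge_in_edges[of _ 3 i] by (auto simp: cross_def)
  then have "card (edges (cube (Suc 3))) = (\<Sum>i\<le>(3::nat). 8)"
    using card_eq_sum_cross[OF subset_refl, of 3] by (simp add: card_verts_cube)
  then show "card (ed ` {..<32}) = card (edges (cube 4))" by (simp add: card_image ed_inj)
qed (auto simp: es_nth)

definition idx :: "bool list set set \<Rightarrow> nat set" where
  "idx S = {j. j < 32 \<and> ed j \<in> S}"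

lemma ed_idx: "S \<subseteq> edges (cube 4) \<Longrightarrow> ed ` idx S = S"
  unfolding idx_def edges4 by auto

lemma card_idx: "S \<subseteq> edges (cube 4) \<Longrightarrow> card (idx S) = card S"
proof -
  have "inj_on ed (idx S)" by (rule inj_on_subset[OF ed_inj]) (auto simp: idx_def)
  then show "S \<subseteq> edges (cube 4) \<Longrightarrow> card (idx S) = card S" using card_image ed_idx by metis
qed

lemma length_row: "length (row i) = 32"
  by (simp add: row_def length_es)

lemma row_Same: "i < 32 \<Longrightarrow> j < 32 \<Longrightarrow> row i ! j = Same \<longleftrightarrow> i = j"
  using distinct_es length_es by (auto simp: row_def nth_eq_iff_index_eq)

lemma row_Touch:
  assumes "i < 32" "j < 32"
  shows "row i ! j = Touch \<longleftrightarrow> i \<noteq> j \<and> ed i \<inter> ed j \<noteq> {}"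
proof -
  have v: "vtx a = vtx b \<longleftrightarrow> a = b" if "a < 16" "b < 16" for a b
    using inj_on_eq_iff[OF vtx_inj] that by simp
  have lt: "fst (es ! i) < 16" "fst (es ! j) < 16" using es_nth(1,2)[of i] es_nth(1,2)[of j] assms by linarith+
  have "es ! j = es ! i \<longleftrightarrow> i = j" using assms distinct_es length_es by (auto simp: nth_eq_iff_index_eq)
  then show ?thesis using assms lt es_nth(2)[of i] es_nth(2)[of j]
    by (auto simp: row_def ed_def length_es v)
qed

lemma st_ok:
  assumes "v < 16"
  shows "fst (st v a b) < 32" "snd (st v a b) < 16" "ed (fst (st v a b)) = {vtx v, vtx (snd (st v a b))}"
proof -
  have "list_all (\<lambda>k. fst (stt ! k) < 32 \<and> snd (stt ! k) < 16 \<and>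
      (es ! fst (stt ! k) = (k div 4, snd (stt ! k)) \<or> es ! fst (stt ! k) = (snd (stt ! k), k div 4))) [0..<64]"
    by (simp add: stt_def es_def upt_rec)
  note * = lt_list_all[OF this, of "4 * v + (if a then 1 else 0) + (if b then 2 else 0)"]
  have "(4 * v + (if a then 1 else 0) + (if b then 2 else 0)) div 4 = v" by (cases a; cases b) simp_all
  moreover have "4 * v + (if a then 1 else 0) + (if b then 2 else 0) < 64" using assms by (cases a; cases b) simp_all
  ultimately have "fst (st v a b) < 32 \<and> snd (st v a b) < 16 \<and>
      (es ! fst (st v a b) = (v, snd (st v a b)) \<or> es ! fst (st v a b) = (snd (st v a b), v))"
    using * unfolding st_def by simp
  then show "fst (st v a b) < 32" "snd (st v a b) < 16" "ed (fst (st v a b)) = {vtx v, vtx (snd (st v a b))}"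
    by (auto simp: ed_def)
qed

lemma walk_range: "v < 16 \<Longrightarrow> e \<in> set (trail v ds) \<Longrightarrow> fst e < 32 \<and> snd e < 16"
  by (induction v ds rule: trail.induct) (auto simp: st_ok)

lemma walk_edges:
  "v < 16 \<Longrightarrow> path_edges (map vtx (v # map snd (trail v ds))) = ed ` fst ` set (trail v ds)"
proof (induction v ds rule: trail.induct)
  case (1 v a b ds)
  then show ?case using st_ok[OF "1.prems", of a b] by simp
qed auto

lemma setbit_eq: "setbit r C = map2 (\<lambda>r c. r = Same \<or> c) r C"
  by (induction r C rule: setbit.induct) auto

lemma mask_nth:
  assumes "\<forall>e\<in>set L. fst e < 32"
  shows "length (mask L) = 32 \<and> (\<forall>j<32. mask L ! j \<longleftrightarrow> j \<in> fst ` set L)"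
  using assms
proof (induction L)
  case (Cons x L)
  then show ?case using length_row[of "fst x"] by (auto simp: setbit_eq row_Same)
next
  case Nil
  have "mask [] = replicate 32 False" by (simp add: numeral_eq_Suc)
  then show ?case by (simp del: mask.simps)
qed

lemma set_all_vertices:
  assumes "distinct L" "length L = 16" "\<forall>v\<in>set L. v < 16"
  shows "distinct (map vtx L)" "set (map vtx L) = verts (cube 4)"
proof -
  have sub: "set L \<subseteq> {..<16}" using assms(3) by auto
  show "distinct (map vtx L)" using assms(1) inj_on_subset[OF vtx_inj sub] by (simp add: distinct_map)
  have "set L = {..<16}"
    using assms(1,2) by (intro card_subset_eq[OF _ sub]) (auto simp: distinct_card)
  then show "set (map vtx L) = verts (cube 4)" by (simp add: verts4)
qed

lemma walk_ham_path:
  assumes s: "s < 16" and ok: "ok_trail s t (trail s ds)" and C: "C = mask (trail s ds)"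
    and M: "M \<subseteq> {..<32}" "\<And>j. j \<in> M \<Longrightarrow> C ! j" and F: "F \<subseteq> {..<32}" "\<And>j. j \<in> F \<Longrightarrow> \<not> C ! j"
  shows "ham_path 4 (ed ` F) (ed ` M) (vtx s) (vtx t)"
proof -
  let ?L = "trail s ds"
  have rng: "\<forall>e\<in>set ?L. fst e < 32" "\<forall>v\<in>set (s # map snd ?L). v < 16"
    using walk_range[OF s] s by auto
  have nth: "C ! j \<longleftrightarrow> j \<in> fst ` set ?L" if "j < 32" for j using mask_nth[OF rng(1)] that C by blast
  have ne: "?L \<noteq> []" using ok by (auto simp: ok_trail_def)
  note all = set_all_vertices[of "s # map snd ?L", OF _ _ rng(2)]
  show ?thesis
  proof (rule ham_pathI[of "map vtx (s # map snd ?L)"])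
    show "last (map vtx (s # map snd ?L)) = vtx t"
      using ok ne by (simp add: ok_trail_def last_map)
    show "path_edges (map vtx (s # map snd ?L)) \<subseteq> edges (cube 4) - ed ` F"
    proof -
      have "ed j \<notin> ed ` F" if "j \<in> fst ` set ?L" for j
      proof
        assume "ed j \<in> ed ` F"
        then obtain k where k: "k \<in> F" "ed j = ed k" by blast
        moreover have "j < 32" using that rng(1) by auto
        ultimately have "j = k" using inj_onD[OF ed_inj, of j k] F(1) by auto
        then show False using F(2)[OF k(1)] nth \<open>j < 32\<close> that by blast
      qed
      moreover have "ed j \<in> edges (cube 4)" if "j \<in> fst ` set ?L" for j using that rng(1) es_nth(3) by auto
      ultimately show ?thesis unfolding walk_edges[OF s] by blast
    qed
    show "ed ` M \<subseteq> path_edges (map vtx (s # map snd ?L))"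
      unfolding walk_edges[OF s] using M nth by (intro image_mono) auto
    show "distinct (map vtx (s # map snd ?L))" "set (map vtx (s # map snd ?L)) = verts (cube 4)"
      using all ok by (auto simp: ok_trail_def)
  qed simp_all
qed

lemma path_mask_walk:
  assumes "ok_trail s t (trail s (nb p\<^sub>0))"
  shows "\<exists>ds. ok_trail s t (trail s ds) \<and> path_mask s t p\<^sub>0 p = mask (trail s ds)"
  using assms unfolding path_mask_def by auto

lemma cyc_ok: "\<exists>ds. ok_trail 8 0 (trail 8 ds) \<and> cyc k = mask (trail 8 ds)"
  unfolding cyc_def by (rule path_mask_walk) (simp add: ok_trail_def nb_numeral st_simps del: One_nat_def)

lemma hp_ok: "\<exists>ds. ok_trail 0 7 (trail 0 ds) \<and> hp k = mask (trail 0 ds)"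
  unfolding hp_def by (rule path_mask_walk) (simp add: ok_trail_def nb_numeral st_simps del: One_nat_def)

lemma length_mask_walk: "v < 16 \<Longrightarrow> length (mask (trail v ds)) = 32"
  using mask_nth[of "trail v ds"] walk_range[of v] by blast

interpretation far: checker row badM4 badF4 no_state hp 32
  "\<lambda>M F. ham_path 4 (ed ` F) (ed ` M) (vtx 0) (vtx 7)"
proof
  fix k show "length (hp k) = 32" using hp_ok[of k] length_mask_walk[of 0] by auto
next
  fix k M F assume "M \<subseteq> {..<32}" "F \<subseteq> {..<32}" "\<And>j. j \<in> M \<Longrightarrow> hp k ! j" "\<And>j. j \<in> F \<Longrightarrow> \<not> hp k ! j"
  then show "ham_path 4 (ed ` F) (ed ` M) (vtx 0) (vtx 7)" using hp_ok[of k] walk_ham_path[of 0 7] by auto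
qed (auto simp: badM4_def badF4_def ixs_eq length_row row_Same no_state_def)

interpretation adj: checker row badM4 badF4 no_state cyc 32
  "\<lambda>M F. ham_path 4 (ed ` F) (ed ` M) (vtx 8) (vtx 0)"
proof
  fix k show "length (cyc k) = 32" using cyc_ok[of k] length_mask_walk[of 8] by auto
next
  fix k M F assume "M \<subseteq> {..<32}" "F \<subseteq> {..<32}" "\<And>j. j \<in> M \<Longrightarrow> cyc k ! j" "\<And>j. j \<in> F \<Longrightarrow> \<not> cyc k ! j"
  then show "ham_path 4 (ed ` F) (ed ` M) (vtx 8) (vtx 0)" using cyc_ok[of k] walk_ham_path[of 8 0] by auto
qed (auto simp: badM4_def badF4_def ixs_eq length_row row_Same no_state_def)

lemma forced_eq:
  "set (forced_M is ss) = {i. \<exists>s. (i, s) \<in> set (zip is ss) \<and> s = Mf}"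
  "set (forced_F is ss) = {i. \<exists>s. (i, s) \<in> set (zip is ss) \<and> s = Ff}"
  by (induction "is" ss rule: forced_M.induct) auto

lemma zip_upt_mem: "length ss = 32 \<Longrightarrow> (j, s) \<in> set (zip ixs ss) \<longleftrightarrow> j < 32 \<and> s = ss ! j"
  by (auto simp: ixs_eq in_set_zip intro!: exI[of _ j])

text \<open>The normalised edge 24 is absent from \<open>M\<close> because it is removed before the
  search.\<close>

definition exc_idx :: "nat set \<Rightarrow> nat set \<Rightarrow> bool" where
  "exc_idx M F \<longleftrightarrow> M = {27, 29, 30} \<and> (\<exists>j\<in>{25, 26, 28, 31}. F = {j})"

interpretation mat: checker row badM4 badF4 exc_state cyc 32
  "\<lambda>M F. ham_path 4 (ed ` F) (ed ` M) (vtx 8) (vtx 0) \<or> exc_idx M F"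
proof
  fix k show "length (cyc k) = 32" by (rule adj.cy_length)
next
  fix k M F assume "M \<subseteq> {..<32}" "F \<subseteq> {..<32}" "\<And>j. j \<in> M \<Longrightarrow> cyc k ! j" "\<And>j. j \<in> F \<Longrightarrow> \<not> cyc k ! j"
  then show "ham_path 4 (ed ` F) (ed ` M) (vtx 8) (vtx 0) \<or> exc_idx M F" using adj.cy_R by blast
next
  fix ss assume ss: "length ss = 32" "exc_state ss"
  have "set (forced_M ixs ss) = {27, 29, 30}" "\<exists>j\<in>{25, 26, 28, 31}. set (forced_F ixs ss) = {j}"
    using ss(2) unfolding exc_state_def by auto
  then have "exc_idx {j. j < 32 \<and> ss ! j = Mf} {j. j < 32 \<and> ss ! j = Ff}"
    unfolding forced_eq exc_idx_def using ss(1) by (simp add: zip_upt_mem)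
  then show "ham_path 4 (ed ` {j. j < 32 \<and> ss ! j = Ff}) (ed ` {j. j < 32 \<and> ss ! j = Mf}) (vtx 8) (vtx 0) \<or>
      exc_idx {j. j < 32 \<and> ss ! j = Mf} {j. j < 32 \<and> ss ! j = Ff}" by blast
qed (auto simp: badM4_def badF4_def ixs_eq length_row row_Same)

lemma card_le_filter: "finite A \<Longrightarrow> card {j \<in> A. P j} \<le> card A"
  by (rule card_mono) auto

lemma matching_rows:
  assumes "good 4 M F" "i \<in> idx M" "j \<in> idx M"
  shows "row i ! j \<noteq> Touch"
proof
  assume t: "row i ! j = Touch"
  have ij: "i < 32" "j < 32" "ed i \<in> M" "ed j \<in> M" using assms(2,3) by (auto simp: idx_def)
  from t row_Touch[OF ij(1,2)] have "i \<noteq> j" "ed i \<inter> ed j \<noteq> {}" by auto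
  then have "ed i = ed j" using good_unique[OF assms(1) ij(3,4)] by blast
  then show False using \<open>i \<noteq> j\<close> inj_onD[OF ed_inj, of i j] ij by auto
qed

lemma idx_disjoint: "good n M F \<Longrightarrow> idx M \<inter> idx F = {}"
  unfolding good_def idx_def by blast

lemma finite_idx [simp]: "finite (idx S)"
  by (simp add: idx_def)

lemma idx_bound: "idx S \<subseteq> {..<32}"
  by (auto simp: idx_def)

lemma far_normal:
  assumes g: "good 4 M F" and w: "card M + 2 * card F \<le> 3"
  shows "ham_path 4 F M (vtx 0) (vtx 7)"
proof -
  have ME: "M \<subseteq> edges (cube 4)" "F \<subseteq> edges (cube 4)" using goodD[OF g] by auto
  let ?S = "map (\<lambda>r. MF) (row 0)"
  have "far.fits (Suc (Suc (Suc 0))) ?S (idx M) (idx F)"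
    unfolding far.fits_def
  proof (intro conjI)
    show "card {j \<in> idx M. ?S ! j \<noteq> Mf} + 2 * card {j \<in> idx F. ?S ! j \<noteq> Ff} \<le> Suc (Suc (Suc 0))"
      using card_le_filter[OF finite_idx, of M "\<lambda>j. ?S ! j \<noteq> Mf"] card_le_filter[OF finite_idx, of F "\<lambda>j. ?S ! j \<noteq> Ff"]
        w card_idx[OF ME(1)] card_idx[OF ME(2)] by linarith
    show "\<forall>i\<in>idx M. \<forall>j\<in>idx M. row i ! j \<noteq> Touch" using matching_rows[OF g] by blast
  qed (simp_all add: length_row idx_bound idx_disjoint[OF g])
  from far.check_sound(1)[OF check_far this] show ?thesis using ed_idx ME by simp
qed

lemma ed_24: "ed 24 = {vtx 0, vtx 8}"
  by (simp add: ed_def es_def)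

lemma adjacent_normal:
  assumes g: "good 4 M F" and w: "card M + 2 * card F \<le> 4" and e: "{vtx 8, vtx 0} \<notin> M"
  shows "ham_path 4 F M (vtx 8) (vtx 0)"
proof -
  have ME: "M \<subseteq> edges (cube 4)" "F \<subseteq> edges (cube 4)" using goodD[OF g] by auto
  let ?S = "map (\<lambda>r. case r of Same \<Rightarrow> Fo | Touch \<Rightarrow> MF | Apart \<Rightarrow> MF) (row 24)"
  have S: "?S ! j = (if j = 24 then Fo else MF)" if "j < 32" for j
    using that row_Same[of 24 j] length_row[of 24] by (auto split: rel.splits)
  have "24 \<notin> idx M" using e ed_24 by (auto simp: idx_def insert_commute)
  have "adj.fits (Suc (Suc (Suc (Suc 0)))) ?S (idx M) (idx F)"
    unfolding adj.fits_def
  proof (intro conjI)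
    show "card {j \<in> idx M. ?S ! j \<noteq> Mf} + 2 * card {j \<in> idx F. ?S ! j \<noteq> Ff} \<le> Suc (Suc (Suc (Suc 0)))"
      using card_le_filter[OF finite_idx, of M "\<lambda>j. ?S ! j \<noteq> Mf"] card_le_filter[OF finite_idx, of F "\<lambda>j. ?S ! j \<noteq> Ff"]
        w card_idx[OF ME(1)] card_idx[OF ME(2)] by linarith
    show "\<forall>i\<in>idx M. \<forall>j\<in>idx M. row i ! j \<noteq> Touch" using matching_rows[OF g] by blast
    show "\<forall>j<32. (j \<in> idx M \<longrightarrow> ?S ! j \<in> {Mf, MF, Mo}) \<and> (j \<in> idx F \<longrightarrow> ?S ! j \<in> {Ff, MF, Fo}) \<and>
        (?S ! j = Mf \<longrightarrow> j \<in> idx M) \<and> (?S ! j = Ff \<longrightarrow> j \<in> idx F)"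
      using S \<open>24 \<notin> idx M\<close> by (simp del: nth_map split: if_splits)
  qed (simp_all add: length_row idx_bound idx_disjoint[OF g])
  from adj.check_sound(1)[OF check_adjacent this] show ?thesis using ed_idx ME by simp
qed

lemma matching_normal:
  assumes g: "good 4 M F" and w: "card M + 2 * card F \<le> 6" and e: "{vtx 8, vtx 0} \<in> M"
  shows "ham_path 4 F (M - {{vtx 8, vtx 0}}) (vtx 8) (vtx 0) \<or> exc_idx (idx (M - {{vtx 8, vtx 0}})) (idx F)"
proof -
  let ?M = "M - {{vtx 8, vtx 0}}"
  have g': "good 4 ?M F" by (rule good_subset[OF g]) auto
  have ME: "?M \<subseteq> edges (cube 4)" "F \<subseteq> edges (cube 4)" using goodD[OF g'] by auto
  let ?S = "map (\<lambda>r. case r of Same \<Rightarrow> No | Touch \<Rightarrow> Fo | Apart \<Rightarrow> MF) (row 24)"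
  have S: "?S ! j = (if j = 24 then No else if row 24 ! j = Touch then Fo else MF)" if "j < 32" for j
    using that row_Same[of 24 j] length_row[of 24] by (auto split: rel.splits)
  have in24: "24 \<in> idx M" using e ed_24 by (auto simp: idx_def insert_commute)
  have n24: "24 \<notin> idx ?M" using ed_24 by (auto simp: idx_def insert_commute)
  have f24: "24 \<notin> idx F" using in24 idx_disjoint[OF g] by blast
  have touch: "row 24 ! j \<noteq> Touch" if "j \<in> idx ?M" for j
    using matching_rows[OF g in24, of j] that by (auto simp: idx_def)
  \<comment> \<open>The normalised edge takes one of the six units of weight.\<close>
  have c: "card ?M = card M - 1" "1 \<le> card M" using e goodD(3)[OF g] card_gt_0_iff[of M] by (auto simp: Suc_le_eq)
  have "mat.fits (Suc (Suc (Suc (Suc (Suc 0))))) ?S (idx ?M) (idx F)"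
    unfolding mat.fits_def
  proof (intro conjI)
    show "card {j \<in> idx ?M. ?S ! j \<noteq> Mf} + 2 * card {j \<in> idx F. ?S ! j \<noteq> Ff} \<le> Suc (Suc (Suc (Suc (Suc 0))))"
      using card_le_filter[OF finite_idx, of ?M "\<lambda>j. ?S ! j \<noteq> Mf"] card_le_filter[OF finite_idx, of F "\<lambda>j. ?S ! j \<noteq> Ff"]
        w card_idx[OF ME(1)] card_idx[OF ME(2)] c by linarith
    show "\<forall>i\<in>idx ?M. \<forall>j\<in>idx ?M. row i ! j \<noteq> Touch" using matching_rows[OF g'] by blast
    show "\<forall>j<32. (j \<in> idx ?M \<longrightarrow> ?S ! j \<in> {Mf, MF, Mo}) \<and> (j \<in> idx F \<longrightarrow> ?S ! j \<in> {Ff, MF, Fo}) \<and>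
        (?S ! j = Mf \<longrightarrow> j \<in> idx ?M) \<and> (?S ! j = Ff \<longrightarrow> j \<in> idx F)"
      using S n24 f24 touch by (simp del: nth_map split: if_splits)
  qed (simp_all add: length_row idx_bound idx_disjoint[OF g'])
  from mat.check_sound(1)[OF check_matching this] show ?thesis using ed_idx ME by simp
qed

lemma two_paths_of_walks:
  assumes s: "s < 16" "x < 16" and ok: "ok_two s t (x, y, p, q)"
  shows "two_paths 4 {} {} (vtx s) (vtx t) (vtx x) (vtx y)"
proof -
  let ?L = "trail s (nb p)" and ?K = "trail x (nb q)"
  have rng: "\<forall>v\<in>set (s # map snd ?L @ x # map snd ?K). v < 16" "\<forall>e\<in>set ?L \<union> set ?K. fst e < 32"
    using walk_range[OF s(1)] walk_range[OF s(2)] s by auto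
  have o: "length ?L + length ?K = 14" "last (s # map snd ?L) = t" "last (x # map snd ?K) = y"
    "distinct (s # map snd ?L @ x # map snd ?K)" using ok unfolding ok_two_def by auto
  note all = set_all_vertices[OF o(4) _ rng(1)]
  show ?thesis
  proof (rule two_pathsI[of "map vtx (s # map snd ?L)" "map vtx (x # map snd ?K)"])
    show "last (map vtx (s # map snd ?L)) = vtx t" "last (map vtx (x # map snd ?K)) = vtx y"
      using o(2,3) last_map[of "s # map snd ?L" vtx] last_map[of "x # map snd ?K" vtx] by simp_all
    show "path_edges (map vtx (s # map snd ?L)) \<union> path_edges (map vtx (x # map snd ?K)) \<subseteq> edges (cube 4) - {}"
      unfolding walk_edges[OF s(1)] walk_edges[OF s(2)] using rng(2) es_nth(3) by auto
  qed (use all o(1) in simp_all)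
qed

lemma two_table_entry:
  assumes "list_all (ok_two s t) tab" "map (\<lambda>(x, y, p, q). (x, y)) tab = List.product xs ys"
    "x \<in> set xs" "y \<in> set ys" "s < 16" "x < 16"
  shows "two_paths 4 {} {} (vtx s) (vtx t) (vtx x) (vtx y)"
proof -
  have "(x, y) \<in> set (map (\<lambda>(x, y, p, q). (x, y)) tab)" using assms(2-4) by simp
  then obtain p q where "(x, y, p, q) \<in> set tab" by auto
  then have "ok_two s t (x, y, p, q)" using assms(1) unfolding list_all_iff by blast
  then show ?thesis using two_paths_of_walks assms by blast
qed

lemma vtx_opposite:
  assumes "v < 16" "w < 16" "par (vtx v) \<noteq> par (vtx w)" "\<not> par (vtx v)"
  shows "v \<in> {0, 3, 5, 6, 9, 10, 12, 15} \<and> w \<in> {1, 2, 4, 7, 8, 11, 13, 14}"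
proof -
  have "list_all (\<lambda>v. if par (vtx v) then v \<in> {1, 2, 4, 7, 8, 11, 13, 14} else v \<in> {0, 3, 5, 6, 9, 10, 12, 15}) [0..<16]"
    by (simp add: par_def vtx_def upt_rec)
  from lt_list_all[OF this, of v] lt_list_all[OF this, of w] show ?thesis using assms by auto
qed

lemma two_paths_normal:
  assumes "length x = 4" "length y = 4" "par x \<noteq> par y"
  shows "x \<notin> {vtx 8, vtx 0} \<Longrightarrow> y \<notin> {vtx 8, vtx 0} \<Longrightarrow> two_paths 4 {} {} (vtx 8) (vtx 0) x y"
    "x \<notin> {vtx 0, vtx 7} \<Longrightarrow> y \<notin> {vtx 0, vtx 7} \<Longrightarrow> two_paths 4 {} {} (vtx 0) (vtx 7) x y"
proof -
  have *: "two_paths 4 {} {} (vtx s) (vtx t) x y"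
    if "list_all (ok_two s t) tab" "map (\<lambda>(x, y, p, q). (x, y)) tab = List.product xs ys"
      "set xs = {0, 3, 5, 6, 9, 10, 12, 15} - {s, t}" "set ys = {1, 2, 4, 7, 8, 11, 13, 14} - {s, t}" "s < 16"
      "x \<notin> {vtx s, vtx t}" "y \<notin> {vtx s, vtx t}" for s t tab xs ys
  proof -
    obtain v where v: "v < 16" "x = vtx v" using vtxE assms(1) by blast
    obtain w where w: "w < 16" "y = vtx w" using vtxE assms(2) by blast
    have ne: "v \<noteq> s" "v \<noteq> t" "w \<noteq> s" "w \<noteq> t" using that(6,7) v w by auto
    show ?thesis
    proof (cases "par (vtx v)")
      case False
      then have "v \<in> set xs" "w \<in> set ys" using vtx_opposite[of v w] v w assms(3) ne that(3,4) by auto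
      then show ?thesis using two_table_entry[OF that(1,2) _ _ that(5) v(1)] v w by blast
    next
      case True
      then have "w \<in> set xs" "v \<in> set ys" using vtx_opposite[of w v] v w assms(3) ne that(3,4) by auto
      then have "two_paths 4 {} {} (vtx s) (vtx t) y x" using two_table_entry[OF that(1,2) _ _ that(5) w(1)] v w by blast
      then show ?thesis by (rule two_paths_rev2)
    qed
  qed
  show "x \<notin> {vtx 8, vtx 0} \<Longrightarrow> y \<notin> {vtx 8, vtx 0} \<Longrightarrow> two_paths 4 {} {} (vtx 8) (vtx 0) x y"
    by (rule *[OF two_table_adjacent_ok two_table_adjacent_complete]) auto
  show "x \<notin> {vtx 0, vtx 7} \<Longrightarrow> y \<notin> {vtx 0, vtx 7} \<Longrightarrow> two_paths 4 {} {} (vtx 0) (vtx 7) x y"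
    by (rule *[OF two_table_far_ok two_table_far_complete]) auto
qed

lemma exc_normal:
  assumes "M \<subseteq> ed ` {24, 27, 29, 30}" "F \<subseteq> {ed 31}" "v \<in> {1, 2, 4, 7, 9, 10, 12, 15}"
  obtains y y' where "y \<noteq> y'" "ham_dist (vtx v) y = 3" "ham_dist (vtx v) y' = 3"
    "ham_path 4 F M (vtx v) y" "ham_path 4 F M (vtx v) y'"
proof -
  have "v \<in> set (map fst exc_table)" using assms(3) by (simp add: exc_table_def)
  then obtain y p y' p' where "(v, y, p, y', p') \<in> set exc_table" by auto
  then have ok: "ok_exc (v, y, p, y', p')" using exc_table_ok unfolding list_all_iff by blast
  have v: "v < 16" using assms(3) by auto
  have *: "ham_path 4 F M (vtx v) (vtx z)"
    if "ok_trail v z (trail v (nb q))" "okc (mask (trail v (nb q))) exc_state0" for z q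
  proof -
    have len: "length (mask (trail v (nb q))) = length exc_state0"
      using length_mask_walk[OF v] by (simp add: exc_state0_def)
    have "exc_state0 ! 24 = Mf \<and> exc_state0 ! 27 = Mf \<and> exc_state0 ! 29 = Mf \<and> exc_state0 ! 30 = Mf \<and> exc_state0 ! 31 = Ff"
      by (simp add: exc_state0_def)
    moreover have "length exc_state0 = 32" by (simp add: exc_state0_def)
    ultimately have "ham_path 4 (ed ` {31}) (ed ` {24, 27, 29, 30}) (vtx v) (vtx z)"
      using that(2) unfolding okc_iff[OF len] by (intro walk_ham_path[OF v that(1) refl]) auto
    then show ?thesis by (rule ham_path_mono) (use assms(1,2) in auto)
  qed
  have "vtx y \<noteq> vtx y'"
  proof
    assume "vtx y = vtx y'"
    moreover have "y < 16" "y' < 16"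
    proof -
      have "last (map snd (trail v ds)) < 16" if "length (trail v ds) = 15" for ds
        using walk_range[OF v, of _ ds] that last_in_set[of "map snd (trail v ds)"] by (cases "trail v ds") fastforce+
      then show "y < 16" "y' < 16" using ok unfolding ok_exc_def ok_trail_def by auto
    qed
    ultimately have "y = y'" using inj_onD[OF vtx_inj, of y y'] by simp
    then show False using ok by (simp add: ok_exc_def)
  qed
  then show ?thesis using that[of "vtx y" "vtx y'"] * ok unfolding ok_exc_def by auto
qed

section \<open>Automorphisms and the base case\<close>

text \<open>Preserving Hamming distance is enough: distance 0 gives injectivity and hence
  bijectivity on the finite cube, distance 1 adjacency, and odd distances parity.\<close>

definition isometry4 :: "(bool list \<Rightarrow> bool list) \<Rightarrow> bool" where
  "isometry4 f \<longleftrightarrow> (\<forall>x. length x = 4 \<longrightarrow> length (f x) = 4) \<and>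
     (\<forall>x y. length x = 4 \<longrightarrow> length y = 4 \<longrightarrow> ham_dist (f x) (f y) = ham_dist x y)"

lemma isometry4_bij:
  assumes "isometry4 f"
  shows "bij_betw f (verts (cube 4)) (verts (cube 4))"
proof -
  have inj: "inj_on f (verts (cube 4))"
    using assms ham_dist_0_iff unfolding isometry4_def by (intro inj_onI) (metis verts_cube)
  moreover have "f ` verts (cube 4) \<subseteq> verts (cube 4)" using assms unfolding isometry4_def by auto
  ultimately show ?thesis by (simp add: bij_betw_def endo_inj_surj)
qed

lemma isometry4_par:
  assumes "isometry4 f" "length x = 4" "length y = 4"
  shows "par (f x) \<noteq> par (f y) \<longleftrightarrow> par x \<noteq> par y"
  using assms odd_ham_dist[of x y] odd_ham_dist[of "f x" "f y"] unfolding isometry4_def by simp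

lemma isometry4_edge:
  assumes "isometry4 f" "e \<in> edges (cube 4)"
  shows "f ` e \<in> edges (cube 4)"
proof -
  obtain x y where "e = {x, y}" using assms(2) by (rule edgeE)
  then show ?thesis using assms unfolding isometry4_def by (simp add: edge_iff_ham_dist)
qed

lemma isometry4_inv:
  assumes "isometry4 f"
  obtains g where "isometry4 g" "\<And>x. length x = 4 \<Longrightarrow> f (g x) = x" "\<And>x. length x = 4 \<Longrightarrow> g (f x) = x"
proof
  let ?g = "inv_into (verts (cube 4)) f"
  note b = isometry4_bij[OF assms]
  show 1: "f (?g x) = x" if "length x = 4" for x using bij_betw_inv_into_right[OF b, of x] that by simp
  show "?g (f x) = x" if "length x = 4" for x using bij_betw_inv_into_left[OF b, of x] that by simp
  have 2: "length (?g x) = 4" if "length x = 4" for x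
    using bij_betwE[OF bij_betw_inv_into[OF b]] that by simp
  show "isometry4 ?g"
    using assms 1 2 unfolding isometry4_def by metis
qed

lemma isometry4_image_edges:
  assumes "isometry4 f" "M \<subseteq> edges (cube 4)"
  shows "inj_on ((`) f) (edges (cube 4))" "card ((`) f ` M) = card M" "(`) f ` M \<subseteq> edges (cube 4)"
proof -
  have "inj_on ((`) f) (Pow (verts (cube 4)))"
    using inj_on_image_Pow isometry4_bij[OF assms(1)] unfolding bij_betw_def by blast
  then show inj: "inj_on ((`) f) (edges (cube 4))" by (rule inj_on_subset) (auto dest: edge_subset_verts)
  show "card ((`) f ` M) = card M" by (rule card_image[OF inj_on_subset[OF inj assms(2)]])
  show "(`) f ` M \<subseteq> edges (cube 4)" using isometry4_edge[OF assms(1)] assms(2) by blast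
qed

lemma isometry4_good:
  assumes f: "isometry4 f" and g: "good 4 M F"
  shows "good 4 ((`) f ` M) ((`) f ` F)"
proof -
  note ME = goodD(1,2)[OF g]
  note inj = isometry4_image_edges(1)[OF f ME(1)]
  have "(`) f ` M \<inter> (`) f ` F = {}"
    using inj_on_image_Int[OF inj ME] g unfolding good_def by simp
  moreover have dj: "disjnt (f ` d) (f ` e)" if "d \<in> M" "e \<in> M" "d \<noteq> e" for d e
  proof -
    have "disjnt d e" using g that unfolding good_def pairwise_def by blast
    moreover have "d \<subseteq> verts (cube 4)" "e \<subseteq> verts (cube 4)" using ME(1) that edge_subset_verts by blast+
    ultimately show ?thesis
      using inj_on_image_Int[of f "verts (cube 4)" d e] isometry4_bij[OF f] unfolding bij_betw_def disjnt_def by auto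
  qed
  moreover have "pairwise disjnt ((`) f ` M)" using dj by (intro pairwiseI) blast
  ultimately show ?thesis using isometry4_image_edges(3)[OF f] ME unfolding good_def by simp
qed

text \<open>The path is carried back by the inverse \<open>g\<close>. The second claim stays on the
  side of images under \<open>f\<close>, where injectivity on edges later cancels
  \<open>f\<close>.\<close>

lemma path_pull_back:
  assumes f: "isometry4 f" and g: "isometry4 g" "\<And>x. length x = 4 \<Longrightarrow> g (f x) = x" "\<And>x. length x = 4 \<Longrightarrow> f (g x) = x"
    and E: "F \<subseteq> edges (cube 4)" "M \<subseteq> edges (cube 4)"
    and p: "set p \<subseteq> verts (cube 4)" "path_edges p \<subseteq> edges (cube 4) - (`) f ` F"
  shows "path_edges (map g p) \<subseteq> edges (cube 4) - F" "(`) f ` M \<inter> path_edges p \<subseteq> (`) f ` (M \<inter> path_edges (map g p))"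
proof -
  have gf: "g ` f ` e = e" if "e \<in> edges (cube 4)" for e
    using edge_subset_verts[OF that] g(2) by (force simp: image_image)
  have fg: "f ` g ` e = e" if "e \<in> edges (cube 4)" for e
    using edge_subset_verts[OF that] g(3) by (force simp: image_image)
  show "path_edges (map g p) \<subseteq> edges (cube 4) - F"
  proof
    fix e assume "e \<in> path_edges (map g p)"
    then obtain d where d: "d \<in> path_edges p" "e = g ` d" by (auto simp: path_edges_map)
    then have dE: "d \<in> edges (cube 4)" "d \<notin> (`) f ` F" using p(2) by auto
    have "e \<notin> F"
    proof
      assume "e \<in> F"
      then have "f ` e \<in> (`) f ` F" by blast
      then show False using d dE fg by simp
    qed
    then show "e \<in> edges (cube 4) - F" using isometry4_edge[OF g(1) dE(1)] d by simp
  qed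
  show "(`) f ` M \<inter> path_edges p \<subseteq> (`) f ` (M \<inter> path_edges (map g p))"
  proof
    fix d assume "d \<in> (`) f ` M \<inter> path_edges p"
    then obtain e where e: "e \<in> M" "d = f ` e" "d \<in> path_edges p" by blast
    then have "e = g ` d" using gf E(2) by auto
    then have "e \<in> path_edges (map g p)" using e(3) by (auto simp: path_edges_map)
    then show "d \<in> (`) f ` (M \<inter> path_edges (map g p))" using e by blast
  qed
qed

lemma set_map_inv:
  assumes "isometry4 g" "distinct p" "set p = verts (cube 4)"
  shows "distinct (map g p)" "set (map g p) = verts (cube 4)"
  using isometry4_bij[OF assms(1)] assms(2,3) unfolding bij_betw_def by (auto simp: distinct_map)

lemma ham_path_pull_back:
  assumes f: "isometry4 f" and E: "F \<subseteq> edges (cube 4)" "M \<subseteq> edges (cube 4)"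
    and l: "length u = 4" "length v = 4" and h: "ham_path 4 ((`) f ` F) ((`) f ` M) (f u) (f v)"
  shows "ham_path 4 F M u v"
proof -
  obtain g where g: "isometry4 g" "\<And>x. length x = 4 \<Longrightarrow> f (g x) = x" "\<And>x. length x = 4 \<Longrightarrow> g (f x) = x"
    using isometry4_inv[OF f] by metis
  obtain p where p: "p \<noteq> []" "hd p = f u" "last p = f v" "distinct p" "set p = verts (cube 4)"
    "path_edges p \<subseteq> edges (cube 4) - (`) f ` F" "(`) f ` M \<subseteq> path_edges p"
    using h unfolding ham_path_def by (elim exE conjE) (rule that; assumption)
  note b = path_pull_back[OF f g(1,3,2) E _ p(6)]
  show ?thesis
  proof (rule ham_pathI[of "map g p"])
    show "path_edges (map g p) \<subseteq> edges (cube 4) - F" using b(1) p(5) by simp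
    have sub: "(`) f ` M \<subseteq> (`) f ` (M \<inter> path_edges (map g p))" using b(2) p(5,7) by blast
    show "M \<subseteq> path_edges (map g p)"
    proof
      fix d assume d: "d \<in> M"
      obtain d' where d': "f ` d = f ` d'" "d' \<in> M \<inter> path_edges (map g p)"
        using subsetD[OF sub imageI[OF d]] by (rule imageE)
      then have "d \<in> edges (cube 4)" "d' \<in> edges (cube 4)" using E(2) d by blast+
      from inj_onD[OF isometry4_image_edges(1)[OF f E(2)] d'(1) this]
      show "d \<in> path_edges (map g p)" using d'(2) by simp
    qed
  qed (use p g(3) l set_map_inv[OF g(1) p(4,5)] in \<open>auto simp: hd_map last_map\<close>)
qed

lemma two_paths_pull_back:
  assumes f: "isometry4 f" and l: "length u = 4" "length v = 4" "length x = 4" "length y = 4"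
    and h: "two_paths 4 {} {} (f u) (f v) (f x) (f y)"
  shows "two_paths 4 {} {} u v x y"
proof -
  obtain g where g: "isometry4 g" "\<And>x. length x = 4 \<Longrightarrow> f (g x) = x" "\<And>x. length x = 4 \<Longrightarrow> g (f x) = x"
    using isometry4_inv[OF f] by metis
  obtain p q where p: "p \<noteq> []" "q \<noteq> []" "hd p = f u" "last p = f v" "hd q = f x" "last q = f y"
    "distinct (p @ q)" "set (p @ q) = verts (cube 4)" "path_edges p \<union> path_edges q \<subseteq> edges (cube 4) - {}"
    using h unfolding two_paths_def by (elim exE conjE) (rule that; assumption)
  have b: "path_edges (map g p) \<subseteq> edges (cube 4) - {}" "path_edges (map g q) \<subseteq> edges (cube 4) - {}"
    using path_pull_back(1)[OF f g(1,3,2), of "{}" "{}"] p(8,9) by auto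
  show ?thesis
  proof (rule two_pathsI[of "map g p" "map g q"])
    show "distinct (map g p @ map g q)" "set (map g p @ map g q) = verts (cube 4)"
      using set_map_inv[OF g(1) p(7,8)] by simp_all
  qed (use p g(3) l b in \<open>auto simp: hd_map last_map\<close>)
qed

section \<open>Moving a vertex or an edge to normal position\<close>

definition xor_list :: "bool list \<Rightarrow> bool list \<Rightarrow> bool list" where
  "xor_list x y = map (\<lambda>(a, b). a \<noteq> b) (zip x y)"

lemma length_xor_list [simp]: "length (xor_list x y) = min (length x) (length y)"
  by (simp add: xor_list_def)

lemma xor_list_simps [simp]: "xor_list [] y = []" "xor_list (a # x) (b # y) = (a \<noteq> b) # xor_list x y"
  by (simp_all add: xor_list_def)

text \<open>\<open>recentre i u\<close> moves position \<open>i\<close> to the front and \<open>u\<close> to the zero vertex.\<close>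

definition recentre :: "nat \<Rightarrow> bool list \<Rightarrow> bool list \<Rightarrow> bool list" where
  "recentre i u x = (x ! i \<noteq> u ! i) # xor_list (del i u) (del i x)"

lemma ham_dist_xor: "length w = length x \<Longrightarrow> length x = length y \<Longrightarrow>
    ham_dist (xor_list w x) (xor_list w y) = ham_dist x y"
  by (induction w x y rule: list_induct3) (auto simp: ham_dist_def)

lemma par_Cons: "par (c # x) \<longleftrightarrow> c \<noteq> par x"
  by (auto simp: par_def)

lemma par_xor: "length w = length x \<Longrightarrow> par (xor_list w x) \<longleftrightarrow> par w \<noteq> par x"
  by (induction w x rule: list_induct2) (auto simp: par_Cons, auto simp: par_def)

lemma ham_dist_Cons: "ham_dist (c # x) (d # y) = ham_dist x y + (if c = d then 0 else 1)"
  by (simp add: ham_dist_def)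

lemma isometry4_recentre:
  assumes "length u = 4" "i \<le> 3"
  shows "isometry4 (recentre i u)"
  unfolding isometry4_def
proof (intro conjI allI impI)
  fix x :: "bool list" assume x: "length x = 4"
  show "length (recentre i u x) = 4" using assms x by (simp add: recentre_def)
  fix y :: "bool list" assume y: "length y = 4"
  have d: "length (del i x) = 3" "length (del i y) = 3" "length (del i u) = 3" using assms x y by simp_all
  have "ham_dist x y = ham_dist (ins i (x ! i) (del i x)) (ins i (y ! i) (del i y))"
    using assms x y by (simp add: ins_del)
  also have "\<dots> = ham_dist (del i x) (del i y) + (if x ! i = y ! i then 0 else 1)"
    using d by (simp add: ham_dist_ins)
  finally show "ham_dist (recentre i u x) (recentre i u y) = ham_dist x y"
    using d unfolding recentre_def ham_dist_Cons by (auto simp: ham_dist_xor)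
qed

lemma recentre_ins:
  "length x = 3 \<Longrightarrow> i \<le> 3 \<Longrightarrow> recentre i u (ins i c x) = (c \<noteq> u ! i) # xor_list (del i u) x"
  by (simp add: recentre_def)

lemma xor_self: "xor_list x x = replicate (length x) False"
  by (induction x) auto

lemma vtx_simps: "vtx 0 = [False, False, False, False]" "vtx 7 = [False, True, True, True]"
  "vtx 8 = [True, False, False, False]"
  by (simp_all add: vtx_def)

lemma replicate_3: "replicate 3 False = [False, False, False]"
  by (simp add: numeral_eq_Suc)

lemma recentre_self: "length u = 4 \<Longrightarrow> i \<le> 3 \<Longrightarrow> recentre i u u = vtx 0"
  by (simp add: recentre_def xor_self vtx_simps replicate_3)

lemma recentre_neighbour:
  assumes "length z = 3" "i \<le> 3"
  shows "recentre i (ins i b z) (ins i (\<not> b) z) = vtx 8"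
  using assms by (simp add: recentre_ins xor_self vtx_simps replicate_3)

lemma recentre_edge:
  assumes "{u, v} \<in> edges (cube 4)"
  obtains i where "i \<le> 3" "recentre i v v = vtx 0" "recentre i v u = vtx 8"
proof -
  obtain i z where iz: "i \<le> 3" "length z = 3" "{u, v} = cross_edge i z"
    using edge_unique_dim[of "{u, v}" 3] assms by auto
  then obtain b where "v = ins i b z" "u = ins i (\<not> b) z"
    unfolding cross_edge_def doubleton_eq_iff by metis
  then show ?thesis using that[OF iz(1)] recentre_self[of v i] recentre_neighbour[OF iz(2,1)] iz by simp
qed

text \<open>Opposite parity without adjacency means distance 3 in dimension 4, so exactly one
  position agrees. Moving it to the front turns the pair into 0000 and 0111.\<close>

lemma recentre_far:
  assumes "length u = 4" "length v = 4" "par u \<noteq> par v" "{u, v} \<notin> edges (cube 4)"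
  obtains i where "i \<le> 3" "recentre i u u = vtx 0" "recentre i u v = vtx 7"
proof -
  obtain a b c d where u: "u = [a, b, c, d]" using assms(1) by (auto simp: numeral_eq_Suc length_Suc_conv)
  obtain a' b' c' d' where v: "v = [a', b', c', d']" using assms(2) by (auto simp: numeral_eq_Suc length_Suc_conv)
  have "ham_dist u v \<noteq> 1" "odd (ham_dist u v)"
    using assms odd_ham_dist[of u v] by (auto simp: edge_iff_ham_dist)
  then consider "a' = a" "b' = (\<not> b)" "c' = (\<not> c)" "d' = (\<not> d)" | "a' = (\<not> a)" "b' = b" "c' = (\<not> c)" "d' = (\<not> d)"
    | "a' = (\<not> a)" "b' = (\<not> b)" "c' = c" "d' = (\<not> d)" | "a' = (\<not> a)" "b' = (\<not> b)" "c' = (\<not> c)" "d' = d"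
    unfolding u v ham_dist_Cons
    by (cases "a = a'"; cases "b = b'"; cases "c = c'"; cases "d = d'"; simp add: ham_dist_def)
  then have "\<exists>i\<le>3. recentre i u v = vtx 7"
  proof cases
    case 1
    then show ?thesis by (intro exI[of _ 0]) (simp add: u v recentre_def del_def vtx_simps)
  next
    case 2
    then show ?thesis by (intro exI[of _ "Suc 0"]) (simp add: u v recentre_def del_def vtx_simps)
  next
    case 3
    then show ?thesis by (intro exI[of _ 2]) (simp add: u v recentre_def del_def vtx_simps)
  next
    case 4
    then show ?thesis by (intro exI[of _ 3]) (simp add: u v recentre_def del_def vtx_simps)
  qed
  then show ?thesis using that recentre_self[OF assms(1)] by blast
qed

section \<open>The four-dimensional statements\<close>

lemma path_ext_4: "path_ext 4"
  unfolding path_ext_def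
proof (intro allI impI)
  fix M F u v
  assume g: "good 4 M F" and w: "card M + 2 * card F \<le> 4 - 1" and l: "length u = 4" "length v = 4"
    and p: "par u \<noteq> par v" and uv: "{u, v} \<notin> M"
  note ME = goodD(1,2)[OF g]
  show "ham_path 4 F M u v"
  proof (cases "{u, v} \<in> edges (cube 4)")
    case True
    then obtain i where i: "i \<le> 3" "recentre i v v = vtx 0" "recentre i v u = vtx 8" by (rule recentre_edge)
    note f = isometry4_recentre[OF l(2) i(1)]
    have "recentre i v ` {u, v} \<notin> (`) (recentre i v) ` M"
      using inj_on_image_mem_iff[OF isometry4_image_edges(1)[OF f ME(1)] True ME(1)] uv by simp
    then have "ham_path 4 ((`) (recentre i v) ` F) ((`) (recentre i v) ` M) (vtx 8) (vtx 0)"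
      using adjacent_normal[OF isometry4_good[OF f g]] isometry4_image_edges(2)[OF f] ME w i by simp
    then show ?thesis using ham_path_pull_back[OF f ME(2,1) l] i by simp
  next
    case False
    then obtain i where i: "i \<le> 3" "recentre i u u = vtx 0" "recentre i u v = vtx 7"
      using recentre_far[OF l p] by metis
    note f = isometry4_recentre[OF l(1) i(1)]
    have "ham_path 4 ((`) (recentre i u) ` F) ((`) (recentre i u) ` M) (vtx 0) (vtx 7)"
      using far_normal[OF isometry4_good[OF f g]] isometry4_image_edges(2)[OF f] ME w by simp
    then show ?thesis using ham_path_pull_back[OF f ME(2,1) l] i by simp
  qed
qed

lemma adjacent_path_ext4: adjacent_path_ext4
  unfolding adjacent_path_ext4_def
proof (intro allI impI)
  fix M F u v
  assume g: "good 4 M F" and w: "card M + 2 * card F \<le> 4" and uv: "{u, v} \<in> edges (cube 4) - M"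
  note ME = goodD(1,2)[OF g]
  have l: "length u = 4" "length v = 4" using edge_length uv by blast+
  obtain i where i: "i \<le> 3" "recentre i v v = vtx 0" "recentre i v u = vtx 8"
    using recentre_edge uv by blast
  note f = isometry4_recentre[OF l(2) i(1)]
  have "recentre i v ` {u, v} \<notin> (`) (recentre i v) ` M"
    using inj_on_image_mem_iff[OF isometry4_image_edges(1)[OF f ME(1)] _ ME(1), of "{u, v}"] uv by simp
  then have "ham_path 4 ((`) (recentre i v) ` F) ((`) (recentre i v) ` M) (vtx 8) (vtx 0)"
    using adjacent_normal[OF isometry4_good[OF f g]] isometry4_image_edges(2)[OF f] ME w i by simp
  then show "ham_path 4 F M u v" using ham_path_pull_back[OF f ME(2,1) l] i by simp
qed

lemma paired_laceable_4: "paired_laceable 4"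
  unfolding paired_laceable_def
proof (intro allI impI)
  fix u v x y :: "bool list"
  assume l: "length u = 4" "length v = 4" "length x = 4" "length y = 4" and p: "par u \<noteq> par v" "par x \<noteq> par y"
    and ne: "u \<noteq> x" "u \<noteq> y" "v \<noteq> x" "v \<noteq> y"
  have image: "f x \<notin> {f u, f v}" "f y \<notin> {f u, f v}" "length (f x) = 4" "length (f y) = 4" "par (f x) \<noteq> par (f y)"
    if f: "isometry4 f" for f
  proof -
    have "inj_on f (verts (cube 4))" using isometry4_bij[OF f] by (simp add: bij_betw_def)
    then have eq: "f a = f b \<longleftrightarrow> a = b" if "length a = 4" "length b = 4" for a b
      using that by (simp add: inj_on_eq_iff)
    show "f x \<notin> {f u, f v}" "f y \<notin> {f u, f v}" using eq l ne by auto
    show "length (f x) = 4" "length (f y) = 4" using f l by (auto simp: isometry4_def)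
    show "par (f x) \<noteq> par (f y)" using isometry4_par[OF f l(3,4)] p by blast
  qed
  show "two_paths 4 {} {} u v x y"
  proof (cases "{u, v} \<in> edges (cube 4)")
    case True
    then obtain i where i: "i \<le> 3" "recentre i v v = vtx 0" "recentre i v u = vtx 8" by (rule recentre_edge)
    note f = isometry4_recentre[OF l(2) i(1)]
    show ?thesis
      using two_paths_pull_back[OF f l] two_paths_normal(1) image[OF f] i by simp
  next
    case False
    then obtain i where i: "i \<le> 3" "recentre i u u = vtx 0" "recentre i u v = vtx 7"
      using recentre_far[OF l(1,2) p(1)] by metis
    note f = isometry4_recentre[OF l(1) i(1)]
    show ?thesis
      using two_paths_pull_back[OF f l] two_paths_normal(2) image[OF f] i by simp
  qed
qed

text \<open>One inclusion is checked edge by edge; the common cardinality 4 gives the other.\<close>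

lemma normal_exc_edges:
  "ed ` {24, 27, 29, 30} = cross_edge 0 ` {z \<in> verts (cube 3). par z = False}"
  "ed ` {25, 26, 28, 31} = cross_edge 0 ` {z \<in> verts (cube 3). par z = True}"
  "ed 31 = cross_edge 0 [True, True, True]"
proof -
  have 1: "ed ` {24, 27, 29, 30} \<subseteq> cross_edge 0 ` {z \<in> verts (cube 3). par z = False}"
    by (auto simp: ed_def es_def vtx_def cross_edge_def ins_def par_def image_iff intro!: exI)
  have 2: "ed ` {25, 26, 28, 31} \<subseteq> cross_edge 0 ` {z \<in> verts (cube 3). par z = True}"
    by (auto simp: ed_def es_def vtx_def cross_edge_def ins_def par_def image_iff intro!: exI)
  have c: "card (cross_edge 0 ` {z \<in> verts (cube 3). par z = p}) = 4" for p
    using card_parity_class[of 0 p] by (simp add: parity_class_def)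
  have fin: "finite (cross_edge 0 ` {z \<in> verts (cube 3). par z = p})" for p
    by (intro finite_imageI rev_finite_subset[OF finite_verts_cube[of 3]]) auto
  have d: "card (ed ` {24, 27, 29, 30}) = 4" "card (ed ` {25, 26, 28, 31}) = 4"
    by (subst card_image[OF inj_on_subset[OF ed_inj]]; simp)+
  show "ed ` {24, 27, 29, 30} = cross_edge 0 ` {z \<in> verts (cube 3). par z = False}"
    by (rule card_subset_eq[OF fin 1]) (simp only: c d)
  show "ed ` {25, 26, 28, 31} = cross_edge 0 ` {z \<in> verts (cube 3). par z = True}"
    by (rule card_subset_eq[OF fin 2]) (simp only: c d)
  show "ed 31 = cross_edge 0 [True, True, True]"
    by (simp add: ed_def es_def vtx_def cross_edge_def ins_def)
qed

lemma ins_0: "ins 0 b x = b # x"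
  by (simp add: ins_def)

lemma recentre_cross_edge:
  assumes "length y = 3" "i \<le> 3"
  shows "recentre i u ` cross_edge i y = cross_edge 0 (xor_list (del i u) y)"
proof -
  have "{recentre i u (ins i False y), recentre i u (ins i True y)} =
      {ins 0 False (xor_list (del i u) y), ins 0 True (xor_list (del i u) y)}"
    using assms by (cases "u ! i") (auto simp: recentre_ins ins_0)
  then show ?thesis by (simp add: cross_edge_def)
qed

lemma exc_path_ext: exc_path_ext
  unfolding exc_path_ext_def
proof (intro allI impI)
  fix M F x z
  assume g: "good 4 M F" and ex: "exc 4 M F" and x: "length x = 4" "x \<notin> \<Union>M" and z: "z \<noteq> x"
  note ME = goodD(1,2)[OF g]
  obtain i p where i: "i \<le> 3" "M = parity_class i p" "F \<subseteq> cross_edge i ` verts (cube 3)"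
    using ex unfolding exc_def by blast
  obtain y where y: "F = {cross_edge i y}" "length y = 3"
    using excD(3)[OF ex] i(3) by (auto simp: card_1_singleton_iff)
  have py: "par y \<noteq> p"
  proof
    assume "par y = p"
    then have "cross_edge i y \<in> M" using y(2) i(2) by (auto simp: parity_class_def)
    then show False using g y(1) unfolding good_def by blast
  qed
  \<comment> \<open>The antipode of \<open>y\<close> in the three-dimensional cube. Recentring over
    it sends \<open>y\<close> to 111, hence the fault to edge 31, and as \<open>w\<close> has parity
    \<open>p\<close>, the matching goes to the even class.\<close>
  define w where "w = xor_list y [True, True, True]"
  have lw: "length w = 3" using y(2) by (simp add: w_def)
  have "par [True, True, True]" by (simp add: par_def)
  then have pw: "par w = p" using par_xor[of y "[True, True, True]"] y(2) py by (auto simp: w_def)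
  have wy: "xor_list w y = [True, True, True]"
    using y(2) by (auto simp: w_def numeral_eq_Suc length_Suc_conv)
  define u where "u = ins i False w"
  have u: "length u = 4" "del i u = w" "u ! i = False" using lw i(1) by (simp_all add: u_def)
  let ?f = "recentre i u"
  note f = isometry4_recentre[OF u(1) i(1)]
  have fM: "(`) ?f ` M \<subseteq> ed ` {24, 27, 29, 30}"
  proof
    fix e assume "e \<in> (`) ?f ` M"
    then obtain y' where y': "length y' = 3" "par y' = p" "e = ?f ` cross_edge i y'"
      unfolding i(2) parity_class_def by auto
    have "e = cross_edge 0 (xor_list w y')" using recentre_cross_edge[OF y'(1) i(1), of u] y'(3) u(2) by simp
    moreover have "\<not> par (xor_list w y')" using par_xor[of w y'] lw y'(1,2) pw by simp
    moreover have "length (xor_list w y') = 3" using lw y'(1) by simp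
    ultimately show "e \<in> ed ` {24, 27, 29, 30}" unfolding normal_exc_edges by auto
  qed
  have fF: "(`) ?f ` F \<subseteq> {ed 31}"
    using y(1) recentre_cross_edge[OF y(2) i(1), of u] u(2) wy normal_exc_edges(3) by simp
  obtain c x' where x': "x = ins i c x'" "length x' = 3" using insE[of x 3 i] x(1) i(1) by auto
  have "par x' \<noteq> p"
  proof
    assume "par x' = p"
    then have "cross_edge i x' \<in> M" using x'(2) i(2) by (auto simp: parity_class_def)
    moreover have "x \<in> cross_edge i x'" using x'(1) by (cases c) (auto simp: cross_edge_def)
    ultimately show False using x(2) by blast
  qed
  then have px: "par (xor_list w x')" using par_xor[of w x'] lw x'(2) pw by auto
  have fx: "?f x = c # xor_list w x'" using recentre_ins[OF x'(2) i(1), of u c] x'(1) u by simp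
  have lf: "length (?f x) = 4" using f x(1) by (simp add: isometry4_def)
  then obtain v where v: "v < 16" "?f x = vtx v" using vtxE by blast
  have "list_all (\<lambda>v. par (tl (vtx v)) \<longrightarrow> v \<in> {1, 2, 4, 7, 9, 10, 12, 15}) [0..<16]"
    by (simp add: vtx_def par_def upt_rec)
  from lt_list_all[OF this v(1)] have "v \<in> {1, 2, 4, 7, 9, 10, 12, 15}" using px v(2) fx by (metis list.sel(3))
  then obtain t t' where t: "t \<noteq> t'" "ham_dist (?f x) t = 3" "ham_dist (?f x) t' = 3"
    "ham_path 4 ((`) ?f ` F) ((`) ?f ` M) (?f x) t" "ham_path 4 ((`) ?f ` F) ((`) ?f ` M) (?f x) t'"
    using exc_normal[OF fM fF] v(2) by metis
  \<comment> \<open>Two different ends are available, and at most one of them is carried back to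
    \<open>z\<close>.\<close>
  have "\<exists>s. length s = 4 \<and> ?f s \<in> {t, t'} \<and> s \<noteq> z"
  proof -
    obtain h where h: "isometry4 h" "\<And>x. length x = 4 \<Longrightarrow> ?f (h x) = x" "\<And>x. length x = 4 \<Longrightarrow> h (?f x) = x"
      using isometry4_inv[OF f] by metis
    have lt: "length t = 4" "length t' = 4" using ham_path_verts t(4,5) by blast+
    then have "?f (h t) = t" "?f (h t') = t'" "length (h t) = 4" "length (h t') = 4"
      using h by (auto simp: isometry4_def)
    moreover from this t(1) have "h t \<noteq> z \<or> h t' \<noteq> z" by metis
    ultimately show ?thesis by (metis insertI1 insertI2 singletonI)
  qed
  then obtain s where s: "length s = 4" "?f s \<in> {t, t'}" "s \<noteq> z" by blast
  have "ham_path 4 ((`) ?f ` F) ((`) ?f ` M) (?f x) (?f s)" "ham_dist (?f x) (?f s) = 3" using s(2) t by auto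
  then have 1: "ham_path 4 F M x s" "ham_dist x s = 3"
    using ham_path_pull_back[OF f ME(2,1) x(1) s(1)] f x(1) s(1) by (auto simp: isometry4_def)
  then have "{x, s} \<notin> edges (cube 4)" "par x \<noteq> par s"
    using odd_ham_dist[of x s] x(1) s(1) by (auto simp: edge_iff_ham_dist)
  with 1 s(3) show "\<exists>y. y \<noteq> z \<and> {x, y} \<notin> edges (cube 4) \<and> par x \<noteq> par y \<and> ham_path 4 F M x y" by blast
qed

text \<open>Translation by \<open>del i u\<close> is an involution, so the preimage of an edge of
  dimension 0 can be written down explicitly.\<close>

lemma cross_edge_of_normal:
  assumes "length u = 4" "i \<le> 3" "e \<in> edges (cube 4)" "recentre i u ` e = cross_edge 0 z" "length z = 3"
  obtains y where "length y = 3" "e = cross_edge i y" "par z \<longleftrightarrow> par (del i u) \<noteq> par y"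
proof -
  note f = isometry4_recentre[OF assms(1,2)]
  have ld: "length (del i u) = 3" using assms(1,2) by simp
  let ?y = "xor_list (del i u) z"
  have ly: "length ?y = 3" using ld assms(5) by simp
  have "xor_list (del i u) ?y = z"
  proof -
    have "length w = length z \<Longrightarrow> xor_list w (xor_list w z) = z" for w z
      by (induction w z rule: list_induct2) auto
    then show ?thesis using ld assms(5) by simp
  qed
  then have z: "recentre i u ` cross_edge i ?y = cross_edge 0 z"
    using recentre_cross_edge[OF ly assms(2), of u] by simp
  have "cross_edge i ?y \<in> edges (cube 4)" using cross_edge_in_edges[OF ly, of i] by simp
  then have "e = cross_edge i ?y"
    using inj_onD[OF isometry4_image_edges(1)[OF f subset_refl], of e "cross_edge i ?y"] z assms(3,4) by simp
  moreover have "par z \<longleftrightarrow> par (del i u) \<noteq> par ?y" using par_xor[of "del i u" z] ld assms(5) by auto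
  ultimately show ?thesis using that ly by blast
qed

text \<open>Normalising one prescribed edge and opening the desired cycle there leaves a path
  problem between its ends. A search leaf without path is carried back to the exceptional
  configuration, which is excluded.\<close>

lemma cycle_ext_4: "cycle_ext 4"
  unfolding cycle_ext_def
proof (intro allI impI)
  fix M F
  assume g: "good 4 M F" and ne: "M \<noteq> {}" and w: "card M + 2 * card F \<le> 2 * 4 - 2" and nex: "\<not> exc 4 M F"
  note ME = goodD(1,2)[OF g]
  obtain e where e: "e \<in> M" using ne by blast
  then obtain u v where uv: "e = {u, v}" "length u = 4" "length v = 4" using ME(1) by (meson edgeE subsetD)
  obtain i where i: "i \<le> 3" "recentre i v v = vtx 0" "recentre i v u = vtx 8"
    using recentre_edge e uv ME(1) by blast
  let ?f = "recentre i v"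
  note f = isometry4_recentre[OF uv(3) i(1)]
  note inj = isometry4_image_edges(1)[OF f ME(1)]
  have fe: "?f ` e = {vtx 8, vtx 0}" using uv i by simp
  have fM: "(`) ?f ` M - {{vtx 8, vtx 0}} = (`) ?f ` (M - {e})"
    using inj_on_image_set_diff[OF inj, of M "{e}"] e ME(1) fe by auto
  have MeE: "M - {e} \<subseteq> edges (cube 4)" using ME(1) by blast
  have wt: "card ((`) ?f ` M) + 2 * card ((`) ?f ` F) \<le> 6" using isometry4_image_edges(2)[OF f] ME w by simp
  have "{vtx 8, vtx 0} \<in> (`) ?f ` M" using e fe by (metis imageI)
  from matching_normal[OF isometry4_good[OF f g] wt this]
  consider "ham_path 4 ((`) ?f ` F) ((`) ?f ` (M - {e})) (vtx 8) (vtx 0)"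
    | "exc_idx (idx ((`) ?f ` (M - {e}))) (idx ((`) ?f ` F))"
    unfolding fM by argo
  then show "ham_cycle 4 F M"
  proof cases
    case 1
    then have "ham_path 4 F (M - {e}) u v" using ham_path_pull_back[OF f ME(2) MeE uv(2,3)] i by simp
    then obtain p where p: "p \<noteq> []" "hd p = u" "last p = v" "distinct p" "set p = verts (cube 4)"
      "path_edges p \<subseteq> edges (cube 4) - F" "M - {e} \<subseteq> path_edges p" unfolding ham_path_def by blast
    have "e \<in> edges (cube 4) - F" using g e unfolding good_def by blast
    then show ?thesis using p uv(1) by (intro ham_cycleI[of p]) (auto simp: cyc_edges_def insert_commute)
  next
    case 2
    have M: "(`) ?f ` (M - {e}) = ed ` {27, 29, 30}"
      using 2 ed_idx[OF isometry4_image_edges(3)[OF f MeE]] unfolding exc_idx_def by metis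
    obtain j where j: "j \<in> {25, 26, 28, 31}" "(`) ?f ` F = {ed j}"
      using 2 ed_idx[OF isometry4_image_edges(3)[OF f ME(2)]] unfolding exc_idx_def by (metis image_empty image_insert)
    have "M \<subseteq> parity_class i (par (del i v))"
    proof
      fix d assume d: "d \<in> M"
      have "?f ` d \<in> ed ` {24, 27, 29, 30}"
      proof (cases "d = e")
        case True
        then show ?thesis using fe ed_24 by (auto simp: insert_commute)
      next
        case False
        then have "?f ` d \<in> (`) ?f ` (M - {e})" using d by blast
        then show ?thesis unfolding M by blast
      qed
      then obtain z where z: "?f ` d = cross_edge 0 z" "length z = 3" "\<not> par z"
        unfolding normal_exc_edges by auto
      obtain y where "length y = 3" "d = cross_edge i y" "par z \<longleftrightarrow> par (del i v) \<noteq> par y"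
        using cross_edge_of_normal[OF uv(3) i(1) _ z(1,2)] d ME(1) by blast
      then show "d \<in> parity_class i (par (del i v))" using z(3) unfolding parity_class_def by auto
    qed
    moreover have "card M = 4"
    proof -
      have "card ((`) ?f ` (M - {e})) = 3"
        unfolding M by (subst card_image[OF inj_on_subset[OF ed_inj]]; simp)
      then have "card (M - {e}) = 3" using isometry4_image_edges(2)[OF f MeE] by simp
      then show ?thesis using e goodD(3)[OF g] card_Suc_Diff1[of M e] by simp
    qed
    moreover have "finite (parity_class i (par (del i v)))"
      using card_parity_class[OF i(1)] by (intro card_ge_0_finite) simp
    ultimately have "M = parity_class i (par (del i v))"
      using card_subset_eq[of "parity_class i (par (del i v))" M] card_parity_class[OF i(1)] by simp
    moreover have "card F = 1" using isometry4_image_edges(2)[OF f ME(2)] j(2) by simp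
    moreover have "F \<subseteq> cross_edge i ` verts (cube 3)"
    proof
      fix d assume d: "d \<in> F"
      then have "?f ` d = ed j" using j(2) by blast
      then have "?f ` d \<in> ed ` {25, 26, 28, 31}" using j(1) by blast
      then obtain z where z: "?f ` d = cross_edge 0 z" "length z = 3" unfolding normal_exc_edges by auto
      obtain y where "length y = 3" "d = cross_edge i y"
        using cross_edge_of_normal[OF uv(3) i(1) _ z(1,2)] d ME(2) by blast
      then show "d \<in> cross_edge i ` verts (cube 3)" by auto
    qed
    ultimately have "exc 4 M F" unfolding exc_def using i(1) by blast
    then show ?thesis using nex by blast
  qed
qed

section \<open>All dimensions\<close>

lemma main_induction:
  assumes "4 \<le> n"
  shows "cycle_ext n \<and> path_ext n \<and> paired_laceable n"
  using assms
proof (induction n rule: dec_induct)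
  case base
  then show ?case using cycle_ext_4 path_ext_4 paired_laceable_4 by blast
next
  case (step n)
  then show ?case
    using cycle_ext_step[OF step.hyps(1)] path_ext_step[OF step.hyps(1)] paired_laceable_step[of n]
      path_ext_laceable exc_path_ext adjacent_path_ext4 by auto
qed

section \<open>The exceptional configuration\<close>

text \<open>Each edge has exactly one end of parity \<open>q\<close>, so the degrees over that
  colour class count every edge once.\<close>

lemma card_edges_by_parity:
  assumes "H \<subseteq> edges (cube m)"
  shows "card H = (\<Sum>z \<in> {z \<in> verts (cube m). par z = q}. card {e \<in> H. z \<in> e})"
proof -
  let ?V = "{z \<in> verts (cube m). par z = q}"
  have fin: "finite H" using assms finite_subset by blast
  have finV: "finite ?V" using finite_verts_cube[of m] by (rule rev_finite_subset) auto
  have "H = (\<Union>z\<in>?V. {e \<in> H. z \<in> e})"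
  proof (intro equalityI subsetI)
    fix e assume "e \<in> H"
    moreover from this obtain x y where "e = {x, y}" "length x = m" "length y = m" "par x \<noteq> par y"
      using assms by (meson edgeE subsetD)
    ultimately show "e \<in> (\<Union>z\<in>?V. {e \<in> H. z \<in> e})" by (cases "par x = q") auto
  qed auto
  then have "card H = card (\<Union>z\<in>?V. {e \<in> H. z \<in> e})" by simp
  also have "\<dots> = (\<Sum>z\<in>?V. card {e \<in> H. z \<in> e})"
  proof (rule card_UN_disjoint[OF finV])
    show "\<forall>z\<in>?V. finite {e \<in> H. z \<in> e}" using fin by simp
    show "\<forall>z\<in>?V. \<forall>w\<in>?V. z \<noteq> w \<longrightarrow> {e \<in> H. z \<in> e} \<inter> {e \<in> H. w \<in> e} = {}"
    proof (intro ballI impI equals0I)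
      fix z w e assume zw: "z \<in> ?V" "w \<in> ?V" "z \<noteq> w" "e \<in> {e \<in> H. z \<in> e} \<inter> {e \<in> H. w \<in> e}"
      then obtain x y where "e = {x, y}" "par x \<noteq> par y" using assms by (auto elim: edgeE)
      then show False using zw by auto
    qed
  qed
  finally show ?thesis .
qed

text \<open>In the half where \<open>x\<^sub>i = 0\<close>, every vertex of the class covered by \<open>M\<close> has one cycle edge
  inside the half, so there are four such edges; a faulty crossing edge would leave the other class
  with at least five.\<close>

lemma parity_class_no_cycle:
  assumes i: "i \<le> 3" and M: "M = parity_class i p" and y: "length y = 3" "par y \<noteq> p" "cross_edge i y \<in> F"
  shows "\<not> ham_cycle 4 F M"
proof
  assume "ham_cycle 4 F M"
  then obtain c where c: "c \<noteq> []" "distinct c" "set c = verts (cube 4)"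
    "cyc_edges c \<subseteq> edges (cube 4) - F" "M \<subseteq> cyc_edges c"
    unfolding ham_cycle_def by blast
  let ?C = "cyc_edges c"
  let ?H = "half 3 i False ?C"
  let ?d = "\<lambda>z. card {e \<in> ?H. z \<in> e}"
  have len: "3 \<le> length c" using length_ham_ge3[OF c(2,3)] by simp
  have CE: "?C \<subseteq> edges (cube (Suc 3))" using c(4) by auto
  \<comment> \<open>The two cycle edges at the copy of \<open>z\<close> in this half lie inside the
    half, except possibly for the crossing edge over \<open>z\<close>.\<close>
  have deg: "?d z + (if cross_edge i z \<in> ?C then 1 else 0) = 2" if z: "length z = 3" for z
  proof -
    let ?x = "ins i False z"
    have "?x \<in> set c" using c(3) z by simp
    then obtain s t where st: "s \<noteq> t" "s \<noteq> ?x" "t \<noteq> ?x" "{e \<in> ?C. ?x \<in> e} = {{?x, s}, {?x, t}}"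
      by (rule cyc_edges_at[OF c(2) len])
    have 2: "card {e \<in> ?C. ?x \<in> e} = 2" unfolding st(4) using st(1-3) by (simp add: doubleton_eq_iff)
    have xi: "?x \<in> ins i False ` e \<longleftrightarrow> z \<in> e" if "e \<in> edges (cube 3)" for e
      using edge_subset_verts[OF that] z i by auto
    have xt: "?x \<notin> ins i True ` e" if "e \<in> edges (cube 3)" for e
      using edge_subset_verts[OF that] z i by auto
    have xc: "?x \<in> cross_edge i w \<longleftrightarrow> w = z" if "length w = 3" for w
      using that z i by (auto simp: cross_edge_def)
    have "{e \<in> ?C. ?x \<in> e} = (`) (ins i False) ` {e \<in> ?H. z \<in> e} \<union> (if cross_edge i z \<in> ?C then {cross_edge i z} else {})"
    proof (intro equalityI subsetI)
      fix e assume e: "e \<in> {e \<in> ?C. ?x \<in> e}"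
      then have "e \<in> (`) (ins i False) ` ?H \<union> (`) (ins i (\<not> False)) ` half 3 i (\<not> False) ?C \<union> cross_edge i ` cross 3 i ?C"
        using split_cover[OF CE i, of False] by blast
      then show "e \<in> (`) (ins i False) ` {e \<in> ?H. z \<in> e} \<union> (if cross_edge i z \<in> ?C then {cross_edge i z} else {})"
      proof (elim UnE imageE)
        fix d assume d: "e = ins i False ` d" "d \<in> ?H"
        then have "z \<in> d" using e xi half_subset by blast
        then show ?thesis using d by blast
      next
        fix d assume d: "e = ins i (\<not> False) ` d" "d \<in> half 3 i (\<not> False) ?C"
        then have "d \<in> edges (cube 3)" using half_subset by blast
        then show ?thesis using e xt[of d] d(1) by simp
      next
        fix w assume w: "e = cross_edge i w" "w \<in> cross 3 i ?C"
        then have "w = z" using e xc mem_cross_length by blast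
        then show ?thesis using w e by simp
      qed
    next
      fix e assume "e \<in> (`) (ins i False) ` {e \<in> ?H. z \<in> e} \<union> (if cross_edge i z \<in> ?C then {cross_edge i z} else {})"
      then show "e \<in> {e \<in> ?C. ?x \<in> e}" using xc[OF z] by (auto simp: half_def split: if_splits)
    qed
    moreover have "card ((`) (ins i False) ` {e \<in> ?H. z \<in> e}) = ?d z"
      by (rule card_image[OF inj_on_subset[OF inj_on_image_ins[OF i]]]) (auto simp: half_def)
    moreover have "cross_edge i z \<notin> (`) (ins i False) ` {e \<in> ?H. z \<in> e}"
      using cross_edge_neq_image[OF i _ z] by (auto simp: half_def)
    moreover have "finite ((`) (ins i False) ` {e \<in> ?H. z \<in> e})" by simp
    ultimately show ?thesis using 2 by (auto split: if_splits)
  qed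
  let ?V = "\<lambda>q. {z \<in> verts (cube 3). par z = q}"
  have fin: "finite (?V q)" for q using finite_verts_cube[of 3] by (rule rev_finite_subset) auto
  have cV: "card (?V q) = 4" for q using card_par[of 2 q] by simp
  have "?d z = 1" if "z \<in> ?V p" for z
  proof -
    have "cross_edge i z \<in> ?C" using that c(5) unfolding M parity_class_def by blast
    then show ?thesis using deg[of z] that by simp
  qed
  then have "card ?H = (\<Sum>z\<in>?V p. 1)" using card_edges_by_parity[OF half_subset, of 3 i False ?C p] by simp
  then have 4: "card ?H = 4" using cV[of p] by simp
  \<comment> \<open>Over the other class each vertex has at least one cycle edge inside the half,
    and \<open>y\<close> has two because its crossing edge is faulty: 3 + 2 = 5.\<close>
  have "(\<Sum>z\<in>?V (\<not> p). if z = y then 2 else 1) \<le> (\<Sum>z\<in>?V (\<not> p). ?d z)"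
  proof (rule sum_mono)
    fix z assume "z \<in> ?V (\<not> p)"
    then have "length z = 3" by simp
    moreover have "cross_edge i y \<notin> ?C" using c(4) y(3) by blast
    ultimately show "(if z = y then 2 else 1) \<le> ?d z" using deg[of z] by (auto split: if_splits)
  qed
  moreover have "(\<Sum>z\<in>?V (\<not> p). if z = y then 2 else 1) = (5::nat)"
  proof -
    have yV: "y \<in> ?V (\<not> p)" using y by auto
    have "(\<Sum>z\<in>?V (\<not> p). if z = y then 2 else (1::nat)) = 2 + (\<Sum>z\<in>?V (\<not> p) - {y}. 1)"
      by (subst sum.remove[OF fin yV]) (auto intro!: sum.cong)
    also have "\<dots> = 5" using cV[of "\<not> p"] fin[of "\<not> p"] yV by simp
    finally show ?thesis .
  qed
  ultimately show False using 4 card_edges_by_parity[OF half_subset, of 3 i False ?C "\<not> p"] by simp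
qed

lemma dim_edges_eq:
  assumes "i \<le> m"
  shows "dim_edges (Suc m) i = cross_edge i ` verts (cube m)"
proof (intro equalityI subsetI)
  fix e assume "e \<in> dim_edges (Suc m) i"
  then obtain x y where e: "e = {x, y}" "{x, y} \<in> edges (cube (Suc m))" "x ! i \<noteq> y ! i"
    unfolding dim_edges_def by blast
  have l: "length x = Suc m" "length y = Suc m" using edge_length[OF e(2)] by auto
  obtain b x' where x: "x = ins i b x'" "length x' = m" using insE[OF l(1) assms] by metis
  obtain c y' where y: "y = ins i c y'" "length y' = m" using insE[OF l(2) assms] by metis
  have "b \<noteq> c" using e(3) x y assms by simp
  then have "x' = y'" using e(2) x y by (simp add: edge_ins_neq)
  moreover have "c = (\<not> b)" using \<open>b \<noteq> c\<close> by auto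
  ultimately have "e = cross_edge i x'" using e(1) x y cross_edge_eq[of i b x'] by simp
  then show "e \<in> cross_edge i ` verts (cube m)" using x(2) by auto
next
  fix e assume "e \<in> cross_edge i ` verts (cube m)"
  then obtain x where x: "length x = m" "e = {ins i False x, ins i True x}" by (auto simp: cross_edge_def)
  moreover have "{ins i False x, ins i True x} \<in> edges (cube (Suc m))"
    using cross_edge_in_edges[OF x(1), of i] by (simp add: cross_edge_def)
  moreover have "ins i False x ! i \<noteq> ins i True x ! i" using x(1) assms by simp
  ultimately show "e \<in> dim_edges (Suc m) i" unfolding dim_edges_def by blast
qed

section \<open>Walks and graph distance two\<close>

lemma successively_path_edges: "successively (\<lambda>x y. {x, y} \<in> A) p \<longleftrightarrow> path_edges p \<subseteq> A"
  by (induction p rule: path_edges.induct) auto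

lemma ham_dist_2_middle:
  assumes "length x = m" "length y = m" "ham_dist x y = 2"
  obtains z where "{x, z} \<in> edges (cube m)" "{z, y} \<in> edges (cube m)"
proof -
  have "x \<noteq> y" using assms ham_dist_0_iff[of x y] by auto
  then obtain j where j: "j < m" "x ! j \<noteq> y ! j" using assms list_eq_iff_nth_eq[of x y] by auto
  let ?z = "ins j (y ! j) (del j x)"
  have x: "ins j (x ! j) (del j x) = x" and y: "ins j (y ! j) (del j y) = y" using ins_del[of j x] ins_del[of j y] j assms by simp_all
  have l: "length (del j x) = length (del j y)" using j assms by simp
  have "ham_dist x ?z = 1" using ham_dist_ins[of "del j x" "del j x" j "x ! j" "y ! j"] x j(2) ham_dist_0_iff[of "del j x" "del j x"]
    by simp
  moreover have "ham_dist ?z y = 1"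
    using ham_dist_ins[OF l, of j "y ! j" "y ! j"] ham_dist_ins[OF l, of j "x ! j" "y ! j"] x y j(2) assms(3) by simp
  moreover have "length ?z = m" using j assms by simp
  ultimately show ?thesis using that[of ?z] assms by (simp add: edge_iff_ham_dist)
qed

lemma graph_dist_2:
  assumes "length x = m" "length y = m" "ham_dist x y = 2"
  shows "graph_dist (cube m) x y = 2"
proof -
  obtain z where z: "{x, z} \<in> edges (cube m)" "{z, y} \<in> edges (cube m)" using ham_dist_2_middle[OF assms] .
  show ?thesis unfolding graph_dist_def
  proof (rule Least_equality)
    show "\<exists>p. walk (cube m) x p y \<and> length p = Suc 2"
      using z assms edge_length[OF z(1)] by (intro exI[of _ "[x, z, y]"]) (simp add: walk_def)
  next
    fix k assume "\<exists>p. walk (cube m) x p y \<and> length p = Suc k"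
    then obtain p where p: "walk (cube m) x p y" "length p = Suc k" by blast
    show "2 \<le> k"
    proof (rule ccontr)
      assume "\<not> 2 \<le> k"
      then consider "k = 0" | "k = 1" by linarith
      then show False
      proof cases
        case 1
        then have "x = y" using p by (auto simp: walk_def length_Suc_conv)
        then show False using assms(3) ham_dist_0_iff[of x x] by simp
      next
        case 2
        then have "{x, y} \<in> edges (cube m)" using p by (auto simp: walk_def length_Suc_conv)
        then show False using assms(3) by (simp add: edge_iff_ham_dist)
      qed
    qed
  qed
qed

text \<open>\<open>LEAST\<close> yields a walk only if some walk exists; an initial segment of a
  Hamiltonian path starting in \<open>x\<close> provides one. The shortest walk then has two edges,
  each of which changes the parity.\<close>

lemma graph_dist_2_par:
  assumes "length x = 4" "length y = 4" "graph_dist (cube 4) x y = 2"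
  shows "par x = par y"
proof -
  let ?P = "\<lambda>k. \<exists>p. walk (cube 4) x p y \<and> length p = Suc k"
  obtain v where v: "length v = 4" "par v \<noteq> par x"
    using exists_opposite_avoiding[of "{}" 4 "\<not> par x"] by auto
  then have "ham_path 4 {} {} x v" using path_ext_laceable[OF path_ext_4] assms(1) unfolding laceable_def by blast
  then obtain q where q: "q \<noteq> []" "hd q = x" "set q = verts (cube 4)" "path_edges q \<subseteq> edges (cube 4)"
    unfolding ham_path_def by auto
  then obtain r s where r: "q = r @ y # s" using assms(2) by (metis split_list verts_cube)
  have "hd (r @ [y]) = x" using q(2) r by (cases r) auto
  moreover have "path_edges (r @ [y]) \<subseteq> edges (cube 4)"
    using q(4) path_edges_append[of "r @ [y]" s] r by simp
  moreover have "set (r @ [y]) \<subseteq> verts (cube 4)" using q(3) r by auto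
  ultimately have "walk (cube 4) x (r @ [y]) y" unfolding walk_def successively_path_edges by simp
  then have "?P (length r)" by (intro exI[of _ "r @ [y]"]) simp
  then have "?P (LEAST k. ?P k)" by (rule LeastI)
  then have "?P 2" using assms(3) unfolding graph_dist_def by simp
  then obtain a b c where "walk (cube 4) x [a, b, c] y" by (auto simp: numeral_eq_Suc length_Suc_conv)
  then have "{x, b} \<in> edges (cube 4)" "{b, y} \<in> edges (cube 4)" by (auto simp: walk_def)
  then show ?thesis using edge_par by blast
qed

text \<open>Distinct vertices of equal parity in the three-dimensional cube have a positive even
  distance of at most 3, hence distance 2.\<close>

lemma exc_exceptional:
  assumes "exc n M F"
  shows "exceptional n F M"
proof -
  obtain i p where i: "i \<le> 3" "M = parity_class i p" "F \<subseteq> cross_edge i ` verts (cube 3)"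
    using assms unfolding exc_def by blast
  have D: "dim_edges 4 i = cross_edge i ` verts (cube 3)" using dim_edges_eq[OF i(1)] by simp
  have "graph_dist (cube 4) x y = 2"
    if xy: "x \<in> \<Union>M" "y \<in> \<Union>M" "x ! i = False" "y ! i = False" "x \<noteq> y" for x y
  proof -
    have *: "\<exists>x'. x = ins i False x' \<and> length x' = 3 \<and> par x' = p" if x: "x \<in> \<Union>M" "x ! i = False" for x
    proof -
      obtain x' where x': "length x' = 3" "par x' = p" "x \<in> cross_edge i x'" using x(1) unfolding i(2) parity_class_def by auto
      then have "x = ins i False x'" using x(2) i(1) by (auto simp: cross_edge_def)
      then show ?thesis using x' by blast
    qed
    obtain x' where x': "x = ins i False x'" "length x' = 3" "par x' = p" using *[OF xy(1,3)] by blast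
    obtain y' where y': "y = ins i False y'" "length y' = 3" "par y' = p" using *[OF xy(2,4)] by blast
    have "ham_dist x' y' \<noteq> 0" "even (ham_dist x' y')" "ham_dist x' y' \<le> 3"
      using xy(5) x' y' ham_dist_0_iff[of x' y'] odd_ham_dist[of x' y'] length_filter_le[of _ "zip x' y'"]
      by (auto simp: ham_dist_def)
    then have "ham_dist x' y' = 2" by presburger
    then have "ham_dist x y = 2" using x' y' by (simp add: ham_dist_ins)
    then show ?thesis using graph_dist_2[of x 4 y] x' y' by simp
  qed
  moreover have "M \<subseteq> dim_edges 4 i" unfolding D i(2) parity_class_def by auto
  ultimately show ?thesis using excD[OF assms] i(1,3) D
    unfolding exceptional_def pairwise_def by (intro conjI exI[of _ i]) auto
qed

text \<open>Distance two preserves parity, so the edges of \<open>M\<close> lie over one colour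
  class, and being four they are the whole class. The fault is not in \<open>M\<close> and therefore
  lies over the other class, where the degree count applies.\<close>

lemma exceptional_no_cycle:
  assumes g: "good n M F" and ex: "exceptional n F M"
  shows "\<not> ham_cycle n F M"
proof -
  have n: "n = 4" "card M = 4" "card F = 1" using ex unfolding exceptional_def by auto
  obtain i where "i < 4" and iM: "M \<union> F \<subseteq> dim_edges 4 i"
    "pairwise (\<lambda>x y. graph_dist (cube 4) x y = 2) {x \<in> \<Union>M. x ! i = False}"
    using ex n(1) unfolding exceptional_def by blast
  then have i: "i \<le> 3" "M \<union> F \<subseteq> dim_edges 4 i"
    "pairwise (\<lambda>x y. graph_dist (cube 4) x y = 2) {x \<in> \<Union>M. x ! i = False}"
    by simp_all
  have D: "dim_edges 4 i = cross_edge i ` verts (cube 3)" using dim_edges_eq[OF i(1)] by simp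
  have "M \<noteq> {}" using n by auto
  then obtain e where "e \<in> M" by blast
  moreover from this have "e \<in> cross_edge i ` verts (cube 3)" using i(2) D by blast
  ultimately obtain x where x: "length x = 3" "cross_edge i x \<in> M" by auto
  have "M \<subseteq> parity_class i (par x)"
  proof
    fix e assume e: "e \<in> M"
    then obtain z where z: "length z = 3" "e = cross_edge i z" using i(2) D by auto
    have "par z = par x"
    proof (cases "z = x")
      case False
      let ?x = "ins i False x" and ?z = "ins i False z"
      have "?x \<in> {x \<in> \<Union>M. x ! i = False}" "?z \<in> {x \<in> \<Union>M. x ! i = False}"
        using x z e i(1) by (auto simp: cross_edge_def)
      moreover have "?x \<noteq> ?z" using False x z i(1) by simp
      ultimately have "graph_dist (cube 4) ?x ?z = 2" using i(3) unfolding pairwise_def by blast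
      then have "par ?x = par ?z" using graph_dist_2_par[of ?x ?z] x z by simp
      then show ?thesis by simp
    qed simp
    then show "e \<in> parity_class i (par x)" using z by (auto simp: parity_class_def)
  qed
  moreover have "finite (parity_class i (par x))"
    using card_parity_class[OF i(1)] by (intro card_ge_0_finite) simp
  ultimately have M: "M = parity_class i (par x)"
    using card_subset_eq[of "parity_class i (par x)" M] card_parity_class[OF i(1)] n(2) by simp
  obtain f where f: "F = {f}" using n(3) by (auto simp: card_1_singleton_iff)
  then obtain y where y: "length y = 3" "f = cross_edge i y" using i(2) D by auto
  have "par y \<noteq> par x"
  proof
    assume "par y = par x"
    then have "f \<in> M" using y unfolding M parity_class_def by auto
    then show False using g f unfolding good_def by blast
  qed
  then show ?thesis using parity_class_no_cycle[OF i(1) M y(1)] f y(2) n(1) by simp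
qed

section \<open>Cyclic vertex sequences\<close>

lemma path_edges_conv_nth: "path_edges p = {{p ! k, p ! Suc k} | k. Suc k < length p}"
proof (induction p rule: path_edges.induct)
  case (1 x y p)
  have "{{(x # y # p) ! k, (x # y # p) ! Suc k} | k. Suc k < length (x # y # p)} =
      insert {x, y} {{(y # p) ! k, (y # p) ! Suc k} | k. Suc k < length (y # p)}"
  proof (intro equalityI subsetI)
    fix e assume "e \<in> {{(x # y # p) ! k, (x # y # p) ! Suc k} | k. Suc k < length (x # y # p)}"
    then obtain k where k: "e = {(x # y # p) ! k, (x # y # p) ! Suc k}" "Suc k < length (x # y # p)" by blast
    then show "e \<in> insert {x, y} {{(y # p) ! k, (y # p) ! Suc k} | k. Suc k < length (y # p)}"
      by (cases k) auto
  next
    fix e assume "e \<in> insert {x, y} {{(y # p) ! k, (y # p) ! Suc k} | k. Suc k < length (y # p)}"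
    then consider "e = {x, y}" | k where "e = {(y # p) ! k, (y # p) ! Suc k}" "Suc k < length (y # p)" by blast
    then show "e \<in> {{(x # y # p) ! k, (x # y # p) ! Suc k} | k. Suc k < length (x # y # p)}"
    proof cases
      case 1
      then show ?thesis by (intro CollectI exI[of _ 0]) simp
    next
      case (2 k)
      then show ?thesis by (intro CollectI exI[of _ "Suc k"]) simp
    qed
  qed
  then show ?case using 1 by simp
qed auto

lemma cycle_edges_eq:
  assumes "c \<noteq> []"
  shows "cycle_edges c = cyc_edges c"
proof (intro equalityI subsetI)
  fix e assume "e \<in> cycle_edges c"
  then obtain k where k: "k < length c" "e = {c ! k, c ! (Suc k mod length c)}" unfolding cycle_edges_def by blast
  show "e \<in> cyc_edges c"
  proof (cases "Suc k < length c")
    case True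
    then show ?thesis using k unfolding cyc_edges_def path_edges_conv_nth by auto
  next
    case False
    then have "Suc k = length c" using k(1) by simp
    then have "k = length c - 1" "Suc k mod length c = 0" by simp_all
    then show ?thesis using k(2) assms by (simp add: cyc_edges_def last_conv_nth hd_conv_nth)
  qed
next
  fix e assume "e \<in> cyc_edges c"
  then consider "e = {last c, hd c}" | k where "e = {c ! k, c ! Suc k}" "Suc k < length c"
    unfolding cyc_edges_def path_edges_conv_nth by blast
  then show "e \<in> cycle_edges c"
  proof cases
    case 1
    have "Suc (length c - 1) mod length c = 0" using assms by simp
    then have "e = {c ! (length c - 1), c ! (Suc (length c - 1) mod length c)}"
      using 1 assms by (simp add: last_conv_nth hd_conv_nth)
    moreover have "length c - 1 < length c" using assms by simp
    ultimately show ?thesis unfolding cycle_edges_def by blast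
  next
    case (2 k)
    then have "Suc k mod length c = Suc k" by simp
    then show ?thesis using 2 unfolding cycle_edges_def by (intro CollectI exI[of _ k]) simp
  qed
qed

lemma hamiltonian_cycle_iff:
  assumes "2 \<le> n"
  shows "(\<exists>c. hamiltonian_cycle (delete_edges (cube n) F) c \<and> M \<subseteq> cycle_edges c) \<longleftrightarrow> ham_cycle n F M"
proof
  assume "\<exists>c. hamiltonian_cycle (delete_edges (cube n) F) c \<and> M \<subseteq> cycle_edges c"
  then obtain c where c: "3 \<le> length c" "distinct c" "set c = verts (cube n)"
    "cycle_edges c \<subseteq> edges (cube n) - F" "M \<subseteq> cycle_edges c"
    unfolding hamiltonian_cycle_def cycle_def delete_edges_def by auto
  then have "c \<noteq> []" by auto
  then show "ham_cycle n F M" using c by (intro ham_cycleI[of c]) (auto simp: cycle_edges_eq)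
next
  assume "ham_cycle n F M"
  then obtain c where c: "c \<noteq> []" "distinct c" "set c = verts (cube n)"
    "cyc_edges c \<subseteq> edges (cube n) - F" "M \<subseteq> cyc_edges c"
    unfolding ham_cycle_def by blast
  then show "\<exists>c. hamiltonian_cycle (delete_edges (cube n) F) c \<and> M \<subseteq> cycle_edges c"
    using length_ham_ge3[OF c(2,3) assms] unfolding hamiltonian_cycle_def cycle_def delete_edges_def
    by (intro exI[of _ c]) (simp add: cycle_edges_eq)
qed

text \<open>The exception is read as an equivalence, so it also has to be shown that the exceptional
  configuration admits no such cycle.\<close>

theorem theorem5p2:
  fixes n :: nat and F M :: "bool list set set"
  assumes "n \<ge> 4"
    and "F \<subseteq> edges (cube n)"
    and "matching (delete_edges (cube n) F) M"
    and "1 \<le> card M" and "card M \<le> 2 * n - 2"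
    and "int (card F) \<le> int n - 1 - \<lceil>real (card M) / 2\<rceil>"
  shows "(\<exists>c. hamiltonian_cycle (delete_edges (cube n) F) c \<and> M \<subseteq> cycle_edges c)
    \<longleftrightarrow> \<not> exceptional n F M"
proof -
  have g: "good n M F"
    using assms(2,3) unfolding good_def matching_def delete_edges_def by auto
  have "real (card M) / 2 \<le> of_int \<lceil>real (card M) / 2\<rceil>" by (rule le_of_int_ceiling)
  also have "\<dots> \<le> of_int (int n - 1 - int (card F))" using assms(6) by linarith
  finally have w: "card M + 2 * card F \<le> 2 * n - 2" using assms(1) by simp
  have "2 \<le> n" using assms(1) by simp
  have ext: "cycle_ext n" using main_induction[OF assms(1)] by blast
  have "ham_cycle n F M \<longleftrightarrow> \<not> exceptional n F M"
  proof
    assume "\<not> exceptional n F M"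
    then have "\<not> exc n M F" using exc_exceptional by blast
    moreover have "M \<noteq> {}" using assms(4) by auto
    ultimately show "ham_cycle n F M" using ext g w unfolding cycle_ext_def by blast
  qed (use exceptional_no_cycle[OF g] in blast)
  then show ?thesis using hamiltonian_cycle_iff[OF \<open>2 \<le> n\<close>] by simp
qed

end
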